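(* Let $B_0:\operatorname{dom}(B_0)\subseteq K_0\to K_1$, $B_1:\operatorname{dom}(B_1)\subseteq K_1\to K_2$, $B_2:\operatorname{dom}(B_2)\subseteq K_2\to K_3$ be densely defined and closed linear operators acting in the Hilbert spaces $K_0,K_1,K_2,K_3$. Assume that $(B_0,B_1)$ and $(B_1,B_2)$ are compact and exact. Put $H=K_2\oplus K_1$. Let $\mu\ge0$, let $(M_n)_n$ be a bounded sequence in $\mathcal{H}^\infty(\mathbb{C}_{\operatorname{Re}>\mu};L(H))$ and let $M\in\mathcal{H}^\infty(\mathbb{C}_{\operatorname{Re}>\mu};L(H))$. Assume that for some $c>0$ $$\operatorname{Re}\lambda M_n(\lambda)\ge c\quad(\lambda\in\mathbb{C}_{\operatorname{Re}>\mu},\ n\in\mathbb{N}),$$ and that for all $\lambda\in\mathbb{R}_{>\mu}$, $M_n(\lambda)\to M(\lambda)$ $H$-nonlocally with respect to $$\left(\begin{pmatrix} 0 & B_2^* \\ B_0 & 0 \end{pmatrix},\begin{pmatrix} 0 & B_1 \\ -B_1^* & 0 \end{pmatrix}\right)$$ as $n\to\infty$. Then $$\overline{\left(\partial_tM_n(\partial_t)+\begin{pmatrix} 0 & B_1 \\ -B_1^* & 0 \end{pmatrix}\right)}^{-1}\to\overline{\left(\partial_tM(\partial_t)+\begin{pmatrix} 0 & B_1 \\ -B_1^* & 0 \end{pmatrix}\right)}^{-1}$$ in the weak operator topology of $L(L_\nu^2(\mathbb{R};H))$ for all $\nu>\mu$.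
   Context: Hilbert spaces are complex. $K^*$ is the space of bounded functionals on $K$, with the convention (linear or conjugate-linear) that $v\mapsto\langle w,v\rangle$ belongs to $K^*$. For $T\in L(K)$, $\operatorname{Re}T=\frac12(T+T^* )$, and $\operatorname{Re}T\ge c$ means $\operatorname{Re}\langle T\phi,\phi\rangle\ge c\|\phi\|^2$ for all $\phi$. Complexes: for densely defined closed $A_0:\operatorname{dom}(A_0)\subseteq H_0\to H_1$, $A_1:\operatorname{dom}(A_1)\subseteq H_1\to H_2$, the pair $(A_0,A_1)$ is a complex if $\operatorname{ran}(A_0)\subseteq\ker(A_1)$; exact if $\operatorname{ran}(A_0)=\ker(A_1)$; closed if both ranges are closed; compact if it is a complex and $\operatorname{dom}(A_0^* )\cap\operatorname{dom}(A_1)\hookrightarrow H_1$ compactly (intersection with the natural graph norm); compact complexes are closed. The block operators are $A_0=\begin{pmatrix} 0 & B_2^* \\ B_0 & 0 \end{pmatrix}$ with $\operatorname{dom}(A_0)=\operatorname{dom}(B_0)\oplus\operatorname{dom}(B_2^* )\subseteq H_0=K_0\oplus K_3$ and $A_1=\begin{pmatrix} 0 & B_1 \\ -B_1^* & 0 \end{pmatrix}$ with $\operatorname{dom}(A_1)=\operatorname{dom}(B_1^* )\oplus\operatorname{dom}(B_1)$, $H_1=H_2=K_2\oplus K_1$; $(A_0,A_1)$ is then compact and exact. Nonlocal $H$-convergence with respect to a closed exact $(A_0,A_1)$: one has $H_1=\operatorname{ran}(A_0)\oplus\operatorname{ran}(A_1^* )$; with canonical embeddings $\iota_0,\iota_1$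 of these subspaces put $a_{jk}=\iota_j^*a\iota_k$. For $\alpha,\beta>0$, $\mathcal{M}(\alpha,\beta,(A_0,A_1))$ is the set of continuously invertible $a\in L(H_1)$ with $\operatorname{Re}a_{00}\ge\alpha$, $\operatorname{Re}(a_{00})^{-1}\ge1/\beta$, $\operatorname{Re}(a^{-1})_{11}\ge1/\beta$, $\operatorname{Re}((a^{-1})_{11})^{-1}\ge\alpha$. Let $\mathcal{A}_0$ be $A_0$ restricted to $\operatorname{dom}(\mathcal{A}_0)=\operatorname{dom}(A_0)\cap\operatorname{ran}(A_0^* )$ and $\mathcal{A}_1^*$ be $A_1^*$ restricted to $\operatorname{dom}(\mathcal{A}_1^* )=\operatorname{dom}(A_1^* )\cap\operatorname{ran}(A_1)$, with graph norms. A sequence $(a_n)_n$ in $\mathcal{M}(\alpha,\beta,(A_0,A_1))$ (for some $\alpha,\beta>0$, which for $a_n=M_n(\lambda)$ may depend on $\lambda$) nonlocally $H$-converges to a continuously invertible $a\in L(H_1)$ if for all $f\in\operatorname{dom}(\mathcal{A}_0)^*$, $g\in\operatorname{dom}(\mathcal{A}_1^* )^*$, the (unique) $u_n\in\operatorname{dom}(\mathcal{A}_0)$, $v_n\in\operatorname{dom}(\mathcal{A}_1^* )$ with $\langle a_nA_0u_n,A_0\phi\rangle=f(\phi)$, $\langle a_n^{-1}A_1^*v_n,A_1^*\psi\rangle=g(\psi)$ for all $\phi\in\operatorname{dom}(\mathcal{A}_0)$, $\psi\in\operatorname{dom}(\mathcal{A}_1^* )$ satisfy: $u_n\rightharpoonup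 u$ in $\operatorname{dom}(A_0)$ for some $u$, $v_n\rightharpoonup v$ in $\operatorname{dom}(A_1^* )$ for some $v$, $a_nA_0u_n\rightharpoonup aA_0u$ and $a_n^{-1}A_1^*v_n\rightharpoonup a^{-1}A_1^*v$ in $H_1$, and $\langle aA_0u,A_0\phi\rangle=f(\phi)$, $\langle a^{-1}A_1^*v,A_1^*\psi\rangle=g(\psi)$ for all such $\phi,\psi$. Time derivative: $\mathbb{C}_{\operatorname{Re}>\mu}=\{\lambda\in\mathbb{C};\operatorname{Re}\lambda>\mu\}$; $\mathcal{H}^\infty(\mathbb{C}_{\operatorname{Re}>\mu};L(H))$ is the space of bounded analytic functions $\mathbb{C}_{\operatorname{Re}>\mu}\to L(H)$ (with sup norm). For $\nu>0$, $L_\nu^2(\mathbb{R};H)=\{f\in L^2_{\mathrm{loc}}(\mathbb{R};H);\int_{\mathbb{R}}\|f(t)\|_H^2e^{-2\nu t}\,dt<\infty\}$ (with the corresponding inner product). $\mathcal{L}_\nu:L_\nu^2(\mathbb{R};H)\to L^2(\mathbb{R};H)$ is the unitary extension of $\mathcal{L}_\nu\phi(\xi)=\frac1{\sqrt{2\pi}}\int_{\mathbb{R}}\phi(t)e^{-it\xi-\nu t}\,dt$, $\phi\in C_c(\mathbb{R};H)$. The weak derivative $\partial_t$ in $L^2_\nu(\mathbb{R};H)$ with maximal domain equals $\mathcal{L}_\nu^*(im+\nu)\mathcal{L}_\nu$, where $im+\nu$ is multiplication by $x\mapsto ix+\nu$. For skew-self-adjoint $A$ in $H$ and $M\in\mathcal{H}^\infty(\mathbb{C}_{\operatorname{Re}>\mu};L(H))$,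 $\nu>\mu$, $\overline{\partial_tM(\partial_t)+A}=\mathcal{L}_\nu^*\big((im+\nu)M(im+\nu)+A\big)\mathcal{L}_\nu$, where $(im+\nu)M(im+\nu)+A$ is the abstract multiplication operator by $x\mapsto(ix+\nu)M(ix+\nu)+A$. *)

theory Defs
  imports "HOL-Analysis.Analysis"
begin

subsection \<open>Complex Hilbert spaces\<close>

text \<open>The inner product is conjugate-linear in the first and linear in the second argument, so the
  functional \<open>v \<mapsto> \<langle>w, v\<rangle>\<close> is linear and dual spaces consist of linear functionals.\<close>

class complex_hilbert = banach +
  fixes scaleC :: "complex \<Rightarrow> 'a \<Rightarrow> 'a" (infixr "*\<^sub>C" 75)
    and cinner :: "'a \<Rightarrow> 'a \<Rightarrow> complex"
  assumes scaleC_add_right: "c *\<^sub>C (x + y) = c *\<^sub>C x + c *\<^sub>C y"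
    and scaleC_add_left: "(c + d) *\<^sub>C x = c *\<^sub>C x + d *\<^sub>C x"
    and scaleC_scaleC: "c *\<^sub>C d *\<^sub>C x = (c * d) *\<^sub>C x"
    and scaleC_of_real: "complex_of_real r *\<^sub>C x = r *\<^sub>R x"
    and cinner_commute: "cinner x y = cnj (cinner y x)"
    and cinner_add_right: "cinner x (y + z) = cinner x y + cinner x z"
    and cinner_scaleC_right: "cinner x (c *\<^sub>C y) = c * cinner x y"
    and cinner_self: "cinner x x = complex_of_real ((norm x)\<^sup>2)"

instantiation complex :: complex_hilbert
begin

definition scaleC_complex :: "complex \<Rightarrow> complex \<Rightarrow> complex" where
  "scaleC_complex c x = c * x"

definition cinner_complex :: "complex \<Rightarrow> complex \<Rightarrow> complex" where
  "cinner_complex x y = cnj x * y"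

instance
proof
  fix x :: complex
  show "cinner x x = complex_of_real ((norm x)\<^sup>2)"
    by (metis cinner_complex_def complex_norm_square mult.commute)
qed (simp_all add: scaleC_complex_def cinner_complex_def scaleR_conv_of_real algebra_simps)

end

text \<open>The product type is the orthogonal sum; its norm is the Hilbert norm of the sum.\<close>

instantiation prod :: (complex_hilbert, complex_hilbert) complex_hilbert
begin

definition scaleC_prod :: "complex \<Rightarrow> 'a \<times> 'b \<Rightarrow> 'a \<times> 'b" where
  "scaleC_prod c p = (c *\<^sub>C fst p, c *\<^sub>C snd p)"

definition cinner_prod :: "'a \<times> 'b \<Rightarrow> 'a \<times> 'b \<Rightarrow> complex" where
  "cinner_prod p q = cinner (fst p) (fst q) + cinner (snd p) (snd q)"

instance
proof
  fix x y :: "'a \<times> 'b"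
  show "cinner x y = cnj (cinner y x)"
    unfolding cinner_prod_def
    by (simp add: cinner_commute[of "fst x" "fst y"] cinner_commute[of "snd x" "snd y"])
  show "cinner x x = complex_of_real ((norm x)\<^sup>2)"
    unfolding cinner_prod_def by (simp add: cinner_self norm_prod_def)
qed (simp_all add: scaleC_prod_def cinner_prod_def scaleC_add_right scaleC_add_left scaleC_scaleC
      scaleC_of_real cinner_add_right cinner_scaleC_right scaleR_prod_def algebra_simps)

end

definition csubspace :: "'a::complex_hilbert set \<Rightarrow> bool" where
  "csubspace S \<longleftrightarrow> 0 \<in> S \<and> (\<forall>x\<in>S. \<forall>y\<in>S. x + y \<in> S) \<and> (\<forall>c. \<forall>x\<in>S. c *\<^sub>C x \<in> S)"

definition weakly_converges_in ::
    "'a::complex_hilbert set \<Rightarrow> (nat \<Rightarrow> 'a) \<Rightarrow> 'a \<Rightarrow> bool" where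
  "weakly_converges_in S x l \<longleftrightarrow>
     (\<forall>n. x n \<in> S) \<and> l \<in> S \<and> (\<forall>q\<in>S. (\<lambda>n. cinner q (x n)) \<longlonglongrightarrow> cinner q l)"


subsection \<open>Bounded operators\<close>

definition bounded_clinear :: "('a::complex_hilbert \<Rightarrow> 'b::complex_hilbert) \<Rightarrow> bool" where
  "bounded_clinear T \<longleftrightarrow> bounded_linear T \<and> (\<forall>c x. T (c *\<^sub>C x) = c *\<^sub>C T x)"

definition continuously_invertible :: "('a::complex_hilbert \<Rightarrow> 'a) \<Rightarrow> bool" where
  "continuously_invertible T \<longleftrightarrow> bounded_clinear T \<and> bij T \<and> bounded_clinear (inv T)"

text \<open>\<open>Re T \<ge> c\<close> for an operator \<open>T\<close> in the Hilbert space \<open>S\<close>.\<close>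

definition re_ge :: "'a::complex_hilbert set \<Rightarrow> ('a \<Rightarrow> 'a) \<Rightarrow> real \<Rightarrow> bool" where
  "re_ge S T c \<longleftrightarrow> (\<forall>x\<in>S. Re (cinner (T x) x) \<ge> c * (norm x)\<^sup>2)"

text \<open>The adjoint of the embedding of a closed subspace \<open>S\<close>, i.e. the orthogonal projection
  onto \<open>S\<close>; and the compression \<open>\<iota>\<^sup>* T \<iota>\<close>, to be used on \<open>S\<close> only.\<close>

definition embedding_adj :: "'a::complex_hilbert set \<Rightarrow> 'a \<Rightarrow> 'a" where
  "embedding_adj S x = (THE y. y \<in> S \<and> (\<forall>z\<in>S. cinner z y = cinner z x))"

definition compression :: "'a::complex_hilbert set \<Rightarrow> ('a \<Rightarrow> 'a) \<Rightarrow> 'a \<Rightarrow> 'a" where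
  "compression S T x = embedding_adj S (T x)"

text \<open>Bounded analytic functions on the half-plane \<open>Re z > \<mu>\<close>, with complex derivatives taken in
  operator norm. Values outside the half-plane are irrelevant.\<close>

definition Hinf :: "real \<Rightarrow> (complex \<Rightarrow> 'a::complex_hilbert \<Rightarrow> 'a) set" where
  "Hinf \<mu> = {M.
     (\<forall>z. Re z > \<mu> \<longrightarrow> bounded_clinear (M z)) \<and>
     (\<forall>z. Re z > \<mu> \<longrightarrow> (\<exists>D. bounded_clinear D \<and>
        ((\<lambda>w. onorm (\<lambda>x. inverse (w - z) *\<^sub>C (M w x - M z x) - D x)) \<longlongrightarrow> 0) (at z))) \<and>
     (\<exists>C. \<forall>z. Re z > \<mu> \<longrightarrow> onorm (M z) \<le> C)}"

definition Hinf_bounded_seq ::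
    "real \<Rightarrow> (nat \<Rightarrow> complex \<Rightarrow> 'a::complex_hilbert \<Rightarrow> 'a) \<Rightarrow> bool" where
  "Hinf_bounded_seq \<mu> M \<longleftrightarrow>
     (\<forall>n. M n \<in> Hinf \<mu>) \<and> (\<exists>C. \<forall>n z. Re z > \<mu> \<longrightarrow> onorm (M n z) \<le> C)"


subsection \<open>Unbounded operators\<close>

text \<open>An unbounded operator is identified with its graph. Hence the domain, range and composition
  are those of relations, and the domain of \<open>R\<close> with the graph norm is the subspace \<open>R\<close> of the
  product space.\<close>

definition closed_operator :: "('a::complex_hilbert \<times> 'b::complex_hilbert) set \<Rightarrow> bool" where
  "closed_operator R \<longleftrightarrow> csubspace R \<and> single_valued R \<and> closed R"

definition densely_defined :: "('a::complex_hilbert \<times> 'b::complex_hilbert) set \<Rightarrow> bool" where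
  "densely_defined R \<longleftrightarrow> closure (Domain R) = UNIV"

definition op_kernel :: "('a::complex_hilbert \<times> 'b::complex_hilbert) set \<Rightarrow> 'a set" where
  "op_kernel R = {x. (x, 0) \<in> R}"

definition op_adj ::
    "('a::complex_hilbert \<times> 'b::complex_hilbert) set \<Rightarrow> ('b \<times> 'a) set" where
  "op_adj R = {(y, x). \<forall>(u, v)\<in>R. cinner v y = cinner u x}"

definition op_neg :: "('a::complex_hilbert \<times> 'b::complex_hilbert) set \<Rightarrow> ('a \<times> 'b) set" where
  "op_neg R = {(x, - y) | x y. (x, y) \<in> R}"

definition op_restrict ::
    "('a::complex_hilbert \<times> 'b::complex_hilbert) set \<Rightarrow> 'a set \<Rightarrow> ('a \<times> 'b) set" where
  "op_restrict R S = {(x, y) \<in> R. x \<in> S}"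

text \<open>The block operator matrix with zero diagonal, upper right entry \<open>P\<close> and lower left
  entry \<open>Q\<close>.\<close>

definition op_antidiag ::
    "('b::complex_hilbert \<times> 'c::complex_hilbert) set \<Rightarrow>
     ('a::complex_hilbert \<times> 'd::complex_hilbert) set \<Rightarrow> (('a \<times> 'b) \<times> ('c \<times> 'd)) set" where
  "op_antidiag P Q = {((x1, x2), (y1, y2)). (x2, y1) \<in> P \<and> (x1, y2) \<in> Q}"

definition is_complex ::
    "('a::complex_hilbert \<times> 'b::complex_hilbert) set \<Rightarrow> ('b \<times> 'c::complex_hilbert) set \<Rightarrow> bool" where
  "is_complex A0 A1 \<longleftrightarrow> Range A0 \<subseteq> op_kernel A1"

definition exact_complex ::
    "('a::complex_hilbert \<times> 'b::complex_hilbert) set \<Rightarrow> ('b \<times> 'c::complex_hilbert) set \<Rightarrow> bool" where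
  "exact_complex A0 A1 \<longleftrightarrow> Range A0 = op_kernel A1"

text \<open>Compactness of the embedding: the unit ball of the intersection of the domains of \<open>A\<^sub>0\<^sup>*\<close>
  and \<open>A\<^sub>1\<close> is relatively compact. The norm of the triple is the graph norm of \<open>x\<close>.\<close>

definition compact_complex ::
    "('a::complex_hilbert \<times> 'b::complex_hilbert) set \<Rightarrow> ('b \<times> 'c::complex_hilbert) set \<Rightarrow> bool" where
  "compact_complex A0 A1 \<longleftrightarrow> is_complex A0 A1 \<and>
     compact (closure {x. \<exists>y z. (x, y) \<in> op_adj A0 \<and> (x, z) \<in> A1 \<and> norm (x, y, z) \<le> 1})"


subsection \<open>Nonlocal H-convergence\<close>

definition nonlocal_class ::
    "real \<Rightarrow> real \<Rightarrow> ('a::complex_hilbert \<times> 'b::complex_hilbert) set \<Rightarrow>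
     ('b \<times> 'c::complex_hilbert) set \<Rightarrow> ('b \<Rightarrow> 'b) set" where
  "nonlocal_class \<alpha> \<beta> A0 A1 = {a. continuously_invertible a \<and>
     (let R0 = Range A0; a00 = compression R0 a;
          R1 = Range (op_adj A1); b11 = compression R1 (inv a)
      in re_ge R0 a00 \<alpha> \<and>
         bij_betw a00 R0 R0 \<and> re_ge R0 (inv_into R0 a00) (1 / \<beta>) \<and>
         re_ge R1 b11 (1 / \<beta>) \<and>
         bij_betw b11 R1 R1 \<and> re_ge R1 (inv_into R1 b11) \<alpha>)}"

text \<open>The dual of the domain of \<open>R\<close> with graph norm. Values outside the domain are irrelevant.\<close>

definition graph_dual ::
    "('a::complex_hilbert \<times> 'b::complex_hilbert) set \<Rightarrow> ('a \<Rightarrow> complex) set" where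
  "graph_dual R = {f.
     (\<forall>x\<in>Domain R. \<forall>y\<in>Domain R. f (x + y) = f x + f y) \<and>
     (\<forall>c. \<forall>x\<in>Domain R. f (c *\<^sub>C x) = c * f x) \<and>
     (\<exists>C. \<forall>(x, y)\<in>R. cmod (f x) \<le> C * norm (x, y))}"

text \<open>\<open>V\<close> stands for \<open>R v\<close>, where \<open>v\<close> in the domain of \<open>R\<close> solves the variational problem
  \<open>\<langle>b R v, R \<phi>\<rangle> = f \<phi>\<close>. For a closed exact complex and coefficients from the class above the
  solutions exist and are unique by the Lax--Milgram lemma, so quantifying over all sequences of
  solutions below amounts to considering the one such sequence.\<close>

definition solves_variational ::
    "('a::complex_hilbert \<times> 'b::complex_hilbert) set \<Rightarrow> ('b \<Rightarrow> 'b) \<Rightarrow> ('a \<Rightarrow> complex) \<Rightarrow> 'b \<Rightarrow> bool" where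
  "solves_variational R b f V \<longleftrightarrow> (\<forall>(\<phi>, \<Phi>)\<in>R. cinner (b V) \<Phi> = f \<phi>)"

definition nonlocal_H_converges ::
    "('a::complex_hilbert \<times> 'b::complex_hilbert) set \<Rightarrow> ('b \<times> 'c::complex_hilbert) set \<Rightarrow>
     (nat \<Rightarrow> 'b \<Rightarrow> 'b) \<Rightarrow> ('b \<Rightarrow> 'b) \<Rightarrow> bool" where
  "nonlocal_H_converges A0 A1 a b \<longleftrightarrow>
     (\<exists>\<alpha>>0. \<exists>\<beta>>0. \<forall>n. a n \<in> nonlocal_class \<alpha> \<beta> A0 A1) \<and>
     continuously_invertible b \<and>
     (let R0 = op_restrict A0 (Range (op_adj A0)); R1 = op_restrict (op_adj A1) (Range A1)
      in \<forall>f\<in>graph_dual R0. \<forall>g\<in>graph_dual R1. \<forall>u U v V.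
        (\<forall>n. (u n, U n) \<in> R0 \<and> solves_variational R0 (a n) f (U n)) \<and>
        (\<forall>n. (v n, V n) \<in> R1 \<and> solves_variational R1 (inv (a n)) g (V n)) \<longrightarrow>
        (\<exists>u' U' v' V'.
          weakly_converges_in A0 (\<lambda>n. (u n, U n)) (u', U') \<and>
          weakly_converges_in (op_adj A1) (\<lambda>n. (v n, V n)) (v', V') \<and>
          weakly_converges_in UNIV (\<lambda>n. a n (U n)) (b U') \<and>
          weakly_converges_in UNIV (\<lambda>n. inv (a n) (V n)) (inv b V') \<and>
          solves_variational R0 b f U' \<and> solves_variational R1 (inv b) g V'))"


subsection \<open>Weighted vector-valued square-integrable functions\<close>

text \<open>Elements of \<open>L\<^sup>2\<^sub>\<nu>(\<real>; H)\<close> are represented by functions, to be read modulo equality almost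
  everywhere. Measurability is strong (Bochner) measurability, which does not require \<open>H\<close> to be
  separable; \<open>L2 0\<close> is the unweighted space.\<close>

definition strongly_measurable :: "(real \<Rightarrow> 'h::complex_hilbert) \<Rightarrow> bool" where
  "strongly_measurable f \<longleftrightarrow>
     (\<exists>s. (\<forall>n. simple_function lebesgue (s n)) \<and> (AE t in lebesgue. (\<lambda>n. s n t) \<longlonglongrightarrow> f t))"

definition L2 :: "real \<Rightarrow> (real \<Rightarrow> 'h::complex_hilbert) set" where
  "L2 \<nu> = {f. strongly_measurable f \<and>
     integrable lebesgue (\<lambda>t. (norm (f t))\<^sup>2 * exp (- 2 * \<nu> * t))}"

definition L2_inner ::
    "real \<Rightarrow> (real \<Rightarrow> 'h::complex_hilbert) \<Rightarrow> (real \<Rightarrow> 'h) \<Rightarrow> complex" where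
  "L2_inner \<nu> f g = (LINT t|lebesgue. cinner (f t) (g t) * complex_of_real (exp (- 2 * \<nu> * t)))"

definition L2_norm :: "real \<Rightarrow> (real \<Rightarrow> 'h::complex_hilbert) \<Rightarrow> real" where
  "L2_norm \<nu> f = sqrt (LINT t|lebesgue. (norm (f t))\<^sup>2 * exp (- 2 * \<nu> * t))"

text \<open>Operators between these spaces are again identified with their graphs. The graphs of all
  operators occurring below, except for the transform on \<open>C\<^sub>c\<close> before closure and sums, are
  saturated with respect to equality almost everywhere, so that relational composition is the
  composition of operators.

  In \<open>L2_closure\<close>, membership of the approximants in the \<open>L\<^sup>2\<close> spaces is demanded explicitly because
  \<open>L2_norm\<close> is meaningless outside of them.\<close>

type_synonym 'h L2_rel = "((real \<Rightarrow> 'h) \<times> (real \<Rightarrow> 'h)) set"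

definition L2_closure :: "real \<Rightarrow> real \<Rightarrow> 'h::complex_hilbert L2_rel \<Rightarrow> 'h L2_rel" where
  "L2_closure \<nu> \<kappa> R = {(f, g). f \<in> L2 \<nu> \<and> g \<in> L2 \<kappa> \<and>
     (\<forall>\<epsilon>>0. \<exists>(f', g')\<in>R. f' \<in> L2 \<nu> \<and> g' \<in> L2 \<kappa> \<and>
        L2_norm \<nu> (\<lambda>t. f t - f' t) < \<epsilon> \<and> L2_norm \<kappa> (\<lambda>t. g t - g' t) < \<epsilon>)}"

definition L2_adj :: "real \<Rightarrow> real \<Rightarrow> 'h::complex_hilbert L2_rel \<Rightarrow> 'h L2_rel" where
  "L2_adj \<nu> \<kappa> R = {(g, f). g \<in> L2 \<kappa> \<and> f \<in> L2 \<nu> \<and>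
     (\<forall>(u, v)\<in>R. L2_inner \<kappa> v g = L2_inner \<nu> u f)}"

definition L2_sum :: "'h::complex_hilbert L2_rel \<Rightarrow> 'h L2_rel \<Rightarrow> 'h L2_rel" where
  "L2_sum R S = {(f, \<lambda>t. g t + h t) | f g h. (f, g) \<in> R \<and> (f, h) \<in> S}"

definition L2_bounded_operator :: "real \<Rightarrow> 'h::complex_hilbert L2_rel \<Rightarrow> bool" where
  "L2_bounded_operator \<nu> T \<longleftrightarrow>
     T \<subseteq> L2 \<nu> \<times> L2 \<nu> \<and> Domain T = L2 \<nu> \<and>
     (\<forall>(f, g)\<in>T. \<forall>(f', g')\<in>T. (\<lambda>t. f t + f' t, \<lambda>t. g t + g' t) \<in> T) \<and>
     (\<forall>c. \<forall>(f, g)\<in>T. (\<lambda>t. c *\<^sub>C f t, \<lambda>t. c *\<^sub>C g t) \<in> T) \<and>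
     (\<exists>C. \<forall>(f, g)\<in>T. L2_norm \<nu> g \<le> C * L2_norm \<nu> f)"

text \<open>Convergence in the weak operator topology of \<open>L(L\<^sup>2\<^sub>\<nu>(\<real>; H))\<close>; that all operators involved
  belong to this space is part of the notion. The linearity and the bound above make the values
  of the operators unique up to equality almost everywhere, so the choice of \<open>u\<close> and \<open>w\<close> is
  immaterial.\<close>

definition L2_wot_converges ::
    "real \<Rightarrow> (nat \<Rightarrow> 'h::complex_hilbert L2_rel) \<Rightarrow> 'h L2_rel \<Rightarrow> bool" where
  "L2_wot_converges \<nu> T S \<longleftrightarrow>
     (\<forall>n. L2_bounded_operator \<nu> (T n)) \<and> L2_bounded_operator \<nu> S \<and>
     (\<forall>f\<in>L2 \<nu>. \<forall>g\<in>L2 \<nu>. \<forall>u w. (\<forall>n. (f, u n) \<in> T n) \<and> (f, w) \<in> S \<longrightarrow>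
        (\<lambda>n. L2_inner \<nu> (u n) g) \<longlonglongrightarrow> L2_inner \<nu> w g)"


subsection \<open>The time derivative and its functional calculus\<close>

definition compactly_supported :: "(real \<Rightarrow> 'a::real_normed_vector) \<Rightarrow> bool" where
  "compactly_supported \<phi> \<longleftrightarrow> compact (closure {t. \<phi> t \<noteq> 0})"

definition test_function :: "(real \<Rightarrow> real) \<Rightarrow> bool" where
  "test_function \<phi> \<longleftrightarrow>
     (\<forall>k t. (deriv ^^ k) \<phi> field_differentiable at t) \<and> compactly_supported \<phi>"

text \<open>Weak derivative with maximal domain. The \<open>H\<close>-valued identity \<open>\<integral> \<phi>' f = - \<integral> \<phi> g\<close> is tested
  against all elements of \<open>H\<close>, as the Bochner integral of the library needs separability.\<close>

definition time_derivative :: "real \<Rightarrow> 'h::complex_hilbert L2_rel" where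
  "time_derivative \<nu> = {(f, g). f \<in> L2 \<nu> \<and> g \<in> L2 \<nu> \<and>
     (\<forall>\<phi> h. test_function \<phi> \<longrightarrow>
        (LINT t|lebesgue. complex_of_real (deriv \<phi> t) * cinner h (f t)) =
        - (LINT t|lebesgue. complex_of_real (\<phi> t) * cinner h (g t)))}"

definition laplace_integral :: "real \<Rightarrow> (real \<Rightarrow> 'h::complex_hilbert) \<Rightarrow> real \<Rightarrow> 'h" where
  "laplace_integral \<nu> \<phi> \<xi> = (1 / sqrt (2 * pi)) *\<^sub>R
     integral UNIV (\<lambda>t. exp (- \<i> * complex_of_real (t * \<xi>) - complex_of_real (\<nu> * t)) *\<^sub>C \<phi> t)"

text \<open>The extension by continuity from \<open>C\<^sub>c(\<real>; H)\<close> to \<open>L\<^sup>2\<^sub>\<nu>(\<real>; H)\<close>.\<close>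

definition fourier_laplace :: "real \<Rightarrow> 'h::complex_hilbert L2_rel" where
  "fourier_laplace \<nu> = L2_closure \<nu> 0
     {(\<phi>, laplace_integral \<nu> \<phi>) | \<phi>. continuous_on UNIV \<phi> \<and> compactly_supported \<phi>}"

definition mult_operator ::
    "(real \<Rightarrow> 'h::complex_hilbert \<Rightarrow> 'h) \<Rightarrow> 'h L2_rel" where
  "mult_operator m = {(F, G). F \<in> L2 0 \<and> G \<in> L2 0 \<and> (AE \<xi> in lebesgue. G \<xi> = m \<xi> (F \<xi>))}"

text \<open>\<open>M(\<partial>\<^sub>t) = \<L>\<^sub>\<nu>\<^sup>* M(im + \<nu>) \<L>\<^sub>\<nu>\<close>; note that relational composition is written in the
  opposite order.\<close>

definition material_law ::
    "real \<Rightarrow> (complex \<Rightarrow> 'h::complex_hilbert \<Rightarrow> 'h) \<Rightarrow> 'h L2_rel" where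
  "material_law \<nu> M =
     fourier_laplace \<nu> O mult_operator (\<lambda>\<xi>. M (\<i> * complex_of_real \<xi> + complex_of_real \<nu>)) O
     L2_adj \<nu> 0 (fourier_laplace \<nu>)"

text \<open>The canonical extension of an operator in \<open>H\<close> to \<open>L\<^sup>2\<^sub>\<nu>(\<real>; H)\<close>.\<close>

definition L2_lift :: "real \<Rightarrow> ('h::complex_hilbert \<times> 'h) set \<Rightarrow> 'h L2_rel" where
  "L2_lift \<nu> A = {(f, g). f \<in> L2 \<nu> \<and> g \<in> L2 \<nu> \<and> (AE t in lebesgue. (f t, g t) \<in> A)}"

definition evolution_operator ::
    "real \<Rightarrow> (complex \<Rightarrow> 'h::complex_hilbert \<Rightarrow> 'h) \<Rightarrow> ('h \<times> 'h) set \<Rightarrow> 'h L2_rel" where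
  "evolution_operator \<nu> M A = L2_sum (material_law \<nu> M O time_derivative \<nu>) (L2_lift \<nu> A)"

end

theory Submission
  imports Defs "HOL-Complex_Analysis.Great_Picard" "HOL-Probability.Characteristic_Functions"
begin

text \<open>
  The transform \<open>\<L>\<^sub>\<nu>\<close> turns \<open>\<partial>\<^sub>t M(\<partial>\<^sub>t) + A\<close> into multiplication by \<open>z M(z) + A\<close> with \<open>z = i\<xi> + \<nu>\<close>. As
  \<open>Re z M(z) \<ge> c\<close> and \<open>A\<close> is skew-self-adjoint, these operators have inverses of norm at most \<open>1 / c\<close>, and the
  closure of the evolution operator has the inverse that multiplies the transform by
  \<open>(z M(z) + A)\<^sup>-\<^sup>1\<close> (\<open>solution_operator_iff\<close>). By dominated convergence the theorem follows if
  \<open>(z M\<^sub>n(z) + A)\<^sup>-\<^sup>1\<close> tends to \<open>(z M(z) + A)\<^sup>-\<^sup>1\<close> in the weak operator topology for each \<open>z\<close> on the line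
  \<open>Re z = \<nu>\<close> (\<open>L2_wot_converges_if_resolvents_converge\<close>).

  Tested with two vectors, these inverses are holomorphic functions of \<open>z\<close> in the half-plane \<open>Re z > \<mu>\<close>, bounded
  uniformly in \<open>n\<close>. By Vitali's theorem it is enough to know the limit for real \<open>z > \<mu>\<close>. The weak limits are then
  the inverses of \<open>z M(z) + A\<close> for all \<open>z\<close> by the identity theorem, and weak lower semicontinuity of the norm gives
  \<open>Re z M(z) \<ge> c\<close> (\<open>resolvent_convergence_half_plane\<close>).

  For real \<open>z = l\<close> put \<open>a\<^sub>n = M\<^sub>n(l)\<close>, \<open>N = ker A\<close> and \<open>u\<^sub>n = (l a\<^sub>n + A)\<^sup>-\<^sup>1 x\<close>. Nonlocal H-convergence to \<open>b\<close> says
  that vectors \<open>w\<^sub>n\<close> for which the \<open>N\<close>-part of \<open>a\<^sub>n w\<^sub>n\<close> and the \<open>N\<^sup>\<bottom>\<close>-part of \<open>w\<^sub>n\<close> are fixed converge weakly to a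
  vector \<open>w\<close>, and \<open>a\<^sub>n w\<^sub>n\<close> to \<open>b w\<close> (\<open>recovery_exists\<close>). The \<open>N\<close>-part of \<open>a\<^sub>n u\<^sub>n\<close> is fixed by the equation, since
  the range of \<open>A\<close> is \<open>N\<^sup>\<bottom>\<close>. The \<open>N\<^sup>\<bottom>\<close>-part of \<open>u\<^sub>n\<close> is bounded in the graph norm of \<open>A\<close>, so by compactness
  it converges in norm along a subsequence, and replacing it by its limit changes \<open>u\<^sub>n\<close> by a null sequence. Hence the
  weak limit \<open>u\<close> of \<open>u\<^sub>n\<close> satisfies \<open>l b u + A u = x\<close>, which determines it
  (\<open>resolvent_converges_at_real_point\<close>).

  The block operator \<open>A\<^sub>1\<close> is skew-self-adjoint, and exactness and compactness of \<open>(B\<^sub>0, B\<^sub>1)\<close> and \<open>(B\<^sub>1, B\<^sub>2)\<close>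
  give \<open>ran A\<^sub>0 = ker A\<^sub>1\<close> and the compactness of the embedding of
  \<open>dom A\<^sub>1 \<inter> (ker A\<^sub>1)\<^sup>\<bottom>\<close> with the graph norm
  (\<open>Range_block_eq_kernel\<close>, \<open>compact_block\<close>).

  The analysis in \<open>L\<^sup>2\<^sub>\<nu>\<close> has to deal with strongly measurable functions in Hilbert spaces that may be
  non-separable. The transform is shown to be unitary by a Gaussian summation (\<open>Plancherel_Cc\<close>). That the weak
  derivative with maximal domain has the symbol \<open>i\<xi> + \<nu>\<close> rests on the fact that for \<open>\<nu> > 0\<close> no function in
  \<open>L\<^sup>2\<^sub>\<nu>\<close> other than zero has weak derivative zero (\<open>weak_derivative_zero\<close>).
\<close>


section \<open>Complex Hilbert spaces\<close>

lemma cinner_add_left: "cinner (x + y) z = cinner x z + cinner y z"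
  by (metis cinner_add_right cinner_commute complex_cnj_add)

lemma cinner_scaleC_left: "cinner (a *\<^sub>C x) y = cnj a * cinner x y"
  by (metis cinner_commute cinner_scaleC_right complex_cnj_mult)

lemma cinner_zero_right [simp]: "cinner x 0 = 0"
  using cinner_add_right[of x 0 0] by simp

lemma cinner_zero_left [simp]: "cinner 0 x = 0"
  using cinner_add_left[of 0 0 x] by simp

lemma cinner_minus_right [simp]: "cinner x (- y) = - cinner x y"
  using cinner_add_right[of x y "- y"] by (simp add: minus_unique)

lemma cinner_minus_left [simp]: "cinner (- x) y = - cinner x y"
  using cinner_add_left[of x "- x" y] by (simp add: minus_unique)

lemma cinner_diff_right: "cinner x (y - z) = cinner x y - cinner x z"
  using cinner_add_right[of x y "- z"] by simp

lemma cinner_diff_left: "cinner (x - y) z = cinner x z - cinner y z"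
  using cinner_add_left[of x "- y" z] by simp

lemma cinner_scaleR_right: "cinner x (r *\<^sub>R y) = of_real r * cinner x y"
  by (metis cinner_scaleC_right scaleC_of_real)

lemma cinner_scaleR_left: "cinner (r *\<^sub>R x) y = of_real r * cinner x y"
  by (metis cinner_scaleC_left complex_cnj_complex_of_real scaleC_of_real)

lemma Re_cinner_commute: "Re (cinner x y) = Re (cinner y x)"
  by (subst cinner_commute) simp

lemma cinner_eq_zero_commute: "cinner x y = 0 \<longleftrightarrow> cinner y x = 0"
  by (metis cinner_commute complex_cnj_zero)

lemma Re_cinner_self: "Re (cinner x x) = (norm x)\<^sup>2"
  by (simp add: cinner_self)

lemma cinner_self_eq_zero [simp]: "cinner x x = 0 \<longleftrightarrow> x = 0"
  by (simp add: cinner_self)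

lemma scaleC_zero_left [simp]: "0 *\<^sub>C x = 0"
  using scaleC_of_real[of 0 x] by simp

lemma scaleC_one [simp]: "1 *\<^sub>C x = x"
  using scaleC_of_real[of 1 x] by simp

lemma scaleC_minus_one: "(- 1) *\<^sub>C x = - x"
  using scaleC_of_real[of "-1" x] by simp

lemma scaleC_zero_right [simp]: "c *\<^sub>C 0 = (0::'a::complex_hilbert)"
  using scaleC_add_right[of c 0 "0::'a"] by simp

lemma scaleC_minus_right: "c *\<^sub>C (- x) = - (c *\<^sub>C x)"
  using scaleC_add_right[of c x "- x"] by (simp add: minus_unique)

lemma scaleC_minus_left: "(- c) *\<^sub>C x = - (c *\<^sub>C x)"
  using scaleC_add_left[of c "- c" x] by (simp add: minus_unique)

lemma scaleC_diff_right: "c *\<^sub>C (x - y) = c *\<^sub>C x - c *\<^sub>C y"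
  using scaleC_add_right[of c x "- y"] by (simp add: scaleC_minus_right)

lemma scaleC_diff_left: "(c - d) *\<^sub>C x = c *\<^sub>C x - d *\<^sub>C x"
  using scaleC_add_left[of c "- d" x] by (simp add: scaleC_minus_left)

lemma scaleC_scaleR: "c *\<^sub>C (r *\<^sub>R x) = (of_real r * c) *\<^sub>C x"
  by (metis mult.commute scaleC_of_real scaleC_scaleC)

lemma scaleR_scaleC: "r *\<^sub>R (c *\<^sub>C x) = (of_real r * c) *\<^sub>C x"
  by (metis scaleC_of_real scaleC_scaleC)

lemma norm_scaleC [simp]: "norm (c *\<^sub>C x) = cmod c * norm x"
proof -
  have "complex_of_real ((norm (c *\<^sub>C x))\<^sup>2) = (c * cnj c) * of_real ((norm x)\<^sup>2)"
    by (simp only: cinner_self[symmetric] cinner_scaleC_left cinner_scaleC_right) simp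
  also have "\<dots> = of_real ((cmod c * norm x)\<^sup>2)"
    by (simp add: complex_norm_square[symmetric] power_mult_distrib)
  finally have "(norm (c *\<^sub>C x))\<^sup>2 = (cmod c * norm x)\<^sup>2"
    using of_real_eq_iff by blast
  then show ?thesis
    by (metis abs_norm_cancel norm_ge_zero norm_mult power2_eq_iff_nonneg zero_le_mult_iff)
qed

lemma norm_add_square: "(norm (x + y))\<^sup>2 = (norm x)\<^sup>2 + 2 * Re (cinner x y) + (norm y)\<^sup>2"
  using Re_cinner_commute[of x y]
  by (simp flip: Re_cinner_self add: cinner_add_left cinner_add_right)

lemma norm_diff_square: "(norm (x - y))\<^sup>2 = (norm x)\<^sup>2 - 2 * Re (cinner x y) + (norm y)\<^sup>2"
  using norm_add_square[of x "- y"] by simp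

lemma Cauchy_Schwarz: "cmod (cinner x y) \<le> norm x * norm y"
proof (cases "y = 0")
  case False
  define c where "c = cinner y x / of_real ((norm y)\<^sup>2)"
  have *: "cinner y (x - c *\<^sub>C y) = 0"
    using False by (simp add: cinner_diff_right cinner_scaleC_right cinner_self c_def)
  have "(norm x)\<^sup>2 = (norm (c *\<^sub>C y + (x - c *\<^sub>C y)))\<^sup>2"
    by simp
  also have "\<dots> = (norm (c *\<^sub>C y))\<^sup>2 + (norm (x - c *\<^sub>C y))\<^sup>2"
    unfolding norm_add_square cinner_scaleC_left * by simp
  finally have "(norm (c *\<^sub>C y))\<^sup>2 \<le> (norm x)\<^sup>2"
    by simp
  then have "norm (c *\<^sub>C y) \<le> norm x"
    by (simp add: power2_le_iff_abs_le)
  moreover have "norm (c *\<^sub>C y) = cmod (cinner y x) / norm y"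
    using False by (simp add: c_def norm_divide norm_power norm_mult power2_eq_square)
  ultimately have "cmod (cinner y x) / norm y \<le> norm x"
    by simp
  then have "cmod (cinner y x) \<le> norm x * norm y"
    using False by (simp add: pos_divide_le_eq)
  then show ?thesis
    by (metis cinner_commute complex_mod_cnj)
qed simp

lemma abs_Re_cinner_le: "\<bar>Re (cinner x y)\<bar> \<le> norm x * norm y"
  using Cauchy_Schwarz[of x y] abs_Re_le_cmod[of "cinner x y"] by linarith

lemma bounded_bilinear_cinner: "bounded_bilinear cinner"
  by unfold_locales
    (auto simp: cinner_add_left cinner_add_right cinner_scaleR_left cinner_scaleR_right
      scaleR_conv_of_real intro!: exI[of _ 1] Cauchy_Schwarz)

lemma bounded_bilinear_scaleC: "bounded_bilinear scaleC"
  by unfold_locales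
    (auto simp: scaleC_add_left scaleC_add_right scaleC_scaleR scaleR_scaleC scaleC_scaleC
      scaleR_conv_of_real mult.commute intro!: exI[of _ 1])

lemmas tendsto_cinner = bounded_bilinear.tendsto[OF bounded_bilinear_cinner]
lemmas tendsto_scaleC = bounded_bilinear.tendsto[OF bounded_bilinear_scaleC]
lemmas continuous_on_cinner = bounded_bilinear.continuous_on[OF bounded_bilinear_cinner]
lemmas continuous_on_scaleC = bounded_bilinear.continuous_on[OF bounded_bilinear_scaleC]

lemma bounded_linear_cinner_right: "bounded_linear (cinner x)"
  using bounded_bilinear_cinner by (rule bounded_bilinear.bounded_linear_right)

lemma cinner_extensionality: "(\<And>z. cinner z x = cinner z y) \<Longrightarrow> x = y"
  by (metis cinner_diff_right cinner_self_eq_zero right_minus_eq)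

lemma cinner_Pair [simp]: "cinner (a, b) (x, y) = cinner a x + cinner b y"
  by (simp add: cinner_prod_def)

lemma scaleC_Pair [simp]: "c *\<^sub>C (x, y) = (c *\<^sub>C x, c *\<^sub>C y)"
  by (simp add: scaleC_prod_def)


subsection \<open>Orthogonal projection\<close>

lemma csubspace_diff: "csubspace S \<Longrightarrow> x \<in> S \<Longrightarrow> y \<in> S \<Longrightarrow> x - y \<in> S"
  unfolding csubspace_def by (metis add_uminus_conv_diff scaleC_minus_one)

lemma csubspace_add: "csubspace S \<Longrightarrow> x \<in> S \<Longrightarrow> y \<in> S \<Longrightarrow> x + y \<in> S"
  and csubspace_scaleC: "csubspace S \<Longrightarrow> x \<in> S \<Longrightarrow> c *\<^sub>C x \<in> S"
  and csubspace_0: "csubspace S \<Longrightarrow> 0 \<in> S"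
  by (auto simp: csubspace_def)

lemma csubspace_scaleR: "csubspace S \<Longrightarrow> x \<in> S \<Longrightarrow> r *\<^sub>R x \<in> S"
  by (metis csubspace_scaleC scaleC_of_real)

text \<open>A sequence in \<open>S\<close> that minimizes the distance to \<open>x\<close> is Cauchy by the parallelogram law, and
  its limit is the foot of the perpendicular.\<close>

lemma orthogonal_projection_exists:
  assumes S: "csubspace S" "closed S"
  obtains y where "y \<in> S" "\<And>z. z \<in> S \<Longrightarrow> cinner z (x - y) = 0"
proof -
  define d where "d = (INF s\<in>S. (norm (x - s))\<^sup>2)"
  have ne: "S \<noteq> {}" using csubspace_0[OF S(1)] by auto
  have bdd: "bdd_below ((\<lambda>s. (norm (x - s))\<^sup>2) ` S)"
    by (rule bdd_belowI[of _ 0]) auto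
  have dle: "d \<le> (norm (x - s))\<^sup>2" if "s \<in> S" for s
    unfolding d_def by (rule cINF_lower[OF bdd that])
  have "\<exists>s\<in>S. (norm (x - s))\<^sup>2 < d + 1 / real (Suc n)" for n
    using cINF_less_iff[OF ne bdd, of "d + 1 / real (Suc n)"] unfolding d_def by simp
  then obtain s where sS: "\<And>n. s n \<in> S" and s: "\<And>n. (norm (x - s n))\<^sup>2 < d + 1 / real (Suc n)"
    by metis
  have par: "(norm (s m - s n))\<^sup>2 \<le> 2 / real (Suc m) + 2 / real (Suc n)" for m n
  proof -
    define a b where "a = x - s m" and "b = x - s n"
    have "(1/2) *\<^sub>R (s m + s n) \<in> S"
      using sS S(1) by (intro csubspace_scaleR csubspace_add)
    then have "d \<le> (norm (x - (1/2) *\<^sub>R (s m + s n)))\<^sup>2"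
      by (rule dle)
    also have "x - (1/2) *\<^sub>R (s m + s n) = (1/2) *\<^sub>R (a + b)"
      by (simp add: a_def b_def algebra_simps flip: scaleR_2)
    finally have "4 * d \<le> (norm (a + b))\<^sup>2"
      by (simp add: power2_eq_square)
    then have "(norm (b - a))\<^sup>2 \<le> 2 * (norm a)\<^sup>2 + 2 * (norm b)\<^sup>2 - 4 * d"
      using norm_add_square[of a b] norm_diff_square[of b a] Re_cinner_commute[of a b] by linarith
    moreover have "b - a = s m - s n" by (simp add: a_def b_def)
    ultimately show ?thesis
      using s[of m] s[of n] by (simp add: a_def b_def)
  qed
  have "Cauchy s"
  proof (rule metric_CauchyI)
    fix e :: real assume "e > 0"
    then obtain N where N: "1 / real (Suc N) < e\<^sup>2 / 4"
      by (meson divide_pos_pos nat_approx_posE zero_less_numeral zero_less_power)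
    show "\<exists>M. \<forall>m\<ge>M. \<forall>n\<ge>M. dist (s m) (s n) < e"
    proof (intro exI allI impI)
      fix m n assume "N \<le> m" "N \<le> n"
      then have "1 / real (Suc m) \<le> 1 / real (Suc N)" "1 / real (Suc n) \<le> 1 / real (Suc N)"
        by (simp_all add: frac_le)
      then have "(norm (s m - s n))\<^sup>2 < e\<^sup>2"
        using par[of m n] N by simp
      then show "dist (s m) (s n) < e"
        using \<open>e > 0\<close> by (simp add: dist_norm power2_less_imp_less)
    qed
  qed
  then obtain y where y: "s \<longlonglongrightarrow> y"
    using Cauchy_convergent_iff convergent_def by blast
  then have yS: "y \<in> S"
    using closed_sequentially[OF S(2)] sS by blast
  have "(norm (x - y))\<^sup>2 \<le> d + 0"
  proof (rule LIMSEQ_le)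
    show "(\<lambda>n. (norm (x - s n))\<^sup>2) \<longlonglongrightarrow> (norm (x - y))\<^sup>2"
      by (intro tendsto_intros y)
    show "(\<lambda>n. d + 1 / real (Suc n)) \<longlonglongrightarrow> d + 0"
      by (intro tendsto_intros) (use LIMSEQ_inverse_real_of_nat in \<open>simp add: inverse_eq_divide\<close>)
  qed (use s less_imp_le in blast)
  then have min: "(norm (x - y))\<^sup>2 \<le> (norm (x - t))\<^sup>2" if "t \<in> S" for t
    using dle[OF that] by linarith
  have "cinner z (x - y) = 0" if z: "z \<in> S" for z
  proof (cases "z = 0")
    case False
    \<comment> \<open>The coefficient of the projection of x - y to the line spanned by z: if it were nonzero, adding c z to y
      would bring y closer to x.\<close>
    define c where "c = cinner z (x - y) / of_real ((norm z)\<^sup>2)"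
    have "y + c *\<^sub>C z \<in> S"
      using yS z S(1) by (intro csubspace_add csubspace_scaleC)
    have *: "cinner z (x - y) = c * of_real ((norm z)\<^sup>2)"
      using False by (simp add: c_def)
    have "(norm (x - y))\<^sup>2 \<le> (norm ((x - y) - c *\<^sub>C z))\<^sup>2"
      using min[OF \<open>y + c *\<^sub>C z \<in> S\<close>] by (simp add: algebra_simps)
    also have "\<dots> = (norm (x - y))\<^sup>2 - 2 * Re (cinner (c *\<^sub>C z) (x - y)) + (cmod c * norm z)\<^sup>2"
      by (subst norm_diff_square) (simp add: Re_cinner_commute)
    also have "cinner (c *\<^sub>C z) (x - y) = of_real ((cmod c * norm z)\<^sup>2)"
      unfolding cinner_scaleC_left * by (simp add: power_mult_distrib complex_norm_square del: of_real_power)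
    finally have "(cmod c * norm z)\<^sup>2 \<le> 0"
      by simp
    then have "c = 0"
      using False by simp
    then show ?thesis
      using * by simp
  qed simp
  with yS show ?thesis
    by (rule that)
qed

lemma orthogonal_projection_unique:
  assumes "csubspace S" "y \<in> S" "y' \<in> S"
    and "\<And>z. z \<in> S \<Longrightarrow> cinner z y = cinner z y'"
  shows "y = y'"
proof -
  have "cinner (y - y') y = cinner (y - y') y'"
    using assms csubspace_diff by blast
  then show ?thesis
    by (metis cinner_diff_right cinner_self_eq_zero right_minus_eq)
qed

lemma embedding_adj_props:
  assumes "csubspace S" "closed S"
  shows "embedding_adj S x \<in> S" and "\<And>z. z \<in> S \<Longrightarrow> cinner z (embedding_adj S x) = cinner z x"
proof -
  obtain y where y: "y \<in> S" "\<And>z. z \<in> S \<Longrightarrow> cinner z (x - y) = 0"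
    using orthogonal_projection_exists[OF assms] by blast
  have "\<exists>!y. y \<in> S \<and> (\<forall>z\<in>S. cinner z y = cinner z x)"
  proof (rule ex1I[of _ y])
    show "y \<in> S \<and> (\<forall>z\<in>S. cinner z y = cinner z x)"
      using y by (simp add: cinner_diff_right)
    then show "y' = y" if "y' \<in> S \<and> (\<forall>z\<in>S. cinner z y' = cinner z x)" for y'
      using that orthogonal_projection_unique[OF assms(1), of y' y] by simp
  qed
  from theI'[OF this] show "embedding_adj S x \<in> S"
    "\<And>z. z \<in> S \<Longrightarrow> cinner z (embedding_adj S x) = cinner z x"
    unfolding embedding_adj_def by blast+
qed

definition orth :: "'a::complex_hilbert set \<Rightarrow> 'a set" where
  "orth S = {x. \<forall>z\<in>S. cinner z x = 0}"

lemma csubspace_orth: "csubspace (orth S)"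
  by (auto simp: csubspace_def orth_def cinner_add_right cinner_scaleC_right)

lemma closed_orth: "closed (orth S)"
proof -
  have "closed ((\<lambda>x. cinner z x) -` {0})" for z :: 'a
    by (intro continuous_closed_vimage bounded_linear.isCont[OF bounded_linear_cinner_right]) auto
  moreover have "orth S = (\<Inter>z\<in>S. (\<lambda>x. cinner z x) -` {0})"
    by (auto simp: orth_def)
  ultimately show ?thesis by auto
qed

lemma orthogonal_decomposition:
  assumes "csubspace S" "closed S"
  obtains y z where "x = y + z" "y \<in> S" "z \<in> orth S"
proof -
  obtain y where "y \<in> S" "\<And>z. z \<in> S \<Longrightarrow> cinner z (x - y) = 0"
    using orthogonal_projection_exists[OF assms] by blast
  then show ?thesis
    using that[of y "x - y"] by (simp add: orth_def)
qed

lemma orth_Int: "x \<in> S \<Longrightarrow> x \<in> orth S \<Longrightarrow> x = 0"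
  by (auto simp: orth_def)

lemma orth_orth:
  assumes "csubspace S" "closed S"
  shows "orth (orth S) = S"
proof
  show "S \<subseteq> orth (orth S)"
    by (auto simp: orth_def cinner_eq_zero_commute)
  show "orth (orth S) \<subseteq> S"
  proof
    fix x assume x: "x \<in> orth (orth S)"
    obtain y z where yz: "x = y + z" "y \<in> S" "z \<in> orth S"
      using orthogonal_decomposition[OF assms] by blast
    then have "cinner z z = 0"
      using x by (auto simp: orth_def cinner_add_right cinner_eq_zero_commute)
    with yz show "x \<in> S" by simp
  qed
qed

lemma csubspace_closure:
  assumes S: "csubspace S" shows "csubspace (closure S)"
  unfolding csubspace_def
proof (intro conjI ballI allI)
  show "0 \<in> closure S"
    using csubspace_0[OF S] closure_subset by blast
next
  fix x y assume "x \<in> closure S" "y \<in> closure S"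
  then obtain f g where "\<And>n. f n \<in> S" "f \<longlonglongrightarrow> x" "\<And>n. g n \<in> S" "g \<longlonglongrightarrow> y"
    unfolding closure_sequential by blast
  then show "x + y \<in> closure S"
    unfolding closure_sequential
    by (intro exI[of _ "\<lambda>n. f n + g n"] conjI allI csubspace_add[OF S] tendsto_add)
next
  fix c x assume "x \<in> closure S"
  then obtain f where "\<And>n. f n \<in> S" "f \<longlonglongrightarrow> x"
    unfolding closure_sequential by blast
  then show "c *\<^sub>C x \<in> closure S"
    unfolding closure_sequential
    by (intro exI[of _ "\<lambda>n. c *\<^sub>C f n"] conjI allI csubspace_scaleC[OF S] tendsto_scaleC tendsto_const)
qed

lemma dense_if_orth_trivial:
  assumes "csubspace S" "\<And>x. x \<in> orth S \<Longrightarrow> x = 0"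
  shows "closure S = UNIV"
proof -
  have "x \<in> closure S" for x
  proof -
    obtain y z where yz: "x = y + z" "y \<in> closure S" "z \<in> orth (closure S)"
      using orthogonal_decomposition[OF csubspace_closure[OF assms(1)] closed_closure] by blast
    have "z \<in> orth S"
      using yz(3) closure_subset[of S] by (auto simp: orth_def)
    with assms(2) have "z = 0" by blast
    with yz show ?thesis by simp
  qed
  then show ?thesis by blast
qed

lemma orth_dense_trivial:
  assumes "closure S = UNIV" "x \<in> orth S" shows "x = 0"
proof -
  have "closed {z. cinner z x = 0}"
    by (intro closed_Collect_eq continuous_on_cinner continuous_on_id continuous_on_const)
  then have "closure S \<subseteq> {z. cinner z x = 0}"
    using assms(2) by (intro closure_minimal) (auto simp: orth_def)
  with assms(1) have "x \<in> {z. cinner z x = 0}" by blast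
  then show ?thesis by simp
qed


subsection \<open>Riesz representation and bounded operators\<close>

text \<open>The representing vector is a multiple of a vector orthogonal to the kernel. The functional
  need only be defined, linear and bounded on a closed subspace.\<close>

lemma Riesz_representation:
  assumes S: "csubspace S" "closed S"
    and add: "\<And>x y. x \<in> S \<Longrightarrow> y \<in> S \<Longrightarrow> f (x + y) = f x + f y"
    and scale: "\<And>c x. x \<in> S \<Longrightarrow> f (c *\<^sub>C x) = c * f x"
    and bound: "\<And>x. x \<in> S \<Longrightarrow> cmod (f x) \<le> C * norm x"
  obtains y where "y \<in> S" "\<And>x. x \<in> S \<Longrightarrow> f x = cinner y x"
proof -
  define K where "K = {x \<in> S. f x = 0}"
  have K: "csubspace K"
    using S(1) add scale scale[of 0 0]
    by (auto simp: csubspace_def K_def)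
  have fdiff: "f (x - y) = f x - f y" if "x \<in> S" "y \<in> S" for x y
    using add[of "x - y" y] that csubspace_diff[OF S(1)] by simp
  have clK: "closed K"
    unfolding closed_sequential_limits
  proof (intro allI impI, elim conjE)
    fix s l assume s: "\<forall>n. s n \<in> K" "s \<longlonglongrightarrow> l"
    then have l: "l \<in> S"
      using closed_sequentially[OF S(2)] by (auto simp: K_def)
    have "cmod (f l) \<le> \<bar>C\<bar> * norm (l - s n)" for n
    proof -
      have "f l = f (l - s n)"
        using s(1) l by (simp add: fdiff K_def)
      also have "cmod \<dots> \<le> C * norm (l - s n)"
        using s(1) l csubspace_diff[OF S(1)] by (intro bound) (auto simp: K_def)
      also have "\<dots> \<le> \<bar>C\<bar> * norm (l - s n)"
        by (intro mult_right_mono) auto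
      finally show ?thesis .
    qed
    moreover have "(\<lambda>n. \<bar>C\<bar> * norm (l - s n)) \<longlonglongrightarrow> \<bar>C\<bar> * norm (l - l)"
      by (intro tendsto_intros s)
    ultimately have "cmod (f l) \<le> \<bar>C\<bar> * norm (l - l)"
      by (intro LIMSEQ_le_const) auto
    with l show "l \<in> K" by (simp add: K_def)
  qed
  show ?thesis
  proof (cases "\<exists>x\<in>S. f x \<noteq> 0")
    case False
    then show ?thesis
      using that[of 0] csubspace_0[OF S(1)] by simp
  next
    case True
    then obtain x where x: "x \<in> S" "f x \<noteq> 0" by blast
    obtain k z where kz: "x = k + z" "k \<in> K" "z \<in> orth K"
      using orthogonal_decomposition[OF K clK] by blast
    have zS: "z \<in> S"
      using kz x csubspace_diff[OF S(1), of x k] by (auto simp: K_def)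
    have fz: "f z \<noteq> 0"
      using kz x zS add[of k z] by (auto simp: K_def)
    then have z0: "z \<noteq> 0"
      using scale[of 0 0] csubspace_0[OF S(1)] by auto
    define y where "y = cnj (f z / of_real ((norm z)\<^sup>2)) *\<^sub>C z"
    have "f w = cinner y w" if w: "w \<in> S" for w
    proof -
      define c where "c = f w / f z"
      have "w - c *\<^sub>C z \<in> K"
        using w zS fz csubspace_diff[OF S(1) w csubspace_scaleC[OF S(1) zS]] csubspace_scaleC[OF S(1) zS]
        by (simp add: K_def fdiff scale c_def)
      then have "cinner z (w - c *\<^sub>C z) = 0"
        using kz(3) by (auto simp: orth_def cinner_eq_zero_commute)
      then have "cinner z w = c * of_real ((norm z)\<^sup>2)"
        by (simp add: cinner_diff_right cinner_scaleC_right cinner_self)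
      then show ?thesis
        using z0 fz by (simp add: y_def cinner_scaleC_left c_def)
    qed
    moreover have "y \<in> S"
      unfolding y_def by (intro csubspace_scaleC S zS)
    ultimately show ?thesis
      using that by blast
  qed
qed

lemma csubspace_UNIV: "csubspace UNIV"
  by (simp add: csubspace_def)

lemma bounded_clinear_linear:
  assumes "bounded_clinear T"
  shows "T (x + y) = T x + T y" "T (x - y) = T x - T y" "T (c *\<^sub>C x) = c *\<^sub>C T x" "T 0 = 0"
  using assms bounded_linear.linear[of T] unfolding bounded_clinear_def
  by (auto simp: linear_add linear_diff linear_0)

lemma bounded_clinear_norm_le: "bounded_clinear T \<Longrightarrow> norm (T x) \<le> onorm T * norm x"
  by (simp add: bounded_clinear_def onorm)

lemma bounded_clinear_adjoint_exists:
  assumes "bounded_clinear T"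
  obtains y where "\<And>x. cinner p (T x) = cinner y x"
proof -
  have b: "cmod (cinner p (T x)) \<le> (norm p * onorm T) * norm x" for x
    using Cauchy_Schwarz[of p "T x"] bounded_clinear_norm_le[OF assms, of x]
      mult_left_mono[OF bounded_clinear_norm_le[OF assms, of x] norm_ge_zero[of p]]
    by (simp add: mult.assoc)
  show ?thesis
    by (rule Riesz_representation[OF csubspace_UNIV closed_UNIV, of "\<lambda>x. cinner p (T x)"])
      (use b that in \<open>auto simp: bounded_clinear_linear[OF assms] cinner_add_right cinner_scaleC_right\<close>)
qed

lemma bounded_clinearI:
  assumes "\<And>x y. T (x + y) = T x + T y" "\<And>c x. T (c *\<^sub>C x) = c *\<^sub>C T x"
    and "\<And>x. norm (T x) \<le> C * norm x"
  shows "bounded_clinear T"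
  unfolding bounded_clinear_def
proof
  show "bounded_linear T"
    by (rule bounded_linear_intro[of _ C]) (use assms in \<open>auto simp: mult.commute simp flip: scaleC_of_real\<close>)
qed (use assms in auto)

lemma bounded_clinear_scaleC: "bounded_clinear T \<Longrightarrow> bounded_clinear (\<lambda>x. c *\<^sub>C T x)"
  by (rule bounded_clinearI[where C = "cmod c * onorm T"])
    (auto simp: bounded_clinear_linear scaleC_add_right scaleC_scaleC mult.commute[of c] mult.assoc
      intro!: mult_left_mono bounded_clinear_norm_le)


subsection \<open>Weak convergence\<close>

lemma weak_limit_unique:
  assumes "\<And>y. (\<lambda>n. cinner y (x n)) \<longlonglongrightarrow> cinner y l" "\<And>y. (\<lambda>n. cinner y (x n)) \<longlonglongrightarrow> cinner y l'"
  shows "l = l'"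
  by (rule cinner_extensionality) (use assms LIMSEQ_unique in blast)

lemma weak_limit_in_closed_subspace:
  assumes S: "csubspace S" "closed S" and "\<And>n. x n \<in> S"
    and lim: "\<And>y. (\<lambda>n. cinner y (x n)) \<longlonglongrightarrow> cinner y l"
  shows "l \<in> S"
proof -
  have "cinner y l = 0" if "y \<in> orth S" for y
  proof (rule LIMSEQ_unique[OF lim])
    have "cinner y (x n) = 0" for n
      using that assms(3) by (auto simp: orth_def cinner_eq_zero_commute)
    then show "(\<lambda>n. cinner y (x n)) \<longlonglongrightarrow> 0" by simp
  qed
  then have "l \<in> orth (orth S)"
    by (simp add: orth_def)
  then show ?thesis
    using orth_orth[OF S] by simp
qed

lemma convergent_if_subsequences:
  fixes X :: "nat \<Rightarrow> 'a::metric_space"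
  assumes "\<And>r::nat \<Rightarrow> nat. strict_mono r \<Longrightarrow> \<exists>s. strict_mono (s::nat \<Rightarrow> nat) \<and> (\<lambda>n. X (r (s n))) \<longlonglongrightarrow> L"
  shows "X \<longlonglongrightarrow> L"
proof (rule ccontr)
  assume "\<not> X \<longlonglongrightarrow> L"
  then obtain e where e: "e > 0" "\<forall>N. \<exists>n\<ge>N. dist (X n) L \<ge> e"
    unfolding lim_sequentially by (auto simp: not_less)
  then have "infinite {n. dist (X n) L \<ge> e}"
    unfolding infinite_nat_iff_unbounded_le by auto
  then obtain r :: "nat \<Rightarrow> nat" where r: "strict_mono r" "\<And>n. r n \<in> {n. dist (X n) L \<ge> e}"
    using infinite_enumerate by metis
  obtain s where "strict_mono (s::nat \<Rightarrow> nat)" "(\<lambda>n. X (r (s n))) \<longlonglongrightarrow> L"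
    using assms[OF r(1)] by blast
  then obtain n where "dist (X (r (s n))) L < e"
    using e(1) unfolding lim_sequentially by blast
  with r(2)[of "s n"] show False by simp
qed

text \<open>The uniform boundedness principle by a gliding hump. For unbounded \<open>W\<close> take \<open>w\<^sub>n \<in> W\<close>
  with \<open>\<parallel>w\<^sub>n\<parallel> \<ge> 4\<^sup>n\<close> and perturb successively by vectors of norm \<open>3\<^sup>-\<^sup>n\<close>, parallel to \<open>w\<^sub>n\<close>,
  with a sign that keeps \<open>\<langle>w\<^sub>n, \<cdot>\<rangle>\<close> large. The later perturbations are too small to cancel this.\<close>

lemma uniform_boundedness:
  fixes W :: "'a::complex_hilbert set"
  assumes pw: "\<And>x. \<exists>B. \<forall>w\<in>W. cmod (cinner w x) \<le> B"
  obtains B where "\<And>w. w \<in> W \<Longrightarrow> norm w \<le> B"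
proof (rule ccontr)
  assume notthesis: "\<not> thesis"
  have "\<exists>w\<in>W. norm w > 4 ^ n" for n :: nat
    using notthesis that not_less by metis
  then obtain w where wW: "\<And>n. w n \<in> W" and w: "\<And>n::nat. norm (w n) > 4 ^ n"
    by metis
  define h where "h n = (1 / (3 ^ n * norm (w n))) *\<^sub>R w n" for n
  have wpos: "norm (w n) > 0" for n
    using w[of n] by (meson less_trans zero_less_numeral zero_less_power)
  have nh: "norm (h n) = 1 / 3 ^ n" for n
    using wpos[of n] by (simp add: h_def)
  have ch: "cinner (w n) (h n) = of_real (norm (w n) / 3 ^ n)" for n
    using wpos[of n] by (simp add: h_def cinner_scaleR_right cinner_self power2_eq_square)
  define step where "step x n = (if cmod (cinner (w n) (x + h n)) \<ge> norm (w n) / 3 ^ n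
      then x + h n else x - h n)" for x n
  have big: "cmod (cinner (w n) (step x n)) \<ge> norm (w n) / 3 ^ n" for x n
  proof (cases "cmod (cinner (w n) (x + h n)) \<ge> norm (w n) / 3 ^ n")
    case False
    have "2 * (norm (w n) / 3 ^ n) = cmod (cinner (w n) (x + h n) - cinner (w n) (x - h n))"
      by (simp add: cinner_add_right cinner_diff_right ch norm_divide norm_mult norm_power flip: mult_2)
    also have "\<dots> \<le> cmod (cinner (w n) (x + h n)) + cmod (cinner (w n) (x - h n))"
      by (rule norm_triangle_ineq4)
    finally show ?thesis using False by (simp add: step_def)
  qed (simp add: step_def)
  define X where "X = rec_nat (0::'a) (\<lambda>n x. step x n)"
  have X: "X (Suc n) = step (X n) n" for n
    by (simp add: X_def)
  have dX: "norm (X (Suc n) - X n) \<le> 1 / 3 ^ n" for n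
    by (simp add: X step_def nh)
  have tail: "norm (X (Suc n + k) - X (Suc n)) \<le> (1 / 3 ^ n) * (1 / 2 - 1 / (2 * 3 ^ k))" for n k
  proof (induction k)
    case (Suc k)
    have "norm (X (Suc n + Suc k) - X (Suc n))
        \<le> norm (X (Suc n + k) - X (Suc n)) + norm (X (Suc (Suc n + k)) - X (Suc n + k))"
      using norm_triangle_ineq[of "X (Suc n + k) - X (Suc n)" "X (Suc (Suc n + k)) - X (Suc n + k)"]
      by simp
    also have "\<dots> \<le> (1 / 3 ^ n) * (1 / 2 - 1 / (2 * 3 ^ k)) + 1 / 3 ^ (Suc n + k)"
      by (intro add_mono Suc dX)
    also have "\<dots> = (1 / 3 ^ n) * (1 / 2 - 1 / (2 * 3 ^ Suc k))"
      by (simp add: power_add field_simps)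
    finally show ?case .
  qed simp
  have tail': "norm (X m - X (Suc n)) \<le> 1 / 2 / 3 ^ n" if "m \<ge> Suc n" for m n
  proof -
    have "norm (X m - X (Suc n)) \<le> (1 / 3 ^ n) * (1 / 2 - 1 / (2 * 3 ^ (m - Suc n)))"
      using tail[of n "m - Suc n"] that by simp
    also have "\<dots> \<le> (1 / 3 ^ n) * (1 / 2)"
      by (intro mult_left_mono) auto
    finally show ?thesis by simp
  qed
  have "summable (\<lambda>n. (1/3::real) ^ n)"
    by (rule summable_geometric) simp
  then have "summable (\<lambda>n. X (Suc n) - X n)"
    by (rule summable_comparison_test'[where N = 0]) (use dX in \<open>simp add: power_divide\<close>)
  then have "convergent (\<lambda>n. X n - X 0)"
    unfolding summable_iff_convergent sum_lessThan_telescope .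
  then have "convergent X"
    by (simp add: convergent_diff_const_right_iff)
  then obtain x where x: "X \<longlonglongrightarrow> x"
    by (auto simp: convergent_def)
  have xn: "norm (x - X (Suc n)) \<le> 1 / 2 / 3 ^ n" for n
    by (rule LIMSEQ_le_const2[of "\<lambda>m. norm (X m - X (Suc n))"])
      (use tail' in \<open>auto intro!: tendsto_intros x\<close>)
  obtain B where B: "\<And>v. v \<in> W \<Longrightarrow> cmod (cinner v x) \<le> B"
    using pw[of x] by blast
  have low: "(4/3) ^ n / 2 \<le> B" for n
  proof -
    have "norm (w n) / 3 ^ n \<le> cmod (cinner (w n) (X (Suc n)))"
      using big X by simp
    also have "cinner (w n) (X (Suc n)) = cinner (w n) x - cinner (w n) (x - X (Suc n))"
      by (simp add: cinner_diff_right)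
    also have "cmod \<dots> \<le> cmod (cinner (w n) x) + cmod (cinner (w n) (x - X (Suc n)))"
      by (rule norm_triangle_ineq4)
    also have "\<dots> \<le> B + norm (w n) * (1 / 2 / 3 ^ n)"
      using Cauchy_Schwarz[of "w n" "x - X (Suc n)"] mult_left_mono[OF xn[of n] norm_ge_zero[of "w n"]]
      by (intro add_mono B wW) linarith
    finally have "norm (w n) / 3 ^ n / 2 \<le> B"
      by simp
    moreover have "(4/3) ^ n \<le> norm (w n) / 3 ^ n"
      using w[of n] by (simp add: power_divide divide_right_mono)
    ultimately show ?thesis
      using order_trans[OF divide_right_mono[of "(4/3) ^ n" _ 2]] by simp
  qed
  have "1 < (4/3 :: real)" by simp
  then obtain n where "2 * B < (4/3) ^ n"
    using real_arch_pow by blast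
  then have "B < (4/3) ^ n / 2" by linarith
  with low[of n] show False by linarith
qed


section \<open>Closed relations, adjoints and ranges\<close>

lemma op_adj_iff: "(y, x) \<in> op_adj R \<longleftrightarrow> (\<forall>u v. (u, v) \<in> R \<longrightarrow> cinner v y = cinner u x)"
  by (auto simp: op_adj_def)

lemma op_neg_iff: "(x, y) \<in> op_neg R \<longleftrightarrow> (x, - y) \<in> R"
  unfolding op_neg_def by force

lemma op_antidiag_iff:
  "((x1, x2), (y1, y2)) \<in> op_antidiag P Q \<longleftrightarrow> (x2, y1) \<in> P \<and> (x1, y2) \<in> Q"
  by (auto simp: op_antidiag_def)

text \<open>The adjoint is the orthogonal complement of the graph, rotated by a quarter turn. Its algebraic and
  topological properties, and the formula for the second adjoint, come from there.\<close>

lemma op_adj_eq_orth: "(y, x) \<in> op_adj R \<longleftrightarrow> (- x, y) \<in> orth R"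
  by (auto simp: op_adj_iff orth_def)

lemma csubspace_op_adj: "csubspace (op_adj R)"
  unfolding csubspace_def
  by (auto simp: op_adj_iff cinner_add_right cinner_scaleC_right zero_prod_def)

lemma closed_op_adj: "closed (op_adj R)"
proof -
  have "op_adj R = (\<lambda>p. (- snd p, fst p)) -` orth R"
    by (auto simp: op_adj_eq_orth)
  then show ?thesis
    by (simp add: closed_vimage closed_orth continuous_intros)
qed

lemma op_adj_op_adj:
  assumes "csubspace R" "closed R"
  shows "op_adj (op_adj R) = R"
proof
  show "R \<subseteq> op_adj (op_adj R)"
    by (auto simp: op_adj_iff) (metis cinner_commute)
  show "op_adj (op_adj R) \<subseteq> R"
  proof clarify
    fix p q assume pq: "(p, q) \<in> op_adj (op_adj R)"
    have "cinner (s, t) (p, q) = 0" if "(s, t) \<in> orth R" for s t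
    proof -
      have "(t, - s) \<in> op_adj R"
        using that by (simp add: op_adj_eq_orth)
      then have "cinner (- s) p = cinner t q"
        using pq unfolding op_adj_iff[of p q] by blast
      then show ?thesis by (simp add: neg_eq_iff_add_eq_0)
    qed
    then have "(p, q) \<in> orth (orth R)"
      by (auto simp: orth_def)
    then show "(p, q) \<in> R"
      using orth_orth[OF assms] by simp
  qed
qed

lemma op_adj_op_neg: "op_adj (op_neg R) = op_neg (op_adj R)"
proof -
  have "(y, x) \<in> op_adj (op_neg R) \<longleftrightarrow> (y, x) \<in> op_neg (op_adj R)" for y x
  proof
    assume L: "(y, x) \<in> op_adj (op_neg R)"
    have "cinner v y = cinner u (- x)" if "(u, v) \<in> R" for u v
    proof -
      have "(u, - v) \<in> op_neg R" using that by (simp add: op_neg_iff)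
      then have "cinner (- v) y = cinner u x"
        using L unfolding op_adj_iff by blast
      then show ?thesis by (simp add: minus_equation_iff[of "cinner v y"] eq_commute)
    qed
    then show "(y, x) \<in> op_neg (op_adj R)"
      unfolding op_neg_iff op_adj_iff by blast
  next
    assume L: "(y, x) \<in> op_neg (op_adj R)"
    have "cinner v y = cinner u x" if "(u, - v) \<in> R" for u v
    proof -
      have "cinner (- v) y = cinner u (- x)"
        using L that unfolding op_neg_iff op_adj_iff by blast
      then show ?thesis by simp
    qed
    then show "(y, x) \<in> op_adj (op_neg R)"
      unfolding op_neg_iff op_adj_iff by blast
  qed
  then show ?thesis by auto
qed

lemma op_neg_op_neg [simp]: "op_neg (op_neg R) = R"
  by (auto simp: op_neg_iff)

lemma op_neg_op_antidiag: "op_neg (op_antidiag P Q) = op_antidiag (op_neg P) (op_neg Q)"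
  by (auto simp: op_neg_iff op_antidiag_iff)

lemma op_adj_op_antidiag:
  assumes "(0, 0) \<in> P" "(0, 0) \<in> Q"
  shows "op_adj (op_antidiag P Q) = op_antidiag (op_adj Q) (op_adj P)"
proof -
  have "((y1, y2), (x1, x2)) \<in> op_adj (op_antidiag P Q) \<longleftrightarrow>
      ((y1, y2), (x1, x2)) \<in> op_antidiag (op_adj Q) (op_adj P)" for y1 y2 x1 x2
  proof
    assume L: "((y1, y2), (x1, x2)) \<in> op_adj (op_antidiag P Q)"
    have L': "cinner v1 y1 + cinner v2 y2 = cinner u1 x1 + cinner u2 x2"
      if "(u2, v1) \<in> P" "(u1, v2) \<in> Q" for u1 u2 v1 v2
      using L that unfolding op_adj_iff split_paired_All op_antidiag_iff by auto
    show "((y1, y2), (x1, x2)) \<in> op_antidiag (op_adj Q) (op_adj P)"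
      unfolding op_antidiag_iff op_adj_iff using L'[OF assms(1)] L'[OF _ assms(2)] by simp
  next
    assume "((y1, y2), (x1, x2)) \<in> op_antidiag (op_adj Q) (op_adj P)"
    then show "((y1, y2), (x1, x2)) \<in> op_adj (op_antidiag P Q)"
      unfolding op_antidiag_iff op_adj_iff split_paired_All by (auto simp: add.commute)
  qed
  then show ?thesis by auto
qed

lemma csubspace_op_neg: assumes "csubspace R" shows "csubspace (op_neg R)"
  unfolding csubspace_def
proof (safe; unfold zero_prod_def add_Pair scaleC_Pair op_neg_iff)
  show "(0, - 0) \<in> R"
    using csubspace_0[OF assms] by (simp add: zero_prod_def)
  show "(a + c, - (b + d)) \<in> R" if "(a, - b) \<in> R" "(c, - d) \<in> R" for a b c d
    using csubspace_add[OF assms that] by simp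
  show "(k *\<^sub>C a, - (k *\<^sub>C b)) \<in> R" if "(a, - b) \<in> R" for k a b
    using csubspace_scaleC[OF assms that, of k] by (simp add: scaleC_minus_right)
qed

lemma closed_op_neg: assumes "closed R" shows "closed (op_neg R)"
proof -
  have "op_neg R = (\<lambda>p. (fst p, - snd p)) -` R"
    by (auto simp: op_neg_iff)
  then show ?thesis
    using assms by (simp add: closed_vimage continuous_intros)
qed

lemma csubspace_op_antidiag:
  assumes "csubspace P" "csubspace Q" shows "csubspace (op_antidiag P Q)"
  using csubspace_0[OF assms(1)] csubspace_0[OF assms(2)]
    csubspace_add[OF assms(1), of "(_, _)" "(_, _)"] csubspace_add[OF assms(2), of "(_, _)" "(_, _)"]
    csubspace_scaleC[OF assms(1), of "(_, _)"] csubspace_scaleC[OF assms(2), of "(_, _)"]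
  unfolding csubspace_def Ball_def split_paired_All scaleC_Pair add_Pair op_antidiag_iff zero_prod_def
  by simp

lemma closed_op_antidiag: assumes "closed P" "closed Q" shows "closed (op_antidiag P Q)"
proof -
  have "op_antidiag P Q = (\<lambda>p. (snd (fst p), fst (snd p))) -` P \<inter> (\<lambda>p. (fst (fst p), snd (snd p))) -` Q"
    by (auto simp: op_antidiag_iff)
  then show ?thesis
    using assms by (simp add: closed_vimage continuous_intros closed_Int)
qed

lemma single_valued_op_adj: assumes "densely_defined R" shows "single_valued (op_adj R)"
proof (rule single_valuedI)
  fix y x x' assume *: "(y, x) \<in> op_adj R" "(y, x') \<in> op_adj R"
  have "x - x' \<in> orth (Domain R)"
    unfolding orth_def using * by (auto simp: op_adj_iff cinner_diff_right)
  then show "x = x'"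
    using orth_dense_trivial[OF _ \<open>x - x' \<in> _\<close>] assms by (simp add: densely_defined_def)
qed

lemma csubspace_op_kernel: assumes "csubspace R" shows "csubspace (op_kernel R)"
  using csubspace_0[OF assms] csubspace_add[OF assms, of "(_, 0)" "(_, 0)"]
    csubspace_scaleC[OF assms, of "(_, 0)"]
  by (simp add: csubspace_def op_kernel_def zero_prod_def)

lemma closed_op_kernel: assumes "closed R" shows "closed (op_kernel R)"
proof -
  have "op_kernel R = (\<lambda>x. (x, 0)) -` R" by (auto simp: op_kernel_def)
  then show ?thesis using assms by (simp add: closed_vimage continuous_intros)
qed

lemma csubspace_Range: assumes "csubspace R" shows "csubspace (Range R)"
  unfolding csubspace_def Range_iff
proof (safe)
  show "\<exists>y. (y, 0) \<in> R" using csubspace_0[OF assms] by (auto simp: zero_prod_def)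
  show "\<exists>y. (y, x + x') \<in> R" if "(u, x) \<in> R" "(u', x') \<in> R" for x x' u u'
    using csubspace_add[OF assms that] by auto
  show "\<exists>y. (y, c *\<^sub>C x) \<in> R" if "(u, x) \<in> R" for c x u
    using csubspace_scaleC[OF assms that, of c] by auto
qed

lemma op_kernel_op_adj: "op_kernel (op_adj R) = orth (Range R)"
  by (auto simp: op_kernel_def op_adj_iff orth_def)

lemma Range_preimage_orth_kernel:
  assumes "csubspace T" "closed T" "z \<in> Range T"
  obtains x where "(x, z) \<in> T" "x \<in> orth (op_kernel T)"
proof -
  obtain x where x: "(x, z) \<in> T" using assms(3) by auto
  obtain k y where "x = k + y" "k \<in> op_kernel T" "y \<in> orth (op_kernel T)"
    using orthogonal_decomposition[OF csubspace_op_kernel closed_op_kernel] assms by metis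
  moreover have "(x, z) - (k, 0) \<in> T"
    using x calculation assms(1) by (intro csubspace_diff) (auto simp: op_kernel_def)
  ultimately show ?thesis using that[of y] by simp
qed

text \<open>The estimate turns preimages orthogonal to the kernel of a convergent sequence in the range into a
  Cauchy sequence.\<close>

lemma closed_Range_if_estimate:
  assumes T: "csubspace T" "closed T"
    and est: "\<And>x z. (x, z) \<in> T \<Longrightarrow> x \<in> orth (op_kernel T) \<Longrightarrow> norm x \<le> C * norm z"
  shows "closed (Range T)"
  unfolding closed_sequential_limits
proof (intro allI impI, elim conjE)
  fix z l assume z: "\<forall>n. z n \<in> Range T" "z \<longlonglongrightarrow> l"
  have "\<exists>x. (x, z n) \<in> T \<and> x \<in> orth (op_kernel T)" for n
    using Range_preimage_orth_kernel[OF T] z(1) by metis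
  then obtain x where x: "\<And>n. (x n, z n) \<in> T" "\<And>n. x n \<in> orth (op_kernel T)"
    by metis
  have d: "norm (x m - x n) \<le> \<bar>C\<bar> * norm (z m - z n)" for m n
  proof -
    have "norm (x m - x n) \<le> C * norm (z m - z n)"
      using csubspace_diff[OF T(1) x(1)[of m] x(1)[of n]]
        csubspace_diff[OF csubspace_orth x(2)[of m] x(2)[of n]] by (intro est) auto
    also have "\<dots> \<le> \<bar>C\<bar> * norm (z m - z n)"
      by (intro mult_right_mono) auto
    finally show ?thesis .
  qed
  have "Cauchy x"
  proof (rule metric_CauchyI)
    fix e :: real assume e: "e > 0"
    have "Cauchy z" using z(2) by (simp add: LIMSEQ_imp_Cauchy)
    then obtain M where M: "\<forall>m\<ge>M. \<forall>n\<ge>M. dist (z m) (z n) < e / (\<bar>C\<bar> + 1)"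
      using e metric_CauchyD[of z "e / (\<bar>C\<bar> + 1)"] by auto
    have "dist (x m) (x n) < e" if "m \<ge> M" "n \<ge> M" for m n
    proof -
      have "norm (x m - x n) \<le> (\<bar>C\<bar> + 1) * norm (z m - z n)"
        using d[of m n] mult_right_mono[of "\<bar>C\<bar>" "\<bar>C\<bar> + 1" "norm (z m - z n)"] by simp
      also have "\<dots> < (\<bar>C\<bar> + 1) * (e / (\<bar>C\<bar> + 1))"
        using M that by (intro mult_strict_left_mono) (auto simp: dist_norm)
      finally show ?thesis by (simp add: dist_norm)
    qed
    then show "\<exists>M. \<forall>m\<ge>M. \<forall>n\<ge>M. dist (x m) (x n) < e" by blast
  qed
  then obtain y where "x \<longlonglongrightarrow> y"
    using Cauchy_convergent_iff convergent_def by blast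
  then have "(\<lambda>n. (x n, z n)) \<longlonglongrightarrow> (y, l)"
    using z(2) by (intro tendsto_Pair)
  then have "(y, l) \<in> T"
    by (rule closed_sequentially[OF T(2), rotated]) (rule x(1))
  then show "l \<in> Range T" by auto
qed

text \<open>For \<open>w\<close> in the closed range of \<open>T\<close> and \<open>(w, s) \<in> T\<^sup>*\<close>, the number \<open>\<langle>w, T u\<rangle> = \<langle>s, u\<rangle>\<close> is
  controlled by \<open>\<parallel>s\<parallel>\<close> for each fixed \<open>u\<close>. By uniform boundedness \<open>\<parallel>w\<parallel> \<le> C \<parallel>s\<parallel>\<close>, and this makes the
  range of \<open>T\<^sup>*\<close> closed.\<close>

theorem closed_range_theorem:
  assumes T: "csubspace T" "closed T" and cl: "closed (Range T)"
  shows "Range (op_adj T) = orth (op_kernel T)"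
proof -
  let ?S = "op_adj T"
  have oR: "orth (op_kernel ?S) = Range T"
    by (simp add: op_kernel_op_adj orth_orth csubspace_Range T cl)
  define W where "W = {w. \<exists>s. (w, s) \<in> ?S \<and> w \<in> orth (op_kernel ?S) \<and> norm s \<le> 1}"
  have "\<exists>B. \<forall>w\<in>W. cmod (cinner w x) \<le> B" for x
  proof -
    obtain y z where yz: "x = y + z" "y \<in> Range T" "z \<in> orth (Range T)"
      using orthogonal_decomposition[OF csubspace_Range[OF T(1)] cl] by blast
    obtain u where u: "(u, y) \<in> T" using yz by auto
    have "cmod (cinner w x) \<le> norm u" if "w \<in> W" for w
    proof -
      obtain s where s: "(w, s) \<in> ?S" "w \<in> Range T" "norm s \<le> 1"
        using \<open>w \<in> W\<close> by (auto simp: W_def oR)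
      have "cinner w x = cinner w y"
        using s(2) yz by (auto simp: orth_def cinner_add_right)
      also have "\<dots> = cinner s u"
        using s(1) u by (metis cinner_commute op_adj_iff)
      also have "cmod \<dots> \<le> 1 * norm u"
        using Cauchy_Schwarz[of s u] mult_right_mono[OF s(3) norm_ge_zero[of u]] by linarith
      finally show ?thesis by simp
    qed
    then show ?thesis by blast
  qed
  then obtain B where B: "\<And>w. w \<in> W \<Longrightarrow> norm w \<le> B"
    using uniform_boundedness by blast
  have "closed (Range ?S)"
  proof (rule closed_Range_if_estimate[OF csubspace_op_adj closed_op_adj])
    fix w s assume ws: "(w, s) \<in> ?S" "w \<in> orth (op_kernel ?S)"
    show "norm w \<le> B * norm s"
    proof (cases "s = 0")
      case True
      then show ?thesis using ws orth_Int[OF _ ws(2)] by (simp add: op_kernel_def)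
    next
      case False
      have "(1 / norm s) *\<^sub>R w \<in> W"
        unfolding W_def
        using csubspace_scaleR[OF csubspace_op_adj ws(1), of "1 / norm s"]
          csubspace_scaleR[OF csubspace_orth ws(2)] False
        by (auto intro!: exI[of _ "(1 / norm s) *\<^sub>R s"])
      from B[OF this] show ?thesis using False by (simp add: field_simps)
    qed
  qed
  then have "orth (orth (Range ?S)) = Range ?S"
    by (intro orth_orth csubspace_Range csubspace_op_adj)
  moreover have "orth (Range ?S) = op_kernel T"
    using op_kernel_op_adj[of ?S] op_adj_op_adj[OF T] by simp
  ultimately show ?thesis by simp
qed

text \<open>If the range were not closed, some normalized sequence orthogonal to the kernel would have
  images tending to zero; a limit point would be a unit vector in the kernel and orthogonal to it.\<close>

lemma closed_Range_if_compact:
  assumes T: "csubspace T" "closed T"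
    and K: "compact K" "\<And>x z. (x, z) \<in> T \<Longrightarrow> x \<in> orth (op_kernel T) \<Longrightarrow> norm (x, z) \<le> 1 \<Longrightarrow> x \<in> K"
  shows "closed (Range T)"
proof -
  have "\<exists>C. \<forall>x z. (x, z) \<in> T \<longrightarrow> x \<in> orth (op_kernel T) \<longrightarrow> norm x \<le> C * norm z"
  proof (rule ccontr)
    assume "\<not> ?thesis"
    then have "\<exists>x z. (x, z) \<in> T \<and> x \<in> orth (op_kernel T) \<and> norm x > real (Suc n) * norm z" for n
      by (metis not_less)
    then obtain x z where xz: "\<And>n. (x n, z n) \<in> T" "\<And>n. x n \<in> orth (op_kernel T)"
      "\<And>n. norm (x n) > real (Suc n) * norm (z n)"
      by metis
    define r where "r n = norm (x n, z n)" for n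
    have r: "r n > 0" for n
    proof -
      have "norm (x n) > 0"
        using xz(3)[of n] by (smt (verit) norm_ge_zero of_nat_0_le_iff zero_le_mult_iff)
      then show ?thesis by (auto simp: r_def zero_prod_def)
    qed
    define a b where "a n = (1 / r n) *\<^sub>R x n" and "b n = (1 / r n) *\<^sub>R z n" for n
    have ab: "(a n, b n) \<in> T" "a n \<in> orth (op_kernel T)" for n
      using csubspace_scaleR[OF T(1) xz(1)[of n], of "1 / r n"] csubspace_scaleR[OF csubspace_orth xz(2)[of n]]
      by (auto simp: a_def b_def)
    have n1: "norm (a n, b n) = 1" for n
    proof -
      have "(a n, b n) = (1 / r n) *\<^sub>R (x n, z n)" by (simp add: a_def b_def)
      then have "norm (a n, b n) = \<bar>1 / r n\<bar> * r n"
        unfolding r_def by (metis norm_scaleR)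
      then show ?thesis using r[of n] by simp
    qed
    have bn: "norm (b n) \<le> 1 / real (Suc n)" for n
    proof -
      have "real (Suc n) * norm (b n) \<le> norm (a n)"
        using mult_left_mono[OF less_imp_le[OF xz(3)[of n]], of "1 / r n"] r[of n]
        by (simp add: a_def b_def)
      also have "\<dots> \<le> 1"
        using norm_fst_le[of "a n" "b n"] n1[of n] by simp
      finally show ?thesis by (simp add: field_simps)
    qed
    have b0: "b \<longlonglongrightarrow> 0"
      by (rule Lim_null_comparison[of _ "\<lambda>n. 1 / real (Suc n)"])
        (use bn LIMSEQ_inverse_real_of_nat in \<open>auto simp: inverse_eq_divide\<close>)
    have "\<forall>n. a n \<in> K"
      using K(2)[OF ab] n1 by simp
    then obtain l q where lq: "l \<in> K" "strict_mono (q :: nat \<Rightarrow> nat)" "(a \<circ> q) \<longlonglongrightarrow> l"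
      using K(1) unfolding compact_def by blast
    have bq: "(b \<circ> q) \<longlonglongrightarrow> 0"
      using b0 lq(2) by (rule LIMSEQ_subseq_LIMSEQ)
    have lim: "(\<lambda>n. ((a \<circ> q) n, (b \<circ> q) n)) \<longlonglongrightarrow> (l, 0)"
      using lq(3) bq by (rule tendsto_Pair)
    then have "(l, 0) \<in> T"
      by (rule closed_sequentially[OF T(2), rotated]) (simp add: ab)
    moreover have "l \<in> orth (op_kernel T)"
      by (rule closed_sequentially[OF closed_orth _ lq(3)]) (simp add: ab)
    ultimately have "l = 0"
      by (intro orth_Int) (simp_all add: op_kernel_def)
    moreover have "norm (l, 0::'b) = 1"
      using tendsto_norm[OF lim] n1 by (simp add: LIMSEQ_const_iff)
    ultimately show False by (simp add: norm_prod_def)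
  qed
  then show ?thesis
    using closed_Range_if_estimate[OF T] by blast
qed


section \<open>Coercive perturbations of skew-self-adjoint operators\<close>

definition skew_selfadjoint :: "('a::complex_hilbert \<times> 'a) set \<Rightarrow> bool" where
  "skew_selfadjoint A \<longleftrightarrow> csubspace A \<and> closed A \<and> op_adj A = op_neg A"

text \<open>This is \<open>(T + A)\<^sup>-\<^sup>1 x\<close> for a bounded operator \<open>T\<close> and the graph \<open>A\<close> of an unbounded one.\<close>

definition resolvent :: "('a::complex_hilbert \<Rightarrow> 'a) \<Rightarrow> ('a \<times> 'a) set \<Rightarrow> 'a \<Rightarrow> 'a" where
  "resolvent T A x = (THE u. (u, x - T u) \<in> A)"

lemma skew_selfadjoint_Re:
  assumes "skew_selfadjoint A" "(u, v) \<in> A"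
  shows "Re (cinner v u) = 0"
proof -
  have "(u, - v) \<in> op_adj A"
    using assms by (simp add: skew_selfadjoint_def op_neg_iff)
  then have "cinner v u = cinner u (- v)"
    using assms(2) op_adj_iff by blast
  then have "Re (cinner v u) = - Re (cinner u v)" by simp
  then show ?thesis using Re_cinner_commute[of u v] by simp
qed

lemma skew_selfadjointI:
  assumes "skew_selfadjoint A" "\<And>p q. (p, q) \<in> A \<Longrightarrow> cinner q u = - cinner p v"
  shows "(u, v) \<in> A"
proof -
  have "(u, - v) \<in> op_adj A"
    using assms(2) by (auto simp: op_adj_iff)
  then show ?thesis
    using assms(1) by (simp add: skew_selfadjoint_def op_neg_iff)
qed

lemma skew_selfadjointD:
  assumes "skew_selfadjoint A" "(u, v) \<in> A" "(p, q) \<in> A"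
  shows "cinner q u = - cinner p v"
proof -
  have "(u, - v) \<in> op_adj A"
    using assms by (simp add: skew_selfadjoint_def op_neg_iff)
  then show ?thesis
    using assms(3) by (auto simp: op_adj_iff)
qed

context
  fixes T :: "'a::complex_hilbert \<Rightarrow> 'a" and A :: "('a \<times> 'a) set" and c :: real
  assumes T: "bounded_clinear T" and coercive: "re_ge UNIV T c" and c: "c > 0"
    and A: "skew_selfadjoint A"
begin

lemma coercive_estimate:
  assumes "(u, v) \<in> A" shows "c * norm u \<le> norm (v + T u)"
proof (cases "u = 0")
  case False
  have "c * (norm u)\<^sup>2 \<le> Re (cinner (T u) u)"
    using coercive by (simp add: re_ge_def)
  also have "\<dots> = Re (cinner (v + T u) u)"
    using skew_selfadjoint_Re[OF A assms] by (simp add: cinner_add_left)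
  also have "\<dots> \<le> norm (v + T u) * norm u"
    using abs_Re_cinner_le[of "v + T u" u] by linarith
  finally show ?thesis
    using False by (simp add: power2_eq_square)
qed simp

lemma resolvent_unique: "(u, x - T u) \<in> A \<Longrightarrow> (u', x - T u') \<in> A \<Longrightarrow> u = u'"
  using coercive_estimate[of "u - u'" "- T (u - u')"] csubspace_diff[of A "(u, x - T u)" "(u', x - T u')"]
    A c by (simp add: skew_selfadjoint_def bounded_clinear_linear[OF T] mult_le_0_iff)

text \<open>The range of \<open>T + A\<close> is closed by the coercivity estimate; a vector \<open>y\<close> orthogonal to it
  satisfies \<open>A y = T\<^sup>* y\<close>, and then coercivity gives \<open>y = 0\<close>.\<close>

lemma resolvent_exists: "\<exists>u. (u, x - T u) \<in> A"
proof -
  have cA: "csubspace A" "closed A" using A by (auto simp: skew_selfadjoint_def)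
  define G where "G = {(u, v + T u) | u v. (u, v) \<in> A}"
  have Gi: "(u, w) \<in> G \<longleftrightarrow> (u, w - T u) \<in> A" for u w
    by (auto simp: G_def) (metis diff_add_cancel)
  have cG: "csubspace G"
    unfolding csubspace_def
  proof (safe; unfold zero_prod_def add_Pair scaleC_Pair Gi bounded_clinear_linear[OF T])
    show "(0, 0 - 0) \<in> A" using csubspace_0[OF cA(1)] by (simp add: zero_prod_def)
    show "(u + u', w + w' - (T u + T u')) \<in> A" if "(u, w - T u) \<in> A" "(u', w' - T u') \<in> A" for u w u' w'
      using csubspace_add[OF cA(1) that] by (simp add: algebra_simps)
    show "(k *\<^sub>C u, k *\<^sub>C w - k *\<^sub>C T u) \<in> A" if "(u, w - T u) \<in> A" for k u w
      using csubspace_scaleC[OF cA(1) that, of k] by (simp add: scaleC_diff_right)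
  qed
  have "bounded_linear T"
    using T by (simp add: bounded_clinear_def)
  then have "continuous_on UNIV (\<lambda>p. (fst p, snd p - T (fst p)))"
    by (intro linear_continuous_on bounded_linear_Pair bounded_linear_sub bounded_linear_fst
        bounded_linear_snd bounded_linear_compose[of T fst])
  moreover have "G = (\<lambda>p. (fst p, snd p - T (fst p))) -` A"
    by (auto simp: Gi)
  ultimately have clG: "closed G"
    using cA(2) by (simp add: closed_vimage)
  have clR: "closed (Range G)"
  proof (rule closed_Range_if_estimate[OF cG clG])
    fix u w assume "(u, w) \<in> G"
    then show "norm u \<le> (1 / c) * norm w"
      using coercive_estimate[of u "w - T u"] c by (simp add: Gi field_simps)
  qed
  have "y = 0" if y: "y \<in> orth (Range G)" for y
  proof -
    obtain t where t: "\<And>x. cinner y (T x) = cinner t x"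
      using bounded_clinear_adjoint_exists[OF T] by blast
    have "(y, t) \<in> A"
    proof (rule skew_selfadjointI[OF A])
      fix p q assume "(p, q) \<in> A"
      then have "(p, q + T p) \<in> G" by (simp add: Gi)
      then have "cinner (q + T p) y = 0" using y by (auto simp: orth_def)
      moreover have "cinner (T p) y = cinner p t"
        using t by (metis cinner_commute)
      ultimately show "cinner q y = - cinner p t"
        by (simp add: cinner_add_left add_eq_0_iff2)
    qed
    then have "Re (cinner t y) = 0"
      by (rule skew_selfadjoint_Re[OF A])
    then have "Re (cinner (T y) y) = 0"
      by (metis Re_cinner_commute t)
    then have "c * (norm y)\<^sup>2 \<le> 0"
      using coercive by (metis UNIV_I re_ge_def)
    then show ?thesis
      using c by (simp add: mult_le_0_iff)
  qed
  then have "closure (Range G) = UNIV"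
    by (intro dense_if_orth_trivial csubspace_Range cG)
  then have "x \<in> Range G"
    using clR by simp
  then show ?thesis unfolding Range_iff Gi .
qed

lemma resolvent_eqI: "(u, x - T u) \<in> A \<Longrightarrow> resolvent T A x = u"
  unfolding resolvent_def by (rule the_equality) (auto intro: resolvent_unique)

lemma resolvent_mem: "(resolvent T A x, x - T (resolvent T A x)) \<in> A"
proof -
  obtain u where u: "(u, x - T u) \<in> A" using resolvent_exists by blast
  from u show ?thesis unfolding resolvent_eqI[OF u] .
qed

lemma norm_resolvent_le: "norm (resolvent T A x) \<le> norm x / c"
  using coercive_estimate[OF resolvent_mem[of x]] c by (simp add: field_simps)

lemma resolvent_add: "resolvent T A (x + y) = resolvent T A x + resolvent T A y"
  using csubspace_add[OF _ resolvent_mem[of x] resolvent_mem[of y]] A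
  by (intro resolvent_eqI) (simp add: skew_selfadjoint_def bounded_clinear_linear[OF T] algebra_simps)

lemma resolvent_scaleC: "resolvent T A (k *\<^sub>C x) = k *\<^sub>C resolvent T A x"
  using csubspace_scaleC[OF _ resolvent_mem[of x]] A
  by (intro resolvent_eqI) (simp add: skew_selfadjoint_def bounded_clinear_linear[OF T] scaleC_diff_right)

lemma bounded_clinear_resolvent: "bounded_clinear (resolvent T A)"
  by (rule bounded_clinearI[where C = "1 / c"])
    (use norm_resolvent_le in \<open>auto simp: resolvent_add resolvent_scaleC\<close>)

lemma Re_cinner_resolvent_ge: "c * (norm (resolvent T A x))\<^sup>2 \<le> Re (cinner x (resolvent T A x))"
proof -
  let ?u = "resolvent T A x"
  have "c * (norm ?u)\<^sup>2 \<le> Re (cinner (T ?u) ?u)"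
    using coercive by (simp add: re_ge_def)
  also have "\<dots> = Re (cinner x ?u)"
    using skew_selfadjoint_Re[OF A resolvent_mem[of x]] by (simp add: cinner_diff_left)
  finally show ?thesis .
qed

text \<open>The second resolvent identity, where \<open>u'\<close> solves the equation with \<open>T'\<close> in place of \<open>T\<close>.\<close>

lemma resolvent_diff:
  assumes "(u', x - T' u') \<in> A"
  shows "resolvent T A x - u' = resolvent T A (T' u' - T u')"
proof -
  have "(resolvent T A x - u', (x - T (resolvent T A x)) - (x - T' u')) \<in> A"
    using csubspace_diff[OF _ resolvent_mem[of x] assms] A by (simp add: skew_selfadjoint_def)
  then show ?thesis
    by (intro resolvent_eqI[symmetric]) (simp add: bounded_clinear_linear[OF T] algebra_simps)
qed

end


section \<open>Resolvent convergence at real points\<close>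

lemma weakly_converges_in_closed_subspace:
  assumes S: "csubspace S" "closed S" and "weakly_converges_in S x l"
  shows "(\<lambda>n. cinner q (x n)) \<longlonglongrightarrow> cinner q l"
proof -
  let ?q = "embedding_adj S q"
  have *: "cinner q z = cinner ?q z" if "z \<in> S" for z
    using embedding_adj_props(2)[OF S that, of q] by (metis cinner_commute)
  have "(\<lambda>n. cinner ?q (x n)) \<longlonglongrightarrow> cinner ?q l"
    using assms(3) embedding_adj_props(1)[OF S, of q] by (auto simp: weakly_converges_in_def)
  moreover have "x n \<in> S" "l \<in> S" for n
    using assms(3) by (auto simp: weakly_converges_in_def)
  ultimately show ?thesis by (simp add: *)
qed

text \<open>The functionals \<open>\<phi> \<mapsto> \<langle>p, R \<phi>\<rangle>\<close> are the only data for which the variational problems are needed below: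
  with them the problem prescribes the orthogonal projection of the flux onto the range of \<open>R\<close>.\<close>

lemma graph_dual_cinner:
  assumes R: "csubspace R" "single_valued R"
  shows "(\<lambda>\<phi>. cinner p (THE \<Phi>. (\<phi>, \<Phi>) \<in> R)) \<in> graph_dual R"
    and "(\<phi>, \<Phi>) \<in> R \<Longrightarrow> cinner p (THE \<Phi>. (\<phi>, \<Phi>) \<in> R) = cinner p \<Phi>"
proof -
  have the: "(THE \<Phi>. (\<phi>, \<Phi>) \<in> R) = \<Phi>" if "(\<phi>, \<Phi>) \<in> R" for \<phi> \<Phi>
    using that R(2) by (auto simp: single_valued_def)
  then show "(\<phi>, \<Phi>) \<in> R \<Longrightarrow> cinner p (THE \<Phi>. (\<phi>, \<Phi>) \<in> R) = cinner p \<Phi>"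
    by simp
  have add: "cinner p (THE \<Phi>. (x + y, \<Phi>) \<in> R) =
      cinner p (THE \<Phi>. (x, \<Phi>) \<in> R) + cinner p (THE \<Phi>. (y, \<Phi>) \<in> R)"
    if "(x, x') \<in> R" "(y, y') \<in> R" for x y x' y'
    using csubspace_add[OF R(1) that] that by (simp add: the cinner_add_right)
  have scale: "cinner p (THE \<Phi>. (c *\<^sub>C x, \<Phi>) \<in> R) = c * cinner p (THE \<Phi>. (x, \<Phi>) \<in> R)"
    if "(x, x') \<in> R" for x x' c
    using csubspace_scaleC[OF R(1) that, of c] that by (simp add: the cinner_scaleC_right)
  have bound: "cmod (cinner p (THE \<Phi>. (x, \<Phi>) \<in> R)) \<le> norm p * norm (x, y)" if "(x, y) \<in> R" for x y
    using Cauchy_Schwarz[of p y] mult_left_mono[OF norm_snd_le[of y x] norm_ge_zero[of p]]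
    by (simp add: the[OF that])
  show "(\<lambda>\<phi>. cinner p (THE \<Phi>. (\<phi>, \<Phi>) \<in> R)) \<in> graph_dual R"
    unfolding graph_dual_def using add scale bound by (auto simp: Domain_iff) blast
qed

lemma csubspace_op_restrict:
  assumes "csubspace R" "csubspace S" shows "csubspace (op_restrict R S)"
proof -
  have "op_restrict R S = R \<inter> {p. fst p \<in> S}" by (auto simp: op_restrict_def)
  then show ?thesis
    using assms unfolding csubspace_def by (simp add: scaleC_prod_def)
qed

lemma single_valued_op_restrict: "single_valued R \<Longrightarrow> single_valued (op_restrict R S)"
  by (auto simp: single_valued_def op_restrict_def)

lemma Range_op_restrict_Range_op_adj:
  assumes T: "csubspace T" "closed T" "closed (Range T)"
  shows "Range (op_restrict T (Range (op_adj T))) = Range T"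
proof
  show "Range (op_restrict T (Range (op_adj T))) \<subseteq> Range T"
    by (auto simp: op_restrict_def)
  show "Range T \<subseteq> Range (op_restrict T (Range (op_adj T)))"
  proof
    fix z assume "z \<in> Range T"
    then obtain x where "(x, z) \<in> T" "x \<in> orth (op_kernel T)"
      using Range_preimage_orth_kernel[OF T(1,2)] by metis
    then have "(x, z) \<in> op_restrict T (Range (op_adj T))"
      unfolding closed_range_theorem[OF T] by (simp add: op_restrict_def)
    then show "z \<in> Range (op_restrict T (Range (op_adj T)))" by blast
  qed
qed

text \<open>Here \<open>N = ker A\<close> and \<open>N\<^sup>\<bottom>\<close> is the range of \<open>A\<close>. Nonlocal H-convergence
  says that the pair consisting of the \<open>N\<close>-part of \<open>a\<^sub>n w\<^sub>n\<close> and the \<open>N\<^sup>\<bottom>\<close>-part of \<open>w\<^sub>n\<close> determines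
  \<open>w\<^sub>n\<close>, and that for fixed data both \<open>w\<^sub>n\<close> and \<open>a\<^sub>n w\<^sub>n\<close> converge weakly to \<open>w\<close> and \<open>b w\<close>.\<close>

definition follows_data ::
    "'h set \<Rightarrow> ('h::complex_hilbert \<Rightarrow> 'h) \<Rightarrow> 'h \<Rightarrow> 'h \<Rightarrow> 'h \<Rightarrow> bool" where
  "follows_data N a p g w \<longleftrightarrow> w - g \<in> N \<and> a w - p \<in> orth N"

definition recovers ::
    "'h set \<Rightarrow> (nat \<Rightarrow> 'h::complex_hilbert \<Rightarrow> 'h) \<Rightarrow> ('h \<Rightarrow> 'h) \<Rightarrow> 'h \<Rightarrow> 'h \<Rightarrow> (nat \<Rightarrow> 'h) \<Rightarrow> 'h \<Rightarrow> bool"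
  where
  "recovers N a b p g w w' \<longleftrightarrow> p \<in> N \<and> g \<in> orth N \<and>
     (\<forall>n. follows_data N (a n) p g (w n)) \<and> follows_data N b p g w' \<and>
     (\<forall>y. (\<lambda>n. cinner y (w n)) \<longlonglongrightarrow> cinner y w') \<and>
     (\<forall>y. (\<lambda>n. cinner y (a n (w n))) \<longlonglongrightarrow> cinner y (b w'))"

lemma follows_data_cinner:
  assumes "p \<in> N" "g \<in> orth N" "follows_data N a p g w"
  shows "cinner (a w) w = cinner p w + cinner (a w) g"
proof -
  have *: "cinner p g = 0" "cinner (a w - p) (w - g) = 0"
    using assms by (auto simp: orth_def follows_data_def cinner_eq_zero_commute)
  then show ?thesis by (simp add: cinner_diff_left cinner_diff_right diff_eq_eq add.commute)
qed

context
  fixes A0 :: "('g::complex_hilbert \<times> 'h::complex_hilbert) set" and A :: "('h \<times> 'h) set"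
    and a :: "nat \<Rightarrow> 'h \<Rightarrow> 'h" and b :: "'h \<Rightarrow> 'h" and N :: "'h set" and d C :: real
  assumes A0: "csubspace A0" "closed A0" "single_valued A0" "Range A0 = N"
    and A: "skew_selfadjoint A" "single_valued A" "op_kernel A = N" "closed (Range A)"
    and conv: "nonlocal_H_converges A0 A a b"
    and coercive: "\<And>n. re_ge UNIV (a n) d" and d: "d > 0"
    and bound: "\<And>n x. norm (a n x) \<le> C * norm x"
begin

lemma A_skew_closed: "csubspace A" "closed A" "op_adj A = op_neg A"
  using A(1) by (auto simp: skew_selfadjoint_def)

lemma N_closed_subspace: "csubspace N" "closed N"
  using csubspace_op_kernel[OF A_skew_closed(1)] closed_op_kernel[OF A_skew_closed(2)] A(3) by auto

lemma Range_op_adj_A: "Range (op_adj A) = orth N"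
  using closed_range_theorem[OF A_skew_closed(1,2) A(4)] A(3) by simp

lemma Range_A: "Range A = orth N"
proof -
  have "op_kernel (op_adj A) = op_kernel A"
    by (auto simp: A_skew_closed(3) op_kernel_def op_neg_iff)
  then show ?thesis
    using op_kernel_op_adj[of A] orth_orth[OF csubspace_Range[OF A_skew_closed(1)] A(4)] A(3) by simp
qed

lemma coefficients_invertible: "continuously_invertible (a n)" "continuously_invertible b"
  using conv by (auto simp: nonlocal_H_converges_def nonlocal_class_def)

lemma coefficients_linear: "bounded_clinear (a n)" "bounded_clinear b"
  using coefficients_invertible by (auto simp: continuously_invertible_def)

lemma coefficients_inv_cancel: "a n (inv (a n) x) = x" "b (inv b x) = x"
  using coefficients_invertible(1)[of n] coefficients_invertible(2) by (auto simp: continuously_invertible_def bij_def surj_f_inv_f)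

text \<open>Nonlocal H-convergence is used twice: with \<open>U\<^sub>n \<in> N\<close> such that \<open>a\<^sub>n U\<^sub>n\<close> has \<open>N\<close>-part \<open>p\<close>, and with
  \<open>V\<^sub>n \<in> N\<^sup>\<bottom>\<close> such that \<open>a\<^sub>n\<^sup>-\<^sup>1 V\<^sub>n\<close> has \<open>N\<^sup>\<bottom>\<close>-part \<open>g\<close>. Then \<open>w\<^sub>n = U\<^sub>n + a\<^sub>n\<^sup>-\<^sup>1 V\<^sub>n\<close> has both data.\<close>

lemma recovery_exists:
  assumes p: "p \<in> N" and g: "g \<in> orth N"
  obtains w w' where "recovers N a b p g w w'"
proof -
  obtain \<alpha> \<beta> where cl: "\<And>n. a n \<in> nonlocal_class \<alpha> \<beta> A0 A"
    using conv by (auto simp: nonlocal_H_converges_def)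
  have bij: "bij_betw (compression N (a n)) N N"
    "bij_betw (compression (orth N) (inv (a n))) (orth N) (orth N)" for n
    using cl[of n] A0(4) Range_op_adj_A by (auto simp: nonlocal_class_def Let_def)
  have "\<exists>U\<in>N. compression N (a n) U = p" for n
    using bij(1)[of n] p by (metis bij_betw_def imageE)
  then obtain U where UN: "\<And>n. U n \<in> N" and Uc: "\<And>n. compression N (a n) (U n) = p"
    by metis
  have U: "cinner z (a n (U n)) = cinner z p" if "z \<in> N" for z n
    using embedding_adj_props(2)[OF N_closed_subspace that, of "a n (U n)"] Uc[of n] by (simp add: compression_def)
  have "\<exists>V\<in>orth N. compression (orth N) (inv (a n)) V = g" for n
    using bij(2)[of n] g by (metis bij_betw_def imageE)
  then obtain V where VN: "\<And>n. V n \<in> orth N"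
    and Vc: "\<And>n. compression (orth N) (inv (a n)) (V n) = g"
    by metis
  have V: "cinner z (inv (a n) (V n)) = cinner z g" if "z \<in> orth N" for z n
    using embedding_adj_props(2)[OF csubspace_orth closed_orth that, of "inv (a n) (V n)"] Vc[of n]
    by (simp add: compression_def)
  define R0 where "R0 = op_restrict A0 (Range (op_adj A0))"
  define R1 where "R1 = op_restrict (op_adj A) (Range A)"
  have "closed (Range A0)" using A0(4) N_closed_subspace(2) by simp
  then have rR0: "Range R0 = N"
    using Range_op_restrict_Range_op_adj[OF A0(1,2)] A0(4) by (simp add: R0_def)
  have "closed (Range (op_adj A))" by (simp add: Range_op_adj_A closed_orth)
  then have rR1: "Range R1 = orth N"
    using Range_op_restrict_Range_op_adj[OF csubspace_op_adj closed_op_adj, of A]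
    by (simp add: R1_def Range_op_adj_A op_adj_op_adj[OF A_skew_closed(1,2)])
  have R0: "csubspace R0" "single_valued R0"
    unfolding R0_def
    by (intro csubspace_op_restrict csubspace_Range csubspace_op_adj A0 single_valued_op_restrict)+
  have "single_valued (op_adj A)"
    using A(2) unfolding A_skew_closed(3) single_valued_def op_neg_iff by (metis minus_minus)
  then have R1: "csubspace R1" "single_valued R1"
    unfolding R1_def
    by (intro csubspace_op_restrict csubspace_Range csubspace_op_adj A_skew_closed single_valued_op_restrict)+
  define F where "F = (\<lambda>\<phi>. cinner p (THE \<Phi>. (\<phi>, \<Phi>) \<in> R0))"
  define G where "G = (\<lambda>\<phi>. cinner g (THE \<Phi>. (\<phi>, \<Phi>) \<in> R1))"
  have F: "F \<in> graph_dual R0" "\<And>\<phi> \<Phi>. (\<phi>, \<Phi>) \<in> R0 \<Longrightarrow> F \<phi> = cinner p \<Phi>"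
    unfolding F_def using graph_dual_cinner[OF R0] by blast+
  have G: "G \<in> graph_dual R1" "\<And>\<phi> \<Phi>. (\<phi>, \<Phi>) \<in> R1 \<Longrightarrow> G \<phi> = cinner g \<Phi>"
    unfolding G_def using graph_dual_cinner[OF R1] by blast+
  have "\<exists>u. (u, U n) \<in> R0" for n
    using UN[of n] rR0 by blast
  then obtain u where u: "\<And>n. (u n, U n) \<in> R0" by metis
  have "\<exists>v. (v, V n) \<in> R1" for n
    using VN[of n] rR1 by blast
  then obtain v where v: "\<And>n. (v n, V n) \<in> R1" by metis
  have sU: "solves_variational R0 (a n) F (U n)" for n
    unfolding solves_variational_def
  proof clarify
    fix \<phi> \<Phi> assume "(\<phi>, \<Phi>) \<in> R0"
    moreover from this have "\<Phi> \<in> N" using rR0 by blast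
    ultimately show "cinner (a n (U n)) \<Phi> = F \<phi>"
      using U[of \<Phi> n] F(2) by (metis cinner_commute)
  qed
  have sV: "solves_variational R1 (inv (a n)) G (V n)" for n
    unfolding solves_variational_def
  proof clarify
    fix \<phi> \<Phi> assume "(\<phi>, \<Phi>) \<in> R1"
    moreover from this have "\<Phi> \<in> orth N" using rR1 by blast
    ultimately show "cinner (inv (a n) (V n)) \<Phi> = G \<phi>"
      using V[of \<Phi> n] G(2) by (metis cinner_commute)
  qed
  obtain u' U' v' V' where lim:
    "weakly_converges_in A0 (\<lambda>n. (u n, U n)) (u', U')"
    "weakly_converges_in (op_adj A) (\<lambda>n. (v n, V n)) (v', V')"
    "weakly_converges_in UNIV (\<lambda>n. a n (U n)) (b U')"
    "weakly_converges_in UNIV (\<lambda>n. inv (a n) (V n)) (inv b V')"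
    "solves_variational R0 b F U'" "solves_variational R1 (inv b) G V'"
    using conv F(1) G(1) u v sU sV unfolding nonlocal_H_converges_def Let_def
      R0_def[symmetric] R1_def[symmetric] by blast
  have U': "U' \<in> N"
    using lim(1) A0(4) unfolding weakly_converges_in_def by blast
  have V': "V' \<in> orth N"
    using lim(2) Range_op_adj_A unfolding weakly_converges_in_def by blast
  have bU: "b U' - p \<in> orth N"
    unfolding orth_def
  proof (safe)
    fix \<Phi> assume "\<Phi> \<in> N"
    then obtain \<phi> where \<phi>: "(\<phi>, \<Phi>) \<in> R0" using rR0 by blast
    then have "cinner (b U') \<Phi> = cinner p \<Phi>"
      using lim(5) F(2)[OF \<phi>] by (auto simp: solves_variational_def)
    then have "cinner (b U' - p) \<Phi> = 0" by (simp add: cinner_diff_left)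
    then show "cinner \<Phi> (b U' - p) = 0" by (simp add: cinner_eq_zero_commute)
  qed
  have bV: "inv b V' - g \<in> orth (orth N)"
    unfolding orth_def[of "orth N"]
  proof (safe)
    fix \<Phi> assume "\<Phi> \<in> orth N"
    then obtain \<phi> where \<phi>: "(\<phi>, \<Phi>) \<in> R1" using rR1 by blast
    then have "cinner (inv b V') \<Phi> = cinner g \<Phi>"
      using lim(6) G(2)[OF \<phi>] by (auto simp: solves_variational_def)
    then have "cinner (inv b V' - g) \<Phi> = 0" by (simp add: cinner_diff_left)
    then show "cinner \<Phi> (inv b V' - g) = 0" by (simp add: cinner_eq_zero_commute)
  qed
  have aU: "a n (U n) - p \<in> orth N" for n
    using U by (simp add: orth_def cinner_diff_right)
  have aV: "inv (a n) (V n) - g \<in> orth (orth N)" for n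
    using V by (simp add: orth_def[of "orth N"] cinner_diff_right)
  have oo: "orth (orth N) = N" by (rule orth_orth[OF N_closed_subspace])
  define w w' where "w n = U n + inv (a n) (V n)" and "w' = U' + inv b V'" for n
  have aw: "a n (w n) = a n (U n) + V n" "b w' = b U' + V'" for n
    using coefficients_linear(1)[of n] coefficients_linear(2) by (simp_all add: w_def w'_def bounded_clinear_linear coefficients_inv_cancel)
  have limU: "(\<lambda>n. cinner y (U n)) \<longlonglongrightarrow> cinner y U'" for y
    using weakly_converges_in_closed_subspace[OF A0(1,2) lim(1), of "(0, y)"] by simp
  have limV: "(\<lambda>n. cinner y (V n)) \<longlonglongrightarrow> cinner y V'" for y
    using weakly_converges_in_closed_subspace[OF csubspace_op_adj closed_op_adj lim(2), of "(0, y)"] by simp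
  have limaU: "(\<lambda>n. cinner y (a n (U n))) \<longlonglongrightarrow> cinner y (b U')"
    and limaV: "(\<lambda>n. cinner y (inv (a n) (V n))) \<longlonglongrightarrow> cinner y (inv b V')" for y
    using lim(3,4) by (auto simp: weakly_converges_in_def)
  have "follows_data N (a n) p g (w n)" for n
    unfolding follows_data_def aw
    using csubspace_add[OF N_closed_subspace(1) UN[of n] aV[of n, unfolded oo]]
      csubspace_add[OF csubspace_orth aU[of n] VN[of n]] by (simp add: w_def algebra_simps)
  moreover have "follows_data N b p g w'"
    unfolding follows_data_def aw
    using csubspace_add[OF N_closed_subspace(1) U' bV[unfolded oo]]
      csubspace_add[OF csubspace_orth bU V'] by (simp add: w'_def algebra_simps)
  moreover have "(\<lambda>n. cinner y (w n)) \<longlonglongrightarrow> cinner y w'" for y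
    unfolding w_def w'_def cinner_add_right by (intro tendsto_add limU limaV)
  moreover have "(\<lambda>n. cinner y (a n (w n))) \<longlonglongrightarrow> cinner y (b w')" for y
    unfolding aw cinner_add_right by (intro tendsto_add limV limaU)
  ultimately have "recovers N a b p g w w'"
    using p g by (simp add: recovers_def)
  then show ?thesis by (rule that)
qed

text \<open>The product \<open>\<langle>a\<^sub>n w\<^sub>n, w\<^sub>n\<rangle>\<close> passes to the limit although both factors converge only weakly:
  it splits into two terms each of which pairs a weakly convergent sequence with a fixed vector.\<close>

lemma recovery_coercive:
  assumes "recovers N a b p g w w'"
  shows "d * (norm w')\<^sup>2 \<le> Re (cinner (b w') w')"
proof -
  have pg: "p \<in> N" "g \<in> orth N" and fd: "\<And>n. follows_data N (a n) p g (w n)" "follows_data N b p g w'"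
    and lim: "\<And>y. (\<lambda>n. cinner y (w n)) \<longlonglongrightarrow> cinner y w'"
      "\<And>y. (\<lambda>n. cinner y (a n (w n))) \<longlonglongrightarrow> cinner y (b w')"
    using assms by (auto simp: recovers_def)
  have low: "d * (2 * Re (cinner w' (w n)) - (norm w')\<^sup>2) \<le> Re (cinner p (w n)) + Re (cinner g (a n (w n)))"
    for n
  proof -
    have "2 * Re (cinner w' (w n)) - (norm w')\<^sup>2 \<le> (norm (w n))\<^sup>2"
      using norm_diff_square[of w' "w n"] zero_le_power2[of "norm (w' - w n)"] by linarith
    then have "d * (2 * Re (cinner w' (w n)) - (norm w')\<^sup>2) \<le> d * (norm (w n))\<^sup>2"
      using d by simp
    also have "\<dots> \<le> Re (cinner (a n (w n)) (w n))"
      using coercive[of n] by (simp add: re_ge_def)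
    also have "\<dots> = Re (cinner p (w n)) + Re (cinner g (a n (w n)))"
      using follows_data_cinner[OF pg fd(1)[of n]] Re_cinner_commute[of g] by simp
    finally show ?thesis .
  qed
  have "d * (2 * Re (cinner w' w') - (norm w')\<^sup>2) \<le> Re (cinner p w') + Re (cinner g (b w'))"
  proof (rule LIMSEQ_le)
    show "(\<lambda>n. d * (2 * Re (cinner w' (w n)) - (norm w')\<^sup>2))
        \<longlonglongrightarrow> d * (2 * Re (cinner w' w') - (norm w')\<^sup>2)"
      by (intro tendsto_intros lim)
    show "(\<lambda>n. Re (cinner p (w n)) + Re (cinner g (a n (w n)))) \<longlonglongrightarrow> Re (cinner p w') + Re (cinner g (b w'))"
      by (intro tendsto_intros lim)
  qed (use low in blast)
  also have "\<dots> = Re (cinner (b w') w')"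
    using follows_data_cinner[OF pg fd(2)] Re_cinner_commute[of g] by simp
  finally show ?thesis by (simp add: Re_cinner_self)
qed

lemma recovers_add:
  assumes "recovers N a b p g w w'" "recovers N a b q h v v'"
  shows "recovers N a b (p + q) (g + h) (\<lambda>n. w n + v n) (w' + v')"
proof -
  have fd: "follows_data N T (p + q) (g + h) (x + y)"
    if "bounded_clinear T" "follows_data N T p g x" "follows_data N T q h y" for T x y
    using csubspace_add[OF N_closed_subspace(1), of "x - g" "y - h"] that
      csubspace_add[OF csubspace_orth[of N], of "T x - p" "T y - q"]
    by (simp add: follows_data_def bounded_clinear_linear algebra_simps)
  have "(\<lambda>n. cinner y (a n (w n + v n))) \<longlonglongrightarrow> cinner y (b (w' + v'))" for y
    unfolding bounded_clinear_linear(1)[OF coefficients_linear(1)] bounded_clinear_linear(1)[OF coefficients_linear(2)] cinner_add_right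
    using assms by (intro tendsto_add) (auto simp: recovers_def)
  moreover have "(\<lambda>n. cinner y (w n + v n)) \<longlonglongrightarrow> cinner y (w' + v')" for y
    unfolding cinner_add_right using assms by (intro tendsto_add) (auto simp: recovers_def)
  ultimately show ?thesis
    using assms fd[OF coefficients_linear(1)] fd[OF coefficients_linear(2)] N_closed_subspace(1) csubspace_orth[of N]
    by (simp add: recovers_def csubspace_add)
qed

lemma recovers_scaleC:
  assumes "recovers N a b p g w w'"
  shows "recovers N a b (k *\<^sub>C p) (k *\<^sub>C g) (\<lambda>n. k *\<^sub>C w n) (k *\<^sub>C w')"
proof -
  have fd: "follows_data N T (k *\<^sub>C p) (k *\<^sub>C g) (k *\<^sub>C x)"
    if "bounded_clinear T" "follows_data N T p g x" for T x
    using csubspace_scaleC[OF N_closed_subspace(1), of "x - g" k] that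
      csubspace_scaleC[OF csubspace_orth[of N], of "T x - p" k]
    by (simp add: follows_data_def bounded_clinear_linear scaleC_diff_right)
  have "(\<lambda>n. cinner y (a n (k *\<^sub>C w n))) \<longlonglongrightarrow> cinner y (b (k *\<^sub>C w'))" for y
    unfolding bounded_clinear_linear(3)[OF coefficients_linear(1)] bounded_clinear_linear(3)[OF coefficients_linear(2)] cinner_scaleC_right
    using assms by (intro tendsto_mult_left) (auto simp: recovers_def)
  moreover have "(\<lambda>n. cinner y (k *\<^sub>C w n)) \<longlonglongrightarrow> cinner y (k *\<^sub>C w')" for y
    unfolding cinner_scaleC_right using assms by (intro tendsto_mult_left) (auto simp: recovers_def)
  ultimately show ?thesis
    using assms fd[OF coefficients_linear(1)] fd[OF coefficients_linear(2)] N_closed_subspace(1) csubspace_orth[of N]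
    by (simp add: recovers_def csubspace_scaleC)
qed

text \<open>The limits \<open>w\<close> obtained in this way form a dense subspace, so the limit coefficient inherits the
  coercivity constant.\<close>

lemma nonlocal_limit_coercive: "re_ge UNIV b d"
proof -
  define Q where "Q = {w'. \<exists>p g w. recovers N a b p g w w'}"
  obtain w0 w0' where w0: "recovers N a b 0 0 w0 w0'"
    using recovery_exists[of 0 0] csubspace_0[OF N_closed_subspace(1)] csubspace_0[OF csubspace_orth] by blast
  have "csubspace Q"
    unfolding csubspace_def
  proof (intro conjI ballI allI)
    show "0 \<in> Q"
      using recovers_scaleC[OF w0, of 0] unfolding Q_def by auto
    show "x + y \<in> Q" if "x \<in> Q" "y \<in> Q" for x y
      using that recovers_add unfolding Q_def by blast
    show "k *\<^sub>C x \<in> Q" if "x \<in> Q" for k x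
      using that recovers_scaleC unfolding Q_def by blast
  qed
  moreover have "z = 0" if z: "z \<in> orth Q" for z
  proof -
    obtain p g where pg: "z = p + g" "p \<in> N" "g \<in> orth N"
      using orthogonal_decomposition[OF N_closed_subspace] by blast
    obtain w w' where w: "recovers N a b p 0 w w'"
      using recovery_exists[OF pg(2) csubspace_0[OF csubspace_orth]] by blast
    have fd: "w' \<in> N" "b w' - p \<in> orth N"
      using w by (auto simp: recovers_def follows_data_def)
    have "cinner w' z = 0"
      using z w by (auto simp: orth_def Q_def)
    then have "cinner w' p = 0"
      using fd(1) pg by (simp add: orth_def cinner_add_right)
    moreover have "cinner w' (b w' - p) = 0"
      using fd by (simp add: orth_def)
    ultimately have "cinner w' (b w') = 0"
      by (simp add: cinner_diff_right)
    then have "d * (norm w')\<^sup>2 \<le> 0"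
      using recovery_coercive[OF w] Re_cinner_commute[of w' "b w'"] by simp
    then have "w' = 0" using d by (simp add: mult_le_0_iff)
    then have "- p \<in> orth N" using fd(2) bounded_clinear_linear(4)[OF coefficients_linear(2)] by simp
    then have "cinner p (- p) = 0" using pg(2) by (simp add: orth_def)
    then have p0: "p = 0" by simp
    obtain v v' where v: "recovers N a b 0 g v v'"
      using recovery_exists[OF csubspace_0[OF N_closed_subspace(1)] pg(3)] by blast
    have "v' - g \<in> N"
      using v by (auto simp: recovers_def follows_data_def)
    then have "cinner (v' - g) g = 0"
      using pg(3) by (auto simp: orth_def)
    moreover have "cinner v' g = 0"
      using z v pg(1) p0 by (auto simp: orth_def Q_def)
    ultimately have "g = 0"
      by (simp add: cinner_diff_left)
    with pg p0 show ?thesis by simp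
  qed
  ultimately have dense: "closure Q = UNIV"
    by (rule dense_if_orth_trivial)
  have cb: "continuous_on UNIV b"
    using coefficients_linear(2) by (simp add: bounded_clinear_def linear_continuous_on)
  have "closed {x. d * (norm x)\<^sup>2 \<le> Re (cinner (b x) x)}"
    by (intro closed_Collect_le continuous_intros continuous_on_cinner cb)
  moreover have "Q \<subseteq> {x. d * (norm x)\<^sup>2 \<le> Re (cinner (b x) x)}"
    using recovery_coercive by (auto simp: Q_def)
  ultimately have "closure Q \<subseteq> {x. d * (norm x)\<^sup>2 \<le> Re (cinner (b x) x)}"
    by (rule closure_minimal[rotated])
  with dense show ?thesis
    by (auto simp: re_ge_def)
qed

text \<open>If the flux \<open>a\<^sub>n e\<close> is orthogonal to \<open>N\<close>, then \<open>\<langle>a\<^sub>n e, e\<rangle> = \<langle>a\<^sub>n e, h\<rangle>\<close> for every \<open>h\<close> with the same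
  \<open>N\<^sup>\<bottom>\<close>-part, and coercivity bounds \<open>e\<close> by \<open>h\<close>.\<close>

lemma orthogonal_flux_estimate:
  assumes "e - h \<in> N" "a n e \<in> orth N"
  shows "d * norm e \<le> C * norm h"
proof (cases "e = 0")
  case False
  have "cinner (a n e) (e - h) = 0"
    using assms by (auto simp: orth_def cinner_eq_zero_commute)
  moreover have "d * (norm e)\<^sup>2 \<le> Re (cinner (a n e) e)"
    using coercive[of n] by (simp add: re_ge_def)
  ultimately have "d * (norm e)\<^sup>2 \<le> Re (cinner (a n e) h)"
    by (simp add: cinner_diff_right)
  also have "\<dots> \<le> norm (a n e) * norm h"
    using abs_Re_cinner_le[of "a n e" h] by linarith
  also have "\<dots> \<le> (C * norm e) * norm h"
    by (intro mult_right_mono bound) auto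
  finally have "norm e * (d * norm e) \<le> norm e * (C * norm h)"
    by (simp add: power2_eq_square algebra_simps)
  then show ?thesis
    using False by (simp add: mult_le_cancel_left_pos)
next
  case True
  have "0 \<le> norm (a n h)" by simp
  also have "\<dots> \<le> C * norm h" by (rule bound)
  finally show ?thesis using True by simp
qed

text \<open>For \<open>u\<^sub>n = (l a\<^sub>n + A)\<^sup>-\<^sup>1 x\<close> the \<open>N\<close>-part of \<open>a\<^sub>n u\<^sub>n\<close> is that of \<open>x / l\<close>, and by compactness the
  \<open>N\<^sup>\<bottom>\<close>-part of \<open>u\<^sub>n\<close> converges strongly along a subsequence. Up to an error that tends to zero in norm
  \<open>u\<^sub>n\<close> is therefore the recovery sequence of fixed data.\<close>

theorem resolvent_converges_at_real_point:
  assumes l: "l > 0" and K: "compact K"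
    "\<And>x z. (x, z) \<in> A \<Longrightarrow> x \<in> orth N \<Longrightarrow> norm (x, z) \<le> 1 \<Longrightarrow> x \<in> K"
  shows "(\<lambda>n. cinner y (resolvent (\<lambda>x. of_real l *\<^sub>C a n x) A x))
    \<longlonglongrightarrow> cinner y (resolvent (\<lambda>x. of_real l *\<^sub>C b x) A x)"
proof -
  have re: "re_ge UNIV (\<lambda>x. of_real l *\<^sub>C T x) (l * d)" if "re_ge UNIV T d" for T :: "'h \<Rightarrow> 'h"
    using that l by (auto simp: re_ge_def cinner_scaleC_left mult.assoc intro!: mult_left_mono)
  have ld: "l * d > 0" using l d by simp
  note resa = bounded_clinear_scaleC[OF coefficients_linear(1)] re[OF coercive] ld A(1)
  note resb = bounded_clinear_scaleC[OF coefficients_linear(2)] re[OF nonlocal_limit_coercive] ld A(1)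
  define u where "u n = resolvent (\<lambda>x. of_real l *\<^sub>C a n x) A x" for n
  define z where "z n = x - of_real l *\<^sub>C a n (u n)" for n
  have uz: "(u n, z n) \<in> A" for n
    unfolding u_def z_def by (rule resolvent_mem[OF resa])
  have un: "norm (u n) \<le> norm x / (l * d)" for n
    unfolding u_def by (rule norm_resolvent_le[OF resa])
  have "\<exists>g. u n - g \<in> N \<and> g \<in> orth N" for n
  proof -
    obtain m g where "u n = m + g" "m \<in> N" "g \<in> orth N"
      using orthogonal_decomposition[OF N_closed_subspace] by blast
    then show ?thesis by (intro exI[of _ g]) simp
  qed
  then obtain g where g: "\<And>n. u n - g n \<in> N" "\<And>n. g n \<in> orth N" by metis
  have gz: "(g n, z n) \<in> A" for n
  proof -
    have "(u n - g n, 0) \<in> A" using g(1)[of n] A(3) by (auto simp: op_kernel_def)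
    from csubspace_diff[OF A_skew_closed(1) uz[of n] this] show ?thesis by simp
  qed
  have gn: "norm (g n) \<le> norm (u n)" for n
  proof -
    have "cinner (u n - g n) (g n) = 0"
      using g by (auto simp: orth_def)
    then have "(norm (u n))\<^sup>2 = (norm (u n - g n))\<^sup>2 + (norm (g n))\<^sup>2"
      using norm_add_square[of "u n - g n" "g n"] by simp
    then have "(norm (g n))\<^sup>2 \<le> (norm (u n))\<^sup>2" by simp
    then show ?thesis by (simp add: power2_le_iff_abs_le)
  qed
  \<comment> \<open>A bound for the graph norms of g n, so that g n / B lies in the compact set K.\<close>
  define B where "B = norm x / (l * d) + (norm x + l * (\<bar>C\<bar> * (norm x / (l * d)))) + 1"
  have "norm x / (l * d) \<ge> 0" "l * (\<bar>C\<bar> * (norm x / (l * d))) \<ge> 0"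
    using ld l by (simp_all add: less_imp_le del: times_divide_eq_right)
  then have B: "B > 0"
    unfolding B_def using norm_ge_zero[of x] by linarith
  have "norm (g n, z n) \<le> B" for n
  proof -
    have "norm (a n (u n)) \<le> \<bar>C\<bar> * norm (u n)"
      by (rule order_trans[OF bound]) (intro mult_right_mono; simp)
    also have "\<dots> \<le> \<bar>C\<bar> * (norm x / (l * d))"
      by (intro mult_left_mono un) simp
    finally have "l * norm (a n (u n)) \<le> l * (\<bar>C\<bar> * (norm x / (l * d)))"
      by (rule mult_left_mono) (use l in simp)
    moreover have "norm (z n) \<le> norm x + l * norm (a n (u n))"
      unfolding z_def using norm_triangle_ineq4[of x "of_real l *\<^sub>C a n (u n)"] l by simp
    moreover have "norm (g n, z n) \<le> norm (g n) + norm (z n)"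
      by (rule norm_Pair_le)
    ultimately show ?thesis
      using gn[of n] un[of n] unfolding B_def by linarith
  qed
  then have gK: "(1 / B) *\<^sub>R g n \<in> K" for n
    using csubspace_scaleR[OF A_skew_closed(1) gz[of n], of "1 / B"] csubspace_scaleR[OF csubspace_orth g(2)[of n]] B
    by (intro K(2)[of _ "(1 / B) *\<^sub>R z n"]) (simp_all flip: scaleR_Pair)
  obtain x0 x1 where x: "x = x0 + x1" "x0 \<in> N" "x1 \<in> orth N"
    using orthogonal_decomposition[OF N_closed_subspace] by blast
  \<comment> \<open>Since z n is orthogonal to N, the equation fixes the N-part of l a n (u n) as that of x.\<close>
  define p where "p = (1 / l) *\<^sub>R x0"
  have p: "p \<in> N" unfolding p_def by (intro csubspace_scaleR N_closed_subspace x)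
  have aup: "a n (u n) - p \<in> orth N" for n
  proof -
    have "z n \<in> orth N" using uz Range_A by blast
    then have "(1 / l) *\<^sub>R (x1 - z n) \<in> orth N"
      by (intro csubspace_scaleR csubspace_diff csubspace_orth x)
    moreover have "x1 - z n = of_real l *\<^sub>C a n (u n) - x0"
      by (simp add: z_def x(1))
    ultimately show ?thesis
      using l by (simp add: p_def scaleC_of_real scaleR_right_diff_distrib)
  qed
  show ?thesis
    unfolding u_def[symmetric]
  proof (rule convergent_if_subsequences)
    fix r :: "nat \<Rightarrow> nat"
    obtain l' s where ls: "strict_mono (s :: nat \<Rightarrow> nat)" "((\<lambda>n. (1 / B) *\<^sub>R g (r n)) \<circ> s) \<longlonglongrightarrow> l'"
      using K(1) gK unfolding compact_def by meson
    define h where "h = B *\<^sub>R l'"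
    have "(\<lambda>n. B *\<^sub>R ((\<lambda>n. (1 / B) *\<^sub>R g (r n)) \<circ> s) n) \<longlonglongrightarrow> h"
      unfolding h_def by (intro tendsto_scaleR ls tendsto_const)
    then have gh: "(\<lambda>n. g (r (s n))) \<longlonglongrightarrow> h"
      using B by simp
    have hN: "h \<in> orth N"
      by (rule closed_sequentially[OF closed_orth _ gh]) (rule g)
    obtain w w' where w: "recovers N a b p h w w'"
      using recovery_exists[OF p hN] by blast
    then have fd: "follows_data N (a n) p h (w n)" for n by (simp add: recovers_def)
    \<comment> \<open>The error e n has a flux orthogonal to N and the same part orthogonal to N as g n - h.\<close>
    define e where "e n = u n - w n" for n
    have "d * norm (e n) \<le> C * norm (g n - h)" for n
    proof (rule orthogonal_flux_estimate)
      show "e n - (g n - h) \<in> N"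
        using csubspace_diff[OF N_closed_subspace(1) g(1)[of n], of "w n - h"] fd[of n]
        by (simp add: e_def follows_data_def algebra_simps)
      show "a n (e n) \<in> orth N"
        using csubspace_diff[OF csubspace_orth aup[of n], of "a n (w n) - p"] fd[of n]
        by (simp add: e_def follows_data_def bounded_clinear_linear[OF coefficients_linear(1)])
    qed
    then have en: "norm (e n) \<le> (C / d) * norm (g n - h)" for n
      using d by (simp add: field_simps)
    have e0: "(\<lambda>n. e (r (s n))) \<longlonglongrightarrow> 0"
    proof (rule Lim_null_comparison)
      show "\<forall>\<^sub>F n in sequentially. norm (e (r (s n))) \<le> (C / d) * norm (g (r (s n)) - h)"
        by (intro always_eventually allI en)
      have "(\<lambda>n. (C / d) * norm (g (r (s n)) - h)) \<longlonglongrightarrow> (C / d) * norm (h - h)"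
        by (intro tendsto_intros gh)
      then show "(\<lambda>n. (C / d) * norm (g (r (s n)) - h)) \<longlonglongrightarrow> 0" by simp
    qed
    have ae0: "(\<lambda>n. a (r (s n)) (e (r (s n)))) \<longlonglongrightarrow> 0"
    proof (rule Lim_null_comparison)
      show "\<forall>\<^sub>F n in sequentially. norm (a (r (s n)) (e (r (s n)))) \<le> C * norm (e (r (s n)))"
        by (intro always_eventually allI bound)
      have "(\<lambda>n. C * norm (e (r (s n)))) \<longlonglongrightarrow> C * norm (0::'h)"
        by (intro tendsto_intros e0)
      then show "(\<lambda>n. C * norm (e (r (s n)))) \<longlonglongrightarrow> 0" by simp
    qed
    show "\<exists>s. strict_mono (s::nat \<Rightarrow> nat) \<and> (\<lambda>n. cinner y (u (r (s n)))) \<longlonglongrightarrow>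
        cinner y (resolvent (\<lambda>x. of_real l *\<^sub>C b x) A x)" if "strict_mono r"
    proof (intro exI conjI)
      show "strict_mono s" by fact
      have "strict_mono (r \<circ> s)" using ls(1) that by (simp add: strict_mono_o)
      then have sub: "(\<lambda>n. f (r (s n))) \<longlonglongrightarrow> L" if "f \<longlonglongrightarrow> L" for f and L :: complex
        using LIMSEQ_subseq_LIMSEQ[OF that] by (simp add: o_def)
      have limu: "(\<lambda>n. cinner y (u (r (s n)))) \<longlonglongrightarrow> cinner y w'" for y
      proof -
        have "(\<lambda>n. cinner y (w (r (s n))) + cinner y (e (r (s n)))) \<longlonglongrightarrow> cinner y w' + cinner y 0"
          using w by (intro tendsto_add sub[of "\<lambda>n. cinner y (w n)"] tendsto_cinner[OF tendsto_const e0])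
            (auto simp: recovers_def)
        then show ?thesis by (simp add: e_def cinner_diff_right)
      qed
      have limau: "(\<lambda>n. cinner y (a (r (s n)) (u (r (s n))))) \<longlonglongrightarrow> cinner y (b w')" for y
      proof -
        have "(\<lambda>n. cinner y (a (r (s n)) (w (r (s n)))) + cinner y (a (r (s n)) (e (r (s n)))))
            \<longlonglongrightarrow> cinner y (b w') + cinner y 0"
          using w by (intro tendsto_add sub[of "\<lambda>n. cinner y (a n (w n))"] tendsto_cinner[OF tendsto_const ae0])
            (auto simp: recovers_def)
        then show ?thesis
          by (simp add: e_def cinner_diff_right bounded_clinear_linear[OF coefficients_linear(1)])
      qed
      have "(w', x - of_real l *\<^sub>C b w') \<in> A"
      proof (rule weak_limit_in_closed_subspace[OF A_skew_closed(1,2)])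
        show "(u (r (s n)), z (r (s n))) \<in> A" for n by (rule uz)
        show "(\<lambda>n. cinner y (u (r (s n)), z (r (s n)))) \<longlonglongrightarrow> cinner y (w', x - of_real l *\<^sub>C b w')" for y
          unfolding z_def
          by (cases y) (auto simp: cinner_diff_right cinner_scaleC_right intro!: tendsto_intros limu limau)
      qed
      then have "resolvent (\<lambda>x. of_real l *\<^sub>C b x) A x = w'"
        by (rule resolvent_eqI[OF resb])
      then show "(\<lambda>n. cinner y (u (r (s n)))) \<longlonglongrightarrow>
          cinner y (resolvent (\<lambda>x. of_real l *\<^sub>C b x) A x)"
        using limu by simp
    qed
  qed
qed

end


section \<open>Analytic continuation of the resolvent limit\<close>

definition half_plane :: "real \<Rightarrow> complex set" where
  "half_plane \<mu> = {z. Re z > \<mu>}"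

lemma open_half_plane: "open (half_plane \<mu>)"
  unfolding half_plane_def by (rule open_halfspace_Re_gt)

lemma connected_half_plane: "connected (half_plane \<mu>)"
  unfolding half_plane_def by (intro convex_connected convex_halfspace_Re_gt)

lemma eventually_half_plane: "z \<in> half_plane \<mu> \<Longrightarrow> eventually (\<lambda>w. w \<in> half_plane \<mu>) (at z)"
  using open_half_plane by (auto simp: eventually_at_topological)

lemma HinfD:
  assumes "M \<in> Hinf \<mu>"
  shows "z \<in> half_plane \<mu> \<Longrightarrow> bounded_clinear (M z)"
    and "\<exists>C. \<forall>z\<in>half_plane \<mu>. \<forall>x. norm (M z x) \<le> C * norm x"
proof -
  show lin: "bounded_clinear (M z)" if "z \<in> half_plane \<mu>" for z
    using assms that by (simp add: Hinf_def half_plane_def)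
  obtain C where C: "\<And>z. z \<in> half_plane \<mu> \<Longrightarrow> onorm (M z) \<le> C"
    using assms by (auto simp: Hinf_def half_plane_def)
  have "norm (M z x) \<le> C * norm x" if "z \<in> half_plane \<mu>" for z x
    using order_trans[OF bounded_clinear_norm_le[OF lin[OF that]] mult_right_mono[OF C[OF that] norm_ge_zero]] .
  then show "\<exists>C. \<forall>z\<in>half_plane \<mu>. \<forall>x. norm (M z x) \<le> C * norm x" by blast
qed

lemma Hinf_derivative:
  assumes M: "M \<in> Hinf \<mu>" and z: "z \<in> half_plane \<mu>"
  obtains D e where "bounded_clinear D" "(e \<longlongrightarrow> 0) (at z)"
    "\<And>w x. w \<in> half_plane \<mu> \<Longrightarrow> norm (inverse (w - z) *\<^sub>C (M w x - M z x) - D x) \<le> e w * norm x"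
proof -
  obtain D where D: "bounded_clinear D"
    "((\<lambda>w. onorm (\<lambda>x. inverse (w - z) *\<^sub>C (M w x - M z x) - D x)) \<longlongrightarrow> 0) (at z)"
    using M z by (auto simp: Hinf_def half_plane_def)
  have "norm (inverse (w - z) *\<^sub>C (M w x - M z x) - D x) \<le>
      onorm (\<lambda>x. inverse (w - z) *\<^sub>C (M w x - M z x) - D x) * norm x" if w: "w \<in> half_plane \<mu>" for w x
  proof (rule onorm)
    have "bounded_linear (M w)" "bounded_linear (M z)" "bounded_linear D"
      using HinfD(1)[OF M] w z D(1) by (auto simp: bounded_clinear_def)
    then show "bounded_linear (\<lambda>x. inverse (w - z) *\<^sub>C (M w x - M z x) - D x)"
      by (intro bounded_linear_sub bounded_linear_compose[OF
          bounded_bilinear.bounded_linear_right[OF bounded_bilinear_scaleC]])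
  qed
  then show ?thesis by (rule that[OF D])
qed

lemma Hinf_strong_derivative:
  assumes M: "M \<in> Hinf \<mu>" and z: "z \<in> half_plane \<mu>"
  obtains l where "((\<lambda>w. inverse (w - z) *\<^sub>C (M w x - M z x)) \<longlongrightarrow> l) (at z)"
proof -
  obtain D e where De: "(e \<longlongrightarrow> 0) (at z)"
    "\<And>w x. w \<in> half_plane \<mu> \<Longrightarrow> norm (inverse (w - z) *\<^sub>C (M w x - M z x) - D x) \<le> e w * norm x"
    using Hinf_derivative[OF M z] by metis
  have "((\<lambda>w. inverse (w - z) *\<^sub>C (M w x - M z x) - D x) \<longlongrightarrow> 0) (at z)"
  proof (rule Lim_null_comparison)
    show "\<forall>\<^sub>F w in at z. norm (inverse (w - z) *\<^sub>C (M w x - M z x) - D x) \<le> e w * norm x"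
      using eventually_half_plane[OF z] by eventually_elim (rule De)
    show "((\<lambda>w. e w * norm x) \<longlongrightarrow> 0) (at z)"
      using tendsto_mult[OF De(1) tendsto_const] by simp
  qed
  then show ?thesis
    using that[of "D x"] by (simp add: LIM_zero_iff)
qed

lemma Hinf_strongly_continuous:
  assumes M: "M \<in> Hinf \<mu>" and z: "z \<in> half_plane \<mu>"
  shows "((\<lambda>w. M w x) \<longlongrightarrow> M z x) (at z)"
proof -
  obtain l where l: "((\<lambda>w. inverse (w - z) *\<^sub>C (M w x - M z x)) \<longlongrightarrow> l) (at z)"
    using Hinf_strong_derivative[OF M z] by blast
  have "((\<lambda>w. (w - z) *\<^sub>C (inverse (w - z) *\<^sub>C (M w x - M z x)) + M z x) \<longlongrightarrow> (z - z) *\<^sub>C l + M z x) (at z)"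
    by (intro tendsto_add tendsto_scaleC l tendsto_intros)
  moreover have "\<forall>\<^sub>F w in at z. (w - z) *\<^sub>C (inverse (w - z) *\<^sub>C (M w x - M z x)) + M z x = M w x"
    by (auto simp: eventually_at_filter scaleC_scaleC)
  ultimately show ?thesis
    using tendsto_cong by (force simp: tendsto_cong)
qed

context
  fixes A :: "('h::complex_hilbert \<times> 'h) set" and M :: "complex \<Rightarrow> 'h \<Rightarrow> 'h" and \<mu> c :: real
  assumes A: "skew_selfadjoint A" and c: "c > 0"
    and M: "M \<in> Hinf \<mu>"
    and coercive: "\<And>z. z \<in> half_plane \<mu> \<Longrightarrow> re_ge UNIV (\<lambda>x. z *\<^sub>C M z x) c"
begin

abbreviation Res :: "complex \<Rightarrow> 'h \<Rightarrow> 'h" where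
  "Res z \<equiv> resolvent (\<lambda>x. z *\<^sub>C M z x) A"

lemma Res_lin: "z \<in> half_plane \<mu> \<Longrightarrow> bounded_clinear (\<lambda>x. z *\<^sub>C M z x)"
  by (rule bounded_clinear_scaleC[OF HinfD(1)[OF M]])

lemma Res_strongly_continuous:
  assumes z: "z \<in> half_plane \<mu>"
  shows "((\<lambda>w. Res w x) \<longlongrightarrow> Res z x) (at z)"
proof -
  let ?u = "Res z x"
  have "((\<lambda>w. Res w x - ?u) \<longlongrightarrow> 0) (at z)"
  proof (rule Lim_null_comparison)
    show "\<forall>\<^sub>F w in at z. norm (Res w x - ?u) \<le> norm (z *\<^sub>C M z ?u - w *\<^sub>C M w ?u) / c"
      using eventually_half_plane[OF z]
    proof eventually_elim
      case (elim w)
      have "Res w x - ?u = Res w (z *\<^sub>C M z ?u - w *\<^sub>C M w ?u)"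
        by (rule resolvent_diff[where T' = "\<lambda>x. z *\<^sub>C M z x" and u' = ?u, OF Res_lin[OF elim] coercive[OF elim] c A])
          (rule resolvent_mem[OF Res_lin[OF z] coercive[OF z] c A])
      then show ?case
        using norm_resolvent_le[OF Res_lin[OF elim] coercive[OF elim] c A] by simp
    qed
    have "((\<lambda>w. norm (z *\<^sub>C M z ?u - w *\<^sub>C M w ?u) / c) \<longlongrightarrow> norm (z *\<^sub>C M z ?u - z *\<^sub>C M z ?u) / c) (at z)"
      using c by (intro tendsto_intros tendsto_scaleC Hinf_strongly_continuous[OF M z]) auto
    then show "((\<lambda>w. norm (z *\<^sub>C M z ?u - w *\<^sub>C M w ?u) / c) \<longlongrightarrow> 0) (at z)" by simp
  qed
  then show ?thesis by (simp add: LIM_zero_iff)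
qed

text \<open>By the second resolvent identity the difference quotient of the resolvent is the resolvent at the moving
  point applied to a difference quotient of \<open>z \<mapsto> - z M(z) u\<close> with \<open>u\<close> fixed, and both factors converge
  strongly.\<close>

lemma Res_holomorphic: "(\<lambda>z. cinner y (Res z x)) holomorphic_on half_plane \<mu>"
  unfolding holomorphic_on_open[OF open_half_plane]
proof
  fix z assume z: "z \<in> half_plane \<mu>"
  let ?u = "Res z x"
  define Q where "Q w = inverse (w - z) *\<^sub>C (z *\<^sub>C M z ?u - w *\<^sub>C M w ?u)" for w
  obtain l where l: "((\<lambda>w. inverse (w - z) *\<^sub>C (M w ?u - M z ?u)) \<longlongrightarrow> l) (at z)"
    using Hinf_strong_derivative[OF M z] by blast
  define q where "q = - (z *\<^sub>C l + M z ?u)"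
  have "((\<lambda>w. - (w *\<^sub>C inverse (w - z) *\<^sub>C (M w ?u - M z ?u) + M z ?u)) \<longlongrightarrow> q) (at z)"
    unfolding q_def by (intro tendsto_intros tendsto_scaleC l)
  moreover have "- (w *\<^sub>C inverse (w - z) *\<^sub>C (M w ?u - M z ?u) + M z ?u) = Q w" if "w \<noteq> z" for w
  proof -
    have "M z ?u = inverse (w - z) *\<^sub>C (w - z) *\<^sub>C M z ?u"
      using that by (simp add: scaleC_scaleC)
    then have "w *\<^sub>C inverse (w - z) *\<^sub>C (M w ?u - M z ?u) + M z ?u
        = inverse (w - z) *\<^sub>C (w *\<^sub>C (M w ?u - M z ?u) + (w - z) *\<^sub>C M z ?u)"
      by (simp add: scaleC_add_right scaleC_scaleC mult.commute)
    also have "w *\<^sub>C (M w ?u - M z ?u) + (w - z) *\<^sub>C M z ?u = - (z *\<^sub>C M z ?u - w *\<^sub>C M w ?u)"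
      by (simp add: scaleC_diff_left scaleC_diff_right)
    finally show ?thesis
      by (simp only: Q_def scaleC_minus_right minus_minus)
  qed
  then have "\<forall>\<^sub>F w in at z. - (w *\<^sub>C inverse (w - z) *\<^sub>C (M w ?u - M z ?u) + M z ?u) = Q w"
    unfolding eventually_at_filter by (intro always_eventually allI impI)
  ultimately have Q: "(Q \<longlongrightarrow> q) (at z)"
    by (rule Lim_transform_eventually)
  have RQ: "((\<lambda>w. Res w (Q w)) \<longlongrightarrow> Res z q) (at z)"
  proof -
    have "((\<lambda>w. Res w (Q w) - Res w q) \<longlongrightarrow> 0) (at z)"
    proof (rule Lim_null_comparison)
      show "\<forall>\<^sub>F w in at z. norm (Res w (Q w) - Res w q) \<le> norm (Q w - q) / c"
        using eventually_half_plane[OF z]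
      proof eventually_elim
        case (elim w)
        show ?case
          using norm_resolvent_le[OF Res_lin[OF elim] coercive[OF elim] c A, of "Q w - q"]
          by (simp add: bounded_clinear_linear(2)[OF bounded_clinear_resolvent[OF Res_lin[OF elim] coercive[OF elim] c A]])
      qed
      have "((\<lambda>w. norm (Q w - q) / c) \<longlongrightarrow> norm (q - q) / c) (at z)"
        using c by (intro tendsto_intros Q) auto
      then show "((\<lambda>w. norm (Q w - q) / c) \<longlongrightarrow> 0) (at z)" by simp
    qed
    from tendsto_add[OF this Res_strongly_continuous[OF z, of q]] show ?thesis by simp
  qed
  have "((\<lambda>w. (cinner y (Res w x) - cinner y ?u) / (w - z)) \<longlongrightarrow> cinner y (Res z q)) (at z)"
  proof (rule Lim_transform_eventually)
    show "((\<lambda>w. cinner y (Res w (Q w))) \<longlongrightarrow> cinner y (Res z q)) (at z)"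
      by (intro tendsto_cinner tendsto_const RQ)
    show "\<forall>\<^sub>F w in at z. cinner y (Res w (Q w)) = (cinner y (Res w x) - cinner y ?u) / (w - z)"
      using eventually_half_plane[OF z]
    proof eventually_elim
      case (elim w)
      have "Res w x - ?u = Res w (z *\<^sub>C M z ?u - w *\<^sub>C M w ?u)"
        by (rule resolvent_diff[where T' = "\<lambda>x. z *\<^sub>C M z x" and u' = ?u, OF Res_lin[OF elim] coercive[OF elim] c A])
          (rule resolvent_mem[OF Res_lin[OF z] coercive[OF z] c A])
      then have "inverse (w - z) *\<^sub>C (Res w x - ?u) = Res w (Q w)"
        unfolding Q_def by (simp add: resolvent_scaleC[OF Res_lin[OF elim] coercive[OF elim] c A])
      then have "cinner y (Res w (Q w)) = inverse (w - z) * cinner y (Res w x - ?u)"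
        by (metis cinner_scaleC_right)
      then show ?case
        by (simp add: cinner_diff_right divide_inverse mult.commute)
    qed
  qed
  then show "\<exists>f'. ((\<lambda>z. cinner y (Res z x)) has_field_derivative f') (at z)"
    unfolding has_field_derivative_iff by blast
qed

end

lemma holomorphic_zero_if_zero_on_reals:
  assumes "h holomorphic_on half_plane \<mu>" "\<And>l. l > \<mu> \<Longrightarrow> h (of_real l) = 0" "z \<in> half_plane \<mu>"
  shows "h z = 0"
proof (rule analytic_continuation[OF assms(1) open_half_plane connected_half_plane])
  show "of_real ` {\<mu><..} \<subseteq> half_plane \<mu>" "complex_of_real (\<mu> + 1) \<in> half_plane \<mu>"
    by (auto simp: half_plane_def)
  define s where "s n = complex_of_real (\<mu> + 1 + 1 / real (Suc n))" for n
  have "s \<longlonglongrightarrow> complex_of_real (\<mu> + 1 + 0)"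
    unfolding s_def
    by (intro tendsto_intros) (use LIMSEQ_inverse_real_of_nat in \<open>simp add: inverse_eq_divide\<close>)
  moreover have "s n \<in> of_real ` {\<mu><..} - {complex_of_real (\<mu> + 1)}" for n
  proof -
    have "1 / real (Suc n) > 0" by simp
    then have "\<mu> + 1 + 1 / real (Suc n) > \<mu>" "\<mu> + 1 + 1 / real (Suc n) \<noteq> \<mu> + 1" by linarith+
    then show ?thesis unfolding s_def by (metis DiffI greaterThan_iff imageI of_real_eq_iff singletonD)
  qed
  ultimately show "complex_of_real (\<mu> + 1) islimpt of_real ` {\<mu><..}"
    unfolding islimpt_sequential by (intro exI[of _ s]) auto
qed (use assms in auto)

text \<open>Vitali's theorem in a half-plane: by Montel's theorem every subsequence has a locally uniformly
  convergent subsequence, and all limits agree on the real half-line, hence everywhere.\<close>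

lemma Vitali_half_plane:
  assumes hol: "\<And>n. f n holomorphic_on half_plane \<mu>"
    and bound: "\<And>n z. z \<in> half_plane \<mu> \<Longrightarrow> cmod (f n z) \<le> B"
    and real: "\<And>l::real. l > \<mu> \<Longrightarrow> (\<lambda>n. f n (of_real l)) \<longlonglongrightarrow> k l"
  obtains h where "h holomorphic_on half_plane \<mu>" "\<And>z. z \<in> half_plane \<mu> \<Longrightarrow> (\<lambda>n. f n z) \<longlonglongrightarrow> h z"
    "\<And>l. l > \<mu> \<Longrightarrow> h (of_real l) = k l"
proof -
  have sub: "\<exists>h s. h holomorphic_on half_plane \<mu> \<and> strict_mono (s::nat \<Rightarrow> nat) \<and>
      (\<forall>z\<in>half_plane \<mu>. (\<lambda>n. f (r (s n)) z) \<longlonglongrightarrow> h z) \<and> (\<forall>l>\<mu>. h (of_real l) = k l)"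
    if r: "strict_mono r" for r :: "nat \<Rightarrow> nat"
  proof -
    obtain h s where hs: "h holomorphic_on half_plane \<mu>" "strict_mono (s :: nat \<Rightarrow> nat)"
      "\<And>z. z \<in> half_plane \<mu> \<Longrightarrow> (\<lambda>n. f (r (s n)) z) \<longlonglongrightarrow> h z"
      by (rule Montel[of "half_plane \<mu>" "range f" "\<lambda>n. f (r n)"])
        (use hol bound open_half_plane in \<open>auto intro!: exI[of _ B]\<close>)
    have "h (of_real l) = k l" if "l > \<mu>" for l
    proof (rule LIMSEQ_unique)
      show "(\<lambda>n. f (r (s n)) (of_real l)) \<longlonglongrightarrow> h (of_real l)"
        using that by (intro hs) (simp add: half_plane_def)
      have "strict_mono (r \<circ> s)" using r hs(2) by (rule strict_mono_o)
      from LIMSEQ_subseq_LIMSEQ[OF real[OF that] this]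
      show "(\<lambda>n. f (r (s n)) (of_real l)) \<longlonglongrightarrow> k l" by (simp add: o_def)
    qed
    with hs show ?thesis by blast
  qed
  obtain h where h: "h holomorphic_on half_plane \<mu>" "\<forall>l>\<mu>. h (of_real l) = k l"
    using sub[OF strict_mono_id] by blast
  have eq: "h' z = h z" if "h' holomorphic_on half_plane \<mu>" "\<forall>l>\<mu>. h' (of_real l) = k l" "z \<in> half_plane \<mu>"
    for h' z
  proof -
    have "h' z - h z = 0"
      by (rule holomorphic_zero_if_zero_on_reals[of "\<lambda>z. h' z - h z" \<mu>])
        (use that h in \<open>auto intro!: holomorphic_intros\<close>)
    then show ?thesis by simp
  qed
  have "(\<lambda>n. f n z) \<longlonglongrightarrow> h z" if "z \<in> half_plane \<mu>" for z
    using sub eq that by (intro convergent_if_subsequences) metis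
  then show ?thesis using that h by blast
qed

text \<open>The limit is a functional bounded by \<open>B\<close> and therefore represented by a vector.\<close>

lemma weak_limit_exists:
  assumes bound: "\<And>n. norm (x n) \<le> B" and conv: "\<And>y. (\<lambda>n. cinner y (x n)) \<longlonglongrightarrow> h y"
  obtains v where "\<And>y. h y = cinner y v" "norm v \<le> B"
proof -
  have h: "(\<lambda>n. cinner (x n) y) \<longlonglongrightarrow> cnj (h y)" for y
    using tendsto_cnj[OF conv[of y]] by (simp flip: cinner_commute)
  have le: "cmod (cnj (h y)) \<le> B * norm y" for y
  proof (rule LIMSEQ_le_const2[OF tendsto_norm[OF h]])
    have "cmod (cinner (x n) y) \<le> B * norm y" for n
      using Cauchy_Schwarz[of "x n" y] mult_right_mono[OF bound norm_ge_zero[of y]] by (rule order_trans)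
    then show "\<exists>N. \<forall>n\<ge>N. cmod (cinner (x n) y) \<le> B * norm y" by blast
  qed
  have add: "cnj (h (y + z)) = cnj (h y) + cnj (h z)" for y z
    by (rule LIMSEQ_unique[OF h]) (simp add: cinner_add_right tendsto_add h del: complex_cnj_add)
  have scale: "cnj (h (k *\<^sub>C y)) = k * cnj (h y)" for k y
    by (rule LIMSEQ_unique[OF h]) (simp add: cinner_scaleC_right tendsto_mult_left h del: complex_cnj_mult)
  obtain v where v: "\<And>y. cnj (h y) = cinner v y"
    using Riesz_representation[OF csubspace_UNIV closed_UNIV, of "\<lambda>y. cnj (h y)" B] add scale le
    by (metis UNIV_I)
  have hv: "h y = cinner y v" for y
    by (metis v cinner_commute complex_cnj_cnj)
  have "(norm v)\<^sup>2 \<le> B * norm v"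
    using le[of v] v[of v] by (simp add: cinner_self norm_power)
  then have "norm v \<le> B"
    using order_trans[OF norm_ge_zero bound]
    by (cases "v = 0") (auto simp: power2_eq_square)
  with hv show ?thesis by (rule that)
qed

text \<open>The weak limit \<open>V z x\<close> of the resolvents inherits from the real half-line the equation
  \<open>(z M(z) + A) V z x = x\<close>, because tested with an element of the graph of \<open>A\<close> it is an identity
  between holomorphic functions. Coercivity of \<open>z M(z)\<close> on the range of \<open>V z\<close> is weak lower
  semicontinuity, and this range is dense.\<close>

theorem resolvent_convergence_half_plane:
  fixes M :: "nat \<Rightarrow> complex \<Rightarrow> 'h::complex_hilbert \<Rightarrow> 'h"
  assumes A: "skew_selfadjoint A" "single_valued A" and c: "c > 0"
    and M: "\<And>n. M n \<in> Hinf \<mu>" and M': "M' \<in> Hinf \<mu>"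
    and coercive: "\<And>n z. z \<in> half_plane \<mu> \<Longrightarrow> re_ge UNIV (\<lambda>x. z *\<^sub>C M n z x) c"
    and real: "\<And>l x. l > \<mu> \<Longrightarrow> \<exists>v. (v, x - of_real l *\<^sub>C M' (of_real l) v) \<in> A \<and>
      (\<forall>y. (\<lambda>n. cinner y (resolvent (\<lambda>x. of_real l *\<^sub>C M n (of_real l) x) A x)) \<longlonglongrightarrow> cinner y v)"
    and z: "z \<in> half_plane \<mu>"
  shows "re_ge UNIV (\<lambda>x. z *\<^sub>C M' z x) c"
    and "(\<lambda>n. cinner y (resolvent (\<lambda>x. z *\<^sub>C M n z x) A x)) \<longlonglongrightarrow>
      cinner y (resolvent (\<lambda>x. z *\<^sub>C M' z x) A x)"
proof -
  define S where "S n z = resolvent (\<lambda>x. z *\<^sub>C M n z x) A" for n z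
  note S_lin = bounded_clinear_scaleC[OF HinfD(1)[OF M]]
  have nS: "norm (S n z x) \<le> norm x / c" if "z \<in> half_plane \<mu>" for n z x
    unfolding S_def by (rule norm_resolvent_le[OF S_lin[OF that] coercive[OF that] c A(1)])
  have holS: "(\<lambda>z. cinner y (S n z x)) holomorphic_on half_plane \<mu>" for y n x
    unfolding S_def by (rule Res_holomorphic[OF A(1) c M coercive])
  have "\<exists>v. \<forall>l x. l > \<mu> \<longrightarrow> (v l x, x - of_real l *\<^sub>C M' (of_real l) (v l x)) \<in> A \<and>
      (\<forall>y. (\<lambda>n. cinner y (S n (of_real l) x)) \<longlonglongrightarrow> cinner y (v l x))"
    unfolding S_def using real by metis
  then obtain v where v: "\<And>l x. l > \<mu> \<Longrightarrow> (v l x, x - of_real l *\<^sub>C M' (of_real l) (v l x)) \<in> A"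
    "\<And>l x y. l > \<mu> \<Longrightarrow> (\<lambda>n. cinner y (S n (of_real l) x)) \<longlonglongrightarrow> cinner y (v l x)"
    by metis
  have ex: "\<exists>h. h holomorphic_on half_plane \<mu> \<and> (\<forall>z\<in>half_plane \<mu>. (\<lambda>n. cinner y (S n z x)) \<longlonglongrightarrow> h z) \<and>
      (\<forall>l>\<mu>. h (of_real l) = cinner y (v l x))" for x y
  proof -
    have "cmod (cinner y (S n z x)) \<le> norm y * (norm x / c)" if "z \<in> half_plane \<mu>" for n z
      using Cauchy_Schwarz[of y] mult_left_mono[OF nS[OF that] norm_ge_zero] by (rule order_trans)
    from Vitali_half_plane[of "\<lambda>n z. cinner y (S n z x)", OF holS this v(2)] show ?thesis
      by metis
  qed
  define h where "h x y = (SOME h. h holomorphic_on half_plane \<mu> \<and>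
      (\<forall>z\<in>half_plane \<mu>. (\<lambda>n. cinner y (S n z x)) \<longlonglongrightarrow> h z) \<and> (\<forall>l>\<mu>. h (of_real l) = cinner y (v l x)))" for x y
  have h: "h x y holomorphic_on half_plane \<mu>"
      "\<And>z. z \<in> half_plane \<mu> \<Longrightarrow> (\<lambda>n. cinner y (S n z x)) \<longlonglongrightarrow> h x y z"
      "\<And>l. l > \<mu> \<Longrightarrow> h x y (of_real l) = cinner y (v l x)" for x y
    using someI_ex[OF ex[of y x]] unfolding h_def[symmetric] by blast+
  have "\<exists>w. (\<forall>y. h x y z = cinner y w) \<and> norm w \<le> norm x / c" if "z \<in> half_plane \<mu>" for z x
    using weak_limit_exists[of "\<lambda>n. S n z x" "norm x / c" "\<lambda>y. h x y z"] nS h(2) that by metis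
  then obtain V where V: "\<And>z x y. z \<in> half_plane \<mu> \<Longrightarrow> h x y z = cinner y (V z x)"
    "\<And>z x. z \<in> half_plane \<mu> \<Longrightarrow> norm (V z x) \<le> norm x / c"
    by metis
  have SV: "(\<lambda>n. cinner y (S n z x)) \<longlonglongrightarrow> cinner y (V z x)" if "z \<in> half_plane \<mu>" for y z x
    using h(2)[OF that] V(1)[OF that] by simp
  have holV: "(\<lambda>z. cinner y (V z x)) holomorphic_on half_plane \<mu>" for y x
    using h(1) by (rule holomorphic_transform) (rule V(1))
  have Vreal: "V (of_real l) x = v l x" if "l > \<mu>" for l x
    by (rule cinner_extensionality) (metis V(1) h(3) that half_plane_def mem_Collect_eq Re_complex_of_real)
  \<comment> \<open>M' is differentiable in operator norm and V only weakly. In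
    (M' w - M' z) V w + M' z (V w - V z) the first difference quotient may be replaced by D V w, because V is bounded,
    and D and M' z are moved to the other side of the inner product.\<close>
  have holMV: "(\<lambda>z. cinner p (M' z (V z x))) holomorphic_on half_plane \<mu>" for p x
    unfolding holomorphic_on_open[OF open_half_plane]
  proof
    fix z assume z: "z \<in> half_plane \<mu>"
    obtain D e where De: "bounded_clinear D" "(e \<longlongrightarrow> 0) (at z)"
      "\<And>w x. w \<in> half_plane \<mu> \<Longrightarrow> norm (inverse (w - z) *\<^sub>C (M' w x - M' z x) - D x) \<le> e w * norm x"
      using Hinf_derivative[OF M' z] by metis
    obtain p1 where p1: "\<And>x. cinner p (D x) = cinner p1 x"
      using bounded_clinear_adjoint_exists[OF De(1)] by blast
    obtain p2 where p2: "\<And>x. cinner p (M' z x) = cinner p2 x"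
      using bounded_clinear_adjoint_exists[OF HinfD(1)[OF M' z]] by blast
    obtain f2 where f2: "((\<lambda>z. cinner p2 (V z x)) has_field_derivative f2) (at z)"
      using holV[unfolded holomorphic_on_open[OF open_half_plane]] z by blast
    obtain f1 where "((\<lambda>z. cinner p1 (V z x)) has_field_derivative f1) (at z)"
      using holV[unfolded holomorphic_on_open[OF open_half_plane]] z by blast
    then have c1: "((\<lambda>w. cinner p1 (V w x)) \<longlongrightarrow> cinner p1 (V z x)) (at z)"
      using DERIV_isCont isCont_def by blast
    define R where "R w = cinner p (inverse (w - z) *\<^sub>C (M' w (V w x) - M' z (V w x)) - D (V w x))" for w
    have R0: "(R \<longlongrightarrow> 0) (at z)"
    proof (rule Lim_null_comparison)
      show "\<forall>\<^sub>F w in at z. norm (R w) \<le> norm p * (\<bar>e w\<bar> * (norm x / c))"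
        using eventually_half_plane[OF z]
      proof eventually_elim
        case (elim w)
        have "norm (R w) \<le> norm p * norm (inverse (w - z) *\<^sub>C (M' w (V w x) - M' z (V w x)) - D (V w x))"
          unfolding R_def by (rule Cauchy_Schwarz)
        also have "\<dots> \<le> norm p * (\<bar>e w\<bar> * norm (V w x))"
          by (intro mult_left_mono order_trans[OF De(3)[OF elim]] mult_right_mono) auto
        also have "\<dots> \<le> norm p * (\<bar>e w\<bar> * (norm x / c))"
          by (intro mult_left_mono V elim) auto
        finally show ?case .
      qed
      have "((\<lambda>w. norm p * (\<bar>e w\<bar> * (norm x / c))) \<longlongrightarrow> norm p * (\<bar>0\<bar> * (norm x / c))) (at z)"
        by (intro tendsto_mult tendsto_const tendsto_rabs De(2))
      then show "((\<lambda>w. norm p * (\<bar>e w\<bar> * (norm x / c))) \<longlongrightarrow> 0) (at z)" by simp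
    qed
    have "((\<lambda>w. (cinner p (M' w (V w x)) - cinner p (M' z (V z x))) / (w - z))
        \<longlongrightarrow> 0 + cinner p1 (V z x) + f2) (at z)"
    proof (rule Lim_transform_eventually)
      show "((\<lambda>w. R w + cinner p1 (V w x) + (cinner p2 (V w x) - cinner p2 (V z x)) / (w - z))
          \<longlongrightarrow> 0 + cinner p1 (V z x) + f2) (at z)"
        using f2 unfolding has_field_derivative_iff by (intro tendsto_add R0 c1)
      show "\<forall>\<^sub>F w in at z. R w + cinner p1 (V w x) + (cinner p2 (V w x) - cinner p2 (V z x)) / (w - z)
          = (cinner p (M' w (V w x)) - cinner p (M' z (V z x))) / (w - z)"
        by (intro always_eventually allI)
          (simp add: R_def cinner_diff_right cinner_scaleC_right p1 flip: p2 add: divide_inverse algebra_simps)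
    qed
    then show "\<exists>f'. ((\<lambda>z. cinner p (M' z (V z x))) has_field_derivative f') (at z)"
      unfolding has_field_derivative_iff by blast
  qed
  have VA: "(V z x, x - z *\<^sub>C M' z (V z x)) \<in> A" if z: "z \<in> half_plane \<mu>" for z x
  proof (rule skew_selfadjointI[OF A(1)])
    fix p q assume pq: "(p, q) \<in> A"
    define k where "k z = cinner q (V z x) + cinner p x - z * cinner p (M' z (V z x))" for z
    have holk: "k holomorphic_on half_plane \<mu>"
      unfolding k_def by (intro holomorphic_intros holV holMV)
    have k0: "k (of_real l) = 0" if "l > \<mu>" for l
      using skew_selfadjointD[OF A(1) v(1)[OF that] pq, of x]
      by (simp add: k_def Vreal[OF that] cinner_diff_right cinner_scaleC_right)
    have "k z = 0"
      by (rule holomorphic_zero_if_zero_on_reals[OF holk k0 z])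
    then show "cinner q (V z x) = - cinner p (x - z *\<^sub>C M' z (V z x))"
      by (simp add: k_def cinner_diff_right cinner_scaleC_right algebra_simps)
  qed
  \<comment> \<open>The norm of the weak limit is handled by the minorant 2 Re (V, S) - |V|^2 of |S|^2, which is weakly
    continuous in S.\<close>
  have Vre: "c * (norm (V z x))\<^sup>2 \<le> Re (cinner x (V z x))" for x
  proof (rule LIMSEQ_le_const)
    show "(\<lambda>n. Re (cinner x (S n z x)) - c * (2 * Re (cinner (V z x) (S n z x)) - 2 * (norm (V z x))\<^sup>2))
        \<longlonglongrightarrow> Re (cinner x (V z x))"
    proof -
      have "(\<lambda>n. Re (cinner x (S n z x)) - c * (2 * Re (cinner (V z x) (S n z x)) - 2 * (norm (V z x))\<^sup>2))
        \<longlonglongrightarrow> Re (cinner x (V z x)) - c * (2 * Re (cinner (V z x) (V z x)) - 2 * (norm (V z x))\<^sup>2)"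
        by (intro tendsto_intros SV z)
      then show ?thesis by (simp add: Re_cinner_self)
    qed
    have "c * (norm (V z x))\<^sup>2 \<le>
        Re (cinner x (S n z x)) - c * (2 * Re (cinner (V z x) (S n z x)) - 2 * (norm (V z x))\<^sup>2)" for n
    proof -
      have "2 * Re (cinner (V z x) (S n z x)) - (norm (V z x))\<^sup>2 \<le> (norm (S n z x))\<^sup>2"
        using norm_diff_square[of "V z x" "S n z x"] zero_le_power2[of "norm (V z x - S n z x)"] by linarith
      then have "c * (2 * Re (cinner (V z x) (S n z x)) - (norm (V z x))\<^sup>2) \<le> c * (norm (S n z x))\<^sup>2"
        using c by simp
      also have "\<dots> \<le> Re (cinner x (S n z x))"
        unfolding S_def by (rule Re_cinner_resolvent_ge[OF S_lin[OF z] coercive[OF z] c A(1)])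
      finally show ?thesis by (simp add: algebra_simps)
    qed
    then show "\<exists>N. \<forall>n\<ge>N. Re (cinner x (S n z x)) -
        c * (2 * Re (cinner (V z x) (S n z x)) - 2 * (norm (V z x))\<^sup>2) \<ge> c * (norm (V z x))\<^sup>2"
      by blast
  qed
  have Vadd: "V z (x + y) = V z x + V z y" for x y
  proof (rule weak_limit_unique)
    show "(\<lambda>n. cinner w (S n z (x + y))) \<longlonglongrightarrow> cinner w (V z (x + y))" for w
      by (rule SV[OF z])
    show "(\<lambda>n. cinner w (S n z (x + y))) \<longlonglongrightarrow> cinner w (V z x + V z y)" for w
      unfolding S_def resolvent_add[OF S_lin[OF z] coercive[OF z] c A(1)] cinner_add_right
      unfolding S_def[symmetric] by (intro tendsto_add SV z)
  qed
  have Vscale: "V z (k *\<^sub>C x) = k *\<^sub>C V z x" for k x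
  proof (rule weak_limit_unique)
    show "(\<lambda>n. cinner w (S n z (k *\<^sub>C x))) \<longlonglongrightarrow> cinner w (V z (k *\<^sub>C x))" for w
      by (rule SV[OF z])
    show "(\<lambda>n. cinner w (S n z (k *\<^sub>C x))) \<longlonglongrightarrow> cinner w (k *\<^sub>C V z x)" for w
      unfolding S_def resolvent_scaleC[OF S_lin[OF z] coercive[OF z] c A(1)] cinner_scaleC_right
      unfolding S_def[symmetric] by (intro tendsto_mult_left SV z)
  qed
  have "csubspace (range (V z))"
    unfolding csubspace_def
  proof (intro conjI ballI allI)
    have "V z 0 = 0" using Vscale[of 0 0] by simp
    then show "0 \<in> range (V z)" using rangeI[of "V z" 0] by simp
    show "x + y \<in> range (V z)" if "x \<in> range (V z)" "y \<in> range (V z)" for x y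
      using that by (auto simp flip: Vadd)
    show "k *\<^sub>C x \<in> range (V z)" if "x \<in> range (V z)" for k x
      using that by (auto simp flip: Vscale)
  qed
  moreover have "w = 0" if w: "w \<in> orth (range (V z))" for w
  proof -
    have "cinner w (V z w) = 0"
      using w by (auto simp: orth_def cinner_eq_zero_commute)
    then have "c * (norm (V z w))\<^sup>2 \<le> 0"
      using Vre[of w] by simp
    then have "V z w = 0" using c by (simp add: mult_le_0_iff)
    then have "(0, w) \<in> A"
      using VA[OF z, of w] bounded_clinear_linear(4)[OF HinfD(1)[OF M' z]] by simp
    moreover have "(0, 0) \<in> A"
      using A(1) csubspace_0[of A] by (simp add: skew_selfadjoint_def zero_prod_def)
    ultimately show ?thesis using A(2) by (auto simp: single_valued_def)
  qed
  ultimately have dense: "closure (range (V z)) = UNIV"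
    by (rule dense_if_orth_trivial)
  have bM: "bounded_clinear (\<lambda>x. z *\<^sub>C M' z x)"
    by (rule bounded_clinear_scaleC[OF HinfD(1)[OF M' z]])
  have "closed {x. c * (norm x)\<^sup>2 \<le> Re (cinner (z *\<^sub>C M' z x) x)}"
  proof (rule closed_Collect_le)
    have "continuous_on UNIV (\<lambda>x. z *\<^sub>C M' z x)"
      using bM by (simp add: bounded_clinear_def linear_continuous_on)
    from continuous_on_cinner[OF this continuous_on_id]
    have "continuous_on UNIV (\<lambda>x. cinner (z *\<^sub>C M' z x) x)" .
    then show "continuous_on UNIV (\<lambda>x. Re (cinner (z *\<^sub>C M' z x) x))"
      by (rule continuous_on_Re)
    show "continuous_on UNIV (\<lambda>x. c * (norm x)\<^sup>2)"
      by (rule continuous_on_mult_left[OF continuous_on_power[OF continuous_on_norm_id]])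
  qed
  moreover have "c * (norm (V z x))\<^sup>2 \<le> Re (cinner (z *\<^sub>C M' z (V z x)) (V z x))" for x
    using skew_selfadjoint_Re[OF A(1) VA[OF z, of x]] Vre[of x] by (simp add: cinner_diff_left)
  then have "range (V z) \<subseteq> {x. c * (norm x)\<^sup>2 \<le> Re (cinner (z *\<^sub>C M' z x) x)}"
    by auto
  ultimately have "closure (range (V z)) \<subseteq> {x. c * (norm x)\<^sup>2 \<le> Re (cinner (z *\<^sub>C M' z x) x)}"
    by (rule closure_minimal[rotated])
  with dense show re: "re_ge UNIV (\<lambda>x. z *\<^sub>C M' z x) c"
    by (auto simp: re_ge_def)
  show "(\<lambda>n. cinner y (resolvent (\<lambda>x. z *\<^sub>C M n z x) A x)) \<longlonglongrightarrow>
      cinner y (resolvent (\<lambda>x. z *\<^sub>C M' z x) A x)"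
    using SV[OF z, of y x] resolvent_eqI[OF bM re c A(1) VA[OF z]] by (simp add: S_def)
qed


section \<open>Square-integrable functions with values in a Hilbert space\<close>

subsection \<open>Strong measurability\<close>

lemma borel_measurable_lebesgue_AE_eq:
  assumes f: "f \<in> borel_measurable lebesgue" and ae: "AE x in lebesgue. f x = g x"
  shows "g \<in> borel_measurable lebesgue"
proof (rule measurableI)
  fix B :: "'b set" assume B: "B \<in> sets borel"
  have ae': "AE x in lborel. f x = g x"
    using ae by (simp add: AE_completion_iff)
  have "AE x in lborel. \<not> (g x \<in> B \<and> f x \<noteq> g x)" "AE x in lborel. \<not> f x \<noteq> g x"
    using ae' by (auto elim!: eventually_mono)
  then have "Measurable.pred lebesgue (\<lambda>x. g x \<in> B \<and> f x \<noteq> g x)" "Measurable.pred lebesgue (\<lambda>x. f x \<noteq> g x)"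
    by (auto intro: sets_completion_AE)
  then have "{x. g x \<in> B \<and> f x \<noteq> g x} \<in> sets lebesgue" "{x. f x \<noteq> g x} \<in> sets lebesgue"
    by (auto simp: pred_def)
  moreover have "f -` B \<in> sets lebesgue"
    using measurable_sets[OF f B] by simp
  ultimately have "{x. g x \<in> B \<and> f x \<noteq> g x} \<union> (f -` B - {x. f x \<noteq> g x}) \<in> sets lebesgue"
    by blast
  moreover have "{x. g x \<in> B \<and> f x \<noteq> g x} \<union> (f -` B - {x. f x \<noteq> g x}) = g -` B"
    by auto
  ultimately show "g -` B \<inter> space lebesgue \<in> sets lebesgue"
    by simp
qed simp

lemma borel_measurable_lebesgue_AE_limit:
  fixes f :: "real \<Rightarrow> 'b::real_normed_vector"
  assumes s: "\<And>n. s n \<in> borel_measurable lebesgue" and lim: "AE t in lebesgue. (\<lambda>n. s n t) \<longlonglongrightarrow> f t"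
  shows "f \<in> borel_measurable lebesgue"
proof -
  obtain N where N: "{t \<in> space lebesgue. \<not> (\<lambda>n. s n t) \<longlonglongrightarrow> f t} \<subseteq> N" "N \<in> null_sets lebesgue"
    using lim unfolding eventually_ae_filter by blast
  have Nm: "N \<in> sets lebesgue" using N(2) by auto
  have "(\<lambda>t. if t \<in> N then 0 else f t) \<in> borel_measurable lebesgue"
  proof (rule borel_measurable_LIMSEQ_metric)
    show "(\<lambda>t. if t \<in> N then 0 else s n t) \<in> borel_measurable lebesgue" for n
      using Nm by (intro measurable_If_set s) auto
    show "(\<lambda>n. if t \<in> N then 0 else s n t) \<longlonglongrightarrow> (if t \<in> N then 0 else f t)" for t
      using N(1) by auto
  qed
  moreover have "AE t in lebesgue. (if t \<in> N then 0 else f t) = f t"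
    using AE_not_in[OF N(2)] by eventually_elim simp
  ultimately show ?thesis by (rule borel_measurable_lebesgue_AE_eq)
qed

lemma strongly_measurableI:
  assumes "\<And>n. simple_function lebesgue (s n)" "AE t in lebesgue. (\<lambda>n. s n t) \<longlonglongrightarrow> f t"
  shows "strongly_measurable f"
  using assms unfolding strongly_measurable_def by blast

lemma strongly_measurable_simple: "simple_function lebesgue f \<Longrightarrow> strongly_measurable f"
  by (rule strongly_measurableI[of "\<lambda>_. f"]) auto

lemma strongly_measurable_imp_borel: "strongly_measurable f \<Longrightarrow> f \<in> borel_measurable lebesgue"
  unfolding strongly_measurable_def
  by (blast intro: borel_measurable_lebesgue_AE_limit borel_measurable_simple_function)

lemma borel_measurable_norm_strongly:
  "strongly_measurable f \<Longrightarrow> (\<lambda>t. norm (f t)) \<in> borel_measurable lebesgue"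
  using strongly_measurable_imp_borel by measurable

lemma strongly_measurable_AE_eq:
  assumes "strongly_measurable f" "AE t in lebesgue. f t = g t"
  shows "strongly_measurable g"
proof -
  obtain s where s: "\<And>n. simple_function lebesgue (s n)" "AE t in lebesgue. (\<lambda>n. s n t) \<longlonglongrightarrow> f t"
    using assms(1) unfolding strongly_measurable_def by blast
  from s(2) assms(2) have "AE t in lebesgue. (\<lambda>n. s n t) \<longlonglongrightarrow> g t"
    by eventually_elim simp
  with s(1) show ?thesis by (rule strongly_measurableI)
qed

lemma strongly_measurable_compose2:
  assumes "strongly_measurable f" "strongly_measurable g"
    and h: "\<And>a b. isCont (\<lambda>p. h (fst p) (snd p)) (a, b)"
  shows "strongly_measurable (\<lambda>t. h (f t) (g t))"
proof -
  obtain r s where r: "\<And>n. simple_function lebesgue (r n)" "AE t in lebesgue. (\<lambda>n. r n t) \<longlonglongrightarrow> f t"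
    and s: "\<And>n. simple_function lebesgue (s n)" "AE t in lebesgue. (\<lambda>n. s n t) \<longlonglongrightarrow> g t"
    using assms(1,2) unfolding strongly_measurable_def by blast
  have "simple_function lebesgue (\<lambda>t. h (r n t) (s n t))" for n
    by (rule simple_function_compose2[OF r(1) s(1)])
  moreover from r(2) s(2) have "AE t in lebesgue. (\<lambda>n. h (r n t) (s n t)) \<longlonglongrightarrow> h (f t) (g t)"
  proof eventually_elim
    case (elim t)
    from isCont_tendsto_compose[OF h tendsto_Pair[OF elim]] show ?case by simp
  qed
  ultimately show ?thesis by (rule strongly_measurableI)
qed

lemma strongly_measurable_add:
  "strongly_measurable f \<Longrightarrow> strongly_measurable g \<Longrightarrow> strongly_measurable (\<lambda>t. f t + g t)"
  by (rule strongly_measurable_compose2) (auto intro!: continuous_intros)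

lemma strongly_measurable_diff:
  "strongly_measurable f \<Longrightarrow> strongly_measurable g \<Longrightarrow> strongly_measurable (\<lambda>t. f t - g t)"
  by (rule strongly_measurable_compose2) (auto intro!: continuous_intros)

lemma strongly_measurable_cinner:
  assumes "strongly_measurable f" "strongly_measurable g"
  shows "strongly_measurable (\<lambda>t. cinner (f t) (g t))"
  by (rule strongly_measurable_compose2[OF assms])
    (rule bounded_bilinear.isCont[OF bounded_bilinear_cinner]; auto intro!: continuous_intros)

lemma strongly_measurable_scaleC_fun:
  assumes "strongly_measurable f" "strongly_measurable g"
  shows "strongly_measurable (\<lambda>t. f t *\<^sub>C g t)"
  by (rule strongly_measurable_compose2[OF assms])
    (rule bounded_bilinear.isCont[OF bounded_bilinear_scaleC]; auto intro!: continuous_intros)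

lemma strongly_measurable_complex:
  assumes "f \<in> borel_measurable lebesgue" shows "strongly_measurable (f :: real \<Rightarrow> complex)"
  using borel_measurable_implies_sequence_metric[OF assms, of 0] unfolding strongly_measurable_def
  by auto

lemma strongly_measurable_const: "strongly_measurable (\<lambda>_. c)"
  by (rule strongly_measurable_simple) simp

lemma simple_approx_identity:
  obtains q :: "nat \<Rightarrow> real \<Rightarrow> real"
  where "\<And>n. simple_function lebesgue (q n)" "\<And>t. (\<lambda>n. q n t) \<longlonglongrightarrow> t"
proof -
  have "(\<lambda>t::real. t) \<in> borel_measurable lebesgue"
    by (rule measurable_completion) simp
  from borel_measurable_implies_sequence_metric[OF this, of 0] show ?thesis
    using that by auto
qed

text \<open>A family of operators that is strongly continuous and uniformly bounded acts on strongly
  measurable functions.\<close>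

lemma strongly_measurable_operator_family:
  fixes S :: "real \<Rightarrow> 'h::complex_hilbert \<Rightarrow> 'k::complex_hilbert"
  assumes f: "strongly_measurable f"
    and cont: "\<And>\<xi> x. isCont (\<lambda>\<xi>. S \<xi> x) \<xi>"
    and lin: "\<And>\<xi> x y. S \<xi> (x - y) = S \<xi> x - S \<xi> y" and bound: "\<And>\<xi> x. norm (S \<xi> x) \<le> C * norm x"
  shows "strongly_measurable (\<lambda>\<xi>. S \<xi> (f \<xi>))"
proof -
  obtain s where s: "\<And>n. simple_function lebesgue (s n)" "AE t in lebesgue. (\<lambda>n. s n t) \<longlonglongrightarrow> f t"
    using f unfolding strongly_measurable_def by blast
  obtain q :: "nat \<Rightarrow> real \<Rightarrow> real" where q: "\<And>n. simple_function lebesgue (q n)" "\<And>t. (\<lambda>n. q n t) \<longlonglongrightarrow> t"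
    using simple_approx_identity by blast
  have "simple_function lebesgue (\<lambda>t. S (q n t) (s n t))" for n
    by (rule simple_function_compose2[OF q(1) s(1)])
  moreover from s(2) have "AE t in lebesgue. (\<lambda>n. S (q n t) (s n t)) \<longlonglongrightarrow> S t (f t)"
  proof eventually_elim
    case (elim t)
    have "(\<lambda>n. S (q n t) (s n t - f t)) \<longlonglongrightarrow> 0"
    proof (rule Lim_null_comparison)
      show "\<forall>\<^sub>F n in sequentially. norm (S (q n t) (s n t - f t)) \<le> C * norm (s n t - f t)"
        by (intro always_eventually allI bound)
      have "(\<lambda>n. C * norm (s n t - f t)) \<longlonglongrightarrow> C * norm (f t - f t)"
        by (intro tendsto_intros elim)
      then show "(\<lambda>n. C * norm (s n t - f t)) \<longlonglongrightarrow> 0" by simp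
    qed
    moreover have "(\<lambda>n. S (q n t) (f t)) \<longlonglongrightarrow> S t (f t)"
      by (rule isCont_tendsto_compose[OF cont q(2)])
    ultimately have "(\<lambda>n. S (q n t) (s n t - f t) + S (q n t) (f t)) \<longlonglongrightarrow> 0 + S t (f t)"
      by (rule tendsto_add)
    then show ?case by (simp add: lin)
  qed
  ultimately show ?thesis by (rule strongly_measurableI)
qed

lemma strongly_measurable_continuous:
  assumes "continuous_on UNIV f" shows "strongly_measurable f"
proof -
  obtain q :: "nat \<Rightarrow> real \<Rightarrow> real" where q: "\<And>n. simple_function lebesgue (q n)" "\<And>t. (\<lambda>n. q n t) \<longlonglongrightarrow> t"
    using simple_approx_identity by blast
  have "isCont f t" for t
    using assms by (simp add: continuous_on_eq_continuous_at)
  then have "(\<lambda>n. f (q n t)) \<longlonglongrightarrow> f t" for t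
    by (rule isCont_tendsto_compose[OF _ q(2)])
  then show ?thesis
    by (intro strongly_measurableI[of "\<lambda>n t. f (q n t)"] AE_I2) (rule simple_function_compose1[OF q(1)])
qed

lemma strongly_measurable_bounded_clinear:
  assumes T: "bounded_clinear T" and f: "strongly_measurable f"
  shows "strongly_measurable (\<lambda>t. T (f t))"
  by (rule strongly_measurable_operator_family[OF f, of "\<lambda>_. T" "onorm T"])
    (auto simp: bounded_clinear_linear[OF T] bounded_clinear_norm_le[OF T])

text \<open>For the closure under limits almost everywhere, choose for each member \<open>f\<^sub>k\<close> of the sequence a
  simple function that is \<open>1/(k+1)\<close>-close to \<open>f\<^sub>k\<close> on \<open>[-k, k]\<close> outside a set of measure \<open>2\<^sup>-\<^sup>k\<close>, and
  apply the Borel--Cantelli lemma.\<close>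

lemma strongly_measurable_AE_limit:
  fixes f :: "nat \<Rightarrow> real \<Rightarrow> 'h::complex_hilbert"
  assumes f: "\<And>k. strongly_measurable (f k)" and lim: "AE t in lebesgue. (\<lambda>k. f k t) \<longlonglongrightarrow> g t"
  shows "strongly_measurable g"
proof -
  define P where "P k s \<longleftrightarrow> simple_function lebesgue s \<and>
      measure lebesgue {t \<in> {- real k..real k}. norm (s t - f k t) \<ge> 1 / real (Suc k)} < (1/2) ^ k" for k s
  have "\<exists>s. P k s" for k
  proof -
    obtain s where s: "\<And>n. simple_function lebesgue (s n)" "AE t in lebesgue. (\<lambda>n. s n t) \<longlonglongrightarrow> f k t"
      using f[of k] unfolding strongly_measurable_def by blast
    define E where "E n = {t \<in> {- real k..real k}. norm (s n t - f k t) \<ge> 1 / real (Suc k)}" for n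
    have sm: "(\<lambda>t. norm (s n t - f k t)) \<in> borel_measurable lebesgue" for n
      by (intro borel_measurable_norm_strongly strongly_measurable_diff strongly_measurable_simple s f)
    have E: "E n \<in> sets lebesgue" for n
    proof -
      have "{t \<in> space lebesgue. norm (s n t - f k t) \<ge> 1 / real (Suc k)} \<in> sets lebesgue"
        using sm by measurable
      moreover have "E n = {- real k..real k} \<inter> {t \<in> space lebesgue. norm (s n t - f k t) \<ge> 1 / real (Suc k)}"
        by (auto simp: E_def)
      ultimately show ?thesis by auto
    qed
    have "(\<lambda>n. LINT t|lebesgue. indicator (E n) t) \<longlonglongrightarrow> (LINT (t::real)|lebesgue. (0::real))"
    proof (rule integral_dominated_convergence)
      from s(2) show "AE t in lebesgue. (\<lambda>n. indicator (E n) t) \<longlonglongrightarrow> (0::real)"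
      proof eventually_elim
        case (elim t)
        have "(\<lambda>n. norm (s n t - f k t)) \<longlonglongrightarrow> norm (f k t - f k t)"
          by (intro tendsto_intros elim)
        then have "\<forall>\<^sub>F n in sequentially. norm (s n t - f k t) < 1 / real (Suc k)"
          by (intro order_tendstoD) auto
        then have "\<forall>\<^sub>F n in sequentially. indicator (E n) t = (0::real)"
          by eventually_elim (simp add: E_def)
        then show ?case by (rule tendsto_eventually)
      qed
      show "AE t in lebesgue. norm (indicator (E n) t :: real) \<le> indicator {- real k..real k} t" for n
        by (rule AE_I2) (auto simp: indicator_def E_def)
      show "integrable lebesgue (indicator {- real k..real k} :: real \<Rightarrow> real)"
        by (intro integrable_real_indicator) (auto simp: emeasure_lborel_Icc_eq)
    qed (use E in auto)
    then have "(\<lambda>n. measure lebesgue (E n)) \<longlonglongrightarrow> 0"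
      by simp
    then have "\<forall>\<^sub>F n in sequentially. measure lebesgue (E n) < (1/2) ^ k"
      by (rule order_tendstoD) simp
    then obtain n where "measure lebesgue (E n) < (1/2) ^ k"
      using eventually_happens' sequentially_bot by blast
    then have "P k (s n)" unfolding P_def E_def using s(1) by (intro conjI)
    then show ?thesis by (rule exI[of _ "s n"])
  qed
  then have "\<forall>k. \<exists>s. P k s" ..
  from choice[OF this] obtain s where "\<forall>k. P k (s k)" ..
  then have s: "simple_function lebesgue (s k) \<and>
      measure lebesgue {t \<in> {- real k..real k}. norm (s k t - f k t) \<ge> 1 / real (Suc k)} < (1/2) ^ k" for k
    by (simp add: P_def)
  define E where "E k = {t \<in> {- real k..real k}. norm (s k t - f k t) \<ge> 1 / real (Suc k)}" for k
  have E: "E k \<in> sets lebesgue" for k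
  proof -
    have "(\<lambda>t. norm (s k t - f k t)) \<in> borel_measurable lebesgue"
      by (intro borel_measurable_norm_strongly strongly_measurable_diff strongly_measurable_simple s[THEN conjunct1] f)
    then have "{t \<in> space lebesgue. norm (s k t - f k t) \<ge> 1 / real (Suc k)} \<in> sets lebesgue"
      by measurable
    moreover have "E k = {- real k..real k} \<inter> {t \<in> space lebesgue. norm (s k t - f k t) \<ge> 1 / real (Suc k)}"
      by (auto simp: E_def)
    ultimately show ?thesis by auto
  qed
  have "AE t in lebesgue. \<forall>\<^sub>F k in sequentially. t \<in> space lebesgue - E k"
  proof (rule borel_cantelli_AE1[OF E])
    fix k
    have "emeasure lebesgue (E k) \<le> emeasure lebesgue {- real k..real k}"
      by (rule emeasure_mono) (auto simp: E_def)
    also have "\<dots> < \<infinity>" by (auto simp: emeasure_lborel_Icc_eq)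
    finally show "emeasure lebesgue (E k) < \<infinity>" .
  next
    have sum: "summable (\<lambda>k. (1/2::real) ^ k)" by (rule summable_geometric) simp
    have "measure lebesgue (E k) \<le> (1/2) ^ k" for k
      unfolding E_def by (rule less_imp_le[OF s[THEN conjunct2]])
    then have "norm (measure lebesgue (E k)) \<le> (1/2) ^ k" for k
      by (simp only: real_norm_def abs_of_nonneg[OF measure_nonneg])
    then show "summable (\<lambda>k. measure lebesgue (E k))"
      by (rule summable_comparison_test'[OF sum])
  qed
  with lim have "AE t in lebesgue. (\<lambda>k. s k t) \<longlonglongrightarrow> g t"
  proof eventually_elim
    case (elim t)
    have "\<forall>\<^sub>F k in sequentially. norm (s k t - f k t) \<le> 1 / real (Suc k)"
      using elim(2) eventually_ge_at_top[of "nat \<lceil>\<bar>t\<bar>\<rceil>"]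
    proof eventually_elim
      case (elim k)
      then have "t \<in> {- real k..real k}" by (auto simp: nat_le_iff ceiling_le_iff)
      then show ?case using elim(1) by (auto simp: E_def)
    qed
    moreover have "(\<lambda>k. 1 / real (Suc k)) \<longlonglongrightarrow> 0"
      using LIMSEQ_inverse_real_of_nat by (simp add: inverse_eq_divide)
    ultimately have "(\<lambda>k. s k t - f k t) \<longlonglongrightarrow> 0"
      by (rule Lim_null_comparison)
    from tendsto_add[OF this elim(1)] show ?case by simp
  qed
  then show ?thesis by (rule strongly_measurableI[OF s[THEN conjunct1]])
qed


subsection \<open>The Hilbert space structure\<close>

text \<open>Multiplication by \<open>exp (- \<nu> t)\<close> reduces the weighted spaces to the unweighted one.\<close>

definition unweight :: "real \<Rightarrow> (real \<Rightarrow> 'h::complex_hilbert) \<Rightarrow> real \<Rightarrow> 'h" where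
  "unweight \<nu> f t = complex_of_real (exp (- \<nu> * t)) *\<^sub>C f t"

lemma unweight_inverse [simp]: "unweight (- \<nu>) (unweight \<nu> f) = f" "unweight \<nu> (unweight (- \<nu>) f) = f"
  by (auto simp: fun_eq_iff unweight_def scaleC_scaleC simp flip: exp_add of_real_mult)

lemma unweight_linear:
  "unweight \<nu> (\<lambda>t. f t + g t) = (\<lambda>t. unweight \<nu> f t + unweight \<nu> g t)"
  "unweight \<nu> (\<lambda>t. f t - g t) = (\<lambda>t. unweight \<nu> f t - unweight \<nu> g t)"
  "unweight \<nu> (\<lambda>t. c *\<^sub>C f t) = (\<lambda>t. c *\<^sub>C unweight \<nu> f t)"
  by (auto simp: fun_eq_iff unweight_def scaleC_add_right scaleC_diff_right scaleC_scaleC mult.commute)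

lemma strongly_measurable_unweight: "strongly_measurable f \<Longrightarrow> strongly_measurable (unweight \<nu> f)"
  unfolding unweight_def
  by (rule strongly_measurable_scaleC_fun[OF strongly_measurable_continuous]) (intro continuous_intros)

lemma strongly_measurable_unweight_iff: "strongly_measurable (unweight \<nu> f) \<longleftrightarrow> strongly_measurable f"
  using strongly_measurable_unweight[of f \<nu>] strongly_measurable_unweight[of "unweight \<nu> f" "- \<nu>"] by auto

lemma exp_weight: "exp (- 2 * \<nu> * t) = (exp (- \<nu> * t))\<^sup>2" for \<nu> t :: real
  by (simp add: power2_eq_square flip: exp_add)

lemma norm_unweight: "(norm (unweight \<nu> f t))\<^sup>2 = (norm (f t))\<^sup>2 * exp (- 2 * \<nu> * t)"
  unfolding exp_weight unweight_def by (simp add: power_mult_distrib mult.commute)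

lemma L2_0: "f \<in> L2 0 \<longleftrightarrow> strongly_measurable f \<and> integrable lebesgue (\<lambda>t. (norm (f t))\<^sup>2)"
  by (simp add: L2_def)

lemma L2_norm_0: "L2_norm 0 f = sqrt (LINT t|lebesgue. (norm (f t))\<^sup>2)"
  by (simp add: L2_norm_def)

lemma L2_inner_0: "L2_inner 0 f g = (LINT t|lebesgue. cinner (f t) (g t))"
  by (simp add: L2_inner_def)

lemma L2_iff_unweight: "f \<in> L2 \<nu> \<longleftrightarrow> unweight \<nu> f \<in> L2 0"
  unfolding L2_0 by (simp add: L2_def strongly_measurable_unweight_iff norm_unweight)

lemma L2_norm_unweight: "L2_norm \<nu> f = L2_norm 0 (unweight \<nu> f)"
  unfolding L2_norm_0 by (simp add: L2_norm_def norm_unweight)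

lemma L2_inner_unweight: "L2_inner \<nu> f g = L2_inner 0 (unweight \<nu> f) (unweight \<nu> g)"
proof -
  have "cinner (unweight \<nu> f t) (unweight \<nu> g t) = cinner (f t) (g t) * complex_of_real (exp (- 2 * \<nu> * t))"
    for t
    unfolding unweight_def cinner_scaleC_left cinner_scaleC_right exp_weight
    by (simp add: power2_eq_square mult.commute mult.left_commute)
  then show ?thesis
    unfolding L2_inner_0 by (simp add: L2_inner_def)
qed

lemma L2_norm_nonneg: "L2_norm \<nu> f \<ge> 0"
  by (simp add: L2_norm_def)

lemma L2_0_power2: "(L2_norm 0 f)\<^sup>2 = (LINT t|lebesgue. (norm (f t))\<^sup>2)"
  unfolding L2_norm_0 by (rule real_sqrt_pow2) (rule integral_nonneg_AE; simp)

lemma L2_0_dominated: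
  assumes f: "strongly_measurable f" and g: "g \<in> L2 0" and le: "AE t in lebesgue. norm (f t) \<le> C * norm (g t)"
  shows "f \<in> L2 0"
  unfolding L2_0
proof
  show "integrable lebesgue (\<lambda>t. (norm (f t))\<^sup>2)"
  proof (rule Bochner_Integration.integrable_bound)
    show "integrable lebesgue (\<lambda>t. C\<^sup>2 * (norm (g t))\<^sup>2)"
      using g by (simp add: L2_0)
    show "(\<lambda>t. (norm (f t))\<^sup>2) \<in> borel_measurable lebesgue"
      using borel_measurable_norm_strongly[OF f] by measurable
    from le show "AE t in lebesgue. norm ((norm (f t))\<^sup>2) \<le> norm (C\<^sup>2 * (norm (g t))\<^sup>2)"
    proof eventually_elim
      case (elim t)
      then have "(norm (f t))\<^sup>2 \<le> (C * norm (g t))\<^sup>2"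
        by (intro power_mono) auto
      then show ?case by (simp add: power_mult_distrib)
    qed
  qed
qed (rule f)

lemma L2_0_norm_mono:
  assumes g: "g \<in> L2 0" and f: "strongly_measurable f" and le: "AE t in lebesgue. norm (f t) \<le> C * norm (g t)"
    and C: "C \<ge> 0"
  shows "L2_norm 0 f \<le> C * L2_norm 0 g"
proof -
  have "(L2_norm 0 f)\<^sup>2 \<le> (LINT t|lebesgue. C\<^sup>2 * (norm (g t))\<^sup>2)"
    unfolding L2_0_power2
  proof (rule integral_mono_AE)
    show "integrable lebesgue (\<lambda>t. (norm (f t))\<^sup>2)"
      using L2_0_dominated[OF f g le] by (simp add: L2_0)
    show "integrable lebesgue (\<lambda>t. C\<^sup>2 * (norm (g t))\<^sup>2)"
      using g by (simp add: L2_0)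
    from le show "AE t in lebesgue. (norm (f t))\<^sup>2 \<le> C\<^sup>2 * (norm (g t))\<^sup>2"
    proof eventually_elim
      case (elim t)
      then have "(norm (f t))\<^sup>2 \<le> (C * norm (g t))\<^sup>2"
        by (intro power_mono) auto
      then show ?case by (simp add: power_mult_distrib)
    qed
  qed
  also have "\<dots> = (C * L2_norm 0 g)\<^sup>2"
    by (simp add: power_mult_distrib L2_0_power2)
  finally show ?thesis
    by (rule power2_le_imp_le) (intro mult_nonneg_nonneg C L2_norm_nonneg)
qed

lemma L2_0_scaleC: assumes "f \<in> L2 0" shows "(\<lambda>t. c *\<^sub>C f t) \<in> L2 0"
  by (rule L2_0_dominated[OF _ assms, where C = "cmod c"])
    (use assms in \<open>auto intro!: strongly_measurable_scaleC_fun strongly_measurable_const simp: L2_0\<close>)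

lemma L2_0_add: assumes "f \<in> L2 0" "g \<in> L2 0" shows "(\<lambda>t. f t + g t) \<in> L2 0"
  unfolding L2_0
proof
  show sm: "strongly_measurable (\<lambda>t. f t + g t)"
    using assms by (intro strongly_measurable_add) (auto simp: L2_0)
  show "integrable lebesgue (\<lambda>t. (norm (f t + g t))\<^sup>2)"
  proof (rule Bochner_Integration.integrable_bound)
    show "integrable lebesgue (\<lambda>t. 2 * (norm (f t))\<^sup>2 + 2 * (norm (g t))\<^sup>2)"
      using assms by (simp add: L2_0)
    show "(\<lambda>t. (norm (f t + g t))\<^sup>2) \<in> borel_measurable lebesgue"
      using borel_measurable_norm_strongly[OF sm] by measurable
    show "AE t in lebesgue. norm ((norm (f t + g t))\<^sup>2) \<le> norm (2 * (norm (f t))\<^sup>2 + 2 * (norm (g t))\<^sup>2)"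
    proof (rule AE_I2)
      fix t
      have "(norm (f t + g t))\<^sup>2 + (norm (f t - g t))\<^sup>2 = 2 * (norm (f t))\<^sup>2 + 2 * (norm (g t))\<^sup>2"
        unfolding norm_add_square norm_diff_square by simp
      then have "(norm (f t + g t))\<^sup>2 \<le> 2 * (norm (f t))\<^sup>2 + 2 * (norm (g t))\<^sup>2"
        using zero_le_power2[of "norm (f t - g t)"] by linarith
      then show "norm ((norm (f t + g t))\<^sup>2) \<le> norm (2 * (norm (f t))\<^sup>2 + 2 * (norm (g t))\<^sup>2)"
        by simp
    qed
  qed
qed

lemma L2_0_diff: assumes "f \<in> L2 0" "g \<in> L2 0" shows "(\<lambda>t. f t - g t) \<in> L2 0"
  using L2_0_add[OF assms(1) L2_0_scaleC[OF assms(2), of "-1"]] by (simp add: scaleC_minus_one)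

lemma L2_0_integrable_cinner:
  assumes "f \<in> L2 0" "g \<in> L2 0" shows "integrable lebesgue (\<lambda>t. cinner (f t) (g t))"
proof (rule Bochner_Integration.integrable_bound)
  show "integrable lebesgue (\<lambda>t. (norm (f t))\<^sup>2 + (norm (g t))\<^sup>2)"
    using assms by (simp add: L2_0)
  show "(\<lambda>t. cinner (f t) (g t)) \<in> borel_measurable lebesgue"
    using assms by (intro strongly_measurable_imp_borel strongly_measurable_cinner) (auto simp: L2_0)
  show "AE t in lebesgue. norm (cinner (f t) (g t)) \<le> norm ((norm (f t))\<^sup>2 + (norm (g t))\<^sup>2)"
  proof (rule AE_I2)
    fix t
    have "norm (cinner (f t) (g t)) \<le> norm (f t) * norm (g t)" by (rule Cauchy_Schwarz)
    also have "\<dots> \<le> (norm (f t))\<^sup>2 + (norm (g t))\<^sup>2"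
      using sum_squares_bound[of "norm (f t)" "norm (g t)"] mult_nonneg_nonneg[OF norm_ge_zero[of "f t"] norm_ge_zero[of "g t"]]
      by linarith
    finally show "norm (cinner (f t) (g t)) \<le> norm ((norm (f t))\<^sup>2 + (norm (g t))\<^sup>2)" by simp
  qed
qed

lemma L2_0_inner_diff_right:
  "f \<in> L2 0 \<Longrightarrow> g \<in> L2 0 \<Longrightarrow> h \<in> L2 0 \<Longrightarrow> L2_inner 0 f (\<lambda>t. g t - h t) = L2_inner 0 f g - L2_inner 0 f h"
  unfolding L2_inner_0 cinner_diff_right by (intro Bochner_Integration.integral_diff L2_0_integrable_cinner)

lemma L2_0_inner_diff_left:
  "f \<in> L2 0 \<Longrightarrow> g \<in> L2 0 \<Longrightarrow> h \<in> L2 0 \<Longrightarrow> L2_inner 0 (\<lambda>t. f t - g t) h = L2_inner 0 f h - L2_inner 0 g h"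
  unfolding L2_inner_0 cinner_diff_left by (intro Bochner_Integration.integral_diff L2_0_integrable_cinner)

lemma L2_0_inner_scaleC_right: "L2_inner 0 f (\<lambda>t. c *\<^sub>C g t) = c * L2_inner 0 f g"
  unfolding L2_inner_0 cinner_scaleC_right by simp

lemma L2_0_inner_commute: "L2_inner 0 f g = cnj (L2_inner 0 g f)"
  unfolding L2_inner_0 by (subst cinner_commute) (simp add: Bochner_Integration.integral_cnj)

lemma L2_0_inner_self: "L2_inner 0 f f = of_real ((L2_norm 0 f)\<^sup>2)"
  unfolding L2_inner_0 L2_0_power2 cinner_self by (simp flip: of_real_power)

lemma L2_0_norm_add_square:
  assumes "f \<in> L2 0" "g \<in> L2 0"
  shows "(L2_norm 0 (\<lambda>t. f t + g t))\<^sup>2 = (L2_norm 0 f)\<^sup>2 + 2 * Re (L2_inner 0 f g) + (L2_norm 0 g)\<^sup>2"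
proof -
  have int: "integrable lebesgue (\<lambda>t. (norm (f t))\<^sup>2)" "integrable lebesgue (\<lambda>t. (norm (g t))\<^sup>2)"
    "integrable lebesgue (\<lambda>t. Re (cinner (f t) (g t)))"
    using assms L2_0_integrable_cinner[OF assms] by (auto simp: L2_0)
  have "(LINT t|lebesgue. 2 * Re (cinner (f t) (g t))) = 2 * Re (L2_inner 0 f g)"
    using L2_0_integrable_cinner[OF assms] by (simp add: L2_inner_0)
  then show ?thesis
    unfolding L2_0_power2 norm_add_square using int by simp
qed

lemma L2_0_norm_scaleC: "L2_norm 0 (\<lambda>t. c *\<^sub>C f t) = cmod c * L2_norm 0 f"
  unfolding L2_norm_0 by (simp add: power_mult_distrib real_sqrt_mult)

lemma L2_0_norm_eq_0:
  assumes "f \<in> L2 0" shows "L2_norm 0 f = 0 \<longleftrightarrow> (AE t in lebesgue. f t = 0)"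
proof -
  have "L2_norm 0 f = 0 \<longleftrightarrow> (LINT t|lebesgue. (norm (f t))\<^sup>2) = 0"
    by (simp add: L2_norm_0)
  also have "\<dots> \<longleftrightarrow> (AE t in lebesgue. (norm (f t))\<^sup>2 = 0)"
    using assms by (intro integral_nonneg_eq_0_iff_AE) (auto simp: L2_0)
  finally show ?thesis by simp
qed

lemma L2_0_Cauchy_Schwarz:
  assumes "f \<in> L2 0" "g \<in> L2 0" shows "cmod (L2_inner 0 f g) \<le> L2_norm 0 f * L2_norm 0 g"
proof (cases "L2_norm 0 g = 0")
  case True
  then have "AE t in lebesgue. g t = 0" using L2_0_norm_eq_0[OF assms(2)] by simp
  then have "AE t in lebesgue. cinner (f t) (g t) = 0" by eventually_elim simp
  then have "L2_inner 0 f g = 0"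
    unfolding L2_inner_0 by (rule integral_eq_zero_AE)
  with True show ?thesis by simp
next
  case False
  define a where "a = - L2_inner 0 g f / of_real ((L2_norm 0 g)\<^sup>2)"
  have "0 \<le> (L2_norm 0 (\<lambda>t. f t + a *\<^sub>C g t))\<^sup>2" by simp
  also have "\<dots> = (L2_norm 0 f)\<^sup>2 + 2 * Re (a * L2_inner 0 f g) + (cmod a * L2_norm 0 g)\<^sup>2"
    using assms by (simp add: L2_0_norm_add_square L2_0_scaleC L2_0_inner_scaleC_right L2_0_norm_scaleC)
  also have "a * L2_inner 0 f g = - of_real ((cmod (L2_inner 0 f g))\<^sup>2 / (L2_norm 0 g)\<^sup>2)"
    using complex_norm_square[of "L2_inner 0 f g"]
    by (simp add: a_def L2_0_inner_commute[of g f] mult.commute)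
  also have "cmod a = cmod (L2_inner 0 f g) / (L2_norm 0 g)\<^sup>2"
    by (simp add: a_def norm_divide norm_power L2_0_inner_commute[of g f])
  finally have "0 \<le> (L2_norm 0 f)\<^sup>2 - 2 * ((cmod (L2_inner 0 f g))\<^sup>2 / (L2_norm 0 g)\<^sup>2)
      + (cmod (L2_inner 0 f g) / (L2_norm 0 g)\<^sup>2 * L2_norm 0 g)\<^sup>2"
    by (simp only: uminus_complex.sel Re_complex_of_real)
  also have "(cmod (L2_inner 0 f g) / (L2_norm 0 g)\<^sup>2 * L2_norm 0 g)\<^sup>2
      = (cmod (L2_inner 0 f g))\<^sup>2 / (L2_norm 0 g)\<^sup>2"
    using False by (simp add: power2_eq_square)
  finally have "(cmod (L2_inner 0 f g))\<^sup>2 / (L2_norm 0 g)\<^sup>2 \<le> (L2_norm 0 f)\<^sup>2" by simp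
  then have "(cmod (L2_inner 0 f g))\<^sup>2 \<le> (L2_norm 0 f * L2_norm 0 g)\<^sup>2"
    using False by (simp add: power_mult_distrib pos_divide_le_eq)
  then show ?thesis
    by (rule power2_le_imp_le) (simp add: L2_norm_nonneg)
qed

lemma L2_0_triangle:
  assumes "f \<in> L2 0" "g \<in> L2 0"
  shows "L2_norm 0 (\<lambda>t. f t + g t) \<le> L2_norm 0 f + L2_norm 0 g"
proof (rule power2_le_imp_le)
  have "Re (L2_inner 0 f g) \<le> L2_norm 0 f * L2_norm 0 g"
    using L2_0_Cauchy_Schwarz[OF assms] complex_Re_le_cmod order_trans by blast
  then show "(L2_norm 0 (\<lambda>t. f t + g t))\<^sup>2 \<le> (L2_norm 0 f + L2_norm 0 g)\<^sup>2"
    unfolding L2_0_norm_add_square[OF assms] power2_sum by simp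
qed (simp add: L2_norm_nonneg)

lemma L2_add: "f \<in> L2 \<nu> \<Longrightarrow> g \<in> L2 \<nu> \<Longrightarrow> (\<lambda>t. f t + g t) \<in> L2 \<nu>"
  and L2_diff: "f \<in> L2 \<nu> \<Longrightarrow> g \<in> L2 \<nu> \<Longrightarrow> (\<lambda>t. f t - g t) \<in> L2 \<nu>"
  and L2_scaleC: "f \<in> L2 \<nu> \<Longrightarrow> (\<lambda>t. c *\<^sub>C f t) \<in> L2 \<nu>"
  unfolding L2_iff_unweight[of _ \<nu>] unweight_linear by (simp_all add: L2_0_add L2_0_diff L2_0_scaleC)

lemma L2_triangle: "f \<in> L2 \<nu> \<Longrightarrow> g \<in> L2 \<nu> \<Longrightarrow> L2_norm \<nu> (\<lambda>t. f t + g t) \<le> L2_norm \<nu> f + L2_norm \<nu> g"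
  unfolding L2_iff_unweight[of _ \<nu>] L2_norm_unweight[of \<nu>] unweight_linear by (rule L2_0_triangle)

lemma L2_norm_minus_commute: "L2_norm \<nu> (\<lambda>t. f t - g t) = L2_norm \<nu> (\<lambda>t. g t - f t)"
  by (simp add: L2_norm_def norm_minus_commute)

lemma L2_triangle_diff:
  assumes "f \<in> L2 \<nu>" "g \<in> L2 \<nu>" "h \<in> L2 \<nu>"
  shows "L2_norm \<nu> (\<lambda>t. f t - h t) \<le> L2_norm \<nu> (\<lambda>t. f t - g t) + L2_norm \<nu> (\<lambda>t. g t - h t)"
  using L2_triangle[OF L2_diff[OF assms(1,2)] L2_diff[OF assms(2,3)]] by simp

lemma L2_norm_diff_le:
  assumes "f \<in> L2 \<nu>" "g \<in> L2 \<nu>"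
  shows "L2_norm \<nu> f \<le> L2_norm \<nu> g + L2_norm \<nu> (\<lambda>t. f t - g t)"
  using L2_triangle[OF assms(2) L2_diff[OF assms]] by simp

lemma L2_norm_eq_0: "f \<in> L2 \<nu> \<Longrightarrow> L2_norm \<nu> f = 0 \<longleftrightarrow> (AE t in lebesgue. f t = 0)"
  unfolding L2_iff_unweight[of _ \<nu>] L2_norm_unweight[of \<nu>]
  by (subst L2_0_norm_eq_0) (auto simp: unweight_def simp flip: norm_eq_zero[of "_ *\<^sub>C _"])

lemma L2_AE_eq:
  assumes "f \<in> L2 \<nu>" "AE t in lebesgue. f t = g t" shows "g \<in> L2 \<nu>"
proof -
  have sm: "strongly_measurable g"
    using assms by (auto simp: L2_def intro: strongly_measurable_AE_eq)
  have "AE t in lebesgue. (norm (f t))\<^sup>2 * exp (- 2 * \<nu> * t) = (norm (g t))\<^sup>2 * exp (- 2 * \<nu> * t)"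
    using assms(2) by eventually_elim simp
  moreover have "(\<lambda>t. exp (- 2 * \<nu> * t)) \<in> borel_measurable lebesgue"
    by (rule measurable_completion) simp
  then have "(\<lambda>t. (norm (g t))\<^sup>2 * exp (- 2 * \<nu> * t)) \<in> borel_measurable lebesgue"
    using borel_measurable_norm_strongly[OF sm] by (intro borel_measurable_times borel_measurable_power)
  ultimately show ?thesis
    using assms(1) sm by (auto simp: L2_def intro: integrable_cong_AE_imp)
qed

lemma zero_L2: "(\<lambda>_. 0) \<in> L2 \<nu>"
  by (simp add: L2_def strongly_measurable_const)

lemma L2_Cauchy_Schwarz: "f \<in> L2 \<nu> \<Longrightarrow> g \<in> L2 \<nu> \<Longrightarrow> cmod (L2_inner \<nu> f g) \<le> L2_norm \<nu> f * L2_norm \<nu> g"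
  unfolding L2_iff_unweight[of _ \<nu>] L2_norm_unweight[of \<nu>] L2_inner_unweight[of \<nu>]
  by (rule L2_0_Cauchy_Schwarz)

lemma L2_inner_diff_right:
  "f \<in> L2 \<nu> \<Longrightarrow> g \<in> L2 \<nu> \<Longrightarrow> h \<in> L2 \<nu> \<Longrightarrow> L2_inner \<nu> f (\<lambda>t. g t - h t) = L2_inner \<nu> f g - L2_inner \<nu> f h"
  unfolding L2_iff_unweight[of _ \<nu>] L2_inner_unweight[of \<nu>] unweight_linear by (rule L2_0_inner_diff_right)


subsection \<open>Completeness\<close>

lemma L2_0_nn_integral:
  assumes "f \<in> L2 0" shows "(\<integral>\<^sup>+t. ennreal ((norm (f t))\<^sup>2) \<partial>lebesgue) = ennreal ((L2_norm 0 f)\<^sup>2)"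
  unfolding L2_0_power2 using assms by (intro nn_integral_eq_integral) (auto simp: L2_0)

lemma L2_0_Fatou:
  assumes lim: "AE t in lebesgue. (\<lambda>k. f k t) \<longlonglongrightarrow> h t"
    and f: "\<And>k. f k \<in> L2 0" and le: "\<And>k. L2_norm 0 (f k) \<le> B"
  shows "h \<in> L2 0" "L2_norm 0 h \<le> B"
proof -
  have sm: "strongly_measurable h"
    by (rule strongly_measurable_AE_limit[OF _ lim]) (use f in \<open>simp add: L2_0\<close>)
  have B: "B \<ge> 0" using le[of 0] L2_norm_nonneg[of 0 "f 0"] by linarith
  have "(\<integral>\<^sup>+t. ennreal ((norm (h t))\<^sup>2) \<partial>lebesgue)
      = (\<integral>\<^sup>+t. liminf (\<lambda>k. ennreal ((norm (f k t))\<^sup>2)) \<partial>lebesgue)"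
  proof (rule nn_integral_cong_AE)
    from lim show "AE t in lebesgue. ennreal ((norm (h t))\<^sup>2) = liminf (\<lambda>k. ennreal ((norm (f k t))\<^sup>2))"
    proof eventually_elim
      case (elim t)
      have "(\<lambda>k. ennreal ((norm (f k t))\<^sup>2)) \<longlonglongrightarrow> ennreal ((norm (h t))\<^sup>2)"
        by (intro tendsto_ennrealI tendsto_power tendsto_norm elim)
      then show ?case by (rule lim_imp_Liminf[OF trivial_limit_sequentially, symmetric])
    qed
  qed
  also have "\<dots> \<le> liminf (\<lambda>k. \<integral>\<^sup>+t. ennreal ((norm (f k t))\<^sup>2) \<partial>lebesgue)"
  proof (rule nn_integral_liminf)
    fix k
    have "(\<lambda>t. norm (f k t)) \<in> borel_measurable lebesgue"
      using f[of k] by (intro borel_measurable_norm_strongly) (simp add: L2_0)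
    then show "(\<lambda>t. ennreal ((norm (f k t))\<^sup>2)) \<in> borel_measurable lebesgue" by measurable
  qed
  also have "\<dots> \<le> limsup (\<lambda>k. \<integral>\<^sup>+t. ennreal ((norm (f k t))\<^sup>2) \<partial>lebesgue)"
    by (rule Liminf_le_Limsup) simp
  also have "\<dots> \<le> ennreal (B\<^sup>2)"
  proof (rule Limsup_bounded, rule always_eventually, rule allI)
    fix k
    have "(L2_norm 0 (f k))\<^sup>2 \<le> B\<^sup>2"
      by (intro power_mono le L2_norm_nonneg)
    then show "(\<integral>\<^sup>+t. ennreal ((norm (f k t))\<^sup>2) \<partial>lebesgue) \<le> ennreal (B\<^sup>2)"
      unfolding L2_0_nn_integral[OF f] by (rule ennreal_leI)
  qed
  finally have nn: "(\<integral>\<^sup>+t. ennreal ((norm (h t))\<^sup>2) \<partial>lebesgue) \<le> ennreal (B\<^sup>2)" .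
  have int: "integrable lebesgue (\<lambda>t. (norm (h t))\<^sup>2)"
  proof (rule integrableI_bounded)
    show "(\<lambda>t. (norm (h t))\<^sup>2) \<in> borel_measurable lebesgue"
      using borel_measurable_norm_strongly[OF sm] by measurable
    have "(\<integral>\<^sup>+t. ennreal (norm ((norm (h t))\<^sup>2)) \<partial>lebesgue) \<le> ennreal (B\<^sup>2)"
      using nn by simp
    also have "\<dots> < \<infinity>" by simp
    finally show "(\<integral>\<^sup>+t. ennreal (norm ((norm (h t))\<^sup>2)) \<partial>lebesgue) < \<infinity>" .
  qed
  with sm show h: "h \<in> L2 0" by (simp add: L2_0)
  have "ennreal ((L2_norm 0 h)\<^sup>2) \<le> ennreal (B\<^sup>2)"
    using nn L2_0_nn_integral[OF h] by simp
  then have "(L2_norm 0 h)\<^sup>2 \<le> B\<^sup>2" by simp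
  then show "L2_norm 0 h \<le> B" using B by (rule power2_le_imp_le)
qed

text \<open>Along a subsequence the increments \<open>d\<^sub>k\<close> satisfy \<open>\<parallel>d\<^sub>k\<parallel> < 4\<^sup>-\<^sup>k\<close>. Then \<open>\<Sum>k. 4\<^sup>k |d\<^sub>k|\<^sup>2\<close> is integrable,
  hence finite almost everywhere, and \<open>|d\<^sub>k(t)|\<close> decays like \<open>2\<^sup>-\<^sup>k\<close> for almost all \<open>t\<close>.\<close>

theorem L2_0_complete:
  assumes f: "\<And>k. f k \<in> L2 0"
    and cauchy: "\<And>e. e > 0 \<Longrightarrow> \<exists>N. \<forall>m\<ge>N. \<forall>n\<ge>N. L2_norm 0 (\<lambda>t. f m t - f n t) < e"
  obtains h where "h \<in> L2 0" "(\<lambda>k. L2_norm 0 (\<lambda>t. f k t - h t)) \<longlonglongrightarrow> 0"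
proof -
  have "\<forall>k::nat. \<exists>N. \<forall>m\<ge>N. \<forall>n\<ge>N. L2_norm 0 (\<lambda>t. f m t - f n t) < (1/4) ^ k"
    using cauchy by simp
  from choice[OF this] obtain N where
    N: "\<forall>k. \<forall>m\<ge>N k. \<forall>n\<ge>N k. L2_norm 0 (\<lambda>t. f m t - f n t) < (1/4) ^ k" ..
  define r where "r k = (\<Sum>j\<le>k. N j) + k" for k
  have rN: "r k \<ge> N k" "r (Suc k) \<ge> N k" "r k \<ge> k" for k
    using member_le_sum[of k "{..k}" N] by (auto simp: r_def)
  define d where "d k t = f (r (Suc k)) t - f (r k) t" for k t
  have dL: "d k \<in> L2 0" for k
    unfolding d_def by (intro L2_diff f)
  have dn: "L2_norm 0 (d k) \<le> (1/4) ^ k" for k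
    unfolding d_def using N rN by (intro less_imp_le) blast
  define u where "u k t = ennreal (4 ^ k * (norm (d k t))\<^sup>2)" for k t
  have um: "u k \<in> borel_measurable lebesgue" for k
  proof -
    have "(\<lambda>t. norm (d k t)) \<in> borel_measurable lebesgue"
      using dL[of k] by (intro borel_measurable_norm_strongly) (simp add: L2_0)
    then show ?thesis unfolding u_def by measurable
  qed
  have ui: "(\<integral>\<^sup>+t. u k t \<partial>lebesgue) \<le> ennreal ((1/4) ^ k)" for k
  proof -
    have "(\<lambda>t. norm (d k t)) \<in> borel_measurable lebesgue"
      using dL[of k] by (intro borel_measurable_norm_strongly) (simp add: L2_0)
    then have m: "(\<lambda>t. ennreal ((norm (d k t))\<^sup>2)) \<in> borel_measurable lebesgue"
      by measurable
    have "(\<integral>\<^sup>+t. u k t \<partial>lebesgue) = ennreal (4 ^ k) * (\<integral>\<^sup>+t. ennreal ((norm (d k t))\<^sup>2) \<partial>lebesgue)"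
      unfolding u_def using m by (subst nn_integral_cmult[symmetric]) (auto simp: ennreal_mult)
    also have "\<dots> = ennreal (4 ^ k * (L2_norm 0 (d k))\<^sup>2)"
      unfolding L2_0_nn_integral[OF dL] by (rule ennreal_mult[symmetric]) auto
    also have "\<dots> \<le> ennreal (4 ^ k * ((1/4) ^ k)\<^sup>2)"
      by (intro ennreal_leI mult_left_mono power_mono dn L2_norm_nonneg) simp
    also have "4 ^ k * ((1/4) ^ k)\<^sup>2 = ((1/4) ^ k :: real)"
      by (simp only: power2_eq_square power_mult_distrib[symmetric]) simp
    finally show ?thesis .
  qed
  have "(\<integral>\<^sup>+t. (\<Sum>k. u k t) \<partial>lebesgue) = (\<Sum>k. \<integral>\<^sup>+t. u k t \<partial>lebesgue)"
    by (rule nn_integral_suminf[OF um])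
  also have "\<dots> \<le> (\<Sum>k. ennreal ((1/4) ^ k))"
    by (intro suminf_le ui summableI)
  also have "\<dots> = ennreal (\<Sum>k. (1/4) ^ k)"
    by (intro suminf_ennreal2 summable_geometric) auto
  also have "\<dots> < \<infinity>" by simp
  finally have "(\<integral>\<^sup>+t. (\<Sum>k. u k t) \<partial>lebesgue) \<noteq> \<infinity>" by simp
  moreover have "(\<lambda>t. \<Sum>k. u k t) \<in> borel_measurable lebesgue"
    using um by measurable
  ultimately have "AE t in lebesgue. (\<Sum>k. u k t) \<noteq> \<infinity>"
    by (intro nn_integral_PInf_AE)
  then have conv: "AE t in lebesgue. (\<lambda>k. f (r k) t) \<longlonglongrightarrow> lim (\<lambda>k. f (r k) t)"
  proof eventually_elim
    case (elim t)
    define S where "S = enn2real (\<Sum>k. u k t)"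
    have "u k t \<le> (\<Sum>k. u k t)" for k
      using sum_le_suminf[of "\<lambda>k. u k t" "{k}"] by simp
    moreover have "(\<Sum>k. u k t) = ennreal S"
      using elim by (simp add: S_def less_top)
    ultimately have "ennreal (4 ^ k * (norm (d k t))\<^sup>2) \<le> ennreal S" for k
      by (simp add: u_def)
    then have "4 ^ k * (norm (d k t))\<^sup>2 \<le> S" for k
      by (rule ennreal_le_iff[THEN iffD1, rotated]) (simp add: S_def)
    moreover have "(2 ^ k)\<^sup>2 = (4 ^ k :: real)" for k :: nat
      by (simp add: power2_eq_square flip: power_mult_distrib)
    ultimately have "(2 ^ k * norm (d k t))\<^sup>2 \<le> (sqrt S)\<^sup>2" for k
      by (simp add: power_mult_distrib S_def)
    then have "2 ^ k * norm (d k t) \<le> sqrt S" for k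
      by (rule power2_le_imp_le) (simp add: S_def)
    then have b: "norm (d k t) \<le> sqrt S * (1/2) ^ k" for k
      by (simp add: field_simps)
    have "summable (\<lambda>k. sqrt S * (1/2) ^ k)"
      by (intro summable_mult summable_geometric) simp
    then have "summable (\<lambda>k. d k t)"
      by (rule summable_comparison_test'[where N = 0]) (rule b)
    then have "convergent (\<lambda>k. f (r k) t - f (r 0) t)"
      unfolding d_def summable_iff_convergent sum_lessThan_telescope[of "\<lambda>k. f (r k) t"] .
    then have "convergent (\<lambda>k. f (r k) t)"
      by (simp add: convergent_diff_const_right_iff)
    then show ?case by (simp add: convergent_LIMSEQ_iff)
  qed
  define h where "h t = lim (\<lambda>k. f (r k) t)" for t
  have est: "\<exists>M. \<forall>m\<ge>M. (\<lambda>t. f m t - h t) \<in> L2 0 \<and> L2_norm 0 (\<lambda>t. f m t - h t) \<le> e" if "e > 0" for e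
  proof -
    obtain M where M: "\<And>m n. m \<ge> M \<Longrightarrow> n \<ge> M \<Longrightarrow> L2_norm 0 (\<lambda>t. f m t - f n t) < e"
      using cauchy[OF \<open>e > 0\<close>] by blast
    show ?thesis
    proof (intro exI allI impI)
      fix m assume m: "m \<ge> M"
      from conv have ae: "AE t in lebesgue. (\<lambda>k. f m t - f (r (k + M)) t) \<longlonglongrightarrow> f m t - h t"
      proof eventually_elim
        case (elim t)
        have "(\<lambda>k. f (r (k + M)) t) \<longlonglongrightarrow> h t"
          unfolding h_def using elim by (rule LIMSEQ_ignore_initial_segment)
        then show ?case by (intro tendsto_intros)
      qed
      have le: "L2_norm 0 (\<lambda>t. f m t - f (r (k + M)) t) \<le> e" for k
        using M[OF m, of "r (k + M)"] rN(3)[of "k + M"] by (simp add: less_imp_le)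
      from L2_0_Fatou[OF ae L2_diff[OF f f] le]
      show "(\<lambda>t. f m t - h t) \<in> L2 0 \<and> L2_norm 0 (\<lambda>t. f m t - h t) \<le> e" by blast
    qed
  qed
  show ?thesis
  proof
    obtain M where "(\<lambda>t. f M t - h t) \<in> L2 0"
      using est[of 1] by auto
    from L2_diff[OF f[of M] this] show "h \<in> L2 0" by simp
    show "(\<lambda>k. L2_norm 0 (\<lambda>t. f k t - h t)) \<longlonglongrightarrow> 0"
    proof (rule metric_LIMSEQ_I)
      fix e :: real assume e: "e > 0"
      obtain M where M: "\<And>m. m \<ge> M \<Longrightarrow> L2_norm 0 (\<lambda>t. f m t - h t) \<le> e / 2"
        using est[of "e / 2"] e by auto
      have "dist (L2_norm 0 (\<lambda>t. f m t - h t)) 0 < e" if "m \<ge> M" for m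
        using M[OF that] e L2_norm_nonneg[of 0 "\<lambda>t. f m t - h t"] by (simp add: dist_real_def)
      then show "\<exists>M. \<forall>m\<ge>M. dist (L2_norm 0 (\<lambda>t. f m t - h t)) 0 < e" by blast
    qed
  qed
qed


subsection \<open>Continuous functions with compact support are dense\<close>

definition Cc :: "(real \<Rightarrow> 'h::complex_hilbert) set" where
  "Cc = {\<phi>. continuous_on UNIV \<phi> \<and> compactly_supported \<phi>}"

lemma compactly_supported_iff:
  "compactly_supported \<phi> \<longleftrightarrow> (\<exists>a>0. \<forall>t::real. \<bar>t\<bar> > a \<longrightarrow> \<phi> t = 0)"
proof
  assume "compactly_supported \<phi>"
  then have "bounded (closure {t. \<phi> t \<noteq> 0})"
    by (simp add: compactly_supported_def compact_imp_bounded)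
  then obtain a where "a > 0" "\<And>t. t \<in> closure {t. \<phi> t \<noteq> 0} \<Longrightarrow> norm t \<le> a"
    unfolding bounded_pos by blast
  then show "\<exists>a>0. \<forall>t. \<bar>t\<bar> > a \<longrightarrow> \<phi> t = 0"
    using closure_subset[of "{t. \<phi> t \<noteq> 0}"] by (intro exI[of _ a]) force
next
  assume "\<exists>a>0. \<forall>t. \<bar>t\<bar> > a \<longrightarrow> \<phi> t = 0"
  then obtain a where a: "\<And>t. \<bar>t\<bar> > a \<Longrightarrow> \<phi> t = 0" by blast
  have "{t. \<phi> t \<noteq> 0} \<subseteq> {- a..a}"
  proof
    fix t assume "t \<in> {t. \<phi> t \<noteq> 0}"
    then have "\<not> \<bar>t\<bar> > a" using a by auto
    then show "t \<in> {- a..a}" by auto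
  qed
  then have "bounded {t. \<phi> t \<noteq> 0}"
    by (rule bounded_subset[OF bounded_closed_interval])
  then show "compactly_supported \<phi>"
    by (simp add: compactly_supported_def)
qed

lemma CcE:
  assumes "\<phi> \<in> Cc"
  obtains a where "a > 0" "\<And>t. \<bar>t\<bar> > a \<Longrightarrow> \<phi> t = 0" "continuous_on UNIV \<phi>"
  using assms unfolding Cc_def compactly_supported_iff by blast

lemma CcI: "continuous_on UNIV \<phi> \<Longrightarrow> a > 0 \<Longrightarrow> (\<And>t. \<bar>t\<bar> > a \<Longrightarrow> \<phi> t = 0) \<Longrightarrow> \<phi> \<in> Cc"
  unfolding Cc_def compactly_supported_iff by blast

lemma Cc_add: assumes "\<phi> \<in> Cc" "\<psi> \<in> Cc" shows "(\<lambda>t. \<phi> t + \<psi> t) \<in> Cc"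
proof -
  obtain a where a: "a > 0" "\<And>t. \<bar>t\<bar> > a \<Longrightarrow> \<phi> t = 0" "continuous_on UNIV \<phi>" using assms CcE by blast
  obtain b where b: "b > 0" "\<And>t. \<bar>t\<bar> > b \<Longrightarrow> \<psi> t = 0" "continuous_on UNIV \<psi>" using assms CcE by blast
  show ?thesis
    by (rule CcI[of _ "max a b"]) (use a b in \<open>auto intro!: continuous_intros\<close>)
qed

lemma Cc_scaleC_fun:
  assumes "\<phi> \<in> Cc" "continuous_on UNIV w" shows "(\<lambda>t. w t *\<^sub>C \<phi> t) \<in> Cc"
proof -
  obtain a where a: "a > 0" "\<And>t. \<bar>t\<bar> > a \<Longrightarrow> \<phi> t = 0" "continuous_on UNIV \<phi>" using assms CcE by blast
  show ?thesis
    by (rule CcI[of _ a]) (use a in \<open>auto intro!: continuous_on_scaleC assms(2)\<close>)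
qed

lemma Cc_scaleC: "\<phi> \<in> Cc \<Longrightarrow> (\<lambda>t. c *\<^sub>C \<phi> t) \<in> Cc"
  by (rule Cc_scaleC_fun) (auto intro: continuous_intros)

lemma Cc_bounded:
  assumes "\<phi> \<in> Cc" obtains B where "B > 0" "\<And>t. norm (\<phi> t) \<le> B"
proof -
  obtain a where a: "a > 0" "\<And>t. \<bar>t\<bar> > a \<Longrightarrow> \<phi> t = 0" "continuous_on UNIV \<phi>" using assms CcE by blast
  have "compact (\<phi> ` {- a..a})"
    by (intro compact_continuous_image continuous_on_subset[OF a(3)]) auto
  from compact_imp_bounded[OF this] obtain B where B: "B > 0" "\<And>x. x \<in> \<phi> ` {- a..a} \<Longrightarrow> norm x \<le> B"
    unfolding bounded_pos by blast
  have "norm (\<phi> t) \<le> B" for t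
  proof (cases "\<bar>t\<bar> > a")
    case False
    then have "t \<in> {- a..a}" by auto
    then show ?thesis using B(2) by blast
  qed (use a B in simp)
  with B(1) show ?thesis by (rule that)
qed

lemma integrable_indicator_Icc: "integrable lebesgue (indicator {a..b} :: real \<Rightarrow> real)"
  by (intro integrable_real_indicator) (auto simp: emeasure_lborel_Icc_eq)

lemma Cc_L2_0: assumes "\<phi> \<in> Cc" shows "\<phi> \<in> L2 0"
  unfolding L2_0
proof
  obtain a where a: "a > 0" "\<And>t. \<bar>t\<bar> > a \<Longrightarrow> \<phi> t = 0" "continuous_on UNIV \<phi>" using assms CcE by blast
  obtain B where B: "B > 0" "\<And>t. norm (\<phi> t) \<le> B" using assms Cc_bounded by blast
  show sm: "strongly_measurable \<phi>" by (rule strongly_measurable_continuous[OF a(3)])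
  show "integrable lebesgue (\<lambda>t. (norm (\<phi> t))\<^sup>2)"
  proof (rule Bochner_Integration.integrable_bound)
    show "integrable lebesgue (\<lambda>t. B\<^sup>2 * indicator {- a..a} t :: real)"
      by (intro integrable_mult_right integrable_indicator_Icc)
    show "(\<lambda>t. (norm (\<phi> t))\<^sup>2) \<in> borel_measurable lebesgue"
      using borel_measurable_norm_strongly[OF sm] by measurable
    show "AE t in lebesgue. norm ((norm (\<phi> t))\<^sup>2) \<le> norm (B\<^sup>2 * indicator {- a..a} t :: real)"
    proof (rule AE_I2)
      fix t
      have le: "(norm (\<phi> t))\<^sup>2 \<le> B\<^sup>2" by (intro power_mono B) simp
      show "norm ((norm (\<phi> t))\<^sup>2) \<le> norm (B\<^sup>2 * indicator {- a..a} t :: real)"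
      proof (cases "\<bar>t\<bar> > a")
        case True
        then show ?thesis using a(2)[of t] by simp
      next
        case False
        then have "indicator {- a..a} t = (1::real)" by (auto simp: indicator_def abs_le_iff not_less)
        with le show ?thesis by simp
      qed
    qed
  qed
qed

definition Cc_approximable :: "(real \<Rightarrow> 'h::complex_hilbert) \<Rightarrow> bool" where
  "Cc_approximable f \<longleftrightarrow> f \<in> L2 0 \<and> (\<forall>e>0. \<exists>\<phi>\<in>Cc. L2_norm 0 (\<lambda>t. f t - \<phi> t) < e)"

lemma Cc_approximable_add:
  assumes "Cc_approximable f" "Cc_approximable g" shows "Cc_approximable (\<lambda>t. f t + g t)"
  unfolding Cc_approximable_def
proof (intro conjI allI impI)
  show "(\<lambda>t. f t + g t) \<in> L2 0" using assms by (intro L2_add) (auto simp: Cc_approximable_def)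
  fix e :: real assume "e > 0"
  then have "e / 2 > 0" by simp
  then obtain \<phi> \<psi> where p: "\<phi> \<in> Cc" "L2_norm 0 (\<lambda>t. f t - \<phi> t) < e / 2"
    "\<psi> \<in> Cc" "L2_norm 0 (\<lambda>t. g t - \<psi> t) < e / 2"
    using assms unfolding Cc_approximable_def by meson
  have "L2_norm 0 (\<lambda>t. (f t + g t) - (\<phi> t + \<psi> t)) = L2_norm 0 (\<lambda>t. (f t - \<phi> t) + (g t - \<psi> t))"
    by (simp add: algebra_simps)
  also have "\<dots> \<le> L2_norm 0 (\<lambda>t. f t - \<phi> t) + L2_norm 0 (\<lambda>t. g t - \<psi> t)"
  proof (rule L2_triangle)
    show "(\<lambda>t. f t - \<phi> t) \<in> L2 0" "(\<lambda>t. g t - \<psi> t) \<in> L2 0"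
      using assms unfolding Cc_approximable_def by (blast intro: L2_diff Cc_L2_0[OF p(1)] Cc_L2_0[OF p(3)])+
  qed
  also have "\<dots> < e" using p by linarith
  finally have "L2_norm 0 (\<lambda>t. (f t + g t) - (\<phi> t + \<psi> t)) < e" .
  then show "\<exists>\<phi>\<in>Cc. L2_norm 0 (\<lambda>t. (f t + g t) - \<phi> t) < e"
    by (rule bexI[of _ "\<lambda>t. \<phi> t + \<psi> t"]) (rule Cc_add[OF p(1,3)])
qed

lemma Cc_approximable_zero: "Cc_approximable (\<lambda>_. 0)"
proof -
  have "(\<lambda>_. 0) \<in> Cc" by (rule CcI[of _ 1]) auto
  then show ?thesis
    unfolding Cc_approximable_def using zero_L2[of 0]
    by (intro conjI allI impI bexI[of _ "\<lambda>_. 0"]) (simp_all add: L2_norm_0)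
qed

text \<open>By regularity of the measure \<open>A\<close> lies between a closed set \<open>K\<close> and an open set \<open>U\<close> whose difference has
  small measure. A continuous function that is \<open>1\<close> on \<open>K\<close> and \<open>0\<close> outside \<open>U\<close> differs from the indicator
  function on \<open>U - K\<close> only.\<close>

lemma Cc_approximable_indicator:
  fixes h :: "'h::complex_hilbert"
  assumes A: "A \<in> sets lebesgue" "A \<subseteq> {- a..a}"
  shows "Cc_approximable (\<lambda>t. complex_of_real (indicator A t) *\<^sub>C h)"
  unfolding Cc_approximable_def
proof (intro conjI allI impI)
  let ?f = "\<lambda>t. complex_of_real (indicator A t) *\<^sub>C h"
  have am: "(\<lambda>t. complex_of_real (indicator A t)) \<in> borel_measurable lebesgue"
    using A(1) by measurable
  have smf: "strongly_measurable ?f"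
    by (rule strongly_measurable_scaleC_fun[OF strongly_measurable_complex[OF am] strongly_measurable_const])
  have fA: "emeasure lebesgue A < \<infinity>"
    using emeasure_mono[OF A(2), of lebesgue] by (auto simp: emeasure_lborel_Icc_eq intro: le_less_trans)
  have "(\<lambda>t. (norm (?f t))\<^sup>2) = (\<lambda>t. (norm h)\<^sup>2 * indicator A t)"
    by (auto simp: fun_eq_iff indicator_def)
  then show fL: "?f \<in> L2 0"
    unfolding L2_0 using smf A(1) fA by (simp add: integrable_real_indicator)
  fix e :: real assume e: "e > 0"
  define \<delta> where "\<delta> = e\<^sup>2 / (4 * ((norm h)\<^sup>2 + 1))"
  have h1: "(norm h)\<^sup>2 + 1 > 0" by (simp add: add_nonneg_pos)
  have \<delta>: "\<delta> > 0" using e h1 by (simp add: \<delta>_def)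
  have half: "k * (2 * (x / (4 * k))) = x / 2" if "k > 0" for k x :: real
    using that by (simp add: field_simps)
  obtain K where K: "closed K" "K \<subseteq> A" "A - K \<in> lmeasurable" "emeasure lebesgue (A - K) < ennreal \<delta>"
    using sets_lebesgue_inner_closed[OF A(1) \<delta>] by blast
  obtain U where U: "open U" "A \<subseteq> U" "U - A \<in> lmeasurable" "emeasure lebesgue (U - A) < ennreal \<delta>"
    using sets_lebesgue_outer_open[OF A(1) \<delta>] by blast
  define T where "T = - (U \<inter> {- (\<bar>a\<bar> + 1)<..<\<bar>a\<bar> + 1})"
  have "closed T" unfolding T_def using U(1) by (intro closed_Compl open_Int) auto
  moreover have "K \<inter> T = {}" using K(2) U(2) A(2) by (force simp: T_def)
  ultimately obtain w :: "real \<Rightarrow> real" where w: "continuous_on UNIV w" "\<And>t. w t \<in> closed_segment 1 0"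
    "\<And>t. t \<in> K \<Longrightarrow> w t = 1" "\<And>t. t \<in> T \<Longrightarrow> w t = 0"
    using Urysohn[OF K(1)] by blast
  have w01: "0 \<le> w t" "w t \<le> 1" for t
    using w(2)[of t] by (auto simp: closed_segment_eq_real_ivl)
  define \<phi> where "\<phi> t = complex_of_real (w t) *\<^sub>C h" for t
  have \<phi>: "\<phi> \<in> Cc"
  proof (rule CcI[of _ "\<bar>a\<bar> + 1"])
    show "continuous_on UNIV \<phi>"
      unfolding \<phi>_def by (intro continuous_on_scaleC continuous_intros w(1))
    show "\<phi> t = 0" if "\<bar>t\<bar> > \<bar>a\<bar> + 1" for t
    proof -
      have "\<not> (- (\<bar>a\<bar> + 1) < t \<and> t < \<bar>a\<bar> + 1)" using that by linarith
      then have "t \<in> T" unfolding T_def by simp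
      then show ?thesis by (simp add: \<phi>_def w(4))
    qed
  qed simp
  define E where "E = (U - A) \<union> (A - K)"
  have E: "E \<in> lmeasurable" unfolding E_def using K(3) U(3) by (rule fmeasurable.Un[rotated])
  have "measure lebesgue E \<le> measure lebesgue (U - A) + measure lebesgue (A - K)"
    unfolding E_def using K(3) U(3) by (intro measure_Un_le) (auto simp: fmeasurableD)
  also have "\<dots> < \<delta> + \<delta>"
    using K(3,4) U(3,4) by (intro add_strict_mono) (auto simp: emeasure_eq_measure2 ennreal_less_iff)
  finally have mE: "measure lebesgue E < 2 * \<delta>" by simp
  have dL: "(\<lambda>t. ?f t - \<phi> t) \<in> L2 0" by (intro L2_diff fL Cc_L2_0 \<phi>)
  have "(L2_norm 0 (\<lambda>t. ?f t - \<phi> t))\<^sup>2 \<le> (LINT t|lebesgue. (norm h)\<^sup>2 * indicator E t)"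
    unfolding L2_0_power2
  proof (rule integral_mono)
    show "integrable lebesgue (\<lambda>t. (norm (?f t - \<phi> t))\<^sup>2)" using dL by (simp add: L2_0)
    show "integrable lebesgue (\<lambda>t. (norm h)\<^sup>2 * indicator E t)"
      using E by (intro integrable_mult_right integrable_real_indicator) (auto simp: fmeasurable_def)
    fix t
    have d: "?f t - \<phi> t = complex_of_real (indicator A t - w t) *\<^sub>C h"
      by (simp add: \<phi>_def scaleC_diff_left)
    have "\<bar>indicator A t - w t\<bar> \<le> indicator E t"
      using w01[of t] w(3,4)[of t] K(2) U(2) by (auto simp: indicator_def E_def T_def)
    then have "\<bar>indicator A t - w t\<bar>\<^sup>2 \<le> (indicator E t)\<^sup>2"
      by (intro power_mono) auto
    also have "(indicator E t)\<^sup>2 = (indicator E t :: real)" by (auto simp: indicator_def)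
    finally have "(norm h)\<^sup>2 * \<bar>indicator A t - w t\<bar>\<^sup>2 \<le> (norm h)\<^sup>2 * indicator E t"
      by (rule mult_left_mono) simp
    moreover have "norm (?f t - \<phi> t) = \<bar>indicator A t - w t\<bar> * norm h"
      unfolding d norm_scaleC norm_of_real ..
    ultimately show "(norm (?f t - \<phi> t))\<^sup>2 \<le> (norm h)\<^sup>2 * indicator E t"
      by (simp only: power_mult_distrib mult.commute)
  qed
  also have "\<dots> = (norm h)\<^sup>2 * measure lebesgue E"
    using E by (simp add: fmeasurableD)
  also have "\<dots> \<le> ((norm h)\<^sup>2 + 1) * (2 * \<delta>)"
    using mE by (intro mult_mono) auto
  also have "((norm h)\<^sup>2 + 1) * (2 * \<delta>) = e\<^sup>2 / 2"
    unfolding \<delta>_def using h1 by (rule half)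
  finally have "(L2_norm 0 (\<lambda>t. ?f t - \<phi> t))\<^sup>2 \<le> e\<^sup>2 / 2" .
  moreover have "e\<^sup>2 > 0" by (rule zero_less_power[OF e])
  ultimately have "(L2_norm 0 (\<lambda>t. ?f t - \<phi> t))\<^sup>2 < e\<^sup>2" by linarith
  then have "L2_norm 0 (\<lambda>t. ?f t - \<phi> t) < e"
    by (rule power2_less_imp_less) (rule less_imp_le[OF e])
  then show "\<exists>\<phi>\<in>Cc. L2_norm 0 (\<lambda>t. ?f t - \<phi> t) < e"
    by (rule bexI[OF _ \<phi>])
qed

lemma Cc_approximable_simple:
  assumes s: "simple_function lebesgue s" and a: "\<And>t. \<bar>t\<bar> > a \<Longrightarrow> s t = 0"
  shows "Cc_approximable s"
proof -
  define Y where "Y = range s - {0}"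
  have fY: "finite Y" using simple_functionD(1)[OF s] by (simp add: Y_def)
  have "Cc_approximable (\<lambda>t. \<Sum>y\<in>F. complex_of_real (indicator (s -` {y}) t) *\<^sub>C y)"
    if "finite F" "F \<subseteq> Y" for F
    using that
  proof (induction F)
    case empty
    then show ?case by (simp add: Cc_approximable_zero)
  next
    case (insert y F)
    have "s -` {y} \<in> sets lebesgue" using simple_functionD(2)[OF s, of "{y}"] by simp
    moreover have "s -` {y} \<subseteq> {- a..a}"
    proof
      fix t assume "t \<in> s -` {y}"
      then have "\<not> \<bar>t\<bar> > a" using a insert.prems by (auto simp: Y_def)
      then show "t \<in> {- a..a}" by auto
    qed
    ultimately have "Cc_approximable (\<lambda>t. complex_of_real (indicator (s -` {y}) t) *\<^sub>C y)"
      by (rule Cc_approximable_indicator)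
    from Cc_approximable_add[OF this insert.IH] insert show ?case by simp
  qed
  from this[OF fY order_refl]
  have "Cc_approximable (\<lambda>t. \<Sum>y\<in>Y. complex_of_real (indicator (s -` {y}) t) *\<^sub>C y)" .
  moreover have "(\<Sum>y\<in>Y. complex_of_real (indicator (s -` {y}) t) *\<^sub>C y) = s t" for t
  proof -
    have "(\<Sum>y\<in>Y. complex_of_real (indicator (s -` {y}) t) *\<^sub>C y) = (\<Sum>y\<in>Y. if y = s t then y else 0)"
      by (intro sum.cong) (auto simp: indicator_def)
    also have "\<dots> = s t" using fY by (auto simp: sum.delta Y_def)
    finally show ?thesis .
  qed
  ultimately show ?thesis by simp
qed

text \<open>Simple functions converging to \<open>f\<close> almost everywhere need not converge in the norm. Replacing their values
  by zero where they exceed \<open>2 |f|\<close>, and outside \<open>[-n, n]\<close>, does not change the pointwise limit and makes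
  dominated convergence applicable.\<close>

theorem Cc_dense:
  fixes f :: "real \<Rightarrow> 'h::complex_hilbert"
  assumes f: "f \<in> L2 0" and e: "e > 0"
  obtains \<phi> where "\<phi> \<in> Cc" "L2_norm 0 (\<lambda>t. f t - \<phi> t) < e"
proof -
  have smf: "strongly_measurable f" using f by (simp add: L2_0)
  obtain s where s: "\<And>n. simple_function lebesgue (s n)" "AE t in lebesgue. (\<lambda>n. s n t) \<longlonglongrightarrow> f t"
    using smf unfolding strongly_measurable_def by blast
  define g where "g n t = (if norm (s n t) \<le> 2 * norm (f t) \<and> \<bar>t\<bar> \<le> real n then s n t else 0)" for n t
  have sg: "simple_function lebesgue (g n)" for n
    unfolding g_def
  proof (rule simple_function_If[OF s(1)])
    have "(\<lambda>t. norm (s n t)) \<in> borel_measurable lebesgue"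
      by (intro borel_measurable_norm_strongly strongly_measurable_simple s)
    moreover have "(\<lambda>t. norm (f t)) \<in> borel_measurable lebesgue"
      by (rule borel_measurable_norm_strongly[OF smf])
    ultimately have "{t \<in> space lebesgue. norm (s n t) \<le> 2 * norm (f t)} \<in> sets lebesgue"
      by measurable
    moreover have "{t \<in> space lebesgue. norm (s n t) \<le> 2 * norm (f t) \<and> \<bar>t\<bar> \<le> real n}
        = {t \<in> space lebesgue. norm (s n t) \<le> 2 * norm (f t)} \<inter> {- real n..real n}"
      by (auto simp: abs_le_iff)
    ultimately show "{t \<in> space lebesgue. norm (s n t) \<le> 2 * norm (f t) \<and> \<bar>t\<bar> \<le> real n} \<in> sets lebesgue"
      by auto
  qed simp
  have ga: "Cc_approximable (g n)" for n
    by (rule Cc_approximable_simple[OF sg, of "real n"]) (auto simp: g_def)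
  then have gL: "g n \<in> L2 0" for n by (simp add: Cc_approximable_def)
  have "(\<lambda>n. LINT t|lebesgue. (norm (f t - g n t))\<^sup>2) \<longlonglongrightarrow> (LINT (t::real)|lebesgue. (0::real))"
  proof (rule integral_dominated_convergence[where w = "\<lambda>t. 9 * (norm (f t))\<^sup>2"])
    show "(\<lambda>t::real. 0 :: real) \<in> borel_measurable lebesgue" by simp
    show "(\<lambda>t. (norm (f t - g n t))\<^sup>2) \<in> borel_measurable lebesgue" for n
      using L2_diff[OF f gL[of n]] by (auto simp: L2_0)
    show "integrable lebesgue (\<lambda>t. 9 * (norm (f t))\<^sup>2)" using f by (simp add: L2_0)
    from s(2) show "AE t in lebesgue. (\<lambda>n. (norm (f t - g n t))\<^sup>2) \<longlonglongrightarrow> 0"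
    proof eventually_elim
      case (elim t)
      have "\<forall>\<^sub>F n in sequentially. norm (f t - g n t) \<le> norm (f t - s n t)"
      proof (cases "f t = 0")
        case True
        then show ?thesis by (simp add: g_def)
      next
        case False
        have "(\<lambda>n. norm (s n t)) \<longlonglongrightarrow> norm (f t)" by (intro tendsto_norm elim)
        moreover have "norm (f t) < 2 * norm (f t)" using False by simp
        ultimately have "\<forall>\<^sub>F n in sequentially. norm (s n t) < 2 * norm (f t)"
          by (rule order_tendstoD)
        then show ?thesis using eventually_ge_at_top[of "nat \<lceil>\<bar>t\<bar>\<rceil>"]
        proof eventually_elim
          case (elim n)
          then have "\<bar>t\<bar> \<le> real n" by linarith
          with elim show ?case by (simp add: g_def)
        qed
      qed
      moreover have "(\<lambda>n. norm (f t - s n t)) \<longlonglongrightarrow> 0"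
        using tendsto_norm[OF tendsto_diff[OF tendsto_const[of "f t"] elim]] by simp
      ultimately have "(\<lambda>n. f t - g n t) \<longlonglongrightarrow> 0"
        by (rule Lim_null_comparison)
      from tendsto_power[OF tendsto_norm[OF this], of 2] show ?case by simp
    qed
    show "AE t in lebesgue. norm ((norm (f t - g n t))\<^sup>2) \<le> 9 * (norm (f t))\<^sup>2" for n
    proof (rule AE_I2)
      fix t
      have "norm (f t - g n t) \<le> norm (f t) + norm (g n t)" by (rule norm_triangle_ineq4)
      also have "\<dots> \<le> 3 * norm (f t)" by (simp add: g_def)
      finally have "(norm (f t - g n t))\<^sup>2 \<le> (3 * norm (f t))\<^sup>2" by (intro power_mono) auto
      then show "norm ((norm (f t - g n t))\<^sup>2) \<le> 9 * (norm (f t))\<^sup>2" by (simp add: power_mult_distrib)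
    qed
  qed
  then have "(\<lambda>n. (L2_norm 0 (\<lambda>t. f t - g n t))\<^sup>2) \<longlonglongrightarrow> 0"
    unfolding L2_0_power2 by simp
  then have "\<forall>\<^sub>F n in sequentially. (L2_norm 0 (\<lambda>t. f t - g n t))\<^sup>2 < (e / 2)\<^sup>2"
    by (rule order_tendstoD) (use e in simp)
  then obtain n where "(L2_norm 0 (\<lambda>t. f t - g n t))\<^sup>2 < (e / 2)\<^sup>2"
    using eventually_happens' sequentially_bot by blast
  then have n: "L2_norm 0 (\<lambda>t. f t - g n t) < e / 2"
    by (rule power2_less_imp_less) (use e in simp)
  have "e / 2 > 0" using e by simp
  then obtain \<phi> where \<phi>: "\<phi> \<in> Cc" "L2_norm 0 (\<lambda>t. g n t - \<phi> t) < e / 2"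
    using ga[of n] unfolding Cc_approximable_def by blast
  have "L2_norm 0 (\<lambda>t. f t - \<phi> t) < e"
    using L2_triangle_diff[OF f gL[of n] Cc_L2_0[OF \<phi>(1)]] n \<phi>(2) by linarith
  with \<phi>(1) show ?thesis by (rule that)
qed


section \<open>The Fourier--Laplace transform\<close>

subsection \<open>The transform on continuous functions with compact support\<close>

abbreviation ft_const :: real ("\<kappa>") where "\<kappa> \<equiv> 1 / sqrt (2 * pi)"

abbreviation FT :: "(real \<Rightarrow> 'h::complex_hilbert) \<Rightarrow> real \<Rightarrow> 'h" where
  "FT \<equiv> laplace_integral 0"

lemma exp_eq_cis: "exp (- \<i> * complex_of_real x) = cis (- x)"
  by (simp add: cis_conv_exp)

lemma laplace_integral_unweight: "laplace_integral \<nu> \<phi> = FT (unweight \<nu> \<phi>)"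
proof -
  have "exp (- \<i> * complex_of_real x - complex_of_real y) *\<^sub>C v
      = exp (- \<i> * complex_of_real x - complex_of_real 0) *\<^sub>C (complex_of_real (exp (- y)) *\<^sub>C v)"
    for x y and v :: 'a
    by (simp add: scaleC_scaleC exp_diff exp_minus divide_inverse exp_of_real flip: of_real_inverse)
  from this[of "_ * _" "\<nu> * _" "\<phi> _"]
  have "exp (- \<i> * complex_of_real (t * \<xi>) - complex_of_real (\<nu> * t)) *\<^sub>C \<phi> t
      = exp (- \<i> * complex_of_real (t * \<xi>) - complex_of_real (0 * t)) *\<^sub>C unweight \<nu> \<phi> t" for t \<xi>
    unfolding unweight_def by simp
  then show ?thesis
    unfolding laplace_integral_def fun_eq_iff by (simp only: simp_thms)
qed

lemma norm_le_if_cinner_le: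
  assumes "\<And>h. cmod (cinner h v) \<le> C * norm h" "C \<ge> 0" shows "norm v \<le> C"
proof (cases "v = 0")
  case False
  have "(norm v)\<^sup>2 \<le> C * norm v"
    using assms(1)[of v] by (simp add: cinner_self norm_power)
  then show ?thesis using False by (simp add: power2_eq_square)
qed (use assms in simp)

lemma integrable_lborel_indicator_Icc: "integrable lborel (indicator {a..b} :: real \<Rightarrow> real)"
  by (intro integrable_real_indicator) (auto simp: emeasure_lborel_Icc_eq)

lemma Cc_bound:
  assumes "\<phi> \<in> Cc"
  obtains a B where "a > 0" "B > 0" "\<And>t. norm (\<phi> t) \<le> B * indicator {- a..a} t" "\<And>t. \<bar>t\<bar> > a \<Longrightarrow> \<phi> t = 0"
proof -
  obtain a where a: "a > 0" "\<And>t. \<bar>t\<bar> > a \<Longrightarrow> \<phi> t = 0" and "continuous_on UNIV \<phi>"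
    by (rule CcE[OF assms]) (rule that)
  obtain B where B: "B > 0" "\<And>t. norm (\<phi> t) \<le> B" by (rule Cc_bounded[OF assms]) (rule that)
  have "norm (\<phi> t) \<le> B * indicator {- a..a} t" for t
  proof (cases "\<bar>t\<bar> > a")
    case True
    then show ?thesis using a(2)[of t] B(1) by simp
  next
    case False
    then have "indicator {- a..a} t = (1::real)" by (auto simp: indicator_def abs_le_iff not_less)
    then show ?thesis using B(2)[of t] by simp
  qed
  from that[OF a(1) B(1) this a(2)] show ?thesis .
qed

lemma borel_measurable_continuous_UNIV:
  "continuous_on UNIV f \<Longrightarrow> f \<in> borel_measurable lborel"
  by (simp add: borel_measurable_continuous_onI)

lemma Cc_integrable:
  fixes u :: "real \<Rightarrow> complex"
  assumes "u \<in> Cc" shows "integrable lborel u"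
proof -
  obtain a B where "a > 0" "B > 0" and B: "\<And>t. norm (u t) \<le> B * indicator {- a..a} t"
    and "\<And>t. \<bar>t\<bar> > a \<Longrightarrow> u t = 0"
    by (rule Cc_bound[OF assms]) (rule that)
  show ?thesis
  proof (rule Bochner_Integration.integrable_bound)
    show "integrable lborel (\<lambda>t. B * indicator {- a..a} t :: real)"
      by (intro integrable_mult_right integrable_lborel_indicator_Icc)
    show "u \<in> borel_measurable lborel"
      using assms by (intro borel_measurable_continuous_UNIV) (simp add: Cc_def)
    show "AE t in lborel. norm (u t) \<le> norm (B * indicator {- a..a} t)"
      by (rule AE_I2, rule order_trans[OF B]) simp
  qed
qed

lemma Cc_cinner: "\<phi> \<in> Cc \<Longrightarrow> (\<lambda>t. cinner h (\<phi> t)) \<in> Cc"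
  by (erule CcE, rule CcI) (auto intro!: continuous_on_cinner)

lemma Cc_integral_cinner:
  assumes "\<psi> \<in> Cc" shows "cinner h (integral UNIV \<psi>) = (LINT t|lborel. cinner h (\<psi> t))"
proof -
  obtain a where a: "a > 0" "\<And>t. \<bar>t\<bar> > a \<Longrightarrow> \<psi> t = 0" "continuous_on UNIV \<psi>"
    by (rule CcE[OF assms]) (rule that)
  have "\<psi> integrable_on {- a..a}"
    by (intro integrable_continuous_interval continuous_on_subset[OF a(3)]) auto
  then have "(\<psi> has_integral integral {- a..a} \<psi>) UNIV"
    by (intro has_integral_on_superset[OF integrable_integral]) (use a(2) in \<open>auto simp: abs_le_iff not_le\<close>)
  then have "((cinner h \<circ> \<psi>) has_integral cinner h (integral UNIV \<psi>)) UNIV"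
    by (intro has_integral_linear bounded_linear_cinner_right) (simp add: has_integral_iff)
  moreover have "((cinner h \<circ> \<psi>) has_integral (LINT t|lborel. cinner h (\<psi> t))) UNIV"
    using has_integral_integral_lborel[OF Cc_integrable[OF Cc_cinner[OF assms]]] by (simp add: o_def)
  ultimately show ?thesis by (rule has_integral_unique)
qed

lemma FT_cinner_right:
  assumes "\<phi> \<in> Cc"
  shows "cinner h (FT \<phi> \<xi>) = of_real \<kappa> * (LINT t|lborel. cis (- (t * \<xi>)) * cinner h (\<phi> t))"
proof -
  have "(\<lambda>t. cis (- (t * \<xi>)) *\<^sub>C \<phi> t) \<in> Cc"
    by (rule Cc_scaleC_fun[OF assms]) (intro continuous_intros)
  from Cc_integral_cinner[OF this, of h] show ?thesis
    unfolding laplace_integral_def exp_eq_cis[symmetric]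
    by (simp add: cinner_scaleR_right cinner_scaleC_right)
qed

lemma FT_cinner_left:
  assumes "\<phi> \<in> Cc"
  shows "cinner (FT \<phi> \<xi>) h = of_real \<kappa> * (LINT t|lborel. cis (t * \<xi>) * cinner (\<phi> t) h)"
proof -
  have "cinner (FT \<phi> \<xi>) h = cnj (of_real \<kappa> * (LINT t|lborel. cis (- (t * \<xi>)) * cinner h (\<phi> t)))"
    unfolding FT_cinner_right[OF assms, symmetric] by (rule cinner_commute)
  also have "\<dots> = of_real \<kappa> * (LINT t|lborel. cnj (cis (- (t * \<xi>)) * cinner h (\<phi> t)))"
    unfolding complex_cnj_mult[of "of_real _"] complex_cnj_complex_of_real
      Bochner_Integration.integral_cnj[symmetric] ..
  also have "(\<lambda>t. cnj (cis (- (t * \<xi>)) * cinner h (\<phi> t))) = (\<lambda>t. cis (t * \<xi>) * cinner (\<phi> t) h)"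
    by (simp add: fun_eq_iff cis_cnj cinner_commute[of _ h, symmetric])
  finally show ?thesis .
qed

lemma kappa_pos: "\<kappa> > 0" by simp

lemma FT_add:
  fixes \<phi> \<psi> :: "real \<Rightarrow> 'h::complex_hilbert"
  assumes p: "\<phi> \<in> Cc" "\<psi> \<in> Cc"
  shows "FT (\<lambda>t. \<phi> t + \<psi> t) \<xi> = FT \<phi> \<xi> + FT \<psi> \<xi>"
proof (rule cinner_extensionality)
  fix h :: 'h
  have i: "integrable lborel (\<lambda>t. cis (- (t * \<xi>)) * cinner h (u t))" if "u \<in> Cc" for u
    using Cc_integrable[OF Cc_scaleC_fun[OF Cc_cinner[OF that, of h], of "\<lambda>t. cis (- (t * \<xi>))"]]
    by (simp add: scaleC_complex_def continuous_intros)
  show "cinner h (FT (\<lambda>t. \<phi> t + \<psi> t) \<xi>) = cinner h (FT \<phi> \<xi> + FT \<psi> \<xi>)"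
    using i[OF p(1)] i[OF p(2)]
    by (simp add: FT_cinner_right p Cc_add cinner_add_right distrib_left)
qed

lemma FT_bounded_clinear:
  assumes T: "bounded_clinear T" and \<phi>: "\<phi> \<in> Cc" and T\<phi>: "(\<lambda>t. T (\<phi> t)) \<in> Cc"
  shows "FT (\<lambda>t. T (\<phi> t)) \<xi> = T (FT \<phi> \<xi>)"
proof (rule cinner_extensionality)
  fix h
  obtain k where k: "\<And>x. cinner h (T x) = cinner k x"
    using bounded_clinear_adjoint_exists[OF T] by blast
  show "cinner h (FT (\<lambda>t. T (\<phi> t)) \<xi>) = cinner h (T (FT \<phi> \<xi>))"
    by (simp add: k FT_cinner_right[OF \<phi>] FT_cinner_right[OF T\<phi>])
qed

lemma cis_diff_le: "cmod (cis a - cis b) \<le> \<bar>a - b\<bar>"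
proof -
  have "cmod (cis a - cis b) = cmod (cis b) * cmod (cis (a - b) - 1)"
    by (simp only: norm_mult[symmetric] right_diff_distrib cis_mult) simp
  also have "\<dots> \<le> \<bar>a - b\<bar>"
    using iexp_approx1[of "a - b" 0] by (simp add: cis_conv_exp)
  finally show ?thesis .
qed

lemma FT_bounded_and_Lipschitz:
  assumes "\<phi> \<in> Cc"
  obtains C where "C \<ge> 0" "\<And>\<xi>. norm (FT \<phi> \<xi>) \<le> C" "\<And>\<xi> \<eta>. norm (FT \<phi> \<xi> - FT \<phi> \<eta>) \<le> C * \<bar>\<xi> - \<eta>\<bar>"
proof -
  obtain a B where B: "a > 0" "B > 0" "\<And>t. norm (\<phi> t) \<le> B * indicator {- a..a} t"
    and "\<And>t. \<bar>t\<bar> > a \<Longrightarrow> \<phi> t = 0"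
    by (rule Cc_bound[OF assms]) (rule that)
  have est: "norm v \<le> K * (\<kappa> * (B * (2 * a)))"
    if v: "\<And>h. cinner h v = of_real \<kappa> * (LINT t|lborel. w t * cinner h (\<phi> t))"
      and w: "\<And>t. \<bar>t\<bar> \<le> a \<Longrightarrow> cmod (w t) \<le> K" and K: "K \<ge> 0" for v w K
  proof (rule norm_le_if_cinner_le)
    fix h
    have le: "norm (w t * cinner h (\<phi> t)) \<le> K * norm h * B * indicator {- a..a} t" for t
    proof (cases "t \<in> {- a..a}")
      case True
      then have "\<bar>t\<bar> \<le> a" by auto
      have "cmod (cinner h (\<phi> t)) \<le> norm h * B"
        using Cauchy_Schwarz[of h "\<phi> t"] mult_left_mono[OF B(3)[of t] norm_ge_zero[of h]] True by simp
      then have "cmod (w t) * cmod (cinner h (\<phi> t)) \<le> K * (norm h * B)"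
        by (intro mult_mono w \<open>\<bar>t\<bar> \<le> a\<close> K) auto
      then show ?thesis using True by (simp add: norm_mult mult.assoc)
    next
      case False
      then have "\<phi> t = 0" using B(3)[of t] by simp
      then show ?thesis using False by simp
    qed
    have int: "integrable lborel (\<lambda>t. K * norm h * B * indicator {- a..a} t)"
      by (intro integrable_mult_right integrable_lborel_indicator_Icc)
    have "norm (LINT t|lborel. w t * cinner h (\<phi> t)) \<le> (LINT t|lborel. K * norm h * B * indicator {- a..a} t)"
    proof (cases "integrable lborel (\<lambda>t. w t * cinner h (\<phi> t))")
      case True
      then show ?thesis by (intro Bochner_Integration.integral_norm_bound_integral int le)
    next
      case False
      have "0 \<le> (LINT t|lborel. K * norm h * B * indicator {- a..a} t)"
        using K B by (intro integral_nonneg_AE AE_I2) simp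
      then show ?thesis using not_integrable_integral_eq[OF False] by simp
    qed
    also have "\<dots> = K * norm h * B * (2 * a)"
      using B(1) by simp
    finally have "\<kappa> * norm (LINT t|lborel. w t * cinner h (\<phi> t)) \<le> \<kappa> * (K * norm h * B * (2 * a))"
      by (rule mult_left_mono) simp
    moreover have "cmod (complex_of_real \<kappa>) = \<kappa>"
      by (simp only: norm_of_real abs_of_pos[OF kappa_pos])
    ultimately show "cmod (cinner h v) \<le> K * (\<kappa> * (B * (2 * a))) * norm h"
      unfolding v norm_mult by (simp only: mult_ac)
  qed (use K B in simp)
  define C where "C = max 1 a * (\<kappa> * (B * (2 * a)))"
  have C0: "\<kappa> * (B * (2 * a)) \<ge> 0" using B by simp
  show ?thesis
  proof
    show "C \<ge> 0" unfolding C_def by (intro mult_nonneg_nonneg C0) simp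
    fix \<xi> \<eta>
    have "norm (FT \<phi> \<xi>) \<le> 1 * (\<kappa> * (B * (2 * a)))"
      by (rule est[OF FT_cinner_right[OF assms]]) auto
    also have "\<dots> \<le> C" unfolding C_def by (intro mult_right_mono C0) simp
    finally show "norm (FT \<phi> \<xi>) \<le> C" .
    have "norm (FT \<phi> \<xi> - FT \<phi> \<eta>) \<le> (a * \<bar>\<xi> - \<eta>\<bar>) * (\<kappa> * (B * (2 * a)))"
    proof (rule est)
      fix h
      have i: "integrable lborel (\<lambda>t. cis (- (t * x)) * cinner h (\<phi> t))" for x
        using Cc_integrable[OF Cc_scaleC_fun[OF Cc_cinner[OF assms, of h], of "\<lambda>t. cis (- (t * x))"]]
        by (simp add: scaleC_complex_def continuous_intros)
      show "cinner h (FT \<phi> \<xi> - FT \<phi> \<eta>) = of_real \<kappa> *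
          (LINT t|lborel. (cis (- (t * \<xi>)) - cis (- (t * \<eta>))) * cinner h (\<phi> t))"
        using i[of \<xi>] i[of \<eta>]
        by (simp add: cinner_diff_right FT_cinner_right[OF assms] left_diff_distrib right_diff_distrib)
    next
      fix t assume t: "\<bar>t\<bar> \<le> a"
      have "cmod (cis (- (t * \<xi>)) - cis (- (t * \<eta>))) \<le> \<bar>- (t * \<xi>) - - (t * \<eta>)\<bar>"
        by (rule cis_diff_le)
      also have "\<dots> = \<bar>t * (\<xi> - \<eta>)\<bar>" by (simp add: right_diff_distrib abs_minus_commute)
      also have "\<dots> \<le> a * \<bar>\<xi> - \<eta>\<bar>" unfolding abs_mult using t by (rule mult_right_mono) simp
      finally show "cmod (cis (- (t * \<xi>)) - cis (- (t * \<eta>))) \<le> a * \<bar>\<xi> - \<eta>\<bar>" .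
    qed (use B in simp)
    also have "\<dots> = (a * (\<kappa> * (B * (2 * a)))) * \<bar>\<xi> - \<eta>\<bar>" by (simp only: mult_ac)
    also have "\<dots> \<le> C * \<bar>\<xi> - \<eta>\<bar>"
      unfolding C_def by (intro mult_right_mono C0) auto
    finally show "norm (FT \<phi> \<xi> - FT \<phi> \<eta>) \<le> C * \<bar>\<xi> - \<eta>\<bar>" .
  qed
qed

lemma FT_continuous:
  assumes "\<phi> \<in> Cc" shows "continuous_on UNIV (FT \<phi>)"
proof -
  obtain C where "C \<ge> 0" "\<And>\<xi>. norm (FT \<phi> \<xi>) \<le> C"
    and C: "\<And>\<xi> \<eta>. norm (FT \<phi> \<xi> - FT \<phi> \<eta>) \<le> C * \<bar>\<xi> - \<eta>\<bar>"
    by (rule FT_bounded_and_Lipschitz[OF assms]) (rule that)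
  have "isCont (FT \<phi>) \<eta>" for \<eta>
    unfolding isCont_def
  proof (rule LIM_zero_cancel, rule Lim_null_comparison)
    show "\<forall>\<^sub>F \<xi> in at \<eta>. norm (FT \<phi> \<xi> - FT \<phi> \<eta>) \<le> C * \<bar>\<xi> - \<eta>\<bar>"
      by (intro always_eventually allI C)
    have "((\<lambda>\<xi>. C * \<bar>\<xi> - \<eta>\<bar>) \<longlongrightarrow> C * \<bar>\<eta> - \<eta>\<bar>) (at \<eta>)" by (intro tendsto_intros)
    then show "((\<lambda>\<xi>. C * \<bar>\<xi> - \<eta>\<bar>) \<longlongrightarrow> 0) (at \<eta>)" by simp
  qed
  then show ?thesis by (simp add: continuous_on_eq_continuous_at)
qed


subsection \<open>Plancherel's identity\<close>

lemma Fubini_continuous: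
  fixes f :: "real \<Rightarrow> real \<Rightarrow> complex"
  assumes cont: "continuous_on UNIV (\<lambda>p. f (fst p) (snd p))"
    and le: "\<And>s x. norm (f s x) \<le> k s * g x" and k: "integrable lborel k" and g: "integrable lborel g"
  shows "(LINT x|lborel. LINT s|lborel. f s x) = (LINT s|lborel. LINT x|lborel. f s x)"
proof (rule lborel_pair.Fubini_integral)
  have meas: "case_prod f \<in> borel_measurable (lborel \<Otimes>\<^sub>M lborel)"
  proof -
    have "(\<lambda>p. f (fst p) (snd p)) \<in> borel_measurable borel"
      by (rule borel_measurable_continuous_onI[OF cont])
    then show ?thesis by (simp add: split_beta' lborel_prod)
  qed
  have km: "k \<in> borel_measurable lborel" and gm: "g \<in> borel_measurable lborel"
    using k g by auto
  have "integrable (lborel \<Otimes>\<^sub>M lborel) (\<lambda>p. k (fst p) * g (snd p))"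
  proof (rule lborel_pair.Fubini_integrable)
    show "(\<lambda>p. k (fst p) * g (snd p)) \<in> borel_measurable (lborel \<Otimes>\<^sub>M lborel)"
      using km gm by measurable
    have "integrable lborel (\<lambda>x. norm (k x) * (LINT y|lborel. norm (g y)))"
      using k by (intro integrable_mult_left integrable_norm)
    moreover have "(\<lambda>x. LINT y|lborel. norm (k (fst (x, y)) * g (snd (x, y))))
        = (\<lambda>x. norm (k x) * (LINT y|lborel. norm (g y)))"
      by (simp add: fun_eq_iff abs_mult)
    ultimately show "integrable lborel (\<lambda>x. LINT y|lborel. norm (k (fst (x, y)) * g (snd (x, y))))"
      by (simp only:)
    show "AE x in lborel. integrable lborel (\<lambda>y. k (fst (x, y)) * g (snd (x, y)))"
      using g by (intro AE_I2) simp
  qed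
  then show "integrable (lborel \<Otimes>\<^sub>M lborel) (case_prod f)"
  proof (rule Bochner_Integration.integrable_bound[OF _ meas], intro AE_I2)
    fix p :: "real \<times> real"
    have "norm (case_prod f p) \<le> k (fst p) * g (snd p)"
      using le[of "fst p" "snd p"] by (simp add: split_beta')
    then show "norm (case_prod f p) \<le> norm (k (fst p) * g (snd p))"
      by simp
  qed
qed

lemma gaussian_integrable: "integrable lborel (\<lambda>x::real. exp (- x\<^sup>2 / 2))"
proof -
  have "integrable lborel std_normal_density" by (rule integrable_normal_density) simp
  then have "integrable lborel (\<lambda>x. sqrt (2 * pi) * std_normal_density x)" by simp
  then show ?thesis by (simp add: std_normal_density_def)
qed

lemma gaussian_integral: "(LINT x|lborel. \<kappa> * exp (- x\<^sup>2 / 2)) = 1"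
proof -
  have "(\<lambda>x. \<kappa> * exp (- x\<^sup>2 / 2)) = std_normal_density"
    by (simp add: fun_eq_iff std_normal_density_def)
  then show ?thesis using integral_normal_density[of 1 0] by (simp only: zero_less_one)
qed

lemma gaussian_fourier:
  "(LINT x|lborel. complex_of_real (exp (- x\<^sup>2 / 2)) * cis (r * x)) = complex_of_real (sqrt (2 * pi) * exp (- r\<^sup>2 / 2))"
proof -
  have "complex_of_real (exp (- r\<^sup>2 / 2)) = char std_normal_distribution r"
    by (simp add: char_std_normal_distribution)
  also have "\<dots> = (LINT x|lborel. std_normal_density x *\<^sub>R iexp (r * x))"
    unfolding char_def by (subst integral_density) (auto simp: normal_density_nonneg)
  also have "\<dots> = (LINT x|lborel. of_real \<kappa> * (complex_of_real (exp (- x\<^sup>2 / 2)) * cis (r * x)))"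
    by (simp add: std_normal_density_def scaleR_conv_of_real cis_conv_exp mult.assoc)
  also have "\<dots> = of_real \<kappa> * (LINT x|lborel. complex_of_real (exp (- x\<^sup>2 / 2)) * cis (r * x))"
    by simp
  finally show ?thesis
    by (simp add: field_simps)
qed

lemma gaussian_fourier_scaled:
  assumes n: "n > 0"
  shows "(LINT \<xi>|lborel. complex_of_real (exp (- (\<xi> / n)\<^sup>2 / 2)) * cis (r * \<xi>))
    = complex_of_real (n * (sqrt (2 * pi) * exp (- (r * n)\<^sup>2 / 2)))"
proof -
  have "(LINT \<xi>|lborel. complex_of_real (exp (- (\<xi> / n)\<^sup>2 / 2)) * cis (r * \<xi>))
      = \<bar>n\<bar> *\<^sub>R (LINT x|lborel. complex_of_real (exp (- ((0 + n * x) / n)\<^sup>2 / 2)) * cis (r * (0 + n * x)))"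
    by (rule lborel_integral_real_affine) (use n in simp)
  also have "\<dots> = n *\<^sub>R (LINT x|lborel. complex_of_real (exp (- x\<^sup>2 / 2)) * cis ((r * n) * x))"
    using n by (simp add: mult.assoc)
  finally show ?thesis
    unfolding gaussian_fourier by (simp add: scaleR_conv_of_real)
qed

lemma gaussian_scaled_integrable:
  assumes "n > 0" shows "integrable lborel (\<lambda>\<xi>::real. exp (- (\<xi> / n)\<^sup>2 / 2))"
  using lborel_integrable_real_affine[OF gaussian_integrable, of "1 / n" 0] assms by simp

text \<open>Inserting the Gaussian factor \<open>exp (- (\<xi>/n)\<^sup>2/2)\<close> makes all integrals absolutely convergent. By
  Fubini's theorem the integral of \<open>|\<phi>\<^sup>^(\<xi>)|\<^sup>2\<close> with this factor is an average of the autocorrelation of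
  \<open>\<phi>\<close> at distances of order \<open>1/n\<close>.\<close>

lemma FT_gaussian_mean:
  assumes \<phi>: "\<phi> \<in> Cc" and n: "n > 0"
  shows "(LINT \<xi>|lborel. complex_of_real (exp (- (\<xi> / n)\<^sup>2 / 2)) * cinner (FT \<phi> \<xi>) (FT \<phi> \<xi>))
    = (LINT t|lborel. LINT r|lborel. complex_of_real (\<kappa> * exp (- r\<^sup>2 / 2)) * cinner (\<phi> (t + r / n)) (\<phi> t))"
proof -
  define G where "G \<xi> = exp (- (\<xi> / n)\<^sup>2 / 2)" for \<xi>
  have Gi: "integrable lborel G" unfolding G_def by (rule gaussian_scaled_integrable[OF n])
  have G0: "G \<xi> \<ge> 0" for \<xi> by (simp add: G_def)
  have Gc: "continuous_on UNIV G" unfolding G_def using n by (intro continuous_intros) auto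
  obtain C where C: "C \<ge> 0" "\<And>\<xi>. norm (FT \<phi> \<xi>) \<le> C"
    and "\<And>\<xi> \<eta>. norm (FT \<phi> \<xi> - FT \<phi> \<eta>) \<le> C * \<bar>\<xi> - \<eta>\<bar>"
    by (rule FT_bounded_and_Lipschitz[OF \<phi>]) (rule that)
  obtain a B where "a > 0" and B: "B > 0" "\<And>t. norm (\<phi> t) \<le> B * indicator {- a..a} t"
    and "\<And>t. \<bar>t\<bar> > a \<Longrightarrow> \<phi> t = 0"
    by (rule Cc_bound[OF \<phi>]) (rule that)
  have Bi: "integrable lborel (\<lambda>t. D * (B * indicator {- a..a} t))" for D :: real
    by (intro integrable_mult_right integrable_lborel_indicator_Icc)
  have \<phi>c: "continuous_on UNIV \<phi>" using \<phi> by (simp add: Cc_def)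
  have Fc: "continuous_on UNIV (FT \<phi>)" by (rule FT_continuous[OF \<phi>])
  have kk: "complex_of_real \<kappa> * complex_of_real \<kappa> * complex_of_real (sqrt (2 * pi)) = complex_of_real \<kappa>"
  proof -
    have "1 / s * (1 / s) * s = 1 / s" if "s \<noteq> 0" for s :: real using that by simp
    from this[of "sqrt (2 * pi)"] have "\<kappa> * \<kappa> * sqrt (2 * pi) = \<kappa>" by simp
    then show ?thesis by (metis of_real_mult)
  qed
  have cks: "cmod (complex_of_real \<kappa>) \<le> 1"
    using pi_gt3 by (simp add: real_le_rsqrt norm_divide)
  define f1 where "f1 t \<xi> = complex_of_real (G \<xi>) * (complex_of_real \<kappa> * (cis (- (t * \<xi>)) * cinner (FT \<phi> \<xi>) (\<phi> t)))" for t \<xi>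
  define f2 where "f2 t s \<xi> = complex_of_real (G \<xi>) * (complex_of_real \<kappa> * (cis (- (t * \<xi>)) *
      (complex_of_real \<kappa> * (cis (s * \<xi>) * cinner (\<phi> s) (\<phi> t)))))" for t s \<xi>
  have "(LINT \<xi>|lborel. complex_of_real (G \<xi>) * cinner (FT \<phi> \<xi>) (FT \<phi> \<xi>)) = (LINT \<xi>|lborel. LINT t|lborel. f1 t \<xi>)"
    unfolding f1_def FT_cinner_right[OF \<phi>, of "FT \<phi> _"] by simp
  also have "\<dots> = (LINT t|lborel. LINT \<xi>|lborel. f1 t \<xi>)"
  proof (rule Fubini_continuous[OF _ _ Bi[of C] Gi])
    show "continuous_on UNIV (\<lambda>p. f1 (fst p) (snd p))"
      unfolding f1_def
      by (intro continuous_intros continuous_on_cinner continuous_on_compose2[OF Gc]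
          continuous_on_compose2[OF Fc] continuous_on_compose2[OF \<phi>c]) auto
    fix t \<xi>
    have "cmod (cinner (FT \<phi> \<xi>) (\<phi> t)) \<le> C * (B * indicator {- a..a} t)"
      using Cauchy_Schwarz by (rule order_trans) (intro mult_mono C B norm_ge_zero)
    then have "G \<xi> * (cmod (complex_of_real \<kappa>) * cmod (cinner (FT \<phi> \<xi>) (\<phi> t))) \<le> G \<xi> * (1 * (C * (B * indicator {- a..a} t)))"
      by (intro mult_left_mono mult_mono cks G0) auto
    then show "norm (f1 t \<xi>) \<le> C * (B * indicator {- a..a} t) * G \<xi>"
      unfolding f1_def norm_mult using G0[of \<xi>] by (simp add: mult.commute)
  qed
  also have "\<dots> = (LINT t|lborel. LINT r|lborel. complex_of_real (\<kappa> * exp (- r\<^sup>2 / 2)) * cinner (\<phi> (t + r / n)) (\<phi> t))"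
  proof (rule Bochner_Integration.integral_cong[OF refl])
    fix t
    have "(LINT \<xi>|lborel. f1 t \<xi>) = (LINT \<xi>|lborel. LINT s|lborel. f2 t s \<xi>)"
      unfolding f1_def f2_def FT_cinner_left[OF \<phi>] by simp
    also have "\<dots> = (LINT s|lborel. LINT \<xi>|lborel. f2 t s \<xi>)"
    proof (rule Fubini_continuous[OF _ _ Bi[of B] Gi])
      show "continuous_on UNIV (\<lambda>p. f2 t (fst p) (snd p))"
        unfolding f2_def
        by (intro continuous_intros continuous_on_cinner continuous_on_compose2[OF Gc]
            continuous_on_compose2[OF \<phi>c]) auto
      fix s \<xi>
      have "norm (\<phi> t) \<le> B"
        using B(2)[of t] B(1) by (cases "t \<in> {- a..a}") simp_all
      then have "cmod (cinner (\<phi> s) (\<phi> t)) \<le> (B * indicator {- a..a} s) * B"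
        using Cauchy_Schwarz[of "\<phi> s" "\<phi> t"] B(1)
        by (elim order_trans) (intro mult_mono B norm_ge_zero mult_nonneg_nonneg; simp)
      then have "G \<xi> * (cmod (complex_of_real \<kappa>) * (cmod (complex_of_real \<kappa>) * cmod (cinner (\<phi> s) (\<phi> t))))
          \<le> G \<xi> * (1 * (1 * ((B * indicator {- a..a} s) * B)))"
        by (intro mult_left_mono mult_mono cks G0) auto
      then show "norm (f2 t s \<xi>) \<le> B * (B * indicator {- a..a} s) * G \<xi>"
        unfolding f2_def norm_mult using G0[of \<xi>] by (simp add: mult.commute mult.left_commute)
    qed
    also have "\<dots> = (LINT s|lborel. complex_of_real (\<kappa> * n * exp (- ((s - t) * n)\<^sup>2 / 2)) * cinner (\<phi> s) (\<phi> t))"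
    proof (rule Bochner_Integration.integral_cong[OF refl])
      fix s
      have "f2 t s \<xi> = (complex_of_real \<kappa> * complex_of_real \<kappa> * cinner (\<phi> s) (\<phi> t)) *
          (complex_of_real (G \<xi>) * cis ((s - t) * \<xi>))" for \<xi>
      proof -
        have "cis ((s - t) * \<xi>) = cis (- (t * \<xi>)) * cis (s * \<xi>)"
          by (simp add: cis_mult left_diff_distrib)
        then show ?thesis unfolding f2_def by (simp only: mult_ac)
      qed
      then have "(LINT \<xi>|lborel. f2 t s \<xi>) = (complex_of_real \<kappa> * complex_of_real \<kappa> * cinner (\<phi> s) (\<phi> t)) *
          complex_of_real (n * (sqrt (2 * pi) * exp (- ((s - t) * n)\<^sup>2 / 2)))"
        by (simp only: integral_mult_right_zero G_def gaussian_fourier_scaled[OF n])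
      also have "\<dots> = (complex_of_real \<kappa> * complex_of_real \<kappa> * complex_of_real (sqrt (2 * pi))) *
          (complex_of_real (n * exp (- ((s - t) * n)\<^sup>2 / 2)) * cinner (\<phi> s) (\<phi> t))"
        by (simp only: of_real_mult mult_ac)
      also have "\<dots> = complex_of_real (\<kappa> * n * exp (- ((s - t) * n)\<^sup>2 / 2)) * cinner (\<phi> s) (\<phi> t)"
        unfolding kk by (simp only: of_real_mult mult_ac)
      finally show "(LINT \<xi>|lborel. f2 t s \<xi>) =
        complex_of_real (\<kappa> * n * exp (- ((s - t) * n)\<^sup>2 / 2)) * cinner (\<phi> s) (\<phi> t)" .
    qed
    also have "\<dots> = \<bar>1 / n\<bar> *\<^sub>R (LINT r|lborel. complex_of_real (\<kappa> * n * exp (- (((t + 1 / n * r) - t) * n)\<^sup>2 / 2)) *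
        cinner (\<phi> (t + 1 / n * r)) (\<phi> t))"
      by (rule lborel_integral_real_affine) (use n in simp)
    also have "\<dots> = (LINT r|lborel. complex_of_real (\<kappa> * exp (- r\<^sup>2 / 2)) * cinner (\<phi> (t + r / n)) (\<phi> t))"
      unfolding scaleR_conv_of_real integral_mult_right_zero[symmetric]
    proof (rule Bochner_Integration.integral_cong[OF refl])
      fix r
      show "of_real \<bar>1 / n\<bar> * (complex_of_real (\<kappa> * n * exp (- (((t + 1 / n * r) - t) * n)\<^sup>2 / 2)) *
          cinner (\<phi> (t + 1 / n * r)) (\<phi> t)) = complex_of_real (\<kappa> * exp (- r\<^sup>2 / 2)) * cinner (\<phi> (t + r / n)) (\<phi> t)"
        using n by simp
    qed
    finally show "(LINT \<xi>|lborel. f1 t \<xi>) =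
      (LINT r|lborel. complex_of_real (\<kappa> * exp (- r\<^sup>2 / 2)) * cinner (\<phi> (t + r / n)) (\<phi> t))" .
  qed
  finally show ?thesis by (simp add: G_def)
qed


lemma L2_norm_0_lborel:
  assumes "continuous_on UNIV f" shows "(L2_norm 0 f)\<^sup>2 = (LINT t|lborel. (norm (f t))\<^sup>2)"
  unfolding L2_0_power2
  by (rule integral_completion) (intro borel_measurable_continuous_UNIV continuous_intros assms; simp)

lemma L2_0_continuousI:
  assumes "continuous_on UNIV f" "integrable lborel (\<lambda>t. (norm (f t))\<^sup>2)" shows "f \<in> L2 0"
  unfolding L2_0
proof
  have m: "(\<lambda>t. (norm (f t))\<^sup>2) \<in> borel_measurable lborel"
    by (intro borel_measurable_continuous_UNIV continuous_intros assms(1); simp)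
  show "integrable lebesgue (\<lambda>t. (norm (f t))\<^sup>2)"
    using assms(2) unfolding integrable_completion[OF m] .
qed (rule strongly_measurable_continuous[OF assms(1)])

text \<open>Let the width of the Gaussian tend to infinity. The integrals of \<open>|\<phi>\<^sup>^|\<^sup>2\<close> with the Gaussian factor increase to the
  integral without it, and the averaged autocorrelation tends to its value at distance zero, the integral of
  \<open>|\<phi>|\<^sup>2\<close>.\<close>

theorem Plancherel_Cc:
  fixes \<phi> :: "real \<Rightarrow> 'h::complex_hilbert"
  assumes \<phi>: "\<phi> \<in> Cc"
  shows "FT \<phi> \<in> L2 0" "L2_norm 0 (FT \<phi>) = L2_norm 0 \<phi>"
proof -
  define n where "n m = real (Suc m)" for m
  have n: "n m > 0" for m by (simp add: n_def)
  define G where "G m \<xi> = exp (- (\<xi> / n m)\<^sup>2 / 2)" for m \<xi>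
  define g where "g r = \<kappa> * exp (- r\<^sup>2 / 2)" for r :: real
  have g0: "g r \<ge> 0" for r by (simp add: g_def)
  have gi: "integrable lborel g" unfolding g_def by (intro integrable_mult_right gaussian_integrable)
  have g1: "(LINT r|lborel. g r) = 1" unfolding g_def by (rule gaussian_integral)
  have gc: "continuous_on UNIV g" unfolding g_def by (intro continuous_intros; simp)
  obtain a B where "a > 0" and B: "B > 0" "\<And>t. norm (\<phi> t) \<le> B * indicator {- a..a} t"
    and "\<And>t. \<bar>t\<bar> > a \<Longrightarrow> \<phi> t = 0"
    by (rule Cc_bound[OF \<phi>]) (rule that)
  have \<phi>B: "norm (\<phi> t) \<le> B" for t
    using B(2)[of t] B(1) by (cases "t \<in> {- a..a}") simp_all
  have \<phi>c: "continuous_on UNIV \<phi>" using \<phi> by (simp add: Cc_def)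
  obtain C where C: "C \<ge> 0" "\<And>\<xi>. norm (FT \<phi> \<xi>) \<le> C"
    and "\<And>\<xi> \<eta>. norm (FT \<phi> \<xi> - FT \<phi> \<eta>) \<le> C * \<bar>\<xi> - \<eta>\<bar>"
    by (rule FT_bounded_and_Lipschitz[OF \<phi>]) (rule that)
  have Fc: "continuous_on UNIV (FT \<phi>)" by (rule FT_continuous[OF \<phi>])
  define h where "h m t r = complex_of_real (g r) * cinner (\<phi> (t + r / n m)) (\<phi> t)" for m t r
  define H where "H m t = (LINT r|lborel. h m t r)" for m t
  have hc: "continuous_on UNIV (\<lambda>p. h m (fst p) (snd p))" for m
    unfolding h_def using n[of m]
    by (intro continuous_intros continuous_on_cinner continuous_on_compose2[OF gc]
        continuous_on_compose2[OF \<phi>c]) auto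
  have hc': "continuous_on UNIV (h m t)" for m t
    unfolding h_def using n[of m]
    by (intro continuous_intros continuous_on_cinner continuous_on_compose2[OF gc]
        continuous_on_compose2[OF \<phi>c]) auto
  have hb: "norm (h m t r) \<le> B * norm (\<phi> t) * g r" for m t r
  proof -
    have "cmod (cinner (\<phi> (t + r / n m)) (\<phi> t)) \<le> B * norm (\<phi> t)"
      using Cauchy_Schwarz by (rule order_trans) (intro mult_right_mono \<phi>B norm_ge_zero)
    then have "g r * cmod (cinner (\<phi> (t + r / n m)) (\<phi> t)) \<le> g r * (B * norm (\<phi> t))"
      by (rule mult_left_mono) (rule g0)
    then show ?thesis unfolding h_def norm_mult using g0[of r] by (simp add: mult.commute)
  qed
  have hbi: "integrable lborel (\<lambda>r. B * norm (\<phi> t) * g r)" for t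
    by (intro integrable_mult_right gi)
  have hi: "integrable lborel (h m t)" for m t
  proof (rule Bochner_Integration.integrable_bound[OF hbi[of t]])
    show "h m t \<in> borel_measurable lborel" by (rule borel_measurable_continuous_UNIV[OF hc'])
    show "AE r in lborel. norm (h m t r) \<le> norm (B * norm (\<phi> t) * g r)"
      by (rule AE_I2, rule order_trans[OF hb]) simp
  qed
  have Hb: "norm (H m t) \<le> B * (B * indicator {- a..a} t)" for m t
  proof -
    have "norm (H m t) \<le> (LINT r|lborel. B * norm (\<phi> t) * g r)"
      unfolding H_def by (intro Bochner_Integration.integral_norm_bound_integral hi hbi hb)
    also have "\<dots> = B * norm (\<phi> t)" using g1 by simp
    also have "\<dots> \<le> B * (B * indicator {- a..a} t)"
      using B(1) by (intro mult_left_mono B(2)) simp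
    finally show ?thesis .
  qed
  have Hm: "H m \<in> borel_measurable lborel" for m
  proof -
    have "(\<lambda>p. h m (fst p) (snd p)) \<in> borel_measurable borel"
      by (rule borel_measurable_continuous_onI[OF hc])
    then have "case_prod (h m) \<in> borel_measurable (lborel \<Otimes>\<^sub>M lborel)"
      by (simp add: split_beta' lborel_prod)
    then show ?thesis unfolding H_def by (rule lborel.borel_measurable_lebesgue_integral)
  qed
  have nlim: "(\<lambda>m. r / n m) \<longlonglongrightarrow> 0" for r
    unfolding n_def using tendsto_mult[OF tendsto_const[of r] LIMSEQ_inverse_real_of_nat]
    by (simp add: divide_inverse)
  have Hlim: "(\<lambda>m. H m t) \<longlonglongrightarrow> complex_of_real ((norm (\<phi> t))\<^sup>2)" for t
  proof -
    have "H m t = (LINT r|lborel. h m t r)" for m by (simp add: H_def)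
    have "(\<lambda>m. LINT r|lborel. h m t r) \<longlonglongrightarrow> (LINT r|lborel. complex_of_real (g r) * cinner (\<phi> t) (\<phi> t))"
    proof (rule integral_dominated_convergence[where w = "\<lambda>r. B * norm (\<phi> t) * g r"])
      show "(\<lambda>r. complex_of_real (g r) * cinner (\<phi> t) (\<phi> t)) \<in> borel_measurable lborel"
        by (intro borel_measurable_continuous_UNIV continuous_intros gc; simp)
      show "h m t \<in> borel_measurable lborel" for m by (rule borel_measurable_continuous_UNIV[OF hc'])
      show "AE r in lborel. (\<lambda>m. h m t r) \<longlonglongrightarrow> complex_of_real (g r) * cinner (\<phi> t) (\<phi> t)"
      proof (rule AE_I2)
        fix r
        have "(\<lambda>m. t + r / n m) \<longlonglongrightarrow> t + 0" by (intro tendsto_intros nlim)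
        moreover have "isCont \<phi> (t + 0)" using \<phi>c by (simp add: continuous_on_eq_continuous_at)
        ultimately have "(\<lambda>m. \<phi> (t + r / n m)) \<longlonglongrightarrow> \<phi> (t + 0)" by (rule isCont_tendsto_compose[rotated])
        then show "(\<lambda>m. h m t r) \<longlonglongrightarrow> complex_of_real (g r) * cinner (\<phi> t) (\<phi> t)"
          unfolding h_def by (intro tendsto_mult tendsto_const tendsto_cinner) simp
      qed
    qed (use hbi hb in auto)
    moreover have "(LINT r|lborel. complex_of_real (g r) * cinner (\<phi> t) (\<phi> t)) = complex_of_real ((norm (\<phi> t))\<^sup>2)"
      using g1 by (simp add: cinner_self integral_complex_of_real)
    ultimately show ?thesis unfolding H_def by simp
  qed
  define A where "A m = (LINT \<xi>|lborel. G m \<xi> * (norm (FT \<phi> \<xi>))\<^sup>2)" for m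
  have A: "complex_of_real (A m) = (LINT t|lborel. H m t)" for m
  proof -
    have "complex_of_real (A m) = (LINT \<xi>|lborel. complex_of_real (G m \<xi>) * cinner (FT \<phi> \<xi>) (FT \<phi> \<xi>))"
      unfolding A_def integral_complex_of_real[symmetric] by (simp add: cinner_self)
    also have "\<dots> = (LINT t|lborel. H m t)"
      unfolding G_def H_def h_def g_def by (rule FT_gaussian_mean[OF \<phi> n])
    finally show ?thesis .
  qed
  have "(\<lambda>m. LINT t|lborel. H m t) \<longlonglongrightarrow> (LINT t|lborel. complex_of_real ((norm (\<phi> t))\<^sup>2))"
  proof (rule integral_dominated_convergence[where w = "\<lambda>t. B * (B * indicator {- a..a} t)"])
    show "(\<lambda>t. complex_of_real ((norm (\<phi> t))\<^sup>2)) \<in> borel_measurable lborel"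
      by (intro borel_measurable_continuous_UNIV continuous_intros \<phi>c; simp)
    show "integrable lborel (\<lambda>t. B * (B * indicator {- a..a} t))"
      by (intro integrable_mult_right integrable_lborel_indicator_Icc)
  qed (use Hm Hlim Hb in auto)
  then have "(\<lambda>m. complex_of_real (A m)) \<longlonglongrightarrow> complex_of_real (LINT t|lborel. (norm (\<phi> t))\<^sup>2)"
    unfolding A[symmetric] integral_complex_of_real .
  then have Alim: "A \<longlonglongrightarrow> (LINT t|lborel. (norm (\<phi> t))\<^sup>2)"
    by (simp add: tendsto_of_real_iff)
  have GF: "integrable lborel (\<lambda>\<xi>. G m \<xi> * (norm (FT \<phi> \<xi>))\<^sup>2)" for m
  proof (rule Bochner_Integration.integrable_bound)
    show "integrable lborel (\<lambda>\<xi>. G m \<xi> * C\<^sup>2)"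
      unfolding G_def by (intro integrable_mult_left gaussian_scaled_integrable n)
    have "n m \<noteq> 0" using n[of m] by simp
    then show "(\<lambda>\<xi>. G m \<xi> * (norm (FT \<phi> \<xi>))\<^sup>2) \<in> borel_measurable lborel"
      unfolding G_def by (intro borel_measurable_continuous_UNIV continuous_intros Fc) auto
    have "G m \<xi> * (norm (FT \<phi> \<xi>))\<^sup>2 \<le> G m \<xi> * C\<^sup>2" for \<xi>
      unfolding G_def by (intro mult_left_mono power_mono C norm_ge_zero) simp
    then show "AE \<xi> in lborel. norm (G m \<xi> * (norm (FT \<phi> \<xi>))\<^sup>2) \<le> norm (G m \<xi> * C\<^sup>2)"
      by (intro AE_I2) (simp add: G_def)
  qed
  have mono: "AE \<xi> in lborel. mono (\<lambda>m. G m \<xi> * (norm (FT \<phi> \<xi>))\<^sup>2)"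
  proof (rule AE_I2, rule monoI)
    fix \<xi> and m k :: nat assume "m \<le> k"
    have "\<bar>\<xi> / n k\<bar> \<le> \<bar>\<xi> / n m\<bar>"
      unfolding n_def abs_divide using \<open>m \<le> k\<close> by (intro divide_left_mono) auto
    then have "(\<xi> / n k)\<^sup>2 \<le> (\<xi> / n m)\<^sup>2" by (simp only: abs_le_square_iff)
    then have "G m \<xi> \<le> G k \<xi>" unfolding G_def by simp
    then show "G m \<xi> * (norm (FT \<phi> \<xi>))\<^sup>2 \<le> G k \<xi> * (norm (FT \<phi> \<xi>))\<^sup>2"
      by (rule mult_right_mono) simp
  qed
  have pos: "AE \<xi> in lborel. 0 \<le> G m \<xi> * (norm (FT \<phi> \<xi>))\<^sup>2" for m
    by (intro AE_I2) (simp add: G_def)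
  have lim: "AE \<xi> in lborel. (\<lambda>m. G m \<xi> * (norm (FT \<phi> \<xi>))\<^sup>2) \<longlonglongrightarrow> (norm (FT \<phi> \<xi>))\<^sup>2"
  proof (rule AE_I2)
    fix \<xi>
    have "(\<lambda>m. exp (- (\<xi> / n m)\<^sup>2 / 2) * (norm (FT \<phi> \<xi>))\<^sup>2) \<longlonglongrightarrow> exp (- 0\<^sup>2 / 2) * (norm (FT \<phi> \<xi>))\<^sup>2"
      by (intro tendsto_intros nlim) simp
    then show "(\<lambda>m. G m \<xi> * (norm (FT \<phi> \<xi>))\<^sup>2) \<longlonglongrightarrow> (norm (FT \<phi> \<xi>))\<^sup>2" by (simp add: G_def)
  qed
  have meas: "(\<lambda>\<xi>. (norm (FT \<phi> \<xi>))\<^sup>2) \<in> borel_measurable lborel"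
    by (intro borel_measurable_continuous_UNIV continuous_intros Fc; simp)
  note conv = integral_monotone_convergence_nonneg[OF GF mono pos lim Alim[unfolded A_def] meas]
  show "FT \<phi> \<in> L2 0" by (rule L2_0_continuousI[OF Fc conv(1)])
  have "(L2_norm 0 (FT \<phi>))\<^sup>2 = (L2_norm 0 \<phi>)\<^sup>2"
    unfolding L2_norm_0_lborel[OF Fc] L2_norm_0_lborel[OF \<phi>c] by (rule conv(2))
  then show "L2_norm 0 (FT \<phi>) = L2_norm 0 \<phi>"
    by (simp add: L2_norm_nonneg power2_eq_iff_nonneg)
qed

lemma FT_reflect:
  assumes "\<psi> \<in> Cc"
  shows "(\<lambda>t. FT \<psi> (- t)) \<in> L2 0" "L2_norm 0 (\<lambda>t. FT \<psi> (- t)) = L2_norm 0 \<psi>"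
proof -
  have Fc: "continuous_on UNIV (FT \<psi>)" by (rule FT_continuous[OF assms])
  have Rc: "continuous_on UNIV (\<lambda>t. FT \<psi> (- t))"
    by (intro continuous_on_compose2[OF Fc] continuous_intros) auto
  have "(\<lambda>\<xi>. (norm (FT \<psi> \<xi>))\<^sup>2) \<in> borel_measurable lborel"
    by (intro borel_measurable_continuous_UNIV continuous_intros Fc; simp)
  then have i: "integrable lborel (\<lambda>\<xi>. (norm (FT \<psi> \<xi>))\<^sup>2)"
    using Plancherel_Cc(1)[OF assms] by (simp add: L2_0 integrable_completion)
  have "integrable lborel (\<lambda>t. (norm (FT \<psi> (- t)))\<^sup>2)"
    using lborel_integrable_real_affine[OF i, of "-1" 0] by simp
  then show "(\<lambda>t. FT \<psi> (- t)) \<in> L2 0" by (rule L2_0_continuousI[OF Rc])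
  have "(L2_norm 0 (\<lambda>t. FT \<psi> (- t)))\<^sup>2 = (L2_norm 0 (FT \<psi>))\<^sup>2"
    unfolding L2_norm_0_lborel[OF Rc] L2_norm_0_lborel[OF Fc]
    using lborel_integral_real_affine[of "-1" "\<lambda>\<xi>. (norm (FT \<psi> \<xi>))\<^sup>2" 0] by simp
  then show "L2_norm 0 (\<lambda>t. FT \<psi> (- t)) = L2_norm 0 \<psi>"
    using Plancherel_Cc(2)[OF assms] by (simp add: L2_norm_nonneg power2_eq_iff_nonneg)
qed

lemma FT_duality:
  assumes \<phi>: "\<phi> \<in> Cc" and \<psi>: "\<psi> \<in> Cc"
  shows "L2_inner 0 (FT \<phi>) \<psi> = L2_inner 0 \<phi> (\<lambda>t. FT \<psi> (- t))"
proof -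
  have \<phi>c: "continuous_on UNIV \<phi>" and \<psi>c: "continuous_on UNIV \<psi>" using \<phi> \<psi> by (auto simp: Cc_def)
  have F\<phi>: "continuous_on UNIV (FT \<phi>)" and F\<psi>: "continuous_on UNIV (FT \<psi>)"
    by (rule FT_continuous[OF \<phi>], rule FT_continuous[OF \<psi>])
  obtain a A where "a > 0" and A: "A > 0" "\<And>t. norm (\<phi> t) \<le> A * indicator {- a..a} t"
    and "\<And>t. \<bar>t\<bar> > a \<Longrightarrow> \<phi> t = 0"
    by (rule Cc_bound[OF \<phi>]) (rule that)
  obtain b B where "b > 0" and B: "B > 0" "\<And>t. norm (\<psi> t) \<le> B * indicator {- b..b} t"
    and "\<And>t. \<bar>t\<bar> > b \<Longrightarrow> \<psi> t = 0"
    by (rule Cc_bound[OF \<psi>]) (rule that)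
  have "L2_inner 0 (FT \<phi>) \<psi> = (LINT \<xi>|lborel. cinner (FT \<phi> \<xi>) (\<psi> \<xi>))"
    unfolding L2_inner_0
    by (rule integral_completion) (intro borel_measurable_continuous_UNIV continuous_on_cinner F\<phi> \<psi>c)
  also have "\<dots> = (LINT \<xi>|lborel. of_real \<kappa> * (LINT t|lborel. cis (t * \<xi>) * cinner (\<phi> t) (\<psi> \<xi>)))"
    unfolding FT_cinner_left[OF \<phi>] ..
  also have "\<dots> = of_real \<kappa> * (LINT \<xi>|lborel. LINT t|lborel. cis (t * \<xi>) * cinner (\<phi> t) (\<psi> \<xi>))"
    by (rule integral_mult_right_zero)
  also have "(LINT \<xi>|lborel. LINT t|lborel. cis (t * \<xi>) * cinner (\<phi> t) (\<psi> \<xi>))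
      = (LINT t|lborel. LINT \<xi>|lborel. cis (t * \<xi>) * cinner (\<phi> t) (\<psi> \<xi>))"
  proof (rule Fubini_continuous)
    show "continuous_on UNIV (\<lambda>p. cis (fst p * snd p) * cinner (\<phi> (fst p)) (\<psi> (snd p)))"
      by (intro continuous_intros continuous_on_cinner continuous_on_compose2[OF \<phi>c]
          continuous_on_compose2[OF \<psi>c]) auto
    show "norm (cis (s * x) * cinner (\<phi> s) (\<psi> x)) \<le> (A * indicator {- a..a} s) * (B * indicator {- b..b} x)" for s x
    proof -
      have "norm (cis (s * x) * cinner (\<phi> s) (\<psi> x)) \<le> norm (\<phi> s) * norm (\<psi> x)"
        using Cauchy_Schwarz[of "\<phi> s" "\<psi> x"] by (simp add: norm_mult)
      also have "\<dots> \<le> (A * indicator {- a..a} s) * (B * indicator {- b..b} x)"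
        using A(1) by (intro mult_mono A B norm_ge_zero) simp
      finally show ?thesis .
    qed
  qed (intro integrable_mult_right integrable_lborel_indicator_Icc)+
  also have "of_real \<kappa> * (LINT t|lborel. LINT \<xi>|lborel. cis (t * \<xi>) * cinner (\<phi> t) (\<psi> \<xi>))
      = (LINT t|lborel. of_real \<kappa> * (LINT \<xi>|lborel. cis (t * \<xi>) * cinner (\<phi> t) (\<psi> \<xi>)))"
    by (rule integral_mult_right_zero[symmetric])
  also have "\<dots> = (LINT t|lborel. cinner (\<phi> t) (FT \<psi> (- t)))"
    unfolding FT_cinner_right[OF \<psi>] by (simp add: mult.commute)
  also have "\<dots> = L2_inner 0 \<phi> (\<lambda>t. FT \<psi> (- t))"
    unfolding L2_inner_0
    by (rule integral_completion[symmetric])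
      (intro borel_measurable_continuous_UNIV continuous_on_cinner \<phi>c continuous_on_compose2[OF F\<psi>] continuous_intros; simp)
  finally show ?thesis .
qed


subsection \<open>Unitarity\<close>

lemma Bex_graph_Cc:
  "(\<exists>(f', g')\<in>{(\<phi>, F \<phi>) |\<phi>. continuous_on UNIV \<phi> \<and> compactly_supported \<phi>}. P f' g') \<longleftrightarrow> (\<exists>\<phi>\<in>Cc. P \<phi> (F \<phi>))"
  unfolding Cc_def by blast

lemma fourier_0_iff:
  "(f, g) \<in> fourier_laplace 0 \<longleftrightarrow> f \<in> L2 0 \<and> g \<in> L2 0 \<and>
    (\<forall>e>0. \<exists>\<phi>\<in>Cc. L2_norm 0 (\<lambda>t. f t - \<phi> t) < e \<and> L2_norm 0 (\<lambda>t. g t - FT \<phi> t) < e)"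
proof -
  have eq: "(\<exists>\<phi>\<in>Cc. \<phi> \<in> L2 0 \<and> FT \<phi> \<in> L2 0 \<and> Q \<phi>) \<longleftrightarrow> (\<exists>\<phi>\<in>Cc. Q \<phi>)"
    for Q :: "(real \<Rightarrow> 'a) \<Rightarrow> bool"
  proof (rule bex_cong[OF refl])
    fix \<phi> :: "real \<Rightarrow> 'a" assume "\<phi> \<in> Cc"
    from Cc_L2_0[OF this] Plancherel_Cc(1)[OF this]
    show "(\<phi> \<in> L2 0 \<and> FT \<phi> \<in> L2 0 \<and> Q \<phi>) = Q \<phi>" by (simp only: simp_thms)
  qed
  show ?thesis
    unfolding fourier_laplace_def L2_closure_def mem_Collect_eq case_prod_conv Bex_graph_Cc eq ..
qed

lemma Cc_unweight: "\<phi> \<in> Cc \<Longrightarrow> unweight \<nu> \<phi> \<in> Cc"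
  unfolding unweight_def by (rule Cc_scaleC_fun, assumption, intro continuous_intros)

lemma fourier_laplace_unweight: "(f, g) \<in> fourier_laplace \<nu> \<longleftrightarrow> (unweight \<nu> f, g) \<in> fourier_laplace 0"
proof -
  have eq: "(\<exists>\<phi>\<in>Cc. \<phi> \<in> L2 \<nu> \<and> laplace_integral \<nu> \<phi> \<in> L2 0 \<and> L2_norm \<nu> (\<lambda>t. f t - \<phi> t) < e \<and>
      L2_norm 0 (\<lambda>t. g t - laplace_integral \<nu> \<phi> t) < e)
    \<longleftrightarrow> (\<exists>\<phi>\<in>Cc. L2_norm 0 (\<lambda>t. unweight \<nu> f t - \<phi> t) < e \<and> L2_norm 0 (\<lambda>t. g t - FT \<phi> t) < e)"
    (is "?A \<longleftrightarrow> ?B") for e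
  proof
    assume ?A
    then obtain \<phi> where \<phi>: "\<phi> \<in> Cc" "L2_norm \<nu> (\<lambda>t. f t - \<phi> t) < e"
      "L2_norm 0 (\<lambda>t. g t - laplace_integral \<nu> \<phi> t) < e"
      by blast
    then show ?B
      unfolding L2_norm_unweight[of \<nu>] unweight_linear laplace_integral_unweight[of \<nu>]
      by (intro bexI[of _ "unweight \<nu> \<phi>"] conjI Cc_unweight)
  next
    assume ?B
    then obtain \<phi> where \<phi>: "\<phi> \<in> Cc" "L2_norm 0 (\<lambda>t. unweight \<nu> f t - \<phi> t) < e" "L2_norm 0 (\<lambda>t. g t - FT \<phi> t) < e"
      by blast
    have "unweight (- \<nu>) \<phi> \<in> L2 \<nu>" unfolding L2_iff_unweight[of _ \<nu>] using Cc_L2_0[OF \<phi>(1)] by simp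
    moreover have "laplace_integral \<nu> (unweight (- \<nu>) \<phi>) = FT \<phi>" by (simp add: laplace_integral_unweight[of \<nu>])
    moreover have "L2_norm \<nu> (\<lambda>t. f t - unweight (- \<nu>) \<phi> t) < e"
      unfolding L2_norm_unweight[of \<nu>] unweight_linear using \<phi>(2) by simp
    ultimately show ?A
      using \<phi>(3) Plancherel_Cc(1)[OF \<phi>(1)]
      by (intro bexI[OF _ Cc_unweight[OF \<phi>(1), of "- \<nu>"]]) simp
  qed
  show ?thesis
    unfolding fourier_0_iff
    unfolding fourier_laplace_def L2_closure_def mem_Collect_eq case_prod_conv Bex_graph_Cc eq
      L2_iff_unweight[of f \<nu>] ..
qed

lemma fourier_L2: "(f, g) \<in> fourier_laplace \<nu> \<Longrightarrow> f \<in> L2 \<nu>" "(f, g) \<in> fourier_laplace \<nu> \<Longrightarrow> g \<in> L2 0"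
  by (auto simp: fourier_laplace_def L2_closure_def)

lemma fourier_0_Cc: "\<phi> \<in> Cc \<Longrightarrow> (\<phi>, FT \<phi>) \<in> fourier_laplace 0"
  unfolding fourier_0_iff using Cc_L2_0[of \<phi>] Plancherel_Cc(1)[of \<phi>]
  by (intro conjI allI impI bexI[of _ \<phi>]) (simp_all add: L2_norm_0)

lemma fourier_Cc: "\<phi> \<in> Cc \<Longrightarrow> (\<phi>, laplace_integral \<nu> \<phi>) \<in> fourier_laplace \<nu>"
  unfolding fourier_laplace_unweight[of _ _ \<nu>] laplace_integral_unweight[of \<nu>]
  by (intro fourier_0_Cc Cc_unweight)

lemma fourier_0_norm:
  assumes "(f, g) \<in> fourier_laplace 0" shows "L2_norm 0 g = L2_norm 0 f"
proof -
  have fg: "f \<in> L2 0" "g \<in> L2 0" using assms fourier_L2 by auto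
  have "\<bar>L2_norm 0 g - L2_norm 0 f\<bar> \<le> e" if "e > 0" for e
  proof -
    have "e / 2 > 0" using that by simp
    then obtain \<phi> where \<phi>: "\<phi> \<in> Cc" "L2_norm 0 (\<lambda>t. f t - \<phi> t) < e / 2" "L2_norm 0 (\<lambda>t. g t - FT \<phi> t) < e / 2"
      using assms unfolding fourier_0_iff by blast
    note L = Cc_L2_0[OF \<phi>(1)] Plancherel_Cc(1)[OF \<phi>(1)]
    show ?thesis
      using \<phi>(2,3) L2_norm_diff_le[OF fg(1) L(1)] L2_norm_diff_le[OF L(1) fg(1)]
        L2_norm_diff_le[OF fg(2) L(2)] L2_norm_diff_le[OF L(2) fg(2)] Plancherel_Cc(2)[OF \<phi>(1)]
        L2_norm_minus_commute[of 0 f \<phi>] L2_norm_minus_commute[of 0 g "FT \<phi>"] by linarith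
  qed
  then have "\<bar>L2_norm 0 g - L2_norm 0 f\<bar> \<le> 0" by (rule field_le_epsilon) simp
  then show ?thesis by simp
qed

lemma fourier_0_add:
  assumes "(f, g) \<in> fourier_laplace 0" "(f', g') \<in> fourier_laplace 0"
  shows "(\<lambda>t. f t + f' t, \<lambda>t. g t + g' t) \<in> fourier_laplace 0"
  unfolding fourier_0_iff
proof (intro conjI allI impI)
  have L: "f \<in> L2 0" "g \<in> L2 0" "f' \<in> L2 0" "g' \<in> L2 0" using assms fourier_L2 by auto
  show "(\<lambda>t. f t + f' t) \<in> L2 0" "(\<lambda>t. g t + g' t) \<in> L2 0" by (intro L2_add L)+
  fix e :: real assume "e > 0"
  then have e: "e / 2 > 0" by simp
  obtain \<phi> where \<phi>: "\<phi> \<in> Cc" "L2_norm 0 (\<lambda>t. f t - \<phi> t) < e / 2" "L2_norm 0 (\<lambda>t. g t - FT \<phi> t) < e / 2"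
    using assms(1) e unfolding fourier_0_iff by blast
  obtain \<psi> where \<psi>: "\<psi> \<in> Cc" "L2_norm 0 (\<lambda>t. f' t - \<psi> t) < e / 2" "L2_norm 0 (\<lambda>t. g' t - FT \<psi> t) < e / 2"
    using assms(2) e unfolding fourier_0_iff by blast
  note C = Cc_L2_0[OF \<phi>(1)] Plancherel_Cc(1)[OF \<phi>(1)] Cc_L2_0[OF \<psi>(1)] Plancherel_Cc(1)[OF \<psi>(1)]
  have "L2_norm 0 (\<lambda>t. (f t + f' t) - (\<phi> t + \<psi> t)) < e"
    using L2_triangle[OF L2_diff[OF L(1) C(1)] L2_diff[OF L(3) C(3)]] \<phi>(2) \<psi>(2)
    by (simp add: algebra_simps)
  moreover have "L2_norm 0 (\<lambda>t. (g t + g' t) - FT (\<lambda>t. \<phi> t + \<psi> t) t) < e"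
    using L2_triangle[OF L2_diff[OF L(2) C(2)] L2_diff[OF L(4) C(4)]] \<phi>(3) \<psi>(3)
    by (simp add: FT_add[OF \<phi>(1) \<psi>(1)] algebra_simps)
  ultimately show "\<exists>\<phi>\<in>Cc. L2_norm 0 (\<lambda>t. (f t + f' t) - \<phi> t) < e \<and> L2_norm 0 (\<lambda>t. (g t + g' t) - FT \<phi> t) < e"
    by (intro bexI[of _ "\<lambda>t. \<phi> t + \<psi> t"] conjI Cc_add \<phi>(1) \<psi>(1))
qed

lemma L2_0_bounded_clinear:
  assumes T: "bounded_clinear T" and f: "f \<in> L2 0"
  shows "(\<lambda>t. T (f t)) \<in> L2 0" "L2_norm 0 (\<lambda>t. T (f t)) \<le> onorm T * L2_norm 0 f"
proof -
  have sm: "strongly_measurable (\<lambda>t. T (f t))"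
    by (rule strongly_measurable_bounded_clinear[OF T]) (use f in \<open>simp add: L2_0\<close>)
  have le: "AE t in lebesgue. norm (T (f t)) \<le> onorm T * norm (f t)"
    by (intro AE_I2 bounded_clinear_norm_le T)
  show "(\<lambda>t. T (f t)) \<in> L2 0" by (rule L2_0_dominated[OF sm f le])
  have "onorm T \<ge> 0" using T by (simp add: bounded_clinear_def onorm_pos_le)
  then show "L2_norm 0 (\<lambda>t. T (f t)) \<le> onorm T * L2_norm 0 f"
    by (rule L2_0_norm_mono[OF f sm le])
qed

lemma fourier_0_bounded_clinear:
  assumes T: "bounded_clinear T" and fg: "(f, g) \<in> fourier_laplace 0"
  shows "(\<lambda>t. T (f t), \<lambda>t. T (g t)) \<in> fourier_laplace 0"
  unfolding fourier_0_iff
proof (intro conjI allI impI)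
  have L: "f \<in> L2 0" "g \<in> L2 0" using fg fourier_L2 by auto
  show "(\<lambda>t. T (f t)) \<in> L2 0" "(\<lambda>t. T (g t)) \<in> L2 0"
    by (rule L2_0_bounded_clinear(1)[OF T L(1)], rule L2_0_bounded_clinear(1)[OF T L(2)])
  have K: "onorm T \<ge> 0" using T by (simp add: bounded_clinear_def onorm_pos_le)
  fix e :: real assume e: "e > 0"
  then have "e / (onorm T + 1) > 0" using K by simp
  then obtain \<phi> where \<phi>: "\<phi> \<in> Cc" "L2_norm 0 (\<lambda>t. f t - \<phi> t) < e / (onorm T + 1)"
    "L2_norm 0 (\<lambda>t. g t - FT \<phi> t) < e / (onorm T + 1)"
    using fg unfolding fourier_0_iff by blast
  have small: "onorm T * x < e" if "x < e / (onorm T + 1)" "x \<ge> 0" for x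
  proof -
    have "onorm T * x \<le> (onorm T + 1) * x" using that(2) by (simp add: distrib_right)
    also have "\<dots> < e" using that(1) K by (simp add: pos_less_divide_eq mult.commute)
    finally show ?thesis .
  qed
  note C = Cc_L2_0[OF \<phi>(1)] Plancherel_Cc(1)[OF \<phi>(1)]
  have T\<phi>: "(\<lambda>t. T (\<phi> t)) \<in> Cc"
  proof (rule CcE[OF \<phi>(1)], rule CcI)
    fix a assume "continuous_on UNIV \<phi>"
    then show "continuous_on UNIV (\<lambda>t. T (\<phi> t))"
      using T unfolding bounded_clinear_def by (intro bounded_linear.continuous_on[of T]) auto
  qed (auto simp: bounded_clinear_linear[OF T])
  have "L2_norm 0 (\<lambda>t. T (f t) - T (\<phi> t)) < e"
    using L2_0_bounded_clinear(2)[OF T L2_diff[OF L(1) C(1)]] small[OF \<phi>(2) L2_norm_nonneg]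
    by (simp add: bounded_clinear_linear[OF T])
  moreover have "L2_norm 0 (\<lambda>t. T (g t) - FT (\<lambda>t. T (\<phi> t)) t) < e"
    using L2_0_bounded_clinear(2)[OF T L2_diff[OF L(2) C(2)]] small[OF \<phi>(3) L2_norm_nonneg]
    by (simp add: bounded_clinear_linear[OF T] FT_bounded_clinear[OF T \<phi>(1) T\<phi>])
  ultimately show "\<exists>\<phi>\<in>Cc. L2_norm 0 (\<lambda>t. T (f t) - \<phi> t) < e \<and> L2_norm 0 (\<lambda>t. T (g t) - FT \<phi> t) < e"
    by (intro bexI[of _ "\<lambda>t. T (\<phi> t)"] conjI T\<phi>)
qed

lemma bounded_clinear_scale: "bounded_clinear (\<lambda>x. c *\<^sub>C x)"
  by (rule bounded_clinearI[where C = "cmod c"]) (auto simp: scaleC_add_right scaleC_scaleC mult.commute)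

lemma fourier_0_scaleC:
  "(f, g) \<in> fourier_laplace 0 \<Longrightarrow> (\<lambda>t. c *\<^sub>C f t, \<lambda>t. c *\<^sub>C g t) \<in> fourier_laplace 0"
  by (rule fourier_0_bounded_clinear[OF bounded_clinear_scale])

lemma fourier_0_diff:
  "(f, g) \<in> fourier_laplace 0 \<Longrightarrow> (f', g') \<in> fourier_laplace 0 \<Longrightarrow>
    (\<lambda>t. f t - f' t, \<lambda>t. g t - g' t) \<in> fourier_laplace 0"
  using fourier_0_add[of f g "\<lambda>t. (-1) *\<^sub>C f' t" "\<lambda>t. (-1) *\<^sub>C g' t"] fourier_0_scaleC[of f' g' "-1"]
  by (simp add: scaleC_minus_one)

lemma fourier_0_closed:
  assumes f: "f \<in> L2 0" and g: "g \<in> L2 0" and fg: "\<And>k. (f' k, g' k) \<in> fourier_laplace 0"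
    and lf: "(\<lambda>k. L2_norm 0 (\<lambda>t. f' k t - f t)) \<longlonglongrightarrow> 0" and lg: "(\<lambda>k. L2_norm 0 (\<lambda>t. g' k t - g t)) \<longlonglongrightarrow> 0"
  shows "(f, g) \<in> fourier_laplace 0"
  unfolding fourier_0_iff
proof (intro conjI allI impI f g)
  fix e :: real assume "e > 0"
  then have e: "e / 2 > 0" by simp
  have "\<forall>\<^sub>F k in sequentially. L2_norm 0 (\<lambda>t. f' k t - f t) < e / 2"
    using lf e by (rule order_tendstoD)
  moreover have "\<forall>\<^sub>F k in sequentially. L2_norm 0 (\<lambda>t. g' k t - g t) < e / 2"
    using lg e by (rule order_tendstoD)
  ultimately have "\<forall>\<^sub>F k in sequentially. L2_norm 0 (\<lambda>t. f' k t - f t) < e / 2 \<and> L2_norm 0 (\<lambda>t. g' k t - g t) < e / 2"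
    by (rule eventually_conj)
  then obtain k where k: "L2_norm 0 (\<lambda>t. f' k t - f t) < e / 2" "L2_norm 0 (\<lambda>t. g' k t - g t) < e / 2"
    using eventually_happens' sequentially_bot by blast
  obtain \<phi> where \<phi>: "\<phi> \<in> Cc" "L2_norm 0 (\<lambda>t. f' k t - \<phi> t) < e / 2" "L2_norm 0 (\<lambda>t. g' k t - FT \<phi> t) < e / 2"
    using fg[of k] e unfolding fourier_0_iff by blast
  have L: "f' k \<in> L2 0" "g' k \<in> L2 0" using fg[of k] fourier_L2 by auto
  have "L2_norm 0 (\<lambda>t. f t - \<phi> t) < e"
    using L2_triangle_diff[OF f L(1) Cc_L2_0[OF \<phi>(1)]] L2_norm_minus_commute[of 0 f "f' k"] k(1) \<phi>(2) by linarith
  moreover have "L2_norm 0 (\<lambda>t. g t - FT \<phi> t) < e"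
    using L2_triangle_diff[OF g L(2) Plancherel_Cc(1)[OF \<phi>(1)]] L2_norm_minus_commute[of 0 g "g' k"] k(2) \<phi>(3)
    by linarith
  ultimately show "\<exists>\<phi>\<in>Cc. L2_norm 0 (\<lambda>t. f t - \<phi> t) < e \<and> L2_norm 0 (\<lambda>t. g t - FT \<phi> t) < e"
    using \<phi>(1) by blast
qed

lemma L2_0_convergent_Cauchy:
  assumes "\<And>k. f k \<in> L2 0" "h \<in> L2 0" "(\<lambda>k. L2_norm 0 (\<lambda>t. f k t - h t)) \<longlonglongrightarrow> 0" "e > 0"
  shows "\<exists>N. \<forall>m\<ge>N. \<forall>n\<ge>N. L2_norm 0 (\<lambda>t. f m t - f n t) < e"
proof -
  have "e / 2 > 0" using assms(4) by simp
  with assms(3) have "\<forall>\<^sub>F k in sequentially. L2_norm 0 (\<lambda>t. f k t - h t) < e / 2"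
    by (rule order_tendstoD)
  then obtain N where N: "\<And>k. k \<ge> N \<Longrightarrow> L2_norm 0 (\<lambda>t. f k t - h t) < e / 2"
    unfolding eventually_sequentially by blast
  have "L2_norm 0 (\<lambda>t. f m t - f n t) < e" if "m \<ge> N" "n \<ge> N" for m n
    using L2_triangle_diff[OF assms(1)[of m] assms(2) assms(1)[of n]] N[OF that(1)] N[OF that(2)]
      L2_norm_minus_commute[of 0 h "f n"] by linarith
  then show ?thesis by blast
qed

lemma Cc_sequence:
  assumes "f \<in> L2 0"
  obtains \<phi> where "\<And>k::nat. \<phi> k \<in> Cc" "(\<lambda>k. L2_norm 0 (\<lambda>t. \<phi> k t - f t)) \<longlonglongrightarrow> 0"
proof -
  have "\<exists>\<phi>. \<phi> \<in> Cc \<and> L2_norm 0 (\<lambda>t. \<phi> t - f t) < 1 / real (Suc k)" for k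
  proof -
    have "1 / real (Suc k) > 0" by simp
    then obtain \<phi> where "\<phi> \<in> Cc" "L2_norm 0 (\<lambda>t. f t - \<phi> t) < 1 / real (Suc k)"
      by (rule Cc_dense[OF assms])
    then show ?thesis unfolding L2_norm_minus_commute[of 0 f] by blast
  qed
  then have "\<forall>k. \<exists>\<phi>. \<phi> \<in> Cc \<and> L2_norm 0 (\<lambda>t. \<phi> t - f t) < 1 / real (Suc k)" by (rule allI)
  from choice[OF this] obtain \<phi> where \<phi>: "\<forall>k. \<phi> k \<in> Cc \<and> L2_norm 0 (\<lambda>t. \<phi> k t - f t) < 1 / real (Suc k)" ..
  have "(\<lambda>k. L2_norm 0 (\<lambda>t. \<phi> k t - f t)) \<longlonglongrightarrow> 0"
  proof (rule Lim_null_comparison)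
    show "\<forall>\<^sub>F k in sequentially. norm (L2_norm 0 (\<lambda>t. \<phi> k t - f t)) \<le> 1 / real (Suc k)"
      using \<phi> by (intro always_eventually allI) (simp add: L2_norm_nonneg less_imp_le)
    show "(\<lambda>k. 1 / real (Suc k)) \<longlonglongrightarrow> 0"
      using LIMSEQ_inverse_real_of_nat by (simp add: inverse_eq_divide)
  qed
  with \<phi> show ?thesis using that by blast
qed

lemma fourier_0_total:
  assumes f: "f \<in> L2 0" obtains g where "(f, g) \<in> fourier_laplace 0"
proof -
  obtain \<phi> where \<phi>: "\<And>k::nat. \<phi> k \<in> Cc" "(\<lambda>k. L2_norm 0 (\<lambda>t. \<phi> k t - f t)) \<longlonglongrightarrow> 0"
    by (rule Cc_sequence[OF f]) (rule that)
  have iso: "L2_norm 0 (\<lambda>t. FT (\<phi> m) t - FT (\<phi> n) t) = L2_norm 0 (\<lambda>t. \<phi> m t - \<phi> n t)" for m n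
    by (rule fourier_0_norm[OF fourier_0_diff[OF fourier_0_Cc[OF \<phi>(1)] fourier_0_Cc[OF \<phi>(1)]]])
  have "\<exists>N. \<forall>m\<ge>N. \<forall>n\<ge>N. L2_norm 0 (\<lambda>t. FT (\<phi> m) t - FT (\<phi> n) t) < e" if "e > 0" for e
    unfolding iso by (rule L2_0_convergent_Cauchy[OF Cc_L2_0[OF \<phi>(1)] f \<phi>(2) that])
  then obtain g where "g \<in> L2 0" "(\<lambda>k. L2_norm 0 (\<lambda>t. FT (\<phi> k) t - g t)) \<longlonglongrightarrow> 0"
    using L2_0_complete[of "\<lambda>k. FT (\<phi> k)"] Plancherel_Cc(1)[OF \<phi>(1)] by blast
  from fourier_0_closed[OF f this(1) fourier_0_Cc[OF \<phi>(1)] \<phi>(2) this(2)] show ?thesis by (rule that)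
qed

text \<open>On \<open>C\<^sub>c\<close> the adjoint of the transform is the reflected transform, which is isometric as well. An
  isometry with isometric adjoint is onto.\<close>

lemma fourier_0_onto_Cc:
  assumes \<psi>: "\<psi> \<in> Cc" shows "(\<lambda>t. FT \<psi> (- t), \<psi>) \<in> fourier_laplace 0"
proof -
  let ?f = "\<lambda>t. FT \<psi> (- t)"
  have f: "?f \<in> L2 0" by (rule FT_reflect(1)[OF \<psi>])
  have \<psi>L: "\<psi> \<in> L2 0" by (rule Cc_L2_0[OF \<psi>])
  obtain \<phi> where \<phi>: "\<And>k::nat. \<phi> k \<in> Cc" "(\<lambda>k. L2_norm 0 (\<lambda>t. \<phi> k t - ?f t)) \<longlonglongrightarrow> 0"
    by (rule Cc_sequence[OF f]) (rule that)
  note \<phi>L = Cc_L2_0[OF \<phi>(1)] and F\<phi>L = Plancherel_Cc(1)[OF \<phi>(1)]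
  have "\<bar>(L2_norm 0 (\<lambda>t. FT (\<phi> k) t - \<psi> t))\<^sup>2\<bar> \<le> (L2_norm 0 (\<lambda>t. \<phi> k t - ?f t))\<^sup>2" for k
  proof -
    have "(L2_norm 0 (\<lambda>t. FT (\<phi> k) t + (-1) *\<^sub>C \<psi> t))\<^sup>2 = (L2_norm 0 (\<lambda>t. \<phi> k t + (-1) *\<^sub>C ?f t))\<^sup>2"
      unfolding L2_0_norm_add_square[OF F\<phi>L L2_0_scaleC[OF \<psi>L]] L2_0_norm_add_square[OF \<phi>L L2_0_scaleC[OF f]]
        L2_0_inner_scaleC_right L2_0_norm_scaleC FT_duality[OF \<phi>(1) \<psi>] Plancherel_Cc(2)[OF \<phi>(1)] FT_reflect(2)[OF \<psi>] ..
    then show ?thesis by (simp add: scaleC_minus_one)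
  qed
  then have "L2_norm 0 (\<lambda>t. FT (\<phi> k) t - \<psi> t) \<le> L2_norm 0 (\<lambda>t. \<phi> k t - ?f t)" for k
    by (rule power2_le_imp_le[OF order_trans[OF abs_ge_self]]) (rule L2_norm_nonneg)
  then have "(\<lambda>k. L2_norm 0 (\<lambda>t. FT (\<phi> k) t - \<psi> t)) \<longlonglongrightarrow> 0"
    by (intro Lim_null_comparison[OF _ \<phi>(2)] always_eventually allI) (simp add: L2_norm_nonneg)
  from fourier_0_closed[OF f \<psi>L fourier_0_Cc[OF \<phi>(1)] \<phi>(2) this] show ?thesis .
qed

lemma fourier_0_onto:
  assumes g: "g \<in> L2 0" obtains f where "(f, g) \<in> fourier_laplace 0"
proof -
  obtain \<psi> where \<psi>: "\<And>k::nat. \<psi> k \<in> Cc" "(\<lambda>k. L2_norm 0 (\<lambda>t. \<psi> k t - g t)) \<longlonglongrightarrow> 0"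
    by (rule Cc_sequence[OF g]) (rule that)
  define f where "f k t = FT (\<psi> k) (- t)" for k t
  have F: "(f k, \<psi> k) \<in> fourier_laplace 0" for k
    unfolding f_def by (rule fourier_0_onto_Cc[OF \<psi>(1)])
  have iso: "L2_norm 0 (\<lambda>t. f m t - f n t) = L2_norm 0 (\<lambda>t. \<psi> m t - \<psi> n t)" for m n
    by (rule fourier_0_norm[OF fourier_0_diff[OF F F], symmetric])
  have "\<exists>N. \<forall>m\<ge>N. \<forall>n\<ge>N. L2_norm 0 (\<lambda>t. f m t - f n t) < e" if "e > 0" for e
    unfolding iso by (rule L2_0_convergent_Cauchy[OF Cc_L2_0[OF \<psi>(1)] g \<psi>(2) that])
  then obtain h where "h \<in> L2 0" "(\<lambda>k. L2_norm 0 (\<lambda>t. f k t - h t)) \<longlonglongrightarrow> 0"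
    using L2_0_complete[of f] fourier_L2(1)[OF F] by blast
  from fourier_0_closed[OF this(1) g F this(2) \<psi>(2)] show ?thesis by (rule that)
qed

lemma fourier_total: assumes "f \<in> L2 \<nu>" obtains g where "(f, g) \<in> fourier_laplace \<nu>"
proof -
  have "unweight \<nu> f \<in> L2 0" using assms by (simp add: L2_iff_unweight[of f \<nu>])
  then obtain g where "(unweight \<nu> f, g) \<in> fourier_laplace 0" by (rule fourier_0_total)
  then show ?thesis using that by (simp add: fourier_laplace_unweight[of f _ \<nu>])
qed

lemma fourier_onto: assumes "g \<in> L2 0" obtains f where "(f, g) \<in> fourier_laplace \<nu>"
proof -
  obtain f where "(f, g) \<in> fourier_laplace 0" using assms by (rule fourier_0_onto)
  then have "(unweight (- \<nu>) f, g) \<in> fourier_laplace \<nu>" by (simp add: fourier_laplace_unweight[of _ _ \<nu>])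
  then show ?thesis by (rule that)
qed

lemma fourier_norm: "(f, g) \<in> fourier_laplace \<nu> \<Longrightarrow> L2_norm 0 g = L2_norm \<nu> f"
  unfolding fourier_laplace_unweight[of _ _ \<nu>] L2_norm_unweight[of \<nu>] by (rule fourier_0_norm)

lemma fourier_add:
  "(f, g) \<in> fourier_laplace \<nu> \<Longrightarrow> (f', g') \<in> fourier_laplace \<nu> \<Longrightarrow>
    (\<lambda>t. f t + f' t, \<lambda>t. g t + g' t) \<in> fourier_laplace \<nu>"
  unfolding fourier_laplace_unweight[of _ _ \<nu>] unweight_linear by (rule fourier_0_add)

lemma fourier_diff:
  "(f, g) \<in> fourier_laplace \<nu> \<Longrightarrow> (f', g') \<in> fourier_laplace \<nu> \<Longrightarrow>
    (\<lambda>t. f t - f' t, \<lambda>t. g t - g' t) \<in> fourier_laplace \<nu>"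
  unfolding fourier_laplace_unweight[of _ _ \<nu>] unweight_linear by (rule fourier_0_diff)

lemma fourier_bounded_clinear:
  assumes T: "bounded_clinear T" and "(f, g) \<in> fourier_laplace \<nu>"
  shows "(\<lambda>t. T (f t), \<lambda>t. T (g t)) \<in> fourier_laplace \<nu>"
proof -
  have "unweight \<nu> (\<lambda>t. T (f t)) = (\<lambda>t. T (unweight \<nu> f t))"
    by (simp add: unweight_def fun_eq_iff bounded_clinear_linear[OF T])
  then show ?thesis
    using fourier_0_bounded_clinear[OF T] assms(2) unfolding fourier_laplace_unweight[of _ _ \<nu>] by simp
qed

text \<open>The isometry is polarized: the real part of the inner product is a combination of norms, and the
  imaginary part is a real part after multiplication by \<open>\<i>\<close>.\<close>

lemma fourier_inner:
  assumes "(f, g) \<in> fourier_laplace \<nu>" "(f', g') \<in> fourier_laplace \<nu>"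
  shows "L2_inner 0 g g' = L2_inner \<nu> f f'"
proof -
  have Re: "Re (L2_inner 0 g g') = Re (L2_inner 0 f f')"
    if "(f, g) \<in> fourier_laplace 0" "(f', g') \<in> fourier_laplace 0" for f g f' g' :: "real \<Rightarrow> 'a"
    using fourier_0_norm[OF fourier_0_add[OF that]] fourier_0_norm[OF that(1)] fourier_0_norm[OF that(2)]
      L2_0_norm_add_square[OF fourier_L2(1)[OF that(1)] fourier_L2(1)[OF that(2)]]
      L2_0_norm_add_square[OF fourier_L2(2)[OF that(1)] fourier_L2(2)[OF that(2)]] by simp
  have "L2_inner 0 g g' = L2_inner 0 f f'"
    if "(f, g) \<in> fourier_laplace 0" "(f', g') \<in> fourier_laplace 0" for f g f' g' :: "real \<Rightarrow> 'a"
    using Re[OF that] Re[OF that(1) fourier_0_scaleC[OF that(2), of \<i>]]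
    by (simp add: L2_0_inner_scaleC_right complex_eq_iff)
  then show ?thesis
    using assms unfolding fourier_laplace_unweight[of _ _ \<nu>] L2_inner_unweight[of \<nu>] by blast
qed

lemma L2_norm_cong_AE:
  assumes "AE t in lebesgue. f t = g t" "f \<in> L2 \<nu>" shows "L2_norm \<nu> f = L2_norm \<nu> g"
proof -
  have g: "g \<in> L2 \<nu>" by (rule L2_AE_eq[OF assms(2,1)])
  have "AE t in lebesgue. (norm (f t))\<^sup>2 * exp (- 2 * \<nu> * t) = (norm (g t))\<^sup>2 * exp (- 2 * \<nu> * t)"
    using assms(1) by eventually_elim simp
  then have "(LINT t|lebesgue. (norm (f t))\<^sup>2 * exp (- 2 * \<nu> * t)) = (LINT t|lebesgue. (norm (g t))\<^sup>2 * exp (- 2 * \<nu> * t))"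
    using assms(2) g by (intro integral_cong_AE) (auto simp: L2_def)
  then show ?thesis by (simp add: L2_norm_def)
qed

lemma fourier_unique:
  assumes "(f, g) \<in> fourier_laplace \<nu>" "(f', g') \<in> fourier_laplace \<nu>"
  shows "(AE t in lebesgue. f t = f' t) \<longleftrightarrow> (AE t in lebesgue. g t = g' t)"
proof -
  note d = fourier_diff[OF assms]
  have "(AE t in lebesgue. f t - f' t = 0) \<longleftrightarrow> (AE t in lebesgue. g t - g' t = 0)"
    using fourier_norm[OF d] L2_norm_eq_0[OF fourier_L2(1)[OF d]] L2_norm_eq_0[OF fourier_L2(2)[OF d]] by simp
  then show ?thesis by simp
qed

lemma fourier_AE_eq:
  assumes "(f, g) \<in> fourier_laplace \<nu>" "AE t in lebesgue. f t = f' t" "AE t in lebesgue. g t = g' t"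
  shows "(f', g') \<in> fourier_laplace \<nu>"
proof -
  have f': "f' \<in> L2 \<nu>" and g': "g' \<in> L2 0"
    using L2_AE_eq[OF fourier_L2(1)[OF assms(1)] assms(2)] L2_AE_eq[OF fourier_L2(2)[OF assms(1)] assms(3)] .
  have *: "(f', g') \<in> L2_closure \<nu> 0 R" if R: "(f, g) \<in> L2_closure \<nu> 0 R" for R
    unfolding L2_closure_def
  proof (clarsimp simp: f' g')
    fix e :: real assume "e > 0"
    then obtain u v where uv: "(u, v) \<in> R" "u \<in> L2 \<nu>" "v \<in> L2 0" "L2_norm \<nu> (\<lambda>t. f t - u t) < e"
      "L2_norm 0 (\<lambda>t. g t - v t) < e"
      using R by (auto simp: L2_closure_def)
    have "AE t in lebesgue. f t - u t = f' t - u t" "AE t in lebesgue. g t - v t = g' t - v t"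
      using assms(2,3) by (eventually_elim, simp)+
    then have "L2_norm \<nu> (\<lambda>t. f t - u t) = L2_norm \<nu> (\<lambda>t. f' t - u t)" "L2_norm 0 (\<lambda>t. g t - v t) = L2_norm 0 (\<lambda>t. g' t - v t)"
      using L2_diff[OF fourier_L2(1)[OF assms(1)] uv(2)] L2_diff[OF fourier_L2(2)[OF assms(1)] uv(3)]
      by (auto intro: L2_norm_cong_AE)
    with uv show "\<exists>x\<in>R. case x of (u, v) \<Rightarrow> u \<in> L2 \<nu> \<and> v \<in> L2 0 \<and>
        L2_norm \<nu> (\<lambda>t. f' t - u t) < e \<and> L2_norm 0 (\<lambda>t. g' t - v t) < e"
      by (intro bexI[of _ "(u, v)"]) auto
  qed
  show ?thesis using assms(1) * unfolding fourier_laplace_def by blast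
qed

text \<open>The adjoint of a unitary operator is its inverse; in terms of graphs the transform and its adjoint consist of
  the same pairs.\<close>

lemma fourier_adjoint: "(g, f) \<in> L2_adj \<nu> 0 (fourier_laplace \<nu>) \<longleftrightarrow> (f, g) \<in> fourier_laplace \<nu>"
proof
  assume fg: "(f, g) \<in> fourier_laplace \<nu>"
  show "(g, f) \<in> L2_adj \<nu> 0 (fourier_laplace \<nu>)"
    using fourier_L2[OF fg] fourier_inner[OF _ fg] by (auto simp: L2_adj_def)
next
  assume A: "(g, f) \<in> L2_adj \<nu> 0 (fourier_laplace \<nu>)"
  then have gf: "g \<in> L2 0" "f \<in> L2 \<nu>" by (auto simp: L2_adj_def)
  obtain f1 where f1: "(f1, g) \<in> fourier_laplace \<nu>" using gf(1) by (rule fourier_onto)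
  note L = fourier_L2(1)[OF f1]
  define u where "u t = f t - f1 t" for t
  have u: "u \<in> L2 \<nu>" unfolding u_def by (rule L2_diff[OF gf(2) L])
  obtain v where uv: "(u, v) \<in> fourier_laplace \<nu>" using u by (rule fourier_total)
  have "L2_inner 0 v g = L2_inner \<nu> u f" using A uv by (auto simp: L2_adj_def)
  moreover have "L2_inner 0 v g = L2_inner \<nu> u f1" by (rule fourier_inner[OF uv f1])
  ultimately have "L2_inner \<nu> u u = 0"
    unfolding u_def[abs_def] using L2_inner_diff_right[OF u gf(2) L] by (simp add: u_def[abs_def])
  then have "L2_norm \<nu> u = 0"
    unfolding L2_inner_unweight[of \<nu>] L2_norm_unweight[of \<nu>] L2_0_inner_self by simp
  then have "AE t in lebesgue. f t - f1 t = 0"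
    using L2_norm_eq_0[OF u] by (simp add: u_def)
  then have "AE t in lebesgue. f1 t = f t" by eventually_elim simp
  with f1 show "(f, g) \<in> fourier_laplace \<nu>" by (rule fourier_AE_eq) simp
qed


section \<open>The time derivative as a multiplication operator\<close>

subsection \<open>Test functions\<close>

definition smooth :: "(real \<Rightarrow> real) \<Rightarrow> bool" where
  "smooth f \<longleftrightarrow> (\<forall>k t. (deriv ^^ k) f field_differentiable at t)"

lemma test_function_iff: "test_function \<phi> \<longleftrightarrow> smooth \<phi> \<and> (\<exists>a>0. \<forall>t. \<bar>t\<bar> > a \<longrightarrow> \<phi> t = 0)"
  unfolding test_function_def smooth_def compactly_supported_iff ..

lemma smoothI:
  assumes "f \<in> C" and deriv: "\<And>g. g \<in> C \<Longrightarrow> deriv g \<in> C"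
    and diff: "\<And>g t. g \<in> C \<Longrightarrow> g field_differentiable at t"
  shows "smooth f"
proof -
  have "(deriv ^^ k) f \<in> C" for k
    by (induction k) (use assms(1) deriv in auto)
  with diff show ?thesis unfolding smooth_def by blast
qed

lemma smooth_has_derivative: "smooth f \<Longrightarrow> (f has_real_derivative deriv f t) (at t)"
  using DERIV_deriv_iff_field_differentiable[of f t] spec[of _ "0::nat"]
  unfolding smooth_def by (metis funpow_0)

lemma smooth_deriv: assumes "smooth f" shows "smooth (deriv f)"
  unfolding smooth_def
proof (intro allI)
  fix k t
  have "(deriv ^^ Suc k) f field_differentiable at t" using assms unfolding smooth_def by blast
  then show "(deriv ^^ k) (deriv f) field_differentiable at t" by (simp add: funpow_swap1)
qed

lemma smooth_continuous: "smooth f \<Longrightarrow> continuous_on UNIV f"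
  by (rule DERIV_continuous_on[of _ _ "deriv f"]) (rule smooth_has_derivative[THEN DERIV_subset]; simp)

inductive_set smooth_products :: "(real \<Rightarrow> real) set" where
  prod: "smooth f \<Longrightarrow> smooth g \<Longrightarrow> (\<lambda>t. f t * g t) \<in> smooth_products"
| sum: "u \<in> smooth_products \<Longrightarrow> v \<in> smooth_products \<Longrightarrow> (\<lambda>t. u t + v t) \<in> smooth_products"

lemma smooth_mult: assumes "smooth f" "smooth g" shows "smooth (\<lambda>t. f t * g t)"
proof -
  have *: "\<exists>u'\<in>smooth_products. \<forall>t. (u has_real_derivative u' t) (at t)" if "u \<in> smooth_products" for u
    using that
  proof induction
    case (prod f g)
    have "((\<lambda>t. f t * g t) has_real_derivative deriv f t * g t + deriv g t * f t) (at t)" for t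
      by (rule DERIV_mult[OF smooth_has_derivative[OF prod(1)] smooth_has_derivative[OF prod(2)]])
    moreover have "(\<lambda>t. deriv f t * g t + deriv g t * f t) \<in> smooth_products"
      by (intro smooth_products.intros smooth_deriv prod)
    ultimately show ?case by (intro bexI[of _ "\<lambda>t. deriv f t * g t + deriv g t * f t"]) auto
  next
    case (sum u v)
    then obtain u' v' where "u' \<in> smooth_products" "v' \<in> smooth_products"
      "\<forall>t. (u has_real_derivative u' t) (at t)" "\<forall>t. (v has_real_derivative v' t) (at t)" by blast
    then show ?case
      by (intro bexI[of _ "\<lambda>t. u' t + v' t"] smooth_products.sum allI DERIV_add) auto
  qed
  show ?thesis
  proof (rule smoothI[OF smooth_products.prod[OF assms]])
    fix u assume "u \<in> smooth_products"
    from *[OF this] obtain u' where u': "u' \<in> smooth_products" "\<forall>t. (u has_real_derivative u' t) (at t)" by blast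
    then have "deriv u = u'" by (simp add: fun_eq_iff DERIV_imp_deriv)
    with u'(1) show "deriv u \<in> smooth_products" by simp
    show "u field_differentiable at t" for t
      using u'(2) unfolding field_differentiable_def by blast
  qed
qed

lemma smooth_affine: assumes "smooth f" shows "smooth (\<lambda>t. f (a * t + b))"
proof (rule smoothI)
  let ?C = "{\<lambda>t. c * g (a * t + b) |c g. smooth g}"
  show "(\<lambda>t. f (a * t + b)) \<in> ?C"
    using assms by (intro CollectI exI[of _ 1] exI[of _ f]) simp
  have D: "((\<lambda>t. c * g (a * t + b)) has_real_derivative (c * a) * deriv g (a * t + b)) (at t)"
    if "smooth g" for c g t
  proof -
    have "((\<lambda>t. a * t + b) has_real_derivative a) (at t)" by (auto intro!: derivative_eq_intros)
    from DERIV_cmult[OF DERIV_chain2[OF smooth_has_derivative[OF that] this], of c]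
    show ?thesis by (simp add: mult_ac)
  qed
  fix u assume "u \<in> ?C"
  then obtain c g where u: "u = (\<lambda>t. c * g (a * t + b))" and g: "smooth g" by blast
  have "deriv u = (\<lambda>t. (c * a) * deriv g (a * t + b))"
    unfolding u by (intro ext DERIV_imp_deriv D g)
  then show "deriv u \<in> ?C" using smooth_deriv[OF g] by blast
  show "u field_differentiable at t" for t
    unfolding u field_differentiable_def using D[OF g] by blast
qed

lemma smooth_diff_shift: assumes "smooth f" "smooth g" shows "smooth (\<lambda>t. f t - g t)"
proof (rule smoothI)
  let ?C = "{\<lambda>t. u t - v t |u v. smooth u \<and> smooth v}"
  show "(\<lambda>t. f t - g t) \<in> ?C" using assms by blast
  fix w assume "w \<in> ?C"
  then obtain u v where w: "w = (\<lambda>t. u t - v t)" and uv: "smooth u" "smooth v" by blast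
  have D: "(w has_real_derivative deriv u t - deriv v t) (at t)" for t
    unfolding w by (intro DERIV_diff smooth_has_derivative uv)
  then have "deriv w = (\<lambda>t. deriv u t - deriv v t)" by (intro ext DERIV_imp_deriv)
  then show "deriv w \<in> ?C" using smooth_deriv[OF uv(1)] smooth_deriv[OF uv(2)] by blast
  show "w field_differentiable at t" for t unfolding field_differentiable_def using D by blast
qed

text \<open>The functions \<open>p(1/x) exp(-1/x)\<close> for \<open>x > 0\<close>, extended by zero, are closed under differentiation.\<close>

definition flat_exp :: "real poly \<Rightarrow> real \<Rightarrow> real" where
  "flat_exp p x = (if x > 0 then poly p (1 / x) * exp (- (1 / x)) else 0)"

lemma poly_times_exp_tendsto_0: "((\<lambda>y. poly p y * exp (- y)) \<longlongrightarrow> (0::real)) at_top"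
proof -
  have "((\<lambda>y. \<Sum>i\<le>degree p. coeff p i * (y ^ i / exp y)) \<longlongrightarrow> (\<Sum>i\<le>degree p. coeff p i * 0)) at_top"
    by (intro tendsto_sum tendsto_mult_left tendsto_power_div_exp_0)
  then show ?thesis by (simp add: poly_altdef sum_distrib_right exp_minus divide_inverse mult.assoc)
qed

lemma flat_exp_derivative:
  "(flat_exp p has_real_derivative flat_exp ([:0, 0, 1:] * (p - pderiv p)) x) (at x)"
proof -
  consider "x > 0" | "x < 0" | "x = 0" by linarith
  then show ?thesis
  proof cases
    case 1
    have D: "((\<lambda>x. poly p (1 / x) * exp (- (1 / x))) has_real_derivative
        flat_exp ([:0, 0, 1:] * (p - pderiv p)) x) (at x)"
      using 1 by (auto intro!: derivative_eq_intros DERIV_chain2[OF poly_DERIV] simp: flat_exp_def field_simps power2_eq_square)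
    have E: "\<forall>\<^sub>F y in nhds x. flat_exp p y = poly p (1 / y) * exp (- (1 / y))"
      using eventually_nhds_in_open[of "{0<..}" x] 1 by (auto elim!: eventually_mono simp: flat_exp_def)
    show ?thesis by (rule iffD2[OF DERIV_cong_ev[OF refl E refl] D])
  next
    case 2
    have D: "((\<lambda>x. 0) has_real_derivative flat_exp ([:0, 0, 1:] * (p - pderiv p)) x) (at x)"
      using 2 by (simp add: flat_exp_def)
    have E: "\<forall>\<^sub>F y in nhds x. flat_exp p y = 0"
      using eventually_nhds_in_open[of "{..<0}" x] 2 by (auto elim!: eventually_mono simp: flat_exp_def)
    show ?thesis by (rule iffD2[OF DERIV_cong_ev[OF refl E refl] D])
  next
    case 3
    have "((\<lambda>y. flat_exp p y / y) \<longlongrightarrow> 0) (at_right 0)"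
    proof (rule Lim_transform_eventually)
      show "((\<lambda>y. poly (pCons 0 p) (inverse y) * exp (- inverse y)) \<longlongrightarrow> 0) (at_right (0::real))"
        by (rule filterlim_compose[OF poly_times_exp_tendsto_0 filterlim_inverse_at_top_right])
      show "\<forall>\<^sub>F y in at_right 0. poly (pCons 0 p) (inverse y) * exp (- inverse y) = flat_exp p y / y"
        using eventually_at_right_less[of "0::real"]
        by (auto elim!: eventually_mono simp: flat_exp_def divide_inverse mult.commute)
    qed
    moreover have "((\<lambda>y. flat_exp p y / y) \<longlongrightarrow> 0) (at_left 0)"
    proof (rule tendsto_eventually)
      have "\<forall>\<^sub>F y in at_left (0::real). y < 0" by (simp add: eventually_at_left_real eventually_at_filter)
      then show "\<forall>\<^sub>F y in at_left 0. flat_exp p y / y = 0"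
        by eventually_elim (simp add: flat_exp_def)
    qed
    ultimately have "((\<lambda>y. flat_exp p y / y) \<longlongrightarrow> 0) (at 0)"
      by (simp add: filterlim_split_at)
    then show ?thesis using 3 by (simp add: has_field_derivative_iff flat_exp_def)
  qed
qed

lemma smooth_flat_exp: "smooth (flat_exp p)"
proof (rule smoothI[of _ "range flat_exp"])
  fix u assume "u \<in> range flat_exp"
  then obtain p where u: "u = flat_exp p" by blast
  have "deriv u = flat_exp ([:0, 0, 1:] * (p - pderiv p))"
    unfolding u by (intro ext DERIV_imp_deriv flat_exp_derivative)
  then show "deriv u \<in> range flat_exp" by blast
  show "u field_differentiable at t" for t
    unfolding u field_differentiable_def using flat_exp_derivative by blast
qed simp

definition bump :: "real \<Rightarrow> real \<Rightarrow> nat \<Rightarrow> real \<Rightarrow> real" where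
  "bump a b n t = flat_exp 1 (real (Suc n) * (t - a)) * flat_exp 1 (real (Suc n) * (b - t))"

lemma flat_exp_1_bounds: "0 \<le> flat_exp 1 x" "flat_exp 1 x \<le> 1"
  by (auto simp: flat_exp_def)

lemma bump_bounds: "0 \<le> bump a b n t" "bump a b n t \<le> 1"
  unfolding bump_def by (intro mult_nonneg_nonneg mult_le_one flat_exp_1_bounds)+

lemma bump_zero: "t \<le> a \<or> t \<ge> b \<Longrightarrow> bump a b n t = 0"
  by (auto simp: bump_def flat_exp_def zero_less_mult_iff)

lemma test_function_bump: "test_function (bump a b n)"
  unfolding test_function_iff
proof
  have "smooth (\<lambda>t. flat_exp 1 (real (Suc n) * t + - real (Suc n) * a) * flat_exp 1 (- real (Suc n) * t + real (Suc n) * b))"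
    by (intro smooth_mult smooth_affine smooth_flat_exp)
  then show "smooth (bump a b n)" by (simp add: bump_def[abs_def] algebra_simps)
  have "bump a b n t = 0" if "\<bar>t\<bar> > \<bar>a\<bar> + \<bar>b\<bar> + 1" for t
    using that by (intro bump_zero) linarith
  then show "\<exists>c>0. \<forall>t. \<bar>t\<bar> > c \<longrightarrow> bump a b n t = 0" by (intro exI[of _ "\<bar>a\<bar> + \<bar>b\<bar> + 1"]) auto
qed

lemma bump_tendsto: assumes "t \<noteq> a" shows "(\<lambda>n. bump a b n t) \<longlonglongrightarrow> indicator {a..<b} t"
proof -
  have e: "(\<lambda>n. flat_exp 1 (real (Suc n) * s)) \<longlonglongrightarrow> 1" if "s > 0" for s
  proof -
    have "(\<lambda>n. exp (- (inverse (real (Suc n)) * (1 / s)))) \<longlonglongrightarrow> exp (- (0 * (1 / s)))"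
      by (intro tendsto_intros LIMSEQ_inverse_real_of_nat)
    then show ?thesis using that by (simp add: flat_exp_def divide_inverse mult.commute)
  qed
  show ?thesis
  proof (cases "a < t \<and> t < b")
    case True
    have "(\<lambda>n. bump a b n t) \<longlonglongrightarrow> 1 * 1"
      unfolding bump_def using True by (intro tendsto_mult e) auto
    then show ?thesis using True by simp
  next
    case False
    then have "bump a b n t = 0" for n by (intro bump_zero) auto
    then show ?thesis using False assms by simp
  qed
qed


subsection \<open>Pairing with locally square-integrable functions\<close>

lemma pairing_integrable:
  assumes "u \<in> Cc" "k \<in> L2 \<nu>" shows "integrable lebesgue (\<lambda>t. cinner (u t) (k t))"
proof -
  have "integrable lebesgue (\<lambda>t. cinner (unweight (- \<nu>) u t) (unweight \<nu> k t))"
    using assms(2) unfolding L2_iff_unweight[of k \<nu>]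
    by (rule L2_0_integrable_cinner[OF Cc_L2_0[OF Cc_unweight[OF assms(1)]]])
  moreover have "cinner (unweight (- \<nu>) u t) (unweight \<nu> k t) = cinner (u t) (k t)" for t
    by (simp add: unweight_def cinner_scaleC_left cinner_scaleC_right mult.assoc[symmetric] flip: of_real_mult exp_add)
  ultimately show ?thesis by simp
qed

lemma pairing_eq_L2_inner:
  "(LINT t|lebesgue. cinner (u t) (k t)) = L2_inner \<nu> (\<lambda>t. complex_of_real (exp (2 * \<nu> * t)) *\<^sub>C u t) k"
proof -
  have "cinner (complex_of_real (exp (2 * \<nu> * t)) *\<^sub>C u t) (k t) * complex_of_real (exp (- 2 * \<nu> * t)) = cinner (u t) (k t)"
    for t
  proof -
    have "exp (2 * \<nu> * t) * exp (- 2 * \<nu> * t) = 1"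
      by (simp only: exp_add[symmetric]) simp
    then have "complex_of_real (exp (2 * \<nu> * t)) * complex_of_real (exp (- 2 * \<nu> * t)) = 1"
      by (metis of_real_1 of_real_mult)
    then show ?thesis
      unfolding cinner_scaleC_left complex_cnj_complex_of_real
      by (metis mult.commute mult.left_commute mult_1)
  qed
  then show ?thesis unfolding L2_inner_def by (simp only:)
qed

lemma Cc_orthogonal_imp_zero:
  assumes k: "k \<in> L2 \<nu>" and orth: "\<And>\<psi>. \<psi> \<in> Cc \<Longrightarrow> (LINT t|lebesgue. cinner (\<psi> t) (k t)) = 0"
  shows "AE t in lebesgue. k t = 0"
proof -
  define q where "q = unweight \<nu> k"
  have q: "q \<in> L2 0" using k by (simp add: q_def L2_iff_unweight[of k \<nu>])
  have Cq: "L2_inner 0 \<psi> q = 0" if "\<psi> \<in> Cc" for \<psi>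
  proof -
    have "cinner (\<psi> t) (q t) = cinner (unweight \<nu> \<psi> t) (k t)" for t
      by (simp add: q_def unweight_def cinner_scaleC_left cinner_scaleC_right)
    then show ?thesis using orth[OF Cc_unweight[OF that]] by (simp add: L2_inner_0)
  qed
  have "L2_norm 0 q \<le> e" if "e > 0" for e
  proof -
    obtain \<psi> where \<psi>: "\<psi> \<in> Cc" "L2_norm 0 (\<lambda>t. q t - \<psi> t) < e"
      by (rule Cc_dense[OF q \<open>e > 0\<close>]) (rule that)
    have "(L2_norm 0 q)\<^sup>2 = cmod (L2_inner 0 q q)" by (simp add: L2_0_inner_self norm_power L2_norm_nonneg)
    also have "L2_inner 0 q q = L2_inner 0 (\<lambda>t. q t - \<psi> t) q"
      using L2_0_inner_diff_left[OF q Cc_L2_0[OF \<psi>(1)] q] Cq[OF \<psi>(1)] by simp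
    also have "cmod \<dots> \<le> L2_norm 0 (\<lambda>t. q t - \<psi> t) * L2_norm 0 q"
      by (intro L2_0_Cauchy_Schwarz L2_diff q Cc_L2_0 \<psi>)
    also have "\<dots> \<le> e * L2_norm 0 q"
      using \<psi>(2) by (intro mult_right_mono L2_norm_nonneg) simp
    finally have "L2_norm 0 q * L2_norm 0 q \<le> e * L2_norm 0 q" by (simp add: power2_eq_square)
    then show ?thesis
      using L2_norm_nonneg[of 0 q] that by (cases "L2_norm 0 q = 0") auto
  qed
  then have "L2_norm 0 q \<le> 0 + e" if "e > 0" for e using that by simp
  then have "L2_norm 0 q \<le> 0" by (rule field_le_epsilon)
  then have "L2_norm \<nu> k = 0"
    using L2_norm_nonneg[of 0 q] by (simp add: q_def L2_norm_unweight[of \<nu>])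
  then show ?thesis using L2_norm_eq_0[OF k] by simp
qed

lemma test_function_Cc:
  assumes "test_function \<phi>" "continuous_on UNIV w"
  shows "(\<lambda>t. complex_of_real (\<phi> t * w t) *\<^sub>C h) \<in> Cc"
proof -
  obtain a where a: "a > 0" "\<And>t. \<bar>t\<bar> > a \<Longrightarrow> \<phi> t = 0" and s: "smooth \<phi>"
    using assms(1) unfolding test_function_iff by blast
  show ?thesis
    by (rule CcI[OF _ a(1)])
      (simp_all add: a(2), intro continuous_on_scaleC continuous_intros smooth_continuous[OF s] assms(2))
qed

lemma test_function_deriv: assumes "test_function \<phi>" shows "test_function (deriv \<phi>)"
proof -
  obtain a where a: "a > 0" "\<And>t. \<bar>t\<bar> > a \<Longrightarrow> \<phi> t = 0" and s: "smooth \<phi>"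
    using assms unfolding test_function_iff by blast
  have "deriv \<phi> t = 0" if "\<bar>t\<bar> > a" for t
  proof -
    have "open {t. \<bar>t\<bar> > a}" by (intro open_Collect_less continuous_intros)
    then have "\<forall>\<^sub>F y in nhds t. \<phi> y = 0"
      using eventually_nhds_in_open[of "{t. \<bar>t\<bar> > a}" t] that a(2) by (auto elim!: eventually_mono)
    then have "(\<phi> has_real_derivative 0) (at t) \<longleftrightarrow> ((\<lambda>_. 0) has_real_derivative 0) (at t)"
      by (intro DERIV_cong_ev) auto
    then show ?thesis by (intro DERIV_imp_deriv) simp
  qed
  with a(1) smooth_deriv[OF s] show ?thesis unfolding test_function_iff by blast
qed

lemma test_function_antiderivative:
  assumes \<rho>: "smooth \<rho>" and a: "a > 0" "\<And>t. \<bar>t\<bar> > a \<Longrightarrow> \<rho> t = 0" and int: "integral {- a..a} \<rho> = 0"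
  obtains \<Phi> where "test_function \<Phi>" "deriv \<Phi> = \<rho>"
proof -
  define \<Phi> where "\<Phi> t = integral {- a - 1..t} \<rho>" for t
  have \<rho>c: "continuous_on S \<rho>" for S using smooth_continuous[OF \<rho>] continuous_on_subset by blast
  have i: "\<rho> integrable_on {x..y}" for x y by (intro integrable_continuous_interval \<rho>c)
  have low: "\<Phi> t = 0" if "t < - a" for t
  proof -
    have "\<Phi> t = integral {- a - 1..t} (\<lambda>_. 0)"
      unfolding \<Phi>_def by (rule integral_cong) (use that a in auto)
    then show ?thesis by simp
  qed
  have high: "\<Phi> t = 0" if "t > a" for t
  proof -
    have "integral {- a - 1..t} \<rho> = integral {- a - 1..- a} \<rho> + (integral {- a..a} \<rho> + integral {a..t} \<rho>)"
      using that a(1) i by (simp add: Henstock_Kurzweil_Integration.integral_combine)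
    moreover have "integral {- a - 1..- a} \<rho> = integral {- a - 1..- a} (\<lambda>_. 0)"
      by (rule integral_spike[of "{- a}"]) (use a in auto)
    moreover have "integral {a..t} \<rho> = integral {a..t} (\<lambda>_. 0)"
      by (rule integral_spike[of "{a}"]) (use a in auto)
    ultimately show ?thesis using int by (simp add: \<Phi>_def)
  qed
  have D: "(\<Phi> has_real_derivative \<rho> t) (at t)" for t
  proof (cases "t < - a")
    case True
    have "\<forall>\<^sub>F y in nhds t. \<Phi> y = 0"
      using eventually_nhds_in_open[of "{..<- a}" t] True by (auto elim!: eventually_mono intro: low)
    then have "(\<Phi> has_real_derivative 0) (at t) \<longleftrightarrow> ((\<lambda>_. 0) has_real_derivative 0) (at t)"
      by (intro DERIV_cong_ev) auto
    then show ?thesis using True a by simp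
  next
    case False
    have "((\<lambda>u. integral {- a - 1..u} \<rho>) has_real_derivative \<rho> t) (at t within {- a - 1..t + 1})"
      by (rule integral_has_real_derivative[OF \<rho>c]) (use False in auto)
    moreover have "at t within {- a - 1..t + 1} = at t"
      by (rule at_within_interior) (use False in auto)
    ultimately show ?thesis unfolding \<Phi>_def[abs_def] by simp
  qed
  then have d: "deriv \<Phi> = \<rho>" by (intro ext DERIV_imp_deriv)
  have "(deriv ^^ k) \<Phi> field_differentiable at t" for k t
  proof (cases k)
    case 0
    then show ?thesis using D field_differentiable_def by auto
  next
    case (Suc m)
    have "(deriv ^^ k) \<Phi> = (deriv ^^ m) \<rho>" by (simp add: Suc funpow_swap1 d)
    then show ?thesis using \<rho> by (simp add: smooth_def)
  qed
  then have "test_function \<Phi>"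
    unfolding test_function_iff smooth_def using a(1) low high
    by (intro conjI allI exI[of _ a]) (auto simp: abs_if split: if_splits)
  then show ?thesis using d by (rule that)
qed

lemma test_function_pairing_integrable:
  assumes "test_function \<phi>" "k \<in> L2 \<nu>"
  shows "integrable lebesgue (\<lambda>t. cinner (complex_of_real (\<phi> t) *\<^sub>C h) (k t))"
  using pairing_integrable[OF test_function_Cc[OF assms(1) continuous_on_const[of _ 1]] assms(2)] by simp

text \<open>Pairing with the derivative of a test function gives zero, so translating a test function does not change
  its pairing with \<open>k\<close>. When it moves to \<open>-\<infinity>\<close>, its norm in the dual of the weighted space tends to zero because
  \<open>\<nu> > 0\<close>. Hence the pairing is zero.\<close>

lemma test_function_pairing_zero:
  fixes k :: "real \<Rightarrow> 'h::complex_hilbert"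
  assumes \<nu>: "\<nu> > 0" and k: "k \<in> L2 \<nu>"
    and weak: "\<And>\<phi> h. test_function \<phi> \<Longrightarrow> (LINT t|lebesgue. complex_of_real (deriv \<phi> t) * cinner h (k t)) = 0"
    and \<eta>: "test_function \<eta>"
  shows "(LINT t|lebesgue. cinner (complex_of_real (\<eta> t) *\<^sub>C h) (k t)) = 0"
proof -
  have pair: "complex_of_real x * cinner h (k t) = cinner (complex_of_real x *\<^sub>C h) (k t)" for x h t
    by (simp add: cinner_scaleC_left)
  note int = test_function_pairing_integrable[OF _ k]
  define u where "u s t = complex_of_real (\<eta> (t + s)) *\<^sub>C h" for s t
  obtain a where a: "a > 0" "\<And>t. \<bar>t\<bar> > a \<Longrightarrow> \<eta> t = 0" and sm: "smooth \<eta>"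
    using \<eta> unfolding test_function_iff by blast
  have c: "continuous_on S \<eta>" for S using smooth_continuous[OF sm] continuous_on_subset by blast
  have i: "\<eta> integrable_on {x..y}" for x y by (intro integrable_continuous_interval c)
  have sh: "test_function (\<lambda>t. \<eta> (t + s))" for s
    unfolding test_function_iff
  proof
    show "smooth (\<lambda>t. \<eta> (t + s))" using smooth_affine[OF sm, of 1 s] by simp
    show "\<exists>c>0. \<forall>t. \<bar>t\<bar> > c \<longrightarrow> \<eta> (t + s) = 0"
      using a by (intro exI[of _ "a + \<bar>s\<bar>"]) auto
  qed
  have eq: "(LINT t|lebesgue. cinner (u 0 t) (k t)) = (LINT t|lebesgue. cinner (u s t) (k t))" if s: "s \<ge> 0" for s
  proof -
    \<comment> \<open>The difference of two translates has integral zero, so it is the derivative of a test function.\<close>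
    define \<rho> where "\<rho> t = \<eta> t - \<eta> (t + s)" for t
    define b where "b = a + s"
    have b: "b > 0" using a s by (simp add: b_def)
    have sm\<rho>: "smooth \<rho>"
      unfolding \<rho>_def[abs_def] using sh[of s] by (intro smooth_diff_shift sm) (simp add: test_function_iff)
    have \<rho>0: "\<rho> t = 0" if "\<bar>t\<bar> > b" for t
      unfolding \<rho>_def using a(2)[of t] a(2)[of "t + s"] that s by (simp add: b_def)
    have H: "(\<eta> has_integral integral {- a..a} \<eta>) S" if "{- a..a} \<subseteq> S" for S
      by (rule has_integral_on_superset[OF integrable_integral[OF i] _ that]) (use a(2) in \<open>auto simp: abs_le_iff not_le\<close>)
    have I1: "(\<eta> has_integral integral {- a..a} \<eta>) {- b..b}"
      using s by (intro H) (auto simp: b_def)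
    have I2: "((\<lambda>t. \<eta> (t + s)) has_integral integral {- a..a} \<eta>) {- b..b}"
    proof -
      have "(\<eta> has_integral integral {- a..a} \<eta>) (cbox (- b + s) (b + s))"
        using s unfolding cbox_interval by (intro H) (auto simp: b_def)
      from has_integral_affinity[OF this, of 1 s] show ?thesis
        by (simp add: image_affinity_atLeastAtMost_diff)
    qed
    have "(\<rho> has_integral 0) {- b..b}"
      unfolding \<rho>_def[abs_def] using has_integral_diff[OF I1 I2] by simp
    then have \<rho>i: "integral {- b..b} \<rho> = 0" by (rule integral_unique)
    obtain \<Phi> where \<Phi>: "test_function \<Phi>" "deriv \<Phi> = \<rho>"
      by (rule test_function_antiderivative[OF sm\<rho> b _ \<rho>i], rule \<rho>0, assumption, rule that)
    have "0 = (LINT t|lebesgue. cinner (u 0 t) (k t) - cinner (u s t) (k t))"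
      using weak[OF \<Phi>(1), of h] unfolding \<Phi>(2) pair
      by (simp add: \<rho>_def u_def cinner_diff_left scaleC_diff_left)
    also have "\<dots> = (LINT t|lebesgue. cinner (u 0 t) (k t)) - (LINT t|lebesgue. cinner (u s t) (k t))"
      unfolding u_def by (intro Bochner_Integration.integral_diff int sh)
    finally show ?thesis by simp
  qed
  define v where "v s t = complex_of_real (exp (2 * \<nu> * t)) *\<^sub>C u s t" for s t
  have vc: "v s \<in> Cc" for s
  proof -
    have "u s \<in> Cc" unfolding u_def[abs_def]
      using test_function_Cc[OF sh continuous_on_const[of _ 1]] by simp
    then show ?thesis unfolding v_def[abs_def] by (rule Cc_scaleC_fun) (intro continuous_intros)
  qed
  have vL: "v s \<in> L2 \<nu>" for s
    unfolding L2_iff_unweight[of _ \<nu>] by (intro Cc_L2_0 Cc_unweight vc)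
  \<comment> \<open>The factor exp (2 \<nu> t) in v turns the pairing into the inner product of the weighted space, whose norm
      scales by exp (- \<nu> s) under the translation.\<close>
  have vn: "L2_norm \<nu> (v s) = exp (- \<nu> * s) * L2_norm \<nu> (v 0)" for s
  proof -
    have nv: "(L2_norm \<nu> (v s))\<^sup>2 = (LINT t|lborel. (\<eta> (t + s) * exp (\<nu> * t) * norm h)\<^sup>2)" for s
    proof -
      have "continuous_on UNIV (unweight \<nu> (v s))" using Cc_unweight[OF vc] by (simp add: Cc_def)
      from L2_norm_0_lborel[OF this]
      have nv1: "(L2_norm \<nu> (v s))\<^sup>2 = (LINT t|lborel. (norm (unweight \<nu> (v s) t))\<^sup>2)"
        by (simp add: L2_norm_unweight[of \<nu>])
      have "(norm (unweight \<nu> (v s) t))\<^sup>2 = (\<eta> (t + s) * exp (\<nu> * t) * norm h)\<^sup>2" for t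
      proof -
        have "unweight \<nu> (v s) t = complex_of_real (exp (\<nu> * t) * \<eta> (t + s)) *\<^sub>C h"
          unfolding unweight_def v_def u_def scaleC_scaleC
          by (simp add: mult.assoc[symmetric] flip: of_real_mult exp_add)
        then show ?thesis by (simp add: power_mult_distrib mult.commute norm_mult)
      qed
      then show ?thesis unfolding nv1 by (simp only:)
    qed
    have "(LINT t|lborel. (\<eta> t * exp (\<nu> * t) * norm h)\<^sup>2)
        = \<bar>1\<bar> *\<^sub>R (LINT t|lborel. (\<eta> (s + 1 * t) * exp (\<nu> * (s + 1 * t)) * norm h)\<^sup>2)"
      by (rule lborel_integral_real_affine) simp
    also have "\<dots> = (exp (\<nu> * s))\<^sup>2 * (LINT t|lborel. (\<eta> (t + s) * exp (\<nu> * t) * norm h)\<^sup>2)"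
    proof -
      have "(\<eta> (s + 1 * t) * exp (\<nu> * (s + 1 * t)) * norm h)\<^sup>2 = (exp (\<nu> * s))\<^sup>2 * (\<eta> (t + s) * exp (\<nu> * t) * norm h)\<^sup>2" for t
        by (simp add: power_mult_distrib exp_add distrib_left add.commute mult_ac)
      then show ?thesis by (simp only: integral_mult_right_zero abs_one scaleR_one)
    qed
    finally have "(L2_norm \<nu> (v 0))\<^sup>2 = (exp (\<nu> * s) * L2_norm \<nu> (v s))\<^sup>2"
      unfolding nv power_mult_distrib by simp
    then have "L2_norm \<nu> (v 0) = exp (\<nu> * s) * L2_norm \<nu> (v s)"
      by (subst (asm) power2_eq_iff_nonneg) (auto simp: L2_norm_nonneg)
    then show ?thesis by (simp add: mult.assoc[symmetric] flip: exp_add)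
  qed
  have le: "cmod (LINT t|lebesgue. cinner (u 0 t) (k t)) \<le> exp (- \<nu> * s) * (L2_norm \<nu> (v 0) * L2_norm \<nu> k)"
    if "s \<ge> 0" for s
    unfolding eq[OF that] pairing_eq_L2_inner[of _ _ \<nu>] v_def[symmetric]
    using L2_Cauchy_Schwarz[OF vL k, of s] by (simp add: vn[of s] mult.assoc)
  have "((\<lambda>s. exp (- \<nu> * s) * (L2_norm \<nu> (v 0) * L2_norm \<nu> k)) \<longlongrightarrow> 0 * (L2_norm \<nu> (v 0) * L2_norm \<nu> k)) at_top"
  proof (intro tendsto_mult tendsto_const filterlim_compose[OF exp_at_bot])
    show "filterlim (\<lambda>s. - \<nu> * s) at_bot at_top"
      using \<nu> by (intro filterlim_tendsto_neg_mult_at_bot[OF tendsto_const _ filterlim_ident]) simp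
  qed
  then have "cmod (LINT t|lebesgue. cinner (u 0 t) (k t)) \<le> 0 * (L2_norm \<nu> (v 0) * L2_norm \<nu> k)"
  proof (rule tendsto_lowerbound)
    show "\<forall>\<^sub>F s in at_top. cmod (LINT t|lebesgue. cinner (u 0 t) (k t))
        \<le> exp (- \<nu> * s) * (L2_norm \<nu> (v 0) * L2_norm \<nu> k)"
      using eventually_ge_at_top[of "0::real"] by eventually_elim (rule le)
  qed simp
  then show ?thesis by (simp add: u_def)
qed

lemma indicator_pairing_zero:
  fixes k :: "real \<Rightarrow> 'h::complex_hilbert"
  assumes k: "k \<in> L2 \<nu>"
    and test0: "\<And>\<eta> h. test_function \<eta> \<Longrightarrow> (LINT t|lebesgue. cinner (complex_of_real (\<eta> t) *\<^sub>C h) (k t)) = 0"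
  shows "(LINT t|lebesgue. cinner (complex_of_real (indicator {a..<b} t) *\<^sub>C h) (k t)) = 0"
    and "integrable lebesgue (\<lambda>t. cinner (complex_of_real (indicator {a..<b} t) *\<^sub>C h) (k t))"
proof -
  note int = test_function_pairing_integrable[OF _ k]
  define R where "R = \<bar>a\<bar> + \<bar>b\<bar>"
  define \<tau> where "\<tau> t = max 0 (min 1 (R + 1 - \<bar>t\<bar>))" for t
  have \<tau>: "(\<lambda>t. complex_of_real (\<tau> t) *\<^sub>C h) \<in> Cc"
    by (rule CcI[of _ "R + 1"])
      (auto simp: \<tau>_def R_def intro!: continuous_on_scaleC continuous_intros)
  have w: "integrable lebesgue (\<lambda>t. norm (cinner (complex_of_real (\<tau> t) *\<^sub>C h) (k t)))"
    by (intro integrable_norm pairing_integrable[OF \<tau> k])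
  have s: "(\<lambda>t. cinner (complex_of_real (bump a b n t) *\<^sub>C h) (k t)) \<in> borel_measurable lebesgue" for n
    by (rule borel_measurable_integrable[OF int[OF test_function_bump]])
  have "AE t in lborel. t \<noteq> a" by (rule AE_lborel_singleton)
  then have na: "AE t in lebesgue. t \<noteq> a" by (rule AE_completion)
  then have lim: "AE t in lebesgue. (\<lambda>n. cinner (complex_of_real (bump a b n t) *\<^sub>C h) (k t))
      \<longlonglongrightarrow> cinner (complex_of_real (indicator {a..<b} t) *\<^sub>C h) (k t)"
    by eventually_elim (intro tendsto_cinner tendsto_scaleC tendsto_of_real bump_tendsto tendsto_const)
  have bd: "AE t in lebesgue. norm (cinner (complex_of_real (bump a b n t) *\<^sub>C h) (k t))
      \<le> norm (cinner (complex_of_real (\<tau> t) *\<^sub>C h) (k t))" for n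
  proof (rule AE_I2)
    fix t
    have "bump a b n t \<le> \<tau> t"
    proof (cases "t \<le> a \<or> t \<ge> b")
      case True
      then show ?thesis by (simp add: bump_zero \<tau>_def)
    next
      case False
      then have "\<bar>t\<bar> \<le> R" by (auto simp: R_def)
      then show ?thesis using bump_bounds(2)[of a b n t] by (simp add: \<tau>_def)
    qed
    then show "norm (cinner (complex_of_real (bump a b n t) *\<^sub>C h) (k t))
        \<le> norm (cinner (complex_of_real (\<tau> t) *\<^sub>C h) (k t))"
      using bump_bounds(1)[of a b n t]
      by (simp add: cinner_scaleC_left norm_mult mult_right_mono)
  qed
  have m: "(\<lambda>t. cinner (complex_of_real (indicator {a..<b} t) *\<^sub>C h) (k t)) \<in> borel_measurable lebesgue"
    by (rule borel_measurable_lebesgue_AE_limit[OF s lim])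
  show "integrable lebesgue (\<lambda>t. cinner (complex_of_real (indicator {a..<b} t) *\<^sub>C h) (k t))"
    by (rule integrable_dominated_convergence[OF m s w lim bd])
  have "(\<lambda>n. LINT t|lebesgue. cinner (complex_of_real (bump a b n t) *\<^sub>C h) (k t))
      \<longlonglongrightarrow> (LINT t|lebesgue. cinner (complex_of_real (indicator {a..<b} t) *\<^sub>C h) (k t))"
    by (rule integral_dominated_convergence[OF m s w lim bd])
  then show "(LINT t|lebesgue. cinner (complex_of_real (indicator {a..<b} t) *\<^sub>C h) (k t)) = 0"
    unfolding test0[OF test_function_bump] by (simp add: LIMSEQ_const_iff)
qed

text \<open>The pairing with \<open>k\<close> vanishes for test functions, then for the step functions that are their limits, and
  finally for the continuous functions with compact support that are limits of step functions.\<close>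

lemma weak_derivative_zero:
  fixes k :: "real \<Rightarrow> 'h::complex_hilbert"
  assumes \<nu>: "\<nu> > 0" and k: "k \<in> L2 \<nu>"
    and weak: "\<And>\<phi> h. test_function \<phi> \<Longrightarrow> (LINT t|lebesgue. complex_of_real (deriv \<phi> t) * cinner h (k t)) = 0"
  shows "AE t in lebesgue. k t = 0"
proof -
  have ind0: "(LINT t|lebesgue. cinner (complex_of_real (indicator {a..<b} t) *\<^sub>C h) (k t)) = 0"
    and indi: "integrable lebesgue (\<lambda>t. cinner (complex_of_real (indicator {a..<b} t) *\<^sub>C h) (k t))" for a b h
    by (rule indicator_pairing_zero[OF k test_function_pairing_zero[OF \<nu> k weak]], assumption+)+
  show ?thesis
  proof (rule Cc_orthogonal_imp_zero[OF k])
    fix \<psi> :: "real \<Rightarrow> 'h" assume \<psi>: "\<psi> \<in> Cc"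
    obtain a B where a: "a > 0" and B: "B > 0" "\<And>t. norm (\<psi> t) \<le> B * indicator {- a..a} t"
      and \<psi>0: "\<And>t. \<bar>t\<bar> > a \<Longrightarrow> \<psi> t = 0"
      by (rule Cc_bound[OF \<psi>]) (rule that)
    have \<psi>B: "norm (\<psi> t) \<le> B" for t
      using B(2)[of t] B(1) by (cases "t \<in> {- a..a}") simp_all
    \<comment> \<open>P n is the step function that takes the value of \<psi> at the left end of each interval of length 1 / (n + 1);
      J n indexes enough of these intervals to cover the support.\<close>
    define N where "N = \<lceil>a\<rceil> + 1"
    define J where "J n = {- (int (Suc n) * N)..int (Suc n) * N}" for n
    define P where "P n t = (\<Sum>j\<in>J n. complex_of_real (indicator {of_int j / real (Suc n)..<(of_int j + 1) / real (Suc n)} t)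
        *\<^sub>C \<psi> (of_int j / real (Suc n)))" for n t
    have aN: "a < of_int N" unfolding N_def by linarith
    have P: "P n t = \<psi> (of_int \<lfloor>real (Suc n) * t\<rfloor> / real (Suc n))" for n t
    proof -
      have n: "real (Suc n) > 0" by simp
      have ind: "t \<in> {of_int j / real (Suc n)..<(of_int j + 1) / real (Suc n)} \<longleftrightarrow> j = \<lfloor>real (Suc n) * t\<rfloor>" for j
        using n by (auto simp: pos_divide_le_eq pos_less_divide_eq mult.commute[of t] floor_eq_iff eq_commute[of j] simp del: of_nat_Suc)
      have "P n t = (\<Sum>j\<in>J n. if j = \<lfloor>real (Suc n) * t\<rfloor> then \<psi> (of_int j / real (Suc n)) else 0)"
        unfolding P_def indicator_def ind by (intro sum.cong refl) simp
      also have "\<dots> = (if \<lfloor>real (Suc n) * t\<rfloor> \<in> J n then \<psi> (of_int \<lfloor>real (Suc n) * t\<rfloor> / real (Suc n)) else 0)"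
        by (simp add: J_def)
      also have "\<dots> = \<psi> (of_int \<lfloor>real (Suc n) * t\<rfloor> / real (Suc n))"
      proof -
        have "\<psi> (of_int j / real (Suc n)) = 0" if "j \<notin> J n" for j
        proof (rule \<psi>0)
          have "int (Suc n) * N < \<bar>j\<bar>" using that by (auto simp: J_def)
          then have "of_int (int (Suc n) * N) < (of_int \<bar>j\<bar> :: real)" by (rule of_int_less_iff[THEN iffD2])
          then have "real (Suc n) * of_int N < \<bar>of_int j\<bar>"
            unfolding of_int_mult of_int_of_nat_eq of_int_abs .
          then have "of_int N < \<bar>of_int j / real (Suc n)\<bar>"
            using n by (simp add: abs_divide pos_less_divide_eq mult.commute del: of_nat_Suc)
          with aN show "a < \<bar>of_int j / real (Suc n)\<bar>" by linarith
        qed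
        then show ?thesis by simp
      qed
      finally show ?thesis .
    qed
    define R where "R = a + 1"
    define \<tau> where "\<tau> t = max 0 (min 1 (R + 1 - \<bar>t\<bar>))" for t
    have pm: "(\<lambda>t. cinner (P n t) (k t)) = (\<lambda>t. \<Sum>j\<in>J n. cinner (complex_of_real
        (indicator {of_int j / real (Suc n)..<(of_int j + 1) / real (Suc n)} t) *\<^sub>C \<psi> (of_int j / real (Suc n))) (k t))" for n
    proof -
      have *: "cinner (\<Sum>j\<in>F. x j) y = (\<Sum>j\<in>F. cinner (x j) y)" for F :: "int set" and x :: "int \<Rightarrow> 'h" and y
        by (induction F rule: infinite_finite_induct) (auto simp: cinner_add_left)
      show ?thesis unfolding P_def by (intro ext) (rule *)
    qed
    have "(LINT t|lebesgue. cinner (P n t) (k t)) = 0" for n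
      unfolding pm using indi ind0 by (subst Bochner_Integration.integral_sum) auto
    moreover have "(\<lambda>n. LINT t|lebesgue. cinner (P n t) (k t)) \<longlonglongrightarrow> (LINT t|lebesgue. cinner (\<psi> t) (k t))"
    proof (rule integral_dominated_convergence[where w = "\<lambda>t. B * (indicator {- R..R} t * norm (k t))"])
      show "(\<lambda>t. cinner (\<psi> t) (k t)) \<in> borel_measurable lebesgue"
        by (rule borel_measurable_integrable[OF pairing_integrable[OF \<psi> k]])
      show "(\<lambda>t. cinner (P n t) (k t)) \<in> borel_measurable lebesgue" for n
        unfolding pm by (intro borel_measurable_sum borel_measurable_integrable[OF indi])
      have lim: "(\<lambda>n. P n t) \<longlonglongrightarrow> \<psi> t" for t
      proof -
        have "(\<lambda>n. of_int \<lfloor>real (Suc n) * t\<rfloor> / real (Suc n)) \<longlonglongrightarrow> t"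
        proof (rule LIM_zero_cancel, rule Lim_null_comparison)
          show "\<forall>\<^sub>F n in sequentially. norm (of_int \<lfloor>real (Suc n) * t\<rfloor> / real (Suc n) - t) \<le> inverse (real (Suc n))"
          proof (intro always_eventually allI)
            fix n
            have n: "real (Suc n) > 0" by simp
            have "of_int \<lfloor>real (Suc n) * t\<rfloor> / real (Suc n) - t
                = (of_int \<lfloor>real (Suc n) * t\<rfloor> - real (Suc n) * t) / real (Suc n)"
              using n by (simp add: diff_divide_distrib del: of_nat_Suc)
            moreover have "\<bar>of_int \<lfloor>real (Suc n) * t\<rfloor> - real (Suc n) * t\<bar> \<le> 1" by linarith
            ultimately show "norm (of_int \<lfloor>real (Suc n) * t\<rfloor> / real (Suc n) - t) \<le> inverse (real (Suc n))"
              using n by (simp add: abs_divide divide_right_mono inverse_eq_divide del: of_nat_Suc)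
          qed
          show "(\<lambda>n. inverse (real (Suc n))) \<longlonglongrightarrow> 0" by (rule LIMSEQ_inverse_real_of_nat)
        qed
        moreover have "isCont \<psi> t" using \<psi> by (simp add: Cc_def continuous_on_eq_continuous_at)
        ultimately show ?thesis unfolding P by (rule isCont_tendsto_compose[rotated])
      qed
      show "AE t in lebesgue. (\<lambda>n. cinner (P n t) (k t)) \<longlonglongrightarrow> cinner (\<psi> t) (k t)"
        by (intro AE_I2 tendsto_cinner lim tendsto_const)
      show "AE t in lebesgue. norm (cinner (P n t) (k t)) \<le> B * (indicator {- R..R} t * norm (k t))" for n
      proof (rule AE_I2)
        fix t
        have "norm (P n t) \<le> B * indicator {- R..R} t"
        proof (cases "\<bar>t\<bar> > R")
          case True
          have n: "real (Suc n) \<ge> 1" by simp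
          define x where "x = of_int \<lfloor>real (Suc n) * t\<rfloor> / real (Suc n)"
          have "\<bar>of_int \<lfloor>real (Suc n) * t\<rfloor> - real (Suc n) * t\<bar> \<le> 1" by linarith
          moreover have "of_int \<lfloor>real (Suc n) * t\<rfloor> - real (Suc n) * t = real (Suc n) * (x - t)"
            using n by (simp add: x_def right_diff_distrib del: of_nat_Suc)
          ultimately have "real (Suc n) * \<bar>x - t\<bar> \<le> 1" using n by (simp add: abs_mult del: of_nat_Suc)
          then have "\<bar>x - t\<bar> \<le> 1" using n mult_right_mono[OF n, of "\<bar>x - t\<bar>"] by simp
          then have "\<bar>x\<bar> > a" using True unfolding R_def by linarith
          then have "P n t = 0" unfolding P x_def[symmetric] by (rule \<psi>0)
          then show ?thesis using B(1) by (simp add: indicator_def)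
        next
          case False
          then have "t \<in> {- R..R}" by auto
          then show ?thesis using \<psi>B by (simp add: P)
        qed
        then have "norm (P n t) * norm (k t) \<le> (B * indicator {- R..R} t) * norm (k t)"
          by (intro mult_right_mono) auto
        then show "norm (cinner (P n t) (k t)) \<le> B * (indicator {- R..R} t * norm (k t))"
          using Cauchy_Schwarz[of "P n t" "k t"] by simp
      qed
      have R: "(\<lambda>t. complex_of_real (\<tau> t)) \<in> Cc"
        using a by (intro CcI[of _ "R + 1"]) (auto simp: \<tau>_def R_def intro!: continuous_intros)
      have kn: "(\<lambda>t. complex_of_real (norm (k t))) \<in> L2 \<nu>"
      proof -
        have sm: "strongly_measurable k" using k by (simp add: L2_def)
        have "strongly_measurable (\<lambda>t. complex_of_real (norm (k t)))"
          by (rule strongly_measurable_complex[OF measurable_compose[OF borel_measurable_norm_strongly[OF sm] borel_measurable_of_real]])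
        then show ?thesis using k by (simp add: L2_def)
      qed
      have "integrable lebesgue (\<lambda>t. norm (cinner (complex_of_real (\<tau> t)) (complex_of_real (norm (k t)))))"
        by (intro integrable_norm pairing_integrable[OF R kn])
      moreover have "norm (cinner (complex_of_real (\<tau> t)) (complex_of_real (norm (k t)))) = \<tau> t * norm (k t)" for t
      proof -
        have "0 \<le> \<tau> t" by (simp add: \<tau>_def)
        then show ?thesis by (simp add: cinner_complex_def norm_mult)
      qed
      ultimately have "integrable lebesgue (\<lambda>t. \<tau> t * norm (k t))" by (simp only:)
      then have "integrable lebesgue (\<lambda>t. indicator {- R..R} t * norm (k t))"
      proof (rule Bochner_Integration.integrable_bound)
        have "(\<lambda>t. norm (k t)) \<in> borel_measurable lebesgue"
          using k by (intro borel_measurable_norm_strongly) (simp add: L2_def)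
        then show "(\<lambda>t. indicator {- R..R} t * norm (k t)) \<in> borel_measurable lebesgue"
          by (intro borel_measurable_times borel_measurable_indicator) simp_all
        show "AE t in lebesgue. norm (indicator {- R..R} t * norm (k t)) \<le> norm (\<tau> t * norm (k t))"
        proof (rule AE_I2)
          fix t
          have "indicator {- R..R} t \<le> \<tau> t" "0 \<le> \<tau> t"
            by (auto simp: indicator_def \<tau>_def)
          then show "norm (indicator {- R..R} t * norm (k t)) \<le> norm (\<tau> t * norm (k t))"
            by (simp add: abs_mult mult_right_mono)
        qed
      qed
      then show "integrable lebesgue (\<lambda>t. B * (indicator {- R..R} t * norm (k t)))"
        by (rule integrable_mult_right)
    qed
    ultimately show "(LINT t|lebesgue. cinner (\<psi> t) (k t)) = 0"
      by (simp add: LIMSEQ_const_iff)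
  qed
qed


subsection \<open>The symbol of the time derivative\<close>

lemma integral_derivative_Cc:
  fixes F F' :: "real \<Rightarrow> complex"
  assumes F: "F \<in> Cc" and F': "F' \<in> Cc" and D: "\<And>t. (F has_vector_derivative F' t) (at t)"
  shows "(LINT t|lborel. F' t) = 0"
proof -
  obtain a where a: "a > 0" "\<And>t. \<bar>t\<bar> > a \<Longrightarrow> F t = 0" and "continuous_on UNIV F"
    by (rule CcE[OF F]) (rule that)
  obtain b where b: "b > 0" "\<And>t. \<bar>t\<bar> > b \<Longrightarrow> F' t = 0" and "continuous_on UNIV F'"
    by (rule CcE[OF F']) (rule that)
  define c where "c = a + b"
  have "(F' has_integral F c - F (- c)) {- c..c}"
    using a(1) b(1) D by (intro fundamental_theorem_of_calculus) (auto simp: c_def intro: has_vector_derivative_at_within)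
  moreover have "F c = 0" "F (- c) = 0" using a b(1) by (auto simp: c_def)
  ultimately have "(F' has_integral 0) {- c..c}" by simp
  then have "(F' has_integral 0) UNIV"
    by (rule has_integral_on_superset) (use a(1) b in \<open>auto simp: c_def abs_le_iff not_le\<close>)
  then show ?thesis
    using has_integral_integral_lborel[OF Cc_integrable[OF F']] has_integral_unique by blast
qed

lemma unweight_weighted:
  "unweight \<nu> (\<lambda>t. complex_of_real (\<phi> t * exp (2 * \<nu> * t)) *\<^sub>C h) = (\<lambda>t. complex_of_real (\<phi> t * exp (\<nu> * t)) *\<^sub>C h)"
proof
  fix t
  have "exp (- \<nu> * t) * exp (2 * \<nu> * t) = exp (\<nu> * t)"
    by (simp only: exp_add[symmetric]) simp
  then have "exp (- \<nu> * t) * (\<phi> t * exp (2 * \<nu> * t)) = \<phi> t * exp (\<nu> * t)"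
    by (metis mult.left_commute)
  then show "unweight \<nu> (\<lambda>t. complex_of_real (\<phi> t * exp (2 * \<nu> * t)) *\<^sub>C h) t = complex_of_real (\<phi> t * exp (\<nu> * t)) *\<^sub>C h"
    unfolding unweight_def scaleC_scaleC of_real_mult[symmetric] by (simp only:)
qed

text \<open>The weight \<open>exp (2 \<nu> t)\<close> makes the pairing with a test function an inner product in \<open>L\<^sup>2\<^sub>\<nu>\<close>. Integration
  by parts against the weighted exponential produces the factor \<open>i\<xi> - \<nu>\<close>, and its conjugate is
  \<open>- (i\<xi> + \<nu>)\<close>, with the sign of the weak derivative.\<close>

lemma laplace_integral_deriv:
  fixes h :: "'h::complex_hilbert"
  assumes \<phi>: "test_function \<phi>"
  shows "laplace_integral \<nu> (\<lambda>t. complex_of_real (deriv \<phi> t * exp (2 * \<nu> * t)) *\<^sub>C h) \<xi> =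
    (\<i> * of_real \<xi> - of_real \<nu>) *\<^sub>C laplace_integral \<nu> (\<lambda>t. complex_of_real (\<phi> t * exp (2 * \<nu> * t)) *\<^sub>C h) \<xi>"
  unfolding laplace_integral_unweight[of \<nu>] unweight_weighted
proof (rule cinner_extensionality)
  fix k :: 'h
  have ec: "continuous_on UNIV (\<lambda>t. exp (\<nu> * t))" by (intro continuous_intros)
  note v0 = test_function_Cc[OF \<phi> ec] and v1 = test_function_Cc[OF test_function_deriv[OF \<phi>] ec]
  define z where "z = complex_of_real \<nu> - \<i> * of_real \<xi>"
  have cis_exp: "cis (- (t * \<xi>)) * of_real (exp (\<nu> * t)) = exp (t *\<^sub>R z)" for t
    by (simp add: z_def cis_conv_exp scaleR_conv_of_real exp_of_real[symmetric] exp_add[symmetric] algebra_simps)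
  define F where "F t = cis (- (t * \<xi>)) * cinner k (complex_of_real (\<phi> t * exp (\<nu> * t)) *\<^sub>C h)" for t
  define G where "G t = cis (- (t * \<xi>)) * cinner k (complex_of_real (deriv \<phi> t * exp (\<nu> * t)) *\<^sub>C h)" for t
  have FE: "F t = exp (t *\<^sub>R z) * (of_real (\<phi> t) * cinner k h)" for t
    unfolding F_def cinner_scaleC_right cis_exp[symmetric] by (simp add: mult_ac)
  have GE: "G t = exp (t *\<^sub>R z) * (of_real (deriv \<phi> t) * cinner k h)" for t
    unfolding G_def cinner_scaleC_right cis_exp[symmetric] by (simp add: mult_ac)
  have C: "(\<lambda>t. cis (- (t * \<xi>)) * cinner k (v t)) \<in> Cc" if "v \<in> Cc" for v
    using Cc_scaleC_fun[OF Cc_cinner[OF that, of k], of "\<lambda>t. cis (- (t * \<xi>))"]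
    by (simp add: scaleC_complex_def continuous_intros)
  have FC: "F \<in> Cc" and GC: "G \<in> Cc"
    unfolding F_def[abs_def] G_def[abs_def] by (rule C[OF v0], rule C[OF v1])
  have zF: "(\<lambda>t. z * F t) \<in> Cc" using Cc_scaleC[OF FC, of z] by (simp add: scaleC_complex_def)
  have "(LINT t|lborel. z * F t + G t) = 0"
  proof (rule integral_derivative_Cc[OF FC Cc_add[OF zF GC]])
    fix t
    have "smooth \<phi>" using \<phi> by (simp add: test_function_iff)
    then have "(\<phi> has_vector_derivative deriv \<phi> t) (at t)"
      using smooth_has_derivative by (simp add: has_real_derivative_iff_has_vector_derivative)
    then have "((\<lambda>t. complex_of_real (\<phi> t)) has_vector_derivative of_real (deriv \<phi> t)) (at t)"
      by (rule bounded_linear.has_vector_derivative[OF bounded_linear_of_real])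
    then have "((\<lambda>t. complex_of_real (\<phi> t) * cinner k h) has_vector_derivative of_real (deriv \<phi> t) * cinner k h) (at t)"
      by (rule bounded_linear.has_vector_derivative[OF bounded_linear_mult_left])
    from has_vector_derivative_mult[OF exp_scaleR_has_vector_derivative_right[of z t] this]
    show "(F has_vector_derivative z * F t + G t) (at t)"
      unfolding FE[abs_def] GE by (simp add: algebra_simps)
  qed
  then have "(LINT t|lborel. G t) = - z * (LINT t|lborel. F t)"
    using Cc_integrable[OF FC] Cc_integrable[OF GC] by (simp add: add_eq_0_iff)
  then have "of_real \<kappa> * (LINT t|lborel. G t) = (\<i> * of_real \<xi> - of_real \<nu>) * (of_real \<kappa> * (LINT t|lborel. F t))"
    by (simp add: z_def mult.left_commute)
  then show "cinner k (FT (\<lambda>t. complex_of_real (deriv \<phi> t * exp (\<nu> * t)) *\<^sub>C h) \<xi>) =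
    cinner k ((\<i> * of_real \<xi> - of_real \<nu>) *\<^sub>C FT (\<lambda>t. complex_of_real (\<phi> t * exp (\<nu> * t)) *\<^sub>C h) \<xi>)"
    unfolding cinner_scaleC_right FT_cinner_right[OF v0] FT_cinner_right[OF v1] F_def G_def .
qed

lemma time_derivative_if_fourier:
  fixes f g :: "real \<Rightarrow> 'h::complex_hilbert"
  assumes f: "(f, F) \<in> fourier_laplace \<nu>" and g: "(g, G) \<in> fourier_laplace \<nu>"
    and ae: "AE \<xi> in lebesgue. G \<xi> = (\<i> * of_real \<xi> + of_real \<nu>) *\<^sub>C F \<xi>"
  shows "(f, g) \<in> time_derivative \<nu>"
  unfolding time_derivative_def
proof (safe)
  show "f \<in> L2 \<nu>" "g \<in> L2 \<nu>" using fourier_L2(1)[OF f] fourier_L2(1)[OF g] by auto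
  fix \<phi> and h :: 'h assume \<phi>: "test_function \<phi>"
  have ec: "continuous_on UNIV (\<lambda>t. exp (2 * \<nu> * t))" by (intro continuous_intros)
  define u where "u \<psi> t = complex_of_real (\<psi> t * exp (2 * \<nu> * t)) *\<^sub>C h" for \<psi> t
  have uC: "u \<psi> \<in> Cc" if "test_function \<psi>" for \<psi>
    unfolding u_def[abs_def] by (rule test_function_Cc[OF that ec])
  have pair: "(LINT t|lebesgue. complex_of_real (\<psi> t) * cinner h (k t)) = L2_inner 0 (laplace_integral \<nu> (u \<psi>)) K"
    if \<psi>: "test_function \<psi>" and k: "(k, K) \<in> fourier_laplace \<nu>" for \<psi> k K
  proof -
    have "(LINT t|lebesgue. complex_of_real (\<psi> t) * cinner h (k t))
        = (LINT t|lebesgue. cinner (complex_of_real (\<psi> t) *\<^sub>C h) (k t))"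
      by (simp add: cinner_scaleC_left)
    also have "\<dots> = L2_inner \<nu> (\<lambda>t. complex_of_real (exp (2 * \<nu> * t)) *\<^sub>C (complex_of_real (\<psi> t) *\<^sub>C h)) k"
      by (rule pairing_eq_L2_inner)
    also have "(\<lambda>t. complex_of_real (exp (2 * \<nu> * t)) *\<^sub>C (complex_of_real (\<psi> t) *\<^sub>C h)) = u \<psi>"
      unfolding u_def[abs_def] scaleC_scaleC of_real_mult[symmetric] by (simp only: mult.commute)
    also have "L2_inner \<nu> (u \<psi>) k = L2_inner 0 (laplace_integral \<nu> (u \<psi>)) K"
      by (rule fourier_inner[OF fourier_Cc[OF uC[OF \<psi>]] k, symmetric])
    finally show ?thesis .
  qed
  let ?L = "laplace_integral \<nu> (u \<phi>)" and ?L' = "laplace_integral \<nu> (u (deriv \<phi>))"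
  note \<phi>' = test_function_deriv[OF \<phi>]
  have L: "?L \<in> L2 0" "?L' \<in> L2 0"
    using fourier_L2(2)[OF fourier_Cc[OF uC[OF \<phi>]]] fourier_L2(2)[OF fourier_Cc[OF uC[OF \<phi>']]] .
  have "L2_inner 0 ?L' F = (LINT \<xi>|lebesgue. - cinner (?L \<xi>) (G \<xi>))"
    unfolding L2_inner_0
  proof (rule integral_cong_AE)
    show "(\<lambda>\<xi>. cinner (?L' \<xi>) (F \<xi>)) \<in> borel_measurable lebesgue"
      by (rule borel_measurable_integrable[OF L2_0_integrable_cinner[OF L(2) fourier_L2(2)[OF f]]])
    show "(\<lambda>\<xi>. - cinner (?L \<xi>) (G \<xi>)) \<in> borel_measurable lebesgue"
      by (intro borel_measurable_uminus borel_measurable_integrable[OF L2_0_integrable_cinner[OF L(1) fourier_L2(2)[OF g]]])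
    from ae show "AE \<xi> in lebesgue. cinner (?L' \<xi>) (F \<xi>) = - cinner (?L \<xi>) (G \<xi>)"
    proof eventually_elim
      case (elim \<xi>)
      have "?L' \<xi> = (\<i> * of_real \<xi> - of_real \<nu>) *\<^sub>C ?L \<xi>"
        unfolding u_def[abs_def] by (rule laplace_integral_deriv[OF \<phi>])
      then have "cinner (?L' \<xi>) (F \<xi>) = cnj (\<i> * of_real \<xi> - of_real \<nu>) * cinner (?L \<xi>) (F \<xi>)"
        by (simp only: cinner_scaleC_left)
      also have "cnj (\<i> * of_real \<xi> - of_real \<nu>) = - (\<i> * of_real \<xi> + of_real \<nu>)" by simp
      finally show ?case by (simp only: elim cinner_scaleC_right mult_minus_left)
    qed
  qed
  also have "\<dots> = - L2_inner 0 ?L G"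
    by (simp add: L2_inner_0)
  finally show "(LINT t|lebesgue. complex_of_real (deriv \<phi> t) * cinner h (f t)) =
      - (LINT t|lebesgue. complex_of_real (\<phi> t) * cinner h (g t))"
    unfolding pair[OF \<phi>' f] pair[OF \<phi> g] .
qed

text \<open>The converse compares \<open>f\<close> with the function whose transform is \<open>\<xi> \<mapsto> (i\<xi> + \<nu>)\<^sup>-\<^sup>1 g\<^sup>^(\<xi>)\<close>; their
  difference has vanishing weak derivative.\<close>

lemma fourier_time_derivative:
  fixes f g :: "real \<Rightarrow> 'h::complex_hilbert"
  assumes \<nu>: "\<nu> > 0" and fg: "(f, g) \<in> time_derivative \<nu>"
    and f: "(f, F) \<in> fourier_laplace \<nu>" and g: "(g, G) \<in> fourier_laplace \<nu>"
  shows "AE \<xi> in lebesgue. G \<xi> = (\<i> * of_real \<xi> + of_real \<nu>) *\<^sub>C F \<xi>"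
proof -
  define z where "z \<xi> = \<i> * complex_of_real \<xi> + of_real \<nu>" for \<xi>
  have Re: "Re (z \<xi>) = \<nu>" for \<xi> by (simp add: z_def)
  have z0: "z \<xi> \<noteq> 0" for \<xi> using Re[of \<xi>] \<nu> by auto
  define F1 where "F1 \<xi> = inverse (z \<xi>) *\<^sub>C G \<xi>" for \<xi>
  have GL: "G \<in> L2 0" by (rule fourier_L2(2)[OF g])
  have F1: "F1 \<in> L2 0"
  proof (rule L2_0_dominated[OF _ GL])
    have "continuous_on UNIV (\<lambda>\<xi>. inverse (z \<xi>))"
      using z0 unfolding z_def by (intro continuous_intros) auto
    then show "strongly_measurable F1"
      unfolding F1_def using GL by (intro strongly_measurable_scaleC_fun[OF strongly_measurable_continuous]) (simp_all add: L2_0)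
    have "norm (F1 \<xi>) \<le> inverse \<nu> * norm (G \<xi>)" for \<xi>
    proof -
      have "\<nu> \<le> cmod (z \<xi>)" using abs_Re_le_cmod[of "z \<xi>"] Re[of \<xi>] by simp
      then have "inverse (cmod (z \<xi>)) \<le> inverse \<nu>" using \<nu> by (rule le_imp_inverse_le)
      then show ?thesis by (simp add: F1_def norm_inverse mult_right_mono)
    qed
    then show "AE \<xi> in lebesgue. norm (F1 \<xi>) \<le> inverse \<nu> * norm (G \<xi>)" by simp
  qed
  obtain f1 where f1: "(f1, F1) \<in> fourier_laplace \<nu>" by (rule fourier_onto[OF F1]) (rule that)
  have "AE \<xi> in lebesgue. G \<xi> = (\<i> * of_real \<xi> + of_real \<nu>) *\<^sub>C F1 \<xi>"
    using z0 unfolding z_def[symmetric] by (intro AE_I2) (simp add: F1_def scaleC_scaleC)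
  then have fg1: "(f1, g) \<in> time_derivative \<nu>" by (rule time_derivative_if_fourier[OF f1 g])
  define k where "k t = f t - f1 t" for t
  have fL: "f \<in> L2 \<nu>" "f1 \<in> L2 \<nu>" using fourier_L2(1)[OF f] fourier_L2(1)[OF f1] .
  have k: "k \<in> L2 \<nu>" unfolding k_def by (rule L2_diff[OF fL])
  have "(LINT t|lebesgue. complex_of_real (deriv \<phi> t) * cinner h (k t)) = 0"
    if \<phi>: "test_function \<phi>" for \<phi> and h :: 'h
  proof -
    have i: "integrable lebesgue (\<lambda>t. complex_of_real (deriv \<phi> t) * cinner h (w t))" if "w \<in> L2 \<nu>" for w
      using pairing_integrable[OF test_function_Cc[OF test_function_deriv[OF \<phi>] continuous_on_const[of _ 1], of h] that]
      by (simp add: cinner_scaleC_left)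
    have "(LINT t|lebesgue. complex_of_real (deriv \<phi> t) * cinner h (f t)) =
        (LINT t|lebesgue. complex_of_real (deriv \<phi> t) * cinner h (f1 t))"
      using fg fg1 \<phi> unfolding time_derivative_def by auto
    then show ?thesis
      using i[OF fL(1)] i[OF fL(2)] by (simp add: k_def cinner_diff_right right_diff_distrib)
  qed
  then have "AE t in lebesgue. k t = 0" by (rule weak_derivative_zero[OF \<nu> k])
  then have "AE t in lebesgue. f t = f1 t" by eventually_elim (simp add: k_def)
  then have "AE \<xi> in lebesgue. F \<xi> = F1 \<xi>" using fourier_unique[OF f f1] by simp
  then show ?thesis
  proof eventually_elim
    case (elim \<xi>)
    then show ?case using z0[of \<xi>] unfolding z_def[symmetric] by (simp add: F1_def scaleC_scaleC)
  qed
qed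


section \<open>The evolution operator\<close>

lemma skew_selfadjoint_identity_resolvent:
  assumes A: "skew_selfadjoint A"
  shows "bounded_clinear (resolvent (\<lambda>x. x) A)" "(x, y) \<in> A \<longleftrightarrow> x = resolvent (\<lambda>x. x) A (x + y)"
proof -
  have id: "bounded_clinear (\<lambda>x::'a. x)" by (rule bounded_clinearI[where C = 1]) auto
  have re: "re_ge UNIV (\<lambda>x::'a. x) 1" by (simp add: re_ge_def Re_cinner_self)
  note R = id re zero_less_one A
  show "bounded_clinear (resolvent (\<lambda>x. x) A)" by (rule bounded_clinear_resolvent[OF R])
  show "(x, y) \<in> A \<longleftrightarrow> x = resolvent (\<lambda>x. x) A (x + y)"
  proof
    assume "(x, y) \<in> A"
    then have "(x, (x + y) - x) \<in> A" by simp
    from resolvent_eqI[OF R this] show "x = resolvent (\<lambda>x. x) A (x + y)" by simp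
  next
    assume x: "x = resolvent (\<lambda>x. x) A (x + y)"
    have "(resolvent (\<lambda>x. x) A (x + y), (x + y) - resolvent (\<lambda>x. x) A (x + y)) \<in> A"
      by (rule resolvent_mem[OF R])
    then show "(x, y) \<in> A" unfolding x[symmetric] by simp
  qed
qed

text \<open>Membership in the graph of \<open>A\<close> is an equation for the bounded operator \<open>(1 + A)\<^sup>-\<^sup>1\<close>, which
  commutes with the transform.\<close>

lemma L2_lift_fourier:
  assumes A: "skew_selfadjoint A"
    and f: "(f, F) \<in> fourier_laplace \<nu>" and g: "(g, G) \<in> fourier_laplace \<nu>"
  shows "(f, g) \<in> L2_lift \<nu> A \<longleftrightarrow> (AE \<xi> in lebesgue. (F \<xi>, G \<xi>) \<in> A)"
proof -
  note R = skew_selfadjoint_identity_resolvent[OF A]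
  have "(AE t in lebesgue. f t = resolvent (\<lambda>x. x) A (f t + g t)) \<longleftrightarrow>
      (AE \<xi> in lebesgue. F \<xi> = resolvent (\<lambda>x. x) A (F \<xi> + G \<xi>))"
    by (rule fourier_unique[OF f fourier_bounded_clinear[OF R(1) fourier_add[OF f g]]])
  then show ?thesis
    using fourier_L2(1)[OF f] fourier_L2(1)[OF g] by (simp add: L2_lift_def R(2))
qed

context
  fixes A :: "('h::complex_hilbert \<times> 'h) set" and M :: "complex \<Rightarrow> 'h \<Rightarrow> 'h" and \<nu> :: real
begin

definition z_line :: "real \<Rightarrow> complex" where
  "z_line \<xi> = \<i> * complex_of_real \<xi> + complex_of_real \<nu>"

text \<open>The symbol of the solution operator.\<close>

definition line_resolvent :: "real \<Rightarrow> 'h \<Rightarrow> 'h" where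
  "line_resolvent \<xi> = resolvent (\<lambda>x. z_line \<xi> *\<^sub>C M (z_line \<xi>) x) A"

context
  fixes \<mu> c :: real
  assumes A: "skew_selfadjoint A" and c: "c > 0" and M: "M \<in> Hinf \<mu>"
    and coercive: "\<And>z. z \<in> half_plane \<mu> \<Longrightarrow> re_ge UNIV (\<lambda>x. z *\<^sub>C M z x) c"
    and \<mu>: "\<mu> \<ge> 0" and \<nu>: "\<nu> > \<mu>"
begin

lemma z_line: "z_line \<xi> \<in> half_plane \<mu>"
  using \<nu> by (simp add: z_line_def half_plane_def)

lemmas line_resolvent_lin = bounded_clinear_scaleC[OF HinfD(1)[OF M z_line]]

lemma isCont_z_line: "isCont z_line \<xi>"
  unfolding z_line_def by (intro continuous_intros)

lemma line_resolvent_mem: "(line_resolvent \<xi> x, x - z_line \<xi> *\<^sub>C M (z_line \<xi>) (line_resolvent \<xi> x)) \<in> A"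
  unfolding line_resolvent_def by (rule resolvent_mem[OF line_resolvent_lin coercive[OF z_line] c A])

lemma line_resolvent_eqI: "(u, x - z_line \<xi> *\<^sub>C M (z_line \<xi>) u) \<in> A \<Longrightarrow> line_resolvent \<xi> x = u"
  unfolding line_resolvent_def by (rule resolvent_eqI[OF line_resolvent_lin coercive[OF z_line] c A])

lemma norm_line_resolvent: "norm (line_resolvent \<xi> x) \<le> 1 / c * norm x"
  using norm_resolvent_le[OF line_resolvent_lin coercive[OF z_line] c A, of \<xi> x] by (simp add: line_resolvent_def)

lemma line_resolvent_diff: "line_resolvent \<xi> (x - y) = line_resolvent \<xi> x - line_resolvent \<xi> y"
  unfolding line_resolvent_def
  by (rule bounded_clinear_linear(2)[OF bounded_clinear_resolvent[OF line_resolvent_lin coercive[OF z_line] c A]])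

lemma isCont_compose_z_line:
  assumes "((\<lambda>w. N w) \<longlongrightarrow> N (z_line \<xi>)) (at (z_line \<xi>))" shows "isCont (\<lambda>\<xi>. N (z_line \<xi>)) \<xi>"
  using isCont_z_line by (rule isCont_o2) (use assms in \<open>simp add: isCont_def\<close>)

lemma line_resolvent_L2:
  assumes "G \<in> L2 0"
  shows "(\<lambda>\<xi>. line_resolvent \<xi> (G \<xi>)) \<in> L2 0" "L2_norm 0 (\<lambda>\<xi>. line_resolvent \<xi> (G \<xi>)) \<le> 1 / c * L2_norm 0 G"
proof -
  have "isCont (\<lambda>\<xi>. line_resolvent \<xi> x) \<xi>" for \<xi> x
    unfolding line_resolvent_def
    by (rule isCont_compose_z_line[where N = "\<lambda>z. resolvent (\<lambda>x. z *\<^sub>C M z x) A x"])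
      (rule Res_strongly_continuous[OF A c M coercive z_line])
  then have sm: "strongly_measurable (\<lambda>\<xi>. line_resolvent \<xi> (G \<xi>))"
    using assms by (intro strongly_measurable_operator_family[OF _ _ line_resolvent_diff norm_line_resolvent]) (simp_all add: L2_0)
  have le: "AE \<xi> in lebesgue. norm (line_resolvent \<xi> (G \<xi>)) \<le> 1 / c * norm (G \<xi>)"
    by (intro AE_I2 norm_line_resolvent)
  show "(\<lambda>\<xi>. line_resolvent \<xi> (G \<xi>)) \<in> L2 0" by (rule L2_0_dominated[OF sm assms le])
  show "L2_norm 0 (\<lambda>\<xi>. line_resolvent \<xi> (G \<xi>)) \<le> 1 / c * L2_norm 0 G"
    by (rule L2_0_norm_mono[OF assms sm le]) (use c in simp)
qed

lemma material_law_symbol_L2: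
  assumes "F \<in> L2 0" shows "(\<lambda>\<xi>. M (z_line \<xi>) (F \<xi>)) \<in> L2 0"
proof -
  obtain C where C: "\<forall>z\<in>half_plane \<mu>. \<forall>x. norm (M z x) \<le> C * norm x" using HinfD(2)[OF M] by blast
  then have le: "norm (M (z_line \<xi>) x) \<le> C * norm x" for \<xi> x using z_line by blast
  have "isCont (\<lambda>\<xi>. M (z_line \<xi>) x) \<xi>" for \<xi> x
    by (rule isCont_compose_z_line[where N = "\<lambda>z. M z x"]) (rule Hinf_strongly_continuous[OF M z_line])
  then have sm: "strongly_measurable (\<lambda>\<xi>. M (z_line \<xi>) (F \<xi>))"
    using assms bounded_clinear_linear(2)[OF HinfD(1)[OF M z_line]]
    by (intro strongly_measurable_operator_family[OF _ _ _ le]) (simp_all add: L2_0)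
  show ?thesis by (rule L2_0_dominated[OF sm assms AE_I2[OF le]])
qed

lemma material_law_iff:
  "(f, g) \<in> material_law \<nu> M \<longleftrightarrow> (\<exists>F G. (f, F) \<in> fourier_laplace \<nu> \<and> (g, G) \<in> fourier_laplace \<nu> \<and>
    (AE \<xi> in lebesgue. G \<xi> = M (z_line \<xi>) (F \<xi>)))"
  using fourier_L2(2) unfolding material_law_def relcomp_unfold mem_Collect_eq case_prod_conv fourier_adjoint
    mult_operator_def z_line_def by blast

lemma evolution_operator_symbol:
  assumes fh: "(f, h) \<in> evolution_operator \<nu> M A"
  obtains F H where "(f, F) \<in> fourier_laplace \<nu>" "(h, H) \<in> fourier_laplace \<nu>" "AE \<xi> in lebesgue. F \<xi> = line_resolvent \<xi> (H \<xi>)"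
proof -
  obtain k l k1 where h: "h = (\<lambda>t. k t + l t)" and k1: "(f, k1) \<in> material_law \<nu> M"
    and k: "(k1, k) \<in> time_derivative \<nu>" and l: "(f, l) \<in> L2_lift \<nu> A"
    using fh unfolding evolution_operator_def L2_sum_def by blast
  obtain F K1 where F: "(f, F) \<in> fourier_laplace \<nu>" and K1: "(k1, K1) \<in> fourier_laplace \<nu>"
    and a1: "AE \<xi> in lebesgue. K1 \<xi> = M (z_line \<xi>) (F \<xi>)"
    using k1 unfolding material_law_iff by blast
  have "k \<in> L2 \<nu>" using k by (simp add: time_derivative_def)
  then obtain K where K: "(k, K) \<in> fourier_laplace \<nu>" by (rule fourier_total)
  have "l \<in> L2 \<nu>" using l by (simp add: L2_lift_def)
  then obtain L where L: "(l, L) \<in> fourier_laplace \<nu>" by (rule fourier_total)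
  have "\<nu> > 0" using \<mu> \<nu> by simp
  then have a2: "AE \<xi> in lebesgue. K \<xi> = z_line \<xi> *\<^sub>C K1 \<xi>"
    unfolding z_line_def by (rule fourier_time_derivative[OF _ k K1 K])
  have a3: "AE \<xi> in lebesgue. (F \<xi>, L \<xi>) \<in> A"
    using l unfolding L2_lift_fourier[OF A F L] .
  show ?thesis
  proof (rule that[OF F])
    show "(h, \<lambda>\<xi>. K \<xi> + L \<xi>) \<in> fourier_laplace \<nu>"
      unfolding h by (rule fourier_add[OF K L])
    from a1 a2 a3 show "AE \<xi> in lebesgue. F \<xi> = line_resolvent \<xi> (K \<xi> + L \<xi>)"
    proof eventually_elim
      case (elim \<xi>)
      then have "(F \<xi>, (K \<xi> + L \<xi>) - z_line \<xi> *\<^sub>C M (z_line \<xi>) (F \<xi>)) \<in> A" by simp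
      then show ?case by (rule line_resolvent_eqI[symmetric])
    qed
  qed
qed

text \<open>For a right-hand side whose transform \<open>G\<close> has compact support, \<open>i\<xi> + \<nu>\<close> is bounded on the support, and
  the solution lies in the domain of the unclosed operator.\<close>

lemma evolution_operator_solution:
  assumes G: "G \<in> Cc"
  obtains f h where "(f, \<lambda>\<xi>. line_resolvent \<xi> (G \<xi>)) \<in> fourier_laplace \<nu>" "(h, G) \<in> fourier_laplace \<nu>"
    "(f, h) \<in> evolution_operator \<nu> M A"
proof -
  obtain a where a: "a > 0" "\<And>t. \<bar>t\<bar> > a \<Longrightarrow> G t = 0" and "continuous_on UNIV G"
    by (rule CcE[OF G]) (rule that)
  have GL: "G \<in> L2 0" by (rule Cc_L2_0[OF G])
  define F where "F \<xi> = line_resolvent \<xi> (G \<xi>)" for \<xi>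
  define K1 where "K1 \<xi> = M (z_line \<xi>) (F \<xi>)" for \<xi>
  define K where "K \<xi> = z_line \<xi> *\<^sub>C K1 \<xi>" for \<xi>
  define L where "L \<xi> = G \<xi> - K \<xi>" for \<xi>
  have FL: "F \<in> L2 0" unfolding F_def by (rule line_resolvent_L2(1)[OF GL])
  have K1L: "K1 \<in> L2 0" unfolding K1_def by (rule material_law_symbol_L2[OF FL])
  have KL: "K \<in> L2 0"
  proof (rule L2_0_dominated[OF _ K1L])
    have "continuous_on UNIV z_line" using isCont_z_line by (simp add: continuous_at_imp_continuous_on)
    then show "strongly_measurable K"
      unfolding K_def using K1L by (intro strongly_measurable_scaleC_fun[OF strongly_measurable_continuous]) (simp_all add: L2_0)
    have "norm (K \<xi>) \<le> (a + \<bar>\<nu>\<bar>) * norm (K1 \<xi>)" for \<xi>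
    proof (cases "\<bar>\<xi>\<bar> > a")
      case True
      then have "F \<xi> = 0" using a(2) norm_line_resolvent[of \<xi> "G \<xi>"] by (simp add: F_def)
      then have "K1 \<xi> = 0" by (simp add: K1_def bounded_clinear_linear(4)[OF HinfD(1)[OF M z_line]])
      then show ?thesis by (simp add: K_def)
    next
      case False
      have "cmod (z_line \<xi>) \<le> cmod (\<i> * complex_of_real \<xi>) + cmod (complex_of_real \<nu>)"
        unfolding z_line_def by (rule norm_triangle_ineq)
      also have "\<dots> \<le> a + \<bar>\<nu>\<bar>" using False by (simp add: norm_mult)
      finally show ?thesis by (simp add: K_def mult_right_mono)
    qed
    then show "AE \<xi> in lebesgue. norm (K \<xi>) \<le> (a + \<bar>\<nu>\<bar>) * norm (K1 \<xi>)" by simp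
  qed
  have LL: "L \<in> L2 0" unfolding L_def by (rule L2_diff[OF GL KL])
  obtain f where f: "(f, F) \<in> fourier_laplace \<nu>" by (rule fourier_onto[OF FL]) (rule that)
  obtain k1 where k1: "(k1, K1) \<in> fourier_laplace \<nu>" by (rule fourier_onto[OF K1L]) (rule that)
  obtain k where k: "(k, K) \<in> fourier_laplace \<nu>" by (rule fourier_onto[OF KL]) (rule that)
  obtain l where l: "(l, L) \<in> fourier_laplace \<nu>" by (rule fourier_onto[OF LL]) (rule that)
  have "(f, k1) \<in> material_law \<nu> M"
    unfolding material_law_iff
    by (intro exI[of _ F] exI[of _ K1] conjI f k1 AE_I2) (simp add: K1_def)
  moreover have "(k1, k) \<in> time_derivative \<nu>"
    by (rule time_derivative_if_fourier[OF k1 k]) (simp add: K_def z_line_def)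
  moreover have "(f, l) \<in> L2_lift \<nu> A"
    unfolding L2_lift_fourier[OF A f l] using line_resolvent_mem by (simp add: F_def L_def K_def K1_def)
  ultimately have "(f, \<lambda>t. k t + l t) \<in> evolution_operator \<nu> M A"
    unfolding evolution_operator_def L2_sum_def by blast
  moreover have "(\<lambda>t. k t + l t, G) \<in> fourier_laplace \<nu>"
    using fourier_add[OF k l] by (simp add: L_def)
  ultimately show ?thesis using that f unfolding F_def[abs_def] by blast
qed

text \<open>Multiplication by the resolvents is bounded, so the relation on the right is closed; it contains the inverse of
  the unclosed operator and therefore that of its closure. Conversely, the transform of any right-hand side is approximated by functions with compact
  support, for which the unclosed equation has a solution.\<close>

theorem solution_operator_iff:
  "(h, f) \<in> (L2_closure \<nu> \<nu> (evolution_operator \<nu> M A))\<inverse> \<longleftrightarrow>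
    (\<exists>H F. (h, H) \<in> fourier_laplace \<nu> \<and> (f, F) \<in> fourier_laplace \<nu> \<and> (AE \<xi> in lebesgue. F \<xi> = line_resolvent \<xi> (H \<xi>)))"
proof
  assume "(h, f) \<in> (L2_closure \<nu> \<nu> (evolution_operator \<nu> M A))\<inverse>"
  then have fh: "(f, h) \<in> L2_closure \<nu> \<nu> (evolution_operator \<nu> M A)" by simp
  then have "f \<in> L2 \<nu>" "h \<in> L2 \<nu>" by (auto simp: L2_closure_def)
  then obtain F H where F: "(f, F) \<in> fourier_laplace \<nu>" and H: "(h, H) \<in> fourier_laplace \<nu>"
    using fourier_total by metis
  note FL = fourier_L2(2)[OF F] and HL = fourier_L2(2)[OF H]
  have est: "L2_norm 0 (\<lambda>\<xi>. F \<xi> - line_resolvent \<xi> (H \<xi>)) \<le> 0 + e" if "e > 0" for e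
  proof -
    define \<delta> where "\<delta> = e / (1 + 1 / c)"
    have c1: "1 + 1 / c > 0" using c by (simp add: add_pos_pos)
    have \<delta>: "\<delta> > 0" using that c1 by (simp add: \<delta>_def)
    obtain f' h' where fh': "(f', h') \<in> evolution_operator \<nu> M A"
      "L2_norm \<nu> (\<lambda>t. f t - f' t) < \<delta>" "L2_norm \<nu> (\<lambda>t. h t - h' t) < \<delta>"
      using fh \<delta> unfolding L2_closure_def by blast
    obtain F' H' where F': "(f', F') \<in> fourier_laplace \<nu>" and H': "(h', H') \<in> fourier_laplace \<nu>"
      and ae: "AE \<xi> in lebesgue. F' \<xi> = line_resolvent \<xi> (H' \<xi>)"
      by (rule evolution_operator_symbol[OF fh'(1)]) (rule that)
    note F'L = fourier_L2(2)[OF F'] and H'L = fourier_L2(2)[OF H']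
    have n1: "L2_norm 0 (\<lambda>\<xi>. F \<xi> - F' \<xi>) < \<delta>"
      using fourier_norm[OF fourier_diff[OF F F']] fh'(2) by simp
    have "L2_norm 0 (\<lambda>\<xi>. line_resolvent \<xi> (H' \<xi> - H \<xi>)) \<le> 1 / c * L2_norm 0 (\<lambda>\<xi>. H' \<xi> - H \<xi>)"
      by (rule line_resolvent_L2(2)[OF L2_diff[OF H'L HL]])
    also have "L2_norm 0 (\<lambda>\<xi>. H' \<xi> - H \<xi>) = L2_norm \<nu> (\<lambda>t. h t - h' t)"
      using fourier_norm[OF fourier_diff[OF H H']] L2_norm_minus_commute[of 0 H H'] by simp
    also have "1 / c * \<dots> \<le> 1 / c * \<delta>"
      using fh'(3) c by (intro mult_left_mono) auto
    finally have n2: "L2_norm 0 (\<lambda>\<xi>. line_resolvent \<xi> (H' \<xi>) - line_resolvent \<xi> (H \<xi>)) \<le> 1 / c * \<delta>"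
      unfolding line_resolvent_diff .
    have "AE \<xi> in lebesgue. F' \<xi> - line_resolvent \<xi> (H \<xi>) = line_resolvent \<xi> (H' \<xi>) - line_resolvent \<xi> (H \<xi>)"
      using ae by eventually_elim simp
    then have "L2_norm 0 (\<lambda>\<xi>. F' \<xi> - line_resolvent \<xi> (H \<xi>)) = L2_norm 0 (\<lambda>\<xi>. line_resolvent \<xi> (H' \<xi>) - line_resolvent \<xi> (H \<xi>))"
      by (rule L2_norm_cong_AE) (rule L2_diff[OF F'L line_resolvent_L2(1)[OF HL]])
    then have "L2_norm 0 (\<lambda>\<xi>. F \<xi> - line_resolvent \<xi> (H \<xi>)) \<le> \<delta> + 1 / c * \<delta>"
      using L2_triangle_diff[OF FL F'L line_resolvent_L2(1)[OF HL]] n1 n2 by linarith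
    also have "\<dots> = (1 + 1 / c) * \<delta>" by (simp add: distrib_right)
    also have "\<dots> = e" using c1 by (simp add: \<delta>_def)
    finally show ?thesis by simp
  qed
  have "L2_norm 0 (\<lambda>\<xi>. F \<xi> - line_resolvent \<xi> (H \<xi>)) \<le> 0" by (rule field_le_epsilon[OF est])
  then have "L2_norm 0 (\<lambda>\<xi>. F \<xi> - line_resolvent \<xi> (H \<xi>)) = 0"
    by (intro antisym L2_norm_nonneg)
  then have "AE \<xi> in lebesgue. F \<xi> - line_resolvent \<xi> (H \<xi>) = 0"
    using L2_norm_eq_0[OF L2_diff[OF FL line_resolvent_L2(1)[OF HL]]] by simp
  then have "AE \<xi> in lebesgue. F \<xi> = line_resolvent \<xi> (H \<xi>)" by simp
  with F H show "\<exists>H F. (h, H) \<in> fourier_laplace \<nu> \<and> (f, F) \<in> fourier_laplace \<nu> \<and> (AE \<xi> in lebesgue. F \<xi> = line_resolvent \<xi> (H \<xi>))"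
    by blast
next
  assume "\<exists>H F. (h, H) \<in> fourier_laplace \<nu> \<and> (f, F) \<in> fourier_laplace \<nu> \<and> (AE \<xi> in lebesgue. F \<xi> = line_resolvent \<xi> (H \<xi>))"
  then obtain H F where H: "(h, H) \<in> fourier_laplace \<nu>" and F: "(f, F) \<in> fourier_laplace \<nu>"
    and ae: "AE \<xi> in lebesgue. F \<xi> = line_resolvent \<xi> (H \<xi>)" by blast
  note FL = fourier_L2(2)[OF F] and HL = fourier_L2(2)[OF H]
  have "\<exists>(f', h')\<in>evolution_operator \<nu> M A. f' \<in> L2 \<nu> \<and> h' \<in> L2 \<nu> \<and>
      L2_norm \<nu> (\<lambda>t. f t - f' t) < e \<and> L2_norm \<nu> (\<lambda>t. h t - h' t) < e" if "e > 0" for e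
  proof -
    define \<delta> where "\<delta> = min e (e * c)"
    have "\<delta> > 0" using that c by (simp add: \<delta>_def)
    then obtain G where G: "G \<in> Cc" "L2_norm 0 (\<lambda>\<xi>. H \<xi> - G \<xi>) < \<delta>"
      by (rule Cc_dense[OF HL]) (rule that)
    note GL = Cc_L2_0[OF G(1)]
    obtain f' h' where f': "(f', \<lambda>\<xi>. line_resolvent \<xi> (G \<xi>)) \<in> fourier_laplace \<nu>" and h': "(h', G) \<in> fourier_laplace \<nu>"
      and E: "(f', h') \<in> evolution_operator \<nu> M A"
      by (rule evolution_operator_solution[OF G(1)]) (rule that)
    have "L2_norm \<nu> (\<lambda>t. h t - h' t) = L2_norm 0 (\<lambda>\<xi>. H \<xi> - G \<xi>)"
      using fourier_norm[OF fourier_diff[OF H h']] by simp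
    then have nh: "L2_norm \<nu> (\<lambda>t. h t - h' t) < e" using G(2) by (simp add: \<delta>_def)
    have "AE \<xi> in lebesgue. F \<xi> - line_resolvent \<xi> (G \<xi>) = line_resolvent \<xi> (H \<xi>) - line_resolvent \<xi> (G \<xi>)"
      using ae by eventually_elim simp
    then have "L2_norm 0 (\<lambda>\<xi>. F \<xi> - line_resolvent \<xi> (G \<xi>)) = L2_norm 0 (\<lambda>\<xi>. line_resolvent \<xi> (H \<xi>) - line_resolvent \<xi> (G \<xi>))"
      by (rule L2_norm_cong_AE) (rule L2_diff[OF FL line_resolvent_L2(1)[OF GL]])
    also have "\<dots> \<le> 1 / c * L2_norm 0 (\<lambda>\<xi>. H \<xi> - G \<xi>)"
      using line_resolvent_L2(2)[OF L2_diff[OF HL GL]] by (simp add: line_resolvent_diff)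
    also have "\<dots> < e"
      using G(2) c by (simp add: \<delta>_def pos_divide_less_eq)
    finally have "L2_norm \<nu> (\<lambda>t. f t - f' t) < e"
      using fourier_norm[OF fourier_diff[OF F f']] by simp
    with nh E fourier_L2(1)[OF f'] fourier_L2(1)[OF h'] show ?thesis
      by (intro bexI[of _ "(f', h')"]) auto
  qed
  then have "(f, h) \<in> L2_closure \<nu> \<nu> (evolution_operator \<nu> M A)"
    unfolding L2_closure_def using fourier_L2(1)[OF F] fourier_L2(1)[OF H] by blast
  then show "(h, f) \<in> (L2_closure \<nu> \<nu> (evolution_operator \<nu> M A))\<inverse>" by simp
qed

lemma solution_operator_fourier:
  assumes h: "(h, H) \<in> fourier_laplace \<nu>"
    and hf: "(h, f) \<in> (L2_closure \<nu> \<nu> (evolution_operator \<nu> M A))\<inverse>"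
  obtains F where "(f, F) \<in> fourier_laplace \<nu>" "AE \<xi> in lebesgue. F \<xi> = line_resolvent \<xi> (H \<xi>)"
proof -
  obtain H' F where H': "(h, H') \<in> fourier_laplace \<nu>" and F: "(f, F) \<in> fourier_laplace \<nu>"
    and ae: "AE \<xi> in lebesgue. F \<xi> = line_resolvent \<xi> (H' \<xi>)"
    using hf unfolding solution_operator_iff by blast
  have "AE \<xi> in lebesgue. H' \<xi> = H \<xi>" using fourier_unique[OF H' h] by simp
  with ae have "AE \<xi> in lebesgue. F \<xi> = line_resolvent \<xi> (H \<xi>)" by eventually_elim simp
  with F show ?thesis by (rule that)
qed

lemma line_resolvent_add: "line_resolvent \<xi> (x + y) = line_resolvent \<xi> x + line_resolvent \<xi> y"
  and line_resolvent_scaleC: "line_resolvent \<xi> (k *\<^sub>C x) = k *\<^sub>C line_resolvent \<xi> x"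
  unfolding line_resolvent_def
  by (rule resolvent_add[OF line_resolvent_lin coercive[OF z_line] c A], rule resolvent_scaleC[OF line_resolvent_lin coercive[OF z_line] c A])

lemma fourier_scaleC: "(f, F) \<in> fourier_laplace \<nu> \<Longrightarrow> (\<lambda>t. k *\<^sub>C f t, \<lambda>\<xi>. k *\<^sub>C F \<xi>) \<in> fourier_laplace \<nu>"
  by (rule fourier_bounded_clinear[OF bounded_clinear_scale])

theorem solution_operator_bounded:
  "L2_bounded_operator \<nu> ((L2_closure \<nu> \<nu> (evolution_operator \<nu> M A))\<inverse>)"
proof -
  define T where "T = (L2_closure \<nu> \<nu> (evolution_operator \<nu> M A))\<inverse>"
  have iff: "(h, f) \<in> T \<longleftrightarrow> (\<exists>H F. (h, H) \<in> fourier_laplace \<nu> \<and> (f, F) \<in> fourier_laplace \<nu> \<and>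
      (AE \<xi> in lebesgue. F \<xi> = line_resolvent \<xi> (H \<xi>)))" for h f
    unfolding T_def by (rule solution_operator_iff)
  have sub: "T \<subseteq> L2 \<nu> \<times> L2 \<nu>"
    using fourier_L2(1) by (auto simp: iff)
  have "\<exists>f. (h, f) \<in> T" if "h \<in> L2 \<nu>" for h
  proof -
    note h = that
    obtain H where H: "(h, H) \<in> fourier_laplace \<nu>" using h by (rule fourier_total)
    obtain f where f: "(f, \<lambda>\<xi>. line_resolvent \<xi> (H \<xi>)) \<in> fourier_laplace \<nu>"
      by (rule fourier_onto[OF line_resolvent_L2(1)[OF fourier_L2(2)[OF H]]]) (rule that)
    have "AE \<xi> in lebesgue. line_resolvent \<xi> (H \<xi>) = line_resolvent \<xi> (H \<xi>)" by simp
    with H f show ?thesis unfolding iff by blast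
  qed
  then have dom: "Domain T = L2 \<nu>" using sub by blast
  have add: "(\<lambda>t. f t + f' t, \<lambda>t. g t + g' t) \<in> T" if fg: "(f, g) \<in> T" and fg': "(f', g') \<in> T" for f g f' g'
  proof -
    obtain F G where FG: "(f, F) \<in> fourier_laplace \<nu>" "(g, G) \<in> fourier_laplace \<nu>" "AE \<xi> in lebesgue. G \<xi> = line_resolvent \<xi> (F \<xi>)"
      using fg unfolding iff by blast
    obtain F' G' where FG': "(f', F') \<in> fourier_laplace \<nu>" "(g', G') \<in> fourier_laplace \<nu>" "AE \<xi> in lebesgue. G' \<xi> = line_resolvent \<xi> (F' \<xi>)"
      using fg' unfolding iff by blast
    have "AE \<xi> in lebesgue. G \<xi> + G' \<xi> = line_resolvent \<xi> (F \<xi> + F' \<xi>)"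
      using FG(3) FG'(3) by eventually_elim (simp add: line_resolvent_add)
    with fourier_add[OF FG(1) FG'(1)] fourier_add[OF FG(2) FG'(2)] show ?thesis
      unfolding iff by blast
  qed
  have scale: "(\<lambda>t. k *\<^sub>C f t, \<lambda>t. k *\<^sub>C g t) \<in> T" if fg: "(f, g) \<in> T" for f g k
  proof -
    obtain F G where FG: "(f, F) \<in> fourier_laplace \<nu>" "(g, G) \<in> fourier_laplace \<nu>" "AE \<xi> in lebesgue. G \<xi> = line_resolvent \<xi> (F \<xi>)"
      using fg unfolding iff by blast
    have "AE \<xi> in lebesgue. k *\<^sub>C G \<xi> = line_resolvent \<xi> (k *\<^sub>C F \<xi>)"
      using FG(3) by eventually_elim (simp add: line_resolvent_scaleC)
    with fourier_scaleC[OF FG(1), of k] fourier_scaleC[OF FG(2), of k] show ?thesis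
      unfolding iff by blast
  qed
  have bound: "L2_norm \<nu> g \<le> 1 / c * L2_norm \<nu> f" if fg: "(f, g) \<in> T" for f g
  proof -
    obtain F G where FG: "(f, F) \<in> fourier_laplace \<nu>" "(g, G) \<in> fourier_laplace \<nu>" "AE \<xi> in lebesgue. G \<xi> = line_resolvent \<xi> (F \<xi>)"
      using fg unfolding iff by blast
    have "L2_norm 0 G = L2_norm 0 (\<lambda>\<xi>. line_resolvent \<xi> (F \<xi>))"
      by (rule L2_norm_cong_AE[OF FG(3) fourier_L2(2)[OF FG(2)]])
    also have "\<dots> \<le> 1 / c * L2_norm 0 F" by (rule line_resolvent_L2(2)[OF fourier_L2(2)[OF FG(1)]])
    finally show ?thesis using fourier_norm[OF FG(1)] fourier_norm[OF FG(2)] by simp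
  qed
  have "L2_bounded_operator \<nu> T"
    unfolding L2_bounded_operator_def
  proof (intro conjI sub dom)
    show "\<forall>(f, g)\<in>T. \<forall>(f', g')\<in>T. (\<lambda>t. f t + f' t, \<lambda>t. g t + g' t) \<in> T" using add by fast
    show "\<forall>c. \<forall>(f, g)\<in>T. (\<lambda>t. c *\<^sub>C f t, \<lambda>t. c *\<^sub>C g t) \<in> T" using scale by fast
    show "\<exists>C. \<forall>(f, g)\<in>T. L2_norm \<nu> g \<le> C * L2_norm \<nu> f" using bound by fast
  qed
  then show ?thesis unfolding T_def .
qed

end

end


section \<open>Convergence in the weak operator topology\<close>

text \<open>On the transform side the solution operators act pointwise in \<open>\<xi>\<close> and are bounded by \<open>1 / c\<close>, so that
  pointwise weak convergence of the resolvents along the line \<open>i\<xi> + \<nu>\<close> is upgraded by dominated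
  convergence.\<close>

theorem L2_wot_converges_if_resolvents_converge:
  fixes M :: "nat \<Rightarrow> complex \<Rightarrow> 'h::complex_hilbert \<Rightarrow> 'h"
  assumes A: "skew_selfadjoint A" and c: "c > 0"
    and M: "\<And>n. M n \<in> Hinf \<mu>" and M': "M' \<in> Hinf \<mu>"
    and coercive: "\<And>n z. z \<in> half_plane \<mu> \<Longrightarrow> re_ge UNIV (\<lambda>x. z *\<^sub>C M n z x) c"
    and coercive': "\<And>z. z \<in> half_plane \<mu> \<Longrightarrow> re_ge UNIV (\<lambda>x. z *\<^sub>C M' z x) c"
    and \<mu>: "\<mu> \<ge> 0" and \<nu>: "\<nu> > \<mu>"
    and conv: "\<And>z x y. z \<in> half_plane \<mu> \<Longrightarrow> (\<lambda>n. cinner y (resolvent (\<lambda>x. z *\<^sub>C M n z x) A x))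
      \<longlonglongrightarrow> cinner y (resolvent (\<lambda>x. z *\<^sub>C M' z x) A x)"
  shows "L2_wot_converges \<nu> (\<lambda>n. (L2_closure \<nu> \<nu> (evolution_operator \<nu> (M n) A))\<inverse>)
    ((L2_closure \<nu> \<nu> (evolution_operator \<nu> M' A))\<inverse>)"
proof -
  note H = A c M coercive \<mu> \<nu> and H' = A c M' coercive' \<mu> \<nu>
  have lim: "(\<lambda>n. L2_inner \<nu> (u n) g) \<longlonglongrightarrow> L2_inner \<nu> w g"
    if f: "f \<in> L2 \<nu>" and g: "g \<in> L2 \<nu>"
      and u: "\<forall>n. (f, u n) \<in> (L2_closure \<nu> \<nu> (evolution_operator \<nu> (M n) A))\<inverse>"
      and w: "(f, w) \<in> (L2_closure \<nu> \<nu> (evolution_operator \<nu> M' A))\<inverse>" for f g u w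
  proof -
    obtain F where F: "(f, F) \<in> fourier_laplace \<nu>" using f by (rule fourier_total)
    obtain G where G: "(g, G) \<in> fourier_laplace \<nu>" using g by (rule fourier_total)
    note FL = fourier_L2(2)[OF F] and GL = fourier_L2(2)[OF G]
    have "\<exists>U. (u n, U) \<in> fourier_laplace \<nu> \<and> (AE \<xi> in lebesgue. U \<xi> = line_resolvent A (M n) \<nu> \<xi> (F \<xi>))" for n
      by (rule solution_operator_fourier[OF H F spec[OF u]], assumption) (rule exI, rule conjI)
    then obtain U where U: "\<And>n. (u n, U n) \<in> fourier_laplace \<nu>"
      and Ueq: "\<And>n. AE \<xi> in lebesgue. U n \<xi> = line_resolvent A (M n) \<nu> \<xi> (F \<xi>)"
      using choice[of "\<lambda>n U. (u n, U) \<in> fourier_laplace \<nu> \<and> (AE \<xi> in lebesgue. U \<xi> = line_resolvent A (M n) \<nu> \<xi> (F \<xi>))"]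
      by blast
    obtain W where W: "(w, W) \<in> fourier_laplace \<nu>"
      and Weq: "AE \<xi> in lebesgue. W \<xi> = line_resolvent A M' \<nu> \<xi> (F \<xi>)"
      by (rule solution_operator_fourier[OF H' F w], assumption) (rule that)
    note UL = fourier_L2(2)[OF U] and WL = fourier_L2(2)[OF W]
    have "(\<lambda>n. LINT \<xi>|lebesgue. cinner (U n \<xi>) (G \<xi>)) \<longlonglongrightarrow> (LINT \<xi>|lebesgue. cinner (W \<xi>) (G \<xi>))"
    proof (rule integral_dominated_convergence[where w = "\<lambda>\<xi>. 1 / c * ((norm (F \<xi>))\<^sup>2 + (norm (G \<xi>))\<^sup>2)"])
      show "(\<lambda>\<xi>. cinner (W \<xi>) (G \<xi>)) \<in> borel_measurable lebesgue"
        by (rule borel_measurable_integrable[OF L2_0_integrable_cinner[OF WL GL]])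
      show "(\<lambda>\<xi>. cinner (U n \<xi>) (G \<xi>)) \<in> borel_measurable lebesgue" for n
        by (rule borel_measurable_integrable[OF L2_0_integrable_cinner[OF UL GL]])
      show "integrable lebesgue (\<lambda>\<xi>. 1 / c * ((norm (F \<xi>))\<^sup>2 + (norm (G \<xi>))\<^sup>2))"
        using FL GL by (intro integrable_mult_right Bochner_Integration.integrable_add) (simp_all add: L2_0)
      have "AE \<xi> in lebesgue. \<forall>n. U n \<xi> = line_resolvent A (M n) \<nu> \<xi> (F \<xi>)"
        using Ueq by (simp add: AE_all_countable)
      with Weq show "AE \<xi> in lebesgue. (\<lambda>n. cinner (U n \<xi>) (G \<xi>)) \<longlonglongrightarrow> cinner (W \<xi>) (G \<xi>)"
      proof eventually_elim
        case (elim \<xi>)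
        have "(\<lambda>n. cnj (cinner (G \<xi>) (line_resolvent A (M n) \<nu> \<xi> (F \<xi>)))) \<longlonglongrightarrow> cnj (cinner (G \<xi>) (line_resolvent A M' \<nu> \<xi> (F \<xi>)))"
          unfolding line_resolvent_def by (intro tendsto_cnj conv z_line[OF H'])
        then show ?case by (simp only: elim cinner_commute[of _ "G \<xi>"])
      qed
      show "AE \<xi> in lebesgue. norm (cinner (U n \<xi>) (G \<xi>)) \<le> 1 / c * ((norm (F \<xi>))\<^sup>2 + (norm (G \<xi>))\<^sup>2)" for n
        using Ueq[of n]
      proof eventually_elim
        case (elim \<xi>)
        have "norm (cinner (U n \<xi>) (G \<xi>)) \<le> norm (U n \<xi>) * norm (G \<xi>)" by (rule Cauchy_Schwarz)
        also have "\<dots> \<le> (1 / c * norm (F \<xi>)) * norm (G \<xi>)"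
          unfolding elim by (intro mult_right_mono norm_line_resolvent[OF H] norm_ge_zero)
        also have "\<dots> = 1 / c * (norm (F \<xi>) * norm (G \<xi>))" by simp
        also have "\<dots> \<le> 1 / c * ((norm (F \<xi>))\<^sup>2 + (norm (G \<xi>))\<^sup>2)"
        proof (rule mult_left_mono)
          have "0 \<le> norm (F \<xi>) * norm (G \<xi>)" by simp
          then show "norm (F \<xi>) * norm (G \<xi>) \<le> (norm (F \<xi>))\<^sup>2 + (norm (G \<xi>))\<^sup>2"
            using sum_squares_bound[of "norm (F \<xi>)" "norm (G \<xi>)"] by linarith
        qed (use c in simp)
        finally show ?case .
      qed
    qed
    then show ?thesis
      unfolding fourier_inner[OF U G, symmetric] fourier_inner[OF W G, symmetric] L2_inner_0 .
  qed
  show ?thesis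
    unfolding L2_wot_converges_def
  proof (intro conjI allI ballI impI)
    show "L2_bounded_operator \<nu> ((L2_closure \<nu> \<nu> (evolution_operator \<nu> (M n) A))\<inverse>)" for n
      by (rule solution_operator_bounded[OF H])
    show "L2_bounded_operator \<nu> ((L2_closure \<nu> \<nu> (evolution_operator \<nu> M' A))\<inverse>)"
      by (rule solution_operator_bounded[OF H'])
  qed (elim conjE, rule lim)
qed

text \<open>At a real point \<open>l > \<mu>\<close> the coercivity of \<open>l M\<^sub>n(l)\<close> passes to \<open>M\<^sub>n(l)\<close> with constant \<open>c / l\<close>. The weak
  limits of the resolvents at these points determine the limits everywhere in the half-plane.\<close>

theorem evolution_operators_converge:
  fixes A0 :: "('g::complex_hilbert \<times> 'h::complex_hilbert) set"
    and M :: "nat \<Rightarrow> complex \<Rightarrow> 'h \<Rightarrow> 'h"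
  assumes A0: "csubspace A0" "closed A0" "single_valued A0" "Range A0 = op_kernel A"
    and A: "skew_selfadjoint A" "single_valued A"
    and K: "compact K" "\<And>x z. (x, z) \<in> A \<Longrightarrow> x \<in> orth (op_kernel A) \<Longrightarrow> norm (x, z) \<le> 1 \<Longrightarrow> x \<in> K"
    and M: "Hinf_bounded_seq \<mu> M" "M' \<in> Hinf \<mu>" and c: "c > 0"
    and coercive: "\<And>n z. z \<in> half_plane \<mu> \<Longrightarrow> re_ge UNIV (\<lambda>x. z *\<^sub>C M n z x) c"
    and conv: "\<And>l. l > \<mu> \<Longrightarrow> nonlocal_H_converges A0 A (\<lambda>n. M n (of_real l)) (M' (of_real l))"
    and \<mu>: "\<mu> \<ge> 0" and \<nu>: "\<nu> > \<mu>"
  shows "L2_wot_converges \<nu> (\<lambda>n. (L2_closure \<nu> \<nu> (evolution_operator \<nu> (M n) A))\<inverse>)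
    ((L2_closure \<nu> \<nu> (evolution_operator \<nu> M' A))\<inverse>)"
proof -
  have Mn: "M n \<in> Hinf \<mu>" for n using M(1) by (simp add: Hinf_bounded_seq_def)
  obtain C where C: "\<And>n z. Re z > \<mu> \<Longrightarrow> onorm (M n z) \<le> C"
    using M(1) unfolding Hinf_bounded_seq_def by blast
  have bound: "norm (M n z x) \<le> C * norm x" if z: "z \<in> half_plane \<mu>" for n z x
  proof -
    have "onorm (M n z) \<le> C" using z by (intro C) (simp add: half_plane_def)
    from order_trans[OF bounded_clinear_norm_le[OF HinfD(1)[OF Mn z]] mult_right_mono[OF this norm_ge_zero]]
    show ?thesis .
  qed
  have sub: "csubspace A" "closed A" using A(1) by (auto simp: skew_selfadjoint_def)
  have clR: "closed (Range A)" by (rule closed_Range_if_compact[OF sub K])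
  have real: "\<exists>v. (v, x - of_real l *\<^sub>C M' (of_real l) v) \<in> A \<and>
      (\<forall>y. (\<lambda>n. cinner y (resolvent (\<lambda>x. of_real l *\<^sub>C M n (of_real l) x) A x)) \<longlonglongrightarrow> cinner y v)"
    if l: "l > \<mu>" for l x
  proof -
    have lp: "of_real l \<in> half_plane \<mu>" "l > 0" using l \<mu> by (auto simp: half_plane_def)
    have "re_ge UNIV (M n (of_real l)) (c / l)" for n
      using coercive[OF lp(1), of n] lp(2)
      by (simp add: re_ge_def cinner_scaleC_left pos_divide_le_eq mult.commute)
    moreover have cl: "c / l > 0" using c lp(2) by simp
    ultimately have hyps: "nonlocal_H_converges A0 A (\<lambda>n. M n (of_real l)) (M' (of_real l))"
      "\<And>n. re_ge UNIV (M n (of_real l)) (c / l)" "c / l > 0"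
      "\<And>n x. norm (M n (of_real l) x) \<le> C * norm x"
      using conv[OF l] bound[OF lp(1)] by blast+
    note real_point = A0 A refl clR hyps
    have "re_ge UNIV (\<lambda>x. of_real l *\<^sub>C M' (of_real l) x) c"
      using nonlocal_limit_coercive[OF real_point] lp(2)
      by (simp add: re_ge_def cinner_scaleC_left pos_divide_le_eq mult.commute)
    note mem = resolvent_mem[OF bounded_clinear_scaleC[OF HinfD(1)[OF M(2) lp(1)]] this c A(1)]
    have "(\<lambda>n. cinner y (resolvent (\<lambda>x. of_real l *\<^sub>C M n (of_real l) x) A x))
        \<longlonglongrightarrow> cinner y (resolvent (\<lambda>x. of_real l *\<^sub>C M' (of_real l) x) A x)" for y
      by (rule resolvent_converges_at_real_point[OF real_point lp(2) K])
    then show ?thesis by (intro exI[of _ "resolvent (\<lambda>x. of_real l *\<^sub>C M' (of_real l) x) A x"] conjI mem allI)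
  qed
  note half_plane = resolvent_convergence_half_plane[OF A c Mn M(2) coercive real]
  show ?thesis
  proof (rule L2_wot_converges_if_resolvents_converge[OF A(1) c Mn M(2) coercive _ \<mu> \<nu>])
    fix z :: complex and x y :: 'h assume z: "z \<in> half_plane \<mu>"
    show "re_ge UNIV (\<lambda>x. z *\<^sub>C M' z x) c" by (rule half_plane(1)[OF _ _ z])
    show "(\<lambda>n. cinner y (resolvent (\<lambda>x. z *\<^sub>C M n z x) A x))
        \<longlonglongrightarrow> cinner y (resolvent (\<lambda>x. z *\<^sub>C M' z x) A x)" by (rule half_plane(2)[OF _ _ z])
  qed
qed


section \<open>Block operators of compact exact sequences\<close>

lemma single_valued_op_antidiag:
  assumes "single_valued P" "single_valued Q" shows "single_valued (op_antidiag P Q)"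
proof (rule single_valuedI)
  fix x y z assume "(x, y) \<in> op_antidiag P Q" "(x, z) \<in> op_antidiag P Q"
  then show "y = z"
    using assms by (cases x; cases y; cases z) (auto simp: op_antidiag_iff dest: single_valuedD)
qed

lemma single_valued_op_neg: assumes "single_valued R" shows "single_valued (op_neg R)"
proof (rule single_valuedI)
  fix x y z assume "(x, y) \<in> op_neg R" "(x, z) \<in> op_neg R"
  then have "- y = - z" using assms by (auto simp: op_neg_iff dest: single_valuedD)
  then show "y = z" by simp
qed

lemma skew_selfadjoint_op_antidiag:
  assumes "csubspace R" "closed R"
  shows "skew_selfadjoint (op_antidiag R (op_neg (op_adj R)))"
proof -
  have 0: "(0, 0) \<in> S" if "csubspace S" for S :: "('x::complex_hilbert \<times> 'y::complex_hilbert) set"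
    using csubspace_0[OF that] by (simp add: zero_prod_def)
  have neg: "csubspace (op_neg (op_adj R))" "closed (op_neg (op_adj R))"
    by (intro csubspace_op_neg csubspace_op_adj closed_op_neg closed_op_adj)+
  have "op_adj (op_antidiag R (op_neg (op_adj R))) = op_neg (op_antidiag R (op_neg (op_adj R)))"
    unfolding op_adj_op_antidiag[OF 0[OF assms(1)] 0[OF neg(1)]] op_adj_op_neg op_adj_op_adj[OF assms]
      op_neg_op_antidiag op_neg_op_neg ..
  then show ?thesis
    unfolding skew_selfadjoint_def using assms neg by (simp add: csubspace_op_antidiag closed_op_antidiag)
qed

text \<open>On the orthogonal complement of the kernel of \<open>S\<close>, which is the kernel of \<open>T\<^sup>*\<close> by exactness, the
  graph norm of \<open>S\<close> is the norm of the compactly embedded space. The same holds for \<open>T\<^sup>*\<close> and the complement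
  of its kernel, which is the kernel of \<open>S\<close>.\<close>

lemma compact_exact_complex:
  assumes S: "csubspace S" "closed S" and ex: "exact_complex T S" and co: "compact_complex T S"
  obtains K where "compact K"
    "\<And>x z. (x, z) \<in> S \<Longrightarrow> x \<in> orth (op_kernel S) \<Longrightarrow> norm (x, z) \<le> 1 \<Longrightarrow> x \<in> K"
    "\<And>x y. (x, y) \<in> op_adj T \<Longrightarrow> x \<in> orth (op_kernel (op_adj T)) \<Longrightarrow> norm (x, y) \<le> 1 \<Longrightarrow> x \<in> K"
proof
  let ?B = "{x. \<exists>y z. (x, y) \<in> op_adj T \<and> (x, z) \<in> S \<and> norm (x, y, z) \<le> 1}"
  have R: "Range T = op_kernel S" using ex by (simp add: exact_complex_def)
  have k: "op_kernel (op_adj T) = orth (op_kernel S)" by (simp add: op_kernel_op_adj R)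
  show "compact (closure ?B)" using co by (simp add: compact_complex_def)
  show "x \<in> closure ?B" if "(x, z) \<in> S" "x \<in> orth (op_kernel S)" "norm (x, z) \<le> 1" for x z
  proof -
    have "x \<in> op_kernel (op_adj T)" using that(2) by (simp only: k)
    then have "(x, 0) \<in> op_adj T" by (simp add: op_kernel_def)
    moreover have "norm (x, 0, z) \<le> 1" using that(3) by (simp add: norm_prod_def)
    ultimately have "x \<in> ?B" using that(1) by blast
    then show ?thesis by (rule subsetD[OF closure_subset])
  qed
  show "x \<in> closure ?B" if "(x, y) \<in> op_adj T" "x \<in> orth (op_kernel (op_adj T))" "norm (x, y) \<le> 1" for x y
  proof -
    have "x \<in> op_kernel S"
      using that(2) unfolding k orth_orth[OF csubspace_op_kernel[OF S(1)] closed_op_kernel[OF S(2)]] .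
    then have "(x, 0) \<in> S" by (simp add: op_kernel_def)
    moreover have "norm (x, y, 0) \<le> 1" using that(3) by (simp add: norm_prod_def)
    ultimately have "x \<in> ?B" using that(1) by blast
    then show ?thesis by (rule subsetD[OF closure_subset])
  qed
qed

text \<open>Exactness of the block sequence: the kernel of the second operator is \<open>ker B\<^sub>1\<^sup>* \<times> ker B\<^sub>1\<close>, where
  \<open>ker B\<^sub>1 = ran B\<^sub>0\<close> and \<open>ker B\<^sub>1\<^sup>* = (ran B\<^sub>1)\<^sup>\<bottom> = (ker B\<^sub>2)\<^sup>\<bottom> = ran B\<^sub>2\<^sup>*\<close>, the last step because \<open>B\<^sub>2\<close>
  has closed range.\<close>

lemma Range_block_eq_kernel:
  assumes B2: "csubspace B2" "closed B2"
    and ex: "exact_complex B0 B1" "exact_complex B1 B2" and co: "compact_complex B1 B2"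
  shows "Range (op_antidiag (op_adj B2) B0) = op_kernel (op_antidiag B1 (op_neg (op_adj B1)))"
proof -
  obtain K where "compact K"
    "\<And>x z. (x, z) \<in> B2 \<Longrightarrow> x \<in> orth (op_kernel B2) \<Longrightarrow> norm (x, z) \<le> 1 \<Longrightarrow> x \<in> K"
    by (rule compact_exact_complex[OF B2 ex(2) co]) (rule that)
  then have "closed (Range B2)" by (rule closed_Range_if_compact[OF B2])
  then have "Range (op_adj B2) = orth (op_kernel B2)" by (rule closed_range_theorem[OF B2])
  also have "\<dots> = op_kernel (op_adj B1)"
    using ex(2) by (simp add: op_kernel_op_adj exact_complex_def)
  finally have 1: "Range (op_adj B2) = op_kernel (op_adj B1)" .
  have 2: "Range B0 = op_kernel B1" using ex(1) by (simp add: exact_complex_def)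
  have r: "(y1, y2) \<in> Range (op_antidiag (op_adj B2) B0) \<longleftrightarrow> y1 \<in> Range (op_adj B2) \<and> y2 \<in> Range B0" for y1 y2
    unfolding Range_iff split_paired_Ex op_antidiag_iff by blast
  have k: "(y1, y2) \<in> op_kernel (op_antidiag B1 (op_neg (op_adj B1))) \<longleftrightarrow>
      y1 \<in> op_kernel (op_adj B1) \<and> y2 \<in> op_kernel B1" for y1 y2
    by (auto simp: op_kernel_def zero_prod_def op_antidiag_iff op_neg_iff)
  show ?thesis
  proof (rule set_eqI)
    fix y show "y \<in> Range (op_antidiag (op_adj B2) B0) \<longleftrightarrow> y \<in> op_kernel (op_antidiag B1 (op_neg (op_adj B1)))"
      by (cases y) (simp only: r k 1 2)
  qed
qed

lemma compact_block:
  assumes B1: "csubspace B1" "closed B1" and B2: "csubspace B2" "closed B2"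
    and ex: "exact_complex B0 B1" "exact_complex B1 B2"
    and co: "compact_complex B0 B1" "compact_complex B1 B2"
  obtains K where "compact K" "\<And>x z. (x, z) \<in> op_antidiag B1 (op_neg (op_adj B1)) \<Longrightarrow>
    x \<in> orth (op_kernel (op_antidiag B1 (op_neg (op_adj B1)))) \<Longrightarrow> norm (x, z) \<le> 1 \<Longrightarrow> x \<in> K"
proof -
  obtain K1 where K1: "compact K1"
    "\<And>x z. (x, z) \<in> B1 \<Longrightarrow> x \<in> orth (op_kernel B1) \<Longrightarrow> norm (x, z) \<le> 1 \<Longrightarrow> x \<in> K1"
    by (rule compact_exact_complex[OF B1 ex(1) co(1)]) (rule that)
  obtain K2 where K2: "compact K2"
    "\<And>x y. (x, y) \<in> op_adj B1 \<Longrightarrow> x \<in> orth (op_kernel (op_adj B1)) \<Longrightarrow> norm (x, y) \<le> 1 \<Longrightarrow> x \<in> K2"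
    by (rule compact_exact_complex[OF B2 ex(2) co(2)]) (rule that)
  let ?A = "op_antidiag B1 (op_neg (op_adj B1))"
  show ?thesis
  proof (rule that[of "K2 \<times> K1"])
    show "compact (K2 \<times> K1)" by (rule compact_Times[OF K2(1) K1(1)])
    fix x z assume xz: "(x, z) \<in> ?A" "x \<in> orth (op_kernel ?A)" "norm (x, z) \<le> 1"
    obtain x1 x2 z1 z2 where [simp]: "x = (x1, x2)" "z = (z1, z2)" by (cases x; cases z)
    have g: "(x2, z1) \<in> B1" "(x1, - z2) \<in> op_adj B1"
      using xz(1) by (simp_all add: op_antidiag_iff op_neg_iff)
    have 0: "(0, 0) \<in> B1" "(0, 0) \<in> op_adj B1"
      using csubspace_0[OF B1(1)] csubspace_0[OF csubspace_op_adj[of B1]] by (simp_all add: zero_prod_def)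
    have "cinner k x1 = 0" if "k \<in> op_kernel (op_adj B1)" for k
    proof -
      have "(k, 0) \<in> op_kernel ?A"
        using that 0 by (simp add: op_kernel_def zero_prod_def op_antidiag_iff op_neg_iff)
      then have "cinner (k, 0) x = 0" using xz(2) unfolding orth_def by blast
      then show ?thesis by simp
    qed
    then have o1: "x1 \<in> orth (op_kernel (op_adj B1))" by (simp add: orth_def)
    have "cinner k x2 = 0" if "k \<in> op_kernel B1" for k
    proof -
      have "(0, k) \<in> op_kernel ?A"
        using that 0 by (simp add: op_kernel_def zero_prod_def op_antidiag_iff op_neg_iff)
      then have "cinner (0, k) x = 0" using xz(2) unfolding orth_def by blast
      then show ?thesis by simp
    qed
    then have o2: "x2 \<in> orth (op_kernel B1)" by (simp add: orth_def)
    have n: "(norm x1)\<^sup>2 + (norm x2)\<^sup>2 + ((norm z1)\<^sup>2 + (norm z2)\<^sup>2) \<le> 1"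
      using xz(3) by (simp add: norm_Pair)
    have "norm (x1, - z2) \<le> 1" "norm (x2, z1) \<le> 1"
      using n zero_le_power2[of "norm x1"] zero_le_power2[of "norm x2"]
        zero_le_power2[of "norm z1"] zero_le_power2[of "norm z2"]
      unfolding norm_Pair norm_minus_cancel real_sqrt_le_1_iff by linarith+
    from K2(2)[OF g(2) o1 this(1)] K1(2)[OF g(1) o2 this(2)]
    show "x \<in> K2 \<times> K1" unfolding \<open>x = (x1, x2)\<close> by (rule SigmaI)
  qed
qed


section \<open>The convergence theorem\<close>

theorem theorem7p5:
  fixes B0 :: "('k0::complex_hilbert \<times> 'k1::complex_hilbert) set"
    and B1 :: "('k1 \<times> 'k2::complex_hilbert) set"
    and B2 :: "('k2 \<times> 'k3::complex_hilbert) set"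
    and M :: "nat \<Rightarrow> complex \<Rightarrow> 'k2 \<times> 'k1 \<Rightarrow> 'k2 \<times> 'k1"
    and Minf :: "complex \<Rightarrow> 'k2 \<times> 'k1 \<Rightarrow> 'k2 \<times> 'k1"
    and \<mu> c :: real
    and A0 :: "(('k0 \<times> 'k3) \<times> ('k2 \<times> 'k1)) set"
    and A1 :: "(('k2 \<times> 'k1) \<times> ('k2 \<times> 'k1)) set"
  assumes "closed_operator B0" "densely_defined B0"
    and "closed_operator B1" "densely_defined B1"
    and "closed_operator B2" "densely_defined B2"
    and "compact_complex B0 B1" "exact_complex B0 B1"
    and "compact_complex B1 B2" "exact_complex B1 B2"
  defines "A0 \<equiv> op_antidiag (op_adj B2) B0"
    and "A1 \<equiv> op_antidiag B1 (op_neg (op_adj B1))"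
  assumes "\<mu> \<ge> 0"
    and "Hinf_bounded_seq \<mu> M"
    and "Minf \<in> Hinf \<mu>"
    and "c > 0"
    and "\<forall>n z. Re z > \<mu> \<longrightarrow> re_ge UNIV (\<lambda>x. z *\<^sub>C M n z x) c"
    and "\<forall>l>\<mu>. nonlocal_H_converges A0 A1
           (\<lambda>n. M n (complex_of_real l)) (Minf (complex_of_real l))"
  shows "\<forall>\<nu>>\<mu>. L2_wot_converges \<nu>
           (\<lambda>n. (L2_closure \<nu> \<nu> (evolution_operator \<nu> (M n) A1))\<inverse>)
           ((L2_closure \<nu> \<nu> (evolution_operator \<nu> Minf A1))\<inverse>)"
proof (intro allI impI)
  fix \<nu> assume \<nu>: "\<nu> > \<mu>"
  have B0: "csubspace B0" "closed B0" "single_valued B0"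
    and B1: "csubspace B1" "closed B1" "single_valued B1"
    and B2: "csubspace B2" "closed B2"
    using assms(1,3,5) by (simp_all add: closed_operator_def)
  have A0: "csubspace A0" "closed A0" "single_valued A0"
    unfolding A0_def
    by (intro csubspace_op_antidiag closed_op_antidiag single_valued_op_antidiag csubspace_op_adj
        closed_op_adj single_valued_op_adj assms(6) B0)+
  have R: "Range A0 = op_kernel A1"
    unfolding A0_def A1_def by (rule Range_block_eq_kernel[OF B2 assms(8,10,9)])
  have A1: "skew_selfadjoint A1" "single_valued A1"
    unfolding A1_def
    by (intro skew_selfadjoint_op_antidiag single_valued_op_antidiag single_valued_op_neg
        single_valued_op_adj assms(4) B1)+
  obtain K where K: "compact K"
    "\<And>x z. (x, z) \<in> A1 \<Longrightarrow> x \<in> orth (op_kernel A1) \<Longrightarrow> norm (x, z) \<le> 1 \<Longrightarrow> x \<in> K"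
    by (rule compact_block[OF B1(1,2) B2 assms(8,10,7,9), folded A1_def]) (rule that)
  have coercive: "re_ge UNIV (\<lambda>x. z *\<^sub>C M n z x) c" if "z \<in> half_plane \<mu>" for n z
    using assms(17) that by (simp add: half_plane_def)
  have conv: "nonlocal_H_converges A0 A1 (\<lambda>n. M n (complex_of_real l)) (Minf (complex_of_real l))"
    if "l > \<mu>" for l
    using assms(18) that by blast
  show "L2_wot_converges \<nu> (\<lambda>n. (L2_closure \<nu> \<nu> (evolution_operator \<nu> (M n) A1))\<inverse>)
      ((L2_closure \<nu> \<nu> (evolution_operator \<nu> Minf A1))\<inverse>)"
    by (rule evolution_operators_converge[OF A0 R A1 K assms(14,15,16) coercive conv assms(13) \<nu>])
qed

end
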